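(* Let $n\ge1$, $v_i=(i,1)\in N=\mathbb{Z}^2$ for $0\le i\le n$, let $C$ be the cone with rays through $v_0,v_n$, and let $\Sigma$ be the simplicial subdivision of $C$ with rays through $v_{i_0},\dots,v_{i_{r+1}}$, $0=i_0<i_1<\dots<i_{r+1}=n$. Then the pairing $\langle\Gamma,\Gamma^\circ\rangle\in H\otimes H^c$ of the Gamma series is $$\begin{aligned}\langle\Gamma,\Gamma^\circ\rangle=&-n\sum_{\gamma\ne(0,0),\ \sigma(\gamma)=\sigma_{ij}}(j-i)\frac{\sin^2(\pi\gamma_i)}{\pi^2}\,1_\gamma\otimes F_{\emptyset,\gamma^*}+\sum_{\substack{i,j\in\Sigma\\ i<j}}(j-i)^2\frac1{(2\pi\mathrm{i})^2}\,1_{(0,0)}\otimes F_{\{i,j\}}\\&-n\sum_{\substack{i,j\in\Sigma\\ i<j}}(j-i)\frac1{2(2\pi\mathrm{i})^2}\big(D_i1_{(0,0)}\otimes F_j+D_j1_{(0,0)}\otimes F_i\big),\end{aligned}$$ where $F_0=0$, $F_n=0$ and $F_{\{i,j\}}=0$ if $i,j$ are not adjacent in $\Sigma$.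
   Context: **Fan.** The two-dimensional cones of $\Sigma$ are $\sigma_{i_ki_{k+1}}$, where $\sigma_{ij}$ ($i<j$) is the cone generated by $v_i,v_j$. Write $i\in\Sigma$ if $i\in\{i_0,\dots,i_{r+1}\}$, $i\in\Sigma^\circ$ if $i\in\{i_1,\dots,i_r\}$; consecutive $i_k,i_{k+1}$ are adjacent. $\mathrm{Box}(\Sigma)$ consists of $(0,0)$ and of the $\gamma\in N$ (nontrivial twisted sectors) of the form $\gamma=\gamma_iv_i+\gamma_jv_j$, $0<\gamma_i,\gamma_j<1$, with $i<j$ adjacent; then $\sigma(\gamma)=\sigma_{ij}$, $\gamma_i+\gamma_j=1$, and $\gamma^*=(1-\gamma_i)v_i+(1-\gamma_j)v_j$. Put $\gamma_k=0$ for all other indices $k$. **$H$ and $H^c$.** $H=\bigoplus_{\gamma\in\mathrm{Box}(\Sigma)}H_\gamma$, $H^c=\bigoplus_\gamma H^c_\gamma$. For $\gamma\ne(0,0)$: $H_\gamma=\mathbb{C}1_\gamma$ (a copy of $\mathbb{C}$), $H^c_\gamma=\mathbb{C}F_{\emptyset,\gamma}$. $H_{(0,0)}$ is the quotient of $\mathbb{C}[D_0,\dots,D_n]$ by $D_i$ ($i\notin\Sigma$), all $D_iD_j$, $\sum_iD_i$ and $\sum_iiD_i$, with unit $1_{(0,0)}$. $H_{(0,0)}^c$ is the $H_{(0,0)}$-module generated by $F_k$ ($k\in\Sigma^\circ$) and $F_{\{i,j\}}$ ($i,j$ adjacent), with relations $D_iF_j=F_{\{i,j\}}$ ($i,j$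 adjacent, $j\in\Sigma^\circ$), $D_iF_j=0$ ($i\ne j$ not adjacent), $D_kF_{\{i,j\}}=0$. **Gamma series.** Fix branches of $\log x_i$ (the same for $\Gamma$ and $\Gamma^\circ$), $x_i^a=e^{a\log x_i}$. Put $L_{c,\gamma}=\{(l_k)\in\mathbb{Q}^{n+1}:\sum_{k=0}^n l_kv_k=-c,\ l_k-\gamma_k\in\mathbb{Z}\}$. In components with $\gamma\ne(0,0)$ set $D_k=0$. For $c\in C$, resp. $c\in C^\circ$ (lattice points), $$\Gamma_c=\bigoplus_\gamma\sum_{(l_k)\in L_{c,\gamma}}\prod_{k=0}^n\frac{x_k^{l_k+\frac{D_k}{2\pi\mathrm{i}}}}{\Gamma(1+l_k+\frac{D_k}{2\pi\mathrm{i}})}\in H,\qquad \Gamma^\circ_c=\bigoplus_\gamma\sum_{(l_k)\in L_{c,\gamma}}\prod_{k=0}^n\frac{x_k^{l_k+\frac{D_k}{2\pi\mathrm{i}}}}{\Gamma(1+l_k+\frac{D_k}{2\pi\mathrm{i}})}\Big(\prod_{k\in\sigma}D_k^{-1}\Big)F_\sigma\in H^c,$$ where $\sigma=\{k:l_k\in\mathbb{Z}_{<0}\}$; for $k\in\sigma$ the reciprocal Gamma factor is a power series in $D_k$ divisible by $D_k$ and $D_k^{-1}$ cancels this factor. If $\gamma=(0,0)$, $F_\sigma$ is the generator $F_k$ or $F_{\{i,j\}}$, and $F_\sigma=0$ if $\sigma$ does not index a cone of $\Sigma$; if $\gamma\ne(0,0)$, $F_\sigma=F_{\emptyset,\gamma}$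 if $\sigma=\emptyset$ and $0$ otherwise. The series converge absolutely and uniformly on compacts in a nonempty open region of $(x_0,\dots,x_n)$ depending on $\Sigma$ (where $(-\log|x_i|)_i$ is sufficiently deep in the cone of height functions whose lower convex hull induces $\Sigma$). **Pairing.** $$\langle\Gamma,\Gamma^\circ\rangle=\sum_{0\le i<j\le n}(j-i)^2x_ix_j\,\Gamma_{(0,0)}\otimes\Gamma^\circ_{v_i+v_j}-\sum_{0\le i<j\le n}n(j-i)x_ix_j\sum_{\substack{c+d=v_i+v_j\\ c,d\in\sigma_{ij},\ \deg c=1}}\delta_{ij}^c\,\Gamma_c\otimes\Gamma^\circ_d,$$ where $c,d$ are lattice points, $\deg(k,l)=l$, only terms with $d\in C^\circ$ are taken, and $\delta_{ij}^c=1$ if $c$ is in the interior of $\sigma_{ij}$, $\frac12$ otherwise. *)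

theory Defs
  imports "HOL-Complex_Analysis.Complex_Analysis" "HOL-Library.Poly_Mapping"
begin

section \<open>Fan, lattice points and twisted sectors\<close>

text \<open>
  The lattice N is \<open>int \<times> int\<close>, with \<open>v\<^sub>i = (i, 1)\<close>. The simplicial subdivision \<open>\<Sigma>\<close> is given by the set
  \<open>S = {i\<^sub>0 < \<dots> < i\<^sub>r\<^sub>+\<^sub>1}\<close> of the indices of its rays, where \<open>{0, n} \<subseteq> S \<subseteq> {0..n}\<close>; hence
  \<open>i \<in> \<Sigma>\<close> reads \<open>i \<in> S\<close>.
\<close>

definition vlat :: "nat \<Rightarrow> int \<times> int" where
  "vlat i = (int i, 1)"

definition embed :: "int \<times> int \<Rightarrow> real \<times> real" where
  "embed c = (real_of_int (fst c), real_of_int (snd c))"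

definition cone2 :: "nat \<Rightarrow> nat \<Rightarrow> (real \<times> real) set" where
  "cone2 i j = convex_cone hull {embed (vlat i), embed (vlat j)}"

definition lattice_points :: "(real \<times> real) set \<Rightarrow> (int \<times> int) set" where
  "lattice_points A = {c. embed c \<in> A}"

definition inner_rays :: "nat \<Rightarrow> nat set \<Rightarrow> nat set" where
  "inner_rays n S = S - {0, n}"

definition adjacent :: "nat set \<Rightarrow> nat \<Rightarrow> nat \<Rightarrow> bool" where
  "adjacent S i j \<longleftrightarrow> i \<in> S \<and> j \<in> S \<and> i \<noteq> j \<and> (\<forall>k\<in>S. \<not> (min i j < k \<and> k < max i j))"

text \<open>\<open>g\<close> is the family of coefficients of the nontrivial twisted sector \<open>\<gamma> = g\<^sub>i v\<^sub>i + g\<^sub>j v\<^sub>j\<close>,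
  extended by \<open>g\<^sub>k = 0\<close>. As \<open>\<gamma>\<close> is a lattice point, the coefficients are rational.\<close>

definition twisted :: "nat set \<Rightarrow> int \<times> int \<Rightarrow> nat \<Rightarrow> nat \<Rightarrow> (nat \<Rightarrow> rat) \<Rightarrow> bool" where
  "twisted S \<gamma> i j g \<longleftrightarrow>
     i < j \<and> adjacent S i j \<and> 0 < g i \<and> g i < 1 \<and> 0 < g j \<and> g j < 1 \<and>
     (\<forall>k. k \<noteq> i \<and> k \<noteq> j \<longrightarrow> g k = 0) \<and>
     of_int (fst \<gamma>) = g i * of_int (fst (vlat i)) + g j * of_int (fst (vlat j)) \<and>
     of_int (snd \<gamma>) = g i * of_int (snd (vlat i)) + g j * of_int (snd (vlat j))"

definition Box :: "nat set \<Rightarrow> (int \<times> int) set" where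
  "Box S = {(0, 0)} \<union> {\<gamma>. \<exists>i j g. twisted S \<gamma> i j g}"

definition box_coord :: "nat set \<Rightarrow> int \<times> int \<Rightarrow> nat \<Rightarrow> rat" where
  "box_coord S \<gamma> = (if \<gamma> = (0, 0) then (\<lambda>_. 0) else (THE g. \<exists>i j. twisted S \<gamma> i j g))"

text \<open>The pair \<open>(i, j)\<close> with \<open>i < j\<close> and \<open>\<sigma>(\<gamma>) = \<sigma>\<^sub>i\<^sub>j\<close>.\<close>

definition sector_cone :: "nat set \<Rightarrow> int \<times> int \<Rightarrow> nat \<times> nat" where
  "sector_cone S \<gamma> = (THE (i, j). \<exists>g. twisted S \<gamma> i j g)"

text \<open>This is \<open>\<gamma>\<^sup>*\<close>, a lattice point since it equals \<open>v\<^sub>i + v\<^sub>j - \<gamma>\<close>.\<close>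

definition box_dual :: "nat set \<Rightarrow> int \<times> int \<Rightarrow> int \<times> int" where
  "box_dual S \<gamma> = (case sector_cone S \<gamma> of (i, j) \<Rightarrow> THE \<delta>.
     of_int (fst \<delta>) = (1 - box_coord S \<gamma> i) * of_int (fst (vlat i))
                      + (1 - box_coord S \<gamma> j) * of_int (fst (vlat j)) \<and>
     of_int (snd \<delta>) = (1 - box_coord S \<gamma> i) * of_int (snd (vlat i))
                      + (1 - box_coord S \<gamma> j) * of_int (snd (vlat j)))"

text \<open>The open cone of the height functions on \<open>{v\<^sub>0, \<dots>, v\<^sub>n}\<close> whose lower convex hull induces \<open>\<Sigma>\<close>: over every
  two-dimensional cone \<open>\<sigma>\<^sub>i\<^sub>j\<close> there is a linear function on N that agrees with the height at \<open>v\<^sub>i, v\<^sub>j\<close>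
  and lies strictly below it at all other \<open>v\<^sub>m\<close>.\<close>

definition height_cone :: "nat \<Rightarrow> nat set \<Rightarrow> (nat \<Rightarrow> real) set" where
  "height_cone n S = {h. \<forall>i j. i < j \<and> adjacent S i j \<longrightarrow>
     (\<exists>p q. p * real i + q = h i \<and> p * real j + q = h j \<and>
            (\<forall>m\<le>n. m \<noteq> i \<and> m \<noteq> j \<longrightarrow> p * real m + q < h m))}"


section \<open>Modules given by generators and relations, and their tensor product\<close>

text \<open>
  \<open>'g \<Rightarrow>\<^sub>0 'r\<close> is the free \<open>'r\<close>-module on \<open>'g\<close>. A presented module is a free module modulo a submodule
  \<open>W\<close> of relations; its elements are written as elements of the free module, taken modulo \<open>W\<close>.
\<close>

definition pm_scale :: "'r::comm_ring_1 \<Rightarrow> ('g \<Rightarrow>\<^sub>0 'r) \<Rightarrow> ('g \<Rightarrow>\<^sub>0 'r)" where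
  "pm_scale r f = Poly_Mapping.map (\<lambda>a. r * a) f"

lemma lookup_pm_scale: "Poly_Mapping.lookup (pm_scale r f) g = r * Poly_Mapping.lookup f g"
  unfolding pm_scale_def by transfer (simp add: when_def)

lemma module_pm_scale: "module (pm_scale :: 'r::comm_ring_1 \<Rightarrow> ('g \<Rightarrow>\<^sub>0 'r) \<Rightarrow> _)"
  by unfold_locales
     (rule poly_mapping_eqI; simp add: lookup_pm_scale lookup_add algebra_simps)+

text \<open>Polynomials over the complex numbers in variables \<open>D\<^sub>i\<close> indexed by all natural numbers. The variables
  beyond \<open>D\<^sub>n\<close> will be relations along with all other \<open>D\<^sub>i\<close>, \<open>i \<notin> \<Sigma>\<close>, so the quotients are those of
  the polynomial ring in \<open>D\<^sub>0, \<dots>, D\<^sub>n\<close>.\<close>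

type_synonym dpoly = "(nat \<Rightarrow>\<^sub>0 nat) \<Rightarrow>\<^sub>0 complex"

definition Cst :: "complex \<Rightarrow> dpoly" where
  "Cst a = Poly_Mapping.single 0 a"

definition D :: "nat \<Rightarrow> dpoly" where
  "D i = Poly_Mapping.single (Poly_Mapping.single i 1) 1"

definition cscale :: "complex \<Rightarrow> ('g \<Rightarrow>\<^sub>0 dpoly) \<Rightarrow> ('g \<Rightarrow>\<^sub>0 dpoly)" where
  "cscale a = pm_scale (Cst a)"

lemma vector_space_cscale: "vector_space (cscale :: complex \<Rightarrow> ('g \<Rightarrow>\<^sub>0 dpoly) \<Rightarrow> _)"
proof -
  interpret module "pm_scale :: dpoly \<Rightarrow> ('g \<Rightarrow>\<^sub>0 dpoly) \<Rightarrow> _" by (rule module_pm_scale)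
  show ?thesis
    unfolding cscale_def Cst_def
    by unfold_locales
       (simp_all add: scale_right_distrib scale_left_distrib single_add mult_single single_one)
qed

text \<open>
  Convergence, to the class of \<open>s\<close>, of an (unordered) series in a quotient of finite complex
  dimension: every complex-linear functional of the quotient maps it to a convergent
  series. In finite dimension this is absolute convergence with respect to any norm.
\<close>

definition quot_has_sum ::
    "('g \<Rightarrow>\<^sub>0 dpoly) set \<Rightarrow> ('l \<Rightarrow> ('g \<Rightarrow>\<^sub>0 dpoly)) \<Rightarrow> 'l set \<Rightarrow> ('g \<Rightarrow>\<^sub>0 dpoly) \<Rightarrow> bool" where
  "quot_has_sum W f A s \<longleftrightarrow>
     (\<forall>\<phi>. Vector_Spaces.linear cscale (*) \<phi> \<and> (\<forall>w\<in>W. \<phi> w = 0) \<longrightarrow>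
          ((\<lambda>l. \<phi> (f l)) has_sum \<phi> s) A)"

text \<open>The tensor product, over the complex numbers, of two presented modules: the free vector
  space on pairs modulo bilinearity and the relations of the two factors.\<close>

type_synonym ('g, 'h) free_tensor = "(('g \<Rightarrow>\<^sub>0 dpoly) \<times> ('h \<Rightarrow>\<^sub>0 dpoly)) \<Rightarrow>\<^sub>0 complex"

definition tens :: "('g \<Rightarrow>\<^sub>0 dpoly) \<Rightarrow> ('h \<Rightarrow>\<^sub>0 dpoly) \<Rightarrow> ('g, 'h) free_tensor" (infix "\<otimes>" 75) where
  "u \<otimes> v = Poly_Mapping.single (u, v) 1"

definition tensor_rel ::
    "('g \<Rightarrow>\<^sub>0 dpoly) set \<Rightarrow> ('h \<Rightarrow>\<^sub>0 dpoly) set \<Rightarrow> ('g, 'h) free_tensor set" where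
  "tensor_rel W W' = module.span pm_scale
     ({(u + u') \<otimes> v - u \<otimes> v - u' \<otimes> v | u u' v. True} \<union>
      {u \<otimes> (v + v') - u \<otimes> v - u \<otimes> v' | u v v'. True} \<union>
      {cscale a u \<otimes> v - pm_scale a (u \<otimes> v) | a u v. True} \<union>
      {u \<otimes> cscale a v - pm_scale a (u \<otimes> v) | a u v. True} \<union>
      {w \<otimes> v | w v. w \<in> W} \<union>
      {u \<otimes> w' | u w'. w' \<in> W'})"

definition tensor_class ::
    "('g \<Rightarrow>\<^sub>0 dpoly) set \<Rightarrow> ('h \<Rightarrow>\<^sub>0 dpoly) set \<Rightarrow> ('g, 'h) free_tensor \<Rightarrow> ('g, 'h) free_tensor set" where
  "tensor_class W W' t = {t'. t' - t \<in> tensor_rel W W'}"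


section \<open>The spaces H and H^c\<close>

definition untwisted_ideal :: "nat \<Rightarrow> nat set \<Rightarrow> dpoly set" where
  "untwisted_ideal n S = module.span (*)
     ({D i | i. i \<notin> S} \<union> {D i * D j | i j. True} \<union>
      {\<Sum>i\<le>n. D i} \<union> {\<Sum>i\<le>n. of_nat i * D i})"

text \<open>H has the generators \<open>1\<^sub>\<gamma>\<close>, \<open>\<gamma> \<in> Box(\<Sigma>)\<close>. In the twisted sectors the \<open>D\<^sub>k\<close> act as 0,
  so that these components are copies of the complex numbers.\<close>

type_synonym freeH = "(int \<times> int) \<Rightarrow>\<^sub>0 dpoly"

definition oneH :: "int \<times> int \<Rightarrow> freeH" where
  "oneH \<gamma> = Poly_Mapping.single \<gamma> 1"

definition relH :: "nat \<Rightarrow> nat set \<Rightarrow> freeH set" where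
  "relH n S = module.span pm_scale
     ({oneH \<gamma> | \<gamma>. \<gamma> \<notin> Box S} \<union>
      {pm_scale p (oneH (0, 0)) | p. p \<in> untwisted_ideal n S} \<union>
      {pm_scale (D k) (oneH \<gamma>) | k \<gamma>. \<gamma> \<in> Box S \<and> \<gamma> \<noteq> (0, 0)})"

text \<open>\<open>Cone_gen \<sigma>\<close> stands for the generator \<open>F\<^sub>\<sigma>\<close> of the untwisted part (\<open>F\<^sub>k\<close> is the case \<open>\<sigma> = {k}\<close>),
  \<open>Twisted_gen \<gamma>\<close> for \<open>F\<close> with index \<open>\<emptyset>, \<gamma>\<close>. All symbols that do not index a generator are set to 0;
  in particular \<open>F\<^sub>0 = F\<^sub>n = 0\<close>.\<close>

datatype Hc_gen = Cone_gen "nat set" | Twisted_gen "int \<times> int"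

type_synonym freeHc = "Hc_gen \<Rightarrow>\<^sub>0 dpoly"

definition Fcone :: "nat set \<Rightarrow> freeHc" where
  "Fcone \<sigma> = Poly_Mapping.single (Cone_gen \<sigma>) 1"

definition Ftw :: "int \<times> int \<Rightarrow> freeHc" where
  "Ftw \<gamma> = Poly_Mapping.single (Twisted_gen \<gamma>) 1"

definition gen_cones :: "nat \<Rightarrow> nat set \<Rightarrow> nat set set" where
  "gen_cones n S = {{k} | k. k \<in> inner_rays n S} \<union> {{i, j} | i j. adjacent S i j}"

definition relHc :: "nat \<Rightarrow> nat set \<Rightarrow> freeHc set" where
  "relHc n S = module.span pm_scale
     ({Fcone \<sigma> | \<sigma>. \<sigma> \<notin> gen_cones n S} \<union>
      {Ftw \<gamma> | \<gamma>. \<gamma> \<notin> Box S - {(0, 0)}} \<union>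
      {pm_scale p (Fcone \<sigma>) | p \<sigma>. p \<in> untwisted_ideal n S} \<union>
      {pm_scale (D i) (Fcone {j}) - Fcone {i, j} | i j. adjacent S i j \<and> j \<in> inner_rays n S} \<union>
      {pm_scale (D i) (Fcone {j}) | i j. j \<in> inner_rays n S \<and> i \<noteq> j \<and> \<not> adjacent S i j} \<union>
      {pm_scale (D k) (Fcone {i, j}) | k i j. adjacent S i j} \<union>
      {pm_scale (D k) (Ftw \<gamma>) | k \<gamma>. \<gamma> \<in> Box S \<and> \<gamma> \<noteq> (0, 0)})"


section \<open>Gamma series\<close>

text \<open>Tuples \<open>(l\<^sub>0, \<dots>, l\<^sub>n)\<close> are functions that vanish beyond \<open>n\<close>.\<close>

definition Lset :: "nat \<Rightarrow> nat set \<Rightarrow> int \<times> int \<Rightarrow> int \<times> int \<Rightarrow> (nat \<Rightarrow> rat) set" where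
  "Lset n S c \<gamma> = {l. (\<forall>k>n. l k = 0) \<and>
     (\<Sum>k\<le>n. l k * of_int (fst (vlat k))) = - of_int (fst c) \<and>
     (\<Sum>k\<le>n. l k * of_int (snd (vlat k))) = - of_int (snd c) \<and>
     (\<forall>k\<le>n. l k - box_coord S \<gamma> k \<in> \<int>)}"

definition neg_set :: "nat \<Rightarrow> (nat \<Rightarrow> rat) \<Rightarrow> nat set" where
  "neg_set n l = {k. k \<le> n \<and> l k \<in> \<int> \<and> l k < 0}"

text \<open>The power series in \<open>z\<close> of \<open>x\<^bsup>l + z/(2\<pi>i)\<^esup> / \<Gamma>(1 + l + z/(2\<pi>i))\<close>, where \<open>y\<close> is the chosen
  logarithm of \<open>x\<close>.\<close>

definition gamma_factor :: "complex \<Rightarrow> rat \<Rightarrow> complex fps" where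
  "gamma_factor y l = fps_expansion
     (\<lambda>z. exp ((of_rat l + z / (2 * of_real pi * \<i>)) * y)
          * rGamma (1 + of_rat l + z / (2 * of_real pi * \<i>))) 0"

text \<open>A power series evaluated at \<open>D\<^sub>k\<close>; the terms of order at least 2 are dropped because \<open>D\<^sub>k\<^sup>2 = 0\<close>
  in the untwisted sector and \<open>D\<^sub>k = 0\<close> in the twisted ones.\<close>

definition fps_at_D :: "nat \<Rightarrow> complex fps \<Rightarrow> dpoly" where
  "fps_at_D k f = Cst (fps_nth f 0) + Cst (fps_nth f 1) * D k"

definition Gamma_term :: "nat \<Rightarrow> (nat \<Rightarrow> complex) \<Rightarrow> int \<times> int \<Rightarrow> (nat \<Rightarrow> rat) \<Rightarrow> freeH" where
  "Gamma_term n lx \<gamma> l = pm_scale (\<Prod>k\<le>n. fps_at_D k (gamma_factor (lx k) (l k))) (oneH \<gamma>)"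

definition F_sector :: "int \<times> int \<Rightarrow> nat set \<Rightarrow> freeHc" where
  "F_sector \<gamma> \<sigma> = (if \<gamma> = (0, 0) then Fcone \<sigma> else if \<sigma> = {} then Ftw \<gamma> else 0)"

text \<open>For \<open>k \<in> \<sigma>\<close> the shift divides the power series, whose constant coefficient is 0, by the variable.\<close>

definition Gammao_term :: "nat \<Rightarrow> (nat \<Rightarrow> complex) \<Rightarrow> int \<times> int \<Rightarrow> (nat \<Rightarrow> rat) \<Rightarrow> freeHc" where
  "Gammao_term n lx \<gamma> l = pm_scale
     (\<Prod>k\<le>n. fps_at_D k (if k \<in> neg_set n l then fps_shift 1 (gamma_factor (lx k) (l k))
                         else gamma_factor (lx k) (l k)))
     (F_sector \<gamma> (neg_set n l))"

definition Gamma_converges :: "nat \<Rightarrow> nat set \<Rightarrow> (nat \<Rightarrow> complex) \<Rightarrow> int \<times> int \<Rightarrow> bool" where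
  "Gamma_converges n S lx c \<longleftrightarrow>
     (\<forall>\<gamma>\<in>Box S. \<exists>u. quot_has_sum (relH n S) (Gamma_term n lx \<gamma>) (Lset n S c \<gamma>) u)"

definition Gammao_converges :: "nat \<Rightarrow> nat set \<Rightarrow> (nat \<Rightarrow> complex) \<Rightarrow> int \<times> int \<Rightarrow> bool" where
  "Gammao_converges n S lx c \<longleftrightarrow>
     (\<forall>\<gamma>\<in>Box S. \<exists>u. quot_has_sum (relHc n S) (Gammao_term n lx \<gamma>) (Lset n S c \<gamma>) u)"

text \<open>The sums are determined modulo \<open>relH\<close> and \<open>relHc\<close>, i.e. as elements of H and H^c; a representative
  is chosen.\<close>

definition Gamma_series :: "nat \<Rightarrow> nat set \<Rightarrow> (nat \<Rightarrow> complex) \<Rightarrow> int \<times> int \<Rightarrow> freeH" where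
  "Gamma_series n S lx c =
     (\<Sum>\<gamma>\<in>Box S. SOME u. quot_has_sum (relH n S) (Gamma_term n lx \<gamma>) (Lset n S c \<gamma>) u)"

definition Gammao_series :: "nat \<Rightarrow> nat set \<Rightarrow> (nat \<Rightarrow> complex) \<Rightarrow> int \<times> int \<Rightarrow> freeHc" where
  "Gammao_series n S lx c =
     (\<Sum>\<gamma>\<in>Box S. SOME u. quot_has_sum (relHc n S) (Gammao_term n lx \<gamma>) (Lset n S c \<gamma>) u)"


section \<open>The pairing\<close>

definition pair_weight :: "nat \<Rightarrow> nat \<Rightarrow> int \<times> int \<Rightarrow> complex" where
  "pair_weight i j c = (if embed c \<in> interior (cone2 i j) then 1 else 1 / 2)"

definition pair_splits :: "nat \<Rightarrow> nat \<Rightarrow> nat \<Rightarrow> ((int \<times> int) \<times> (int \<times> int)) set" where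
  "pair_splits n i j = {(c, d).
     fst c + fst d = fst (vlat i) + fst (vlat j) \<and>
     snd c + snd d = snd (vlat i) + snd (vlat j) \<and>
     c \<in> lattice_points (cone2 i j) \<and> d \<in> lattice_points (cone2 i j) \<and> snd c = 1 \<and>
     d \<in> lattice_points (interior (cone2 0 n))}"

definition Gamma_pairing ::
    "nat \<Rightarrow> nat set \<Rightarrow> (nat \<Rightarrow> complex) \<Rightarrow> (nat \<Rightarrow> complex) \<Rightarrow> (int \<times> int, Hc_gen) free_tensor" where
  "Gamma_pairing n S x lx =
     (\<Sum>(i, j) | i < j \<and> j \<le> n.
        pm_scale ((of_nat j - of_nat i)\<^sup>2 * x i * x j)
          (Gamma_series n S lx (0, 0) \<otimes>
           Gammao_series n S lx (fst (vlat i) + fst (vlat j), snd (vlat i) + snd (vlat j))))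
     - (\<Sum>(i, j) | i < j \<and> j \<le> n.
        pm_scale (of_nat n * (of_nat j - of_nat i) * x i * x j)
          (\<Sum>(c, d)\<in>pair_splits n i j.
             pm_scale (pair_weight i j c) (Gamma_series n S lx c \<otimes> Gammao_series n S lx d)))"

end

theory Submission
  imports Defs "HOL-Real_Asymp.Real_Asymp"
begin

text \<open>
  Write \<open>x\<^sub>k = exp y\<^sub>k\<close>. Two elements of \<open>H \<otimes> H\<^sup>c\<close> are equal as soon as every bilinear form \<open>B\<close> that
  factors through \<open>H\<close> and \<open>H\<^sup>c\<close> takes the same value on them (\<open>tensor_class_eqI\<close>). Such a form turns
  \<open>\<Gamma>\<^sub>c \<otimes> \<Gamma>\<degree>\<^sub>d\<close> into a number \<open>X(c, d)\<close>, a finite combination of products of scalar series in \<open>y\<close>, whose terms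
  are products of Taylor coefficients of the factors \<open>x\<^bsup>l + D/(2\<pi>i)\<^esup> / \<Gamma>(1 + l + D/(2\<pi>i))\<close>. Stirling-type
  bounds for \<open>1/\<Gamma>\<close> make these series converge once the heights \<open>- ln |x\<^sub>k|\<close> lie deep enough in the cone of
  \<open>\<Sigma>\<close> (\<open>series_has_sum\<close>).

  The pairing does not depend on \<open>x\<close>. The functional equation of \<open>\<Gamma>\<close> says that \<open>\<partial>/\<partial>y\<^sub>k\<close> replaces \<open>c\<close>
  by \<open>c + v\<^sub>k\<close> and multiplies by \<open>x\<^sub>k\<close>; the linear relations between the \<open>l\<^sub>k\<close>, together with the linear
  relations between the \<open>D\<^sub>k\<close>, give the Euler relations \<open>\<Sum>\<^sub>k x\<^sub>k X(c + v\<^sub>k, d) = - deg c \<sqdot> X(c, d)\<close> and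
  \<open>\<Sum>\<^sub>k k x\<^sub>k X(c + v\<^sub>k, d) = - c\<^sub>1 \<sqdot> X(c, d)\<close>, and the same on the right for interior \<open>d\<close>. From these
  relations alone the derivative of the pairing vanishes (\<open>pairing_deriv_zero\<close>): both sums in the pairing have
  derivatives that reduce to the same expression at the two boundary rays. What makes this work is that the
  weight of the splitting \<open>v\<^sub>i + v\<^sub>j = c + d\<close> with \<open>c = (k, 1)\<close> is half of \<open>sgn (j - k) - sgn (i - k)\<close>,
  which is additive in the pair \<open>(i, j)\<close>.

  The constant is found by going to infinity along \<open>y - t h\<close> with \<open>h\<close> in the height cone. A product of
  terms with exponents \<open>l\<close>, \<open>l'\<close> contributes \<open>x\<^sub>i x\<^sub>j x\<^bsup>l + l'\<^esup>\<close>, which decays exponentially, by the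
  convexity of \<open>h\<close>, unless \<open>l + l' = - e\<^sub>i - e\<^sub>j\<close>. What survives are the
  exponents \<open>0\<close> and \<open>- e\<^sub>i - e\<^sub>j\<close> for adjacent \<open>i, j\<close> (\<open>leadX_edge\<close>), \<open>- e\<^sub>i\<close> and \<open>- e\<^sub>j\<close> for
  two rays (\<open>leadX_ray\<close>), and the negated barycentric coordinates of the lattice points strictly between adjacent
  rays, which belong to twisted sectors and yield \<open>sin\<^sup>2\<close> by the reflection formula (\<open>leadX_twisted\<close>). The
  surviving terms form an affine function of \<open>y + \<gamma>\<close>, with \<open>\<gamma>\<close> Euler's constant. Since the pairing is
  constant, the linear part of this function is zero, and its constant part is the stated formula
  (\<open>sym_pairing_total\<close>, \<open>stated_sum_value\<close>).
\<close>

section \<open>Double sums with a sign kernel\<close>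

text \<open>Twice the weight with which the lattice point \<open>(k, 1)\<close> enters the cone over \<open>v\<^sub>b, v\<^sub>a\<close>: equal to 2 inside,
  1 on the two rays and 0 outside, with a sign for the orientation.\<close>

definition sign_kernel :: "int \<Rightarrow> int \<Rightarrow> int \<Rightarrow> complex" where
  "sign_kernel a b k = of_int (sgn (a - k) - sgn (b - k))"

lemma sign_kernel_swap: "sign_kernel a b k = - sign_kernel b a k"
  by (simp add: sign_kernel_def)

lemma sign_kernel_outside: "k < min a b \<or> max a b < k \<Longrightarrow> sign_kernel a b k = 0"
  by (auto simp: sign_kernel_def sgn_if)

lemma sign_kernel_chain: "sign_kernel a b k = sign_kernel a c k + sign_kernel c b k"
  by (simp add: sign_kernel_def)

text \<open>All six signs compare \<open>K\<close> with a sum of two of \<open>i, j, m\<close>, so they cancel in pairs.\<close>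

lemma sign_kernel_shift: "sign_kernel j i (K - m) = sign_kernel m i (K - j) - sign_kernel m j (K - i)"
  by (simp add: sign_kernel_def algebra_simps)

lemma sum_sign_kernel_shift:
  assumes "a \<in> {0..N}" "b \<in> {0..N}" "m \<in> {0..N}"
  shows "(\<Sum>k\<in>{0..N}. sign_kernel a b k * G (k + m)) = (\<Sum>K\<in>{0..2*N}. sign_kernel a b (K - m) * G K)"
proof -
  have "(\<Sum>K\<in>{0..2*N}. sign_kernel a b (K - m) * G K) = (\<Sum>K\<in>{m..N+m}. sign_kernel a b (K - m) * G K)"
    using assms by (intro sum.mono_neutral_right) (auto simp: sign_kernel_def sgn_if)
  also have "\<dots> = (\<Sum>k\<in>{0..N}. sign_kernel a b k * G (k + m))"
    by (rule sum.reindex_bij_witness[of _ "\<lambda>k. k + m" "\<lambda>k. k - m"]) auto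
  finally show ?thesis by simp
qed

text \<open>The weight \<open>(j - i) x\<^sub>i x\<^sub>j\<close> is antisymmetric, so the two halves of an antisymmetrised summand contribute
  equally. All sums with the sign kernel are brought into this form.\<close>

lemma sum_antisym:
  fixes f :: "int \<Rightarrow> int \<Rightarrow> complex"
  shows "(\<Sum>i\<in>I. \<Sum>j\<in>I. of_int (j - i) * x i * x j * (f i j - f j i)) =
         2 * (\<Sum>i\<in>I. \<Sum>j\<in>I. of_int (j - i) * x i * x j * f i j)"
proof -
  have "(\<Sum>i\<in>I. \<Sum>j\<in>I. of_int (j - i) * x i * x j * (f i j - f j i)) =
        (\<Sum>i\<in>I. \<Sum>j\<in>I. of_int (j - i) * x i * x j * f i j) +
        (\<Sum>i\<in>I. \<Sum>j\<in>I. of_int (i - j) * x j * x i * f j i)"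
    unfolding sum.distrib[symmetric] by (intro sum.cong refl) (simp add: algebra_simps)
  also have "(\<Sum>i\<in>I. \<Sum>j\<in>I. of_int (i - j) * x j * x i * f j i) =
        (\<Sum>i\<in>I. \<Sum>j\<in>I. of_int (j - i) * x i * x j * f i j)"
    by (rule sum.swap)
  finally show ?thesis by simp
qed

text \<open>Exchanging \<open>i\<close> and \<open>j\<close> shows that \<open>(i - c) (i - j)\<close> and \<open>(j - c) (j - i)\<close> have the same sum, and
  their total is \<open>(i - j)\<^sup>2\<close>. The free parameter \<open>c\<close> serves to suppress a chosen row of the sum.\<close>

lemma sum_square_diff:
  fixes x f :: "int \<Rightarrow> complex"
  shows "(\<Sum>i\<in>I. \<Sum>j\<in>I. (of_int (i - j))\<^sup>2 * x i * x j * f (i + j)) =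
         2 * (\<Sum>i\<in>I. of_int (i - c) * x i * (\<Sum>j\<in>I. of_int (i - j) * x j * f (i + j)))"
proof -
  have "(\<Sum>i\<in>I. \<Sum>j\<in>I. (of_int (i - j))\<^sup>2 * x i * x j * f (i + j)) =
     (\<Sum>i\<in>I. \<Sum>j\<in>I. of_int (j - i) * x i * x j * (of_int (c - i) * f (i + j) - of_int (c - j) * f (j + i)))"
    by (intro sum.cong refl) (simp add: algebra_simps power2_eq_square)
  also have "\<dots> = 2 * (\<Sum>i\<in>I. \<Sum>j\<in>I. of_int (j - i) * x i * x j * (of_int (c - i) * f (i + j)))"
    by (rule sum_antisym)
  also have "\<dots> = 2 * (\<Sum>i\<in>I. of_int (i - c) * x i * (\<Sum>j\<in>I. of_int (i - j) * x j * f (i + j)))"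
    unfolding sum_distrib_left by (intro sum.cong refl) (simp add: algebra_simps)
  finally show ?thesis .
qed

section \<open>The pairing of two solutions of the Euler relations\<close>

text \<open>An abstraction of \<open>X(c, d) = B(\<Gamma>\<^sub>c, \<Gamma>\<degree>\<^sub>d)\<close>, with \<open>x\<close> fixed: the left argument ranges over the cone over
  \<open>[0, N]\<close> and the right one over its interior. The constancy of the pairing uses nothing but these relations.\<close>

locale euler_pair =
  fixes N :: int and x :: "int \<Rightarrow> complex" and X :: "int \<times> int \<Rightarrow> int \<times> int \<Rightarrow> complex"
  assumes N_pos: "1 \<le> N"
    and left_deg: "\<And>k a p q. 0 \<le> k \<Longrightarrow> k \<le> N * a \<Longrightarrow> 0 < p \<Longrightarrow> p < N * q \<Longrightarrow>
          (\<Sum>j\<in>{0..N}. x j * X (k + j, a + 1) (p, q)) = - of_int a * X (k, a) (p, q)"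
    and left_fst: "\<And>k a p q. 0 \<le> k \<Longrightarrow> k \<le> N * a \<Longrightarrow> 0 < p \<Longrightarrow> p < N * q \<Longrightarrow>
          (\<Sum>j\<in>{0..N}. of_int j * x j * X (k + j, a + 1) (p, q)) = - of_int k * X (k, a) (p, q)"
    and right_deg: "\<And>k a p q. 0 \<le> k \<Longrightarrow> k \<le> N * a \<Longrightarrow> 0 < p \<Longrightarrow> p < N * q \<Longrightarrow>
          (\<Sum>j\<in>{0..N}. x j * X (k, a) (p + j, q + 1)) = - of_int q * X (k, a) (p, q)"
    and right_fst: "\<And>k a p q. 0 \<le> k \<Longrightarrow> k \<le> N * a \<Longrightarrow> 0 < p \<Longrightarrow> p < N * q \<Longrightarrow>
          (\<Sum>j\<in>{0..N}. of_int j * x j * X (k, a) (p + j, q + 1)) = - of_int p * X (k, a) (p, q)"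
begin

lemma right_diff:
  assumes "0 \<le> k" "k \<le> N * a" "0 < p" "p < N * q"
  shows "(\<Sum>j\<in>{0..N}. of_int (i - j) * x j * X (k, a) (p + j, q + 1)) = of_int (p - i * q) * X (k, a) (p, q)"
proof -
  have "(\<Sum>j\<in>{0..N}. of_int (i - j) * x j * X (k, a) (p + j, q + 1)) =
     of_int i * (\<Sum>j\<in>{0..N}. x j * X (k, a) (p + j, q + 1)) -
     (\<Sum>j\<in>{0..N}. of_int j * x j * X (k, a) (p + j, q + 1))"
    unfolding sum_distrib_left sum_subtractf[symmetric] by (intro sum.cong refl) (simp add: algebra_simps)
  then show ?thesis unfolding right_deg[OF assms] right_fst[OF assms] by (simp add: algebra_simps)
qed

lemma left_diff:
  assumes "0 \<le> k" "k \<le> N * a" "0 < p" "p < N * q"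
  shows "(\<Sum>j\<in>{0..N}. of_int (i - j) * x j * X (k + j, a + 1) (p, q)) = of_int (k - i * a) * X (k, a) (p, q)"
proof -
  have "(\<Sum>j\<in>{0..N}. of_int (i - j) * x j * X (k + j, a + 1) (p, q)) =
     of_int i * (\<Sum>j\<in>{0..N}. x j * X (k + j, a + 1) (p, q)) -
     (\<Sum>j\<in>{0..N}. of_int j * x j * X (k + j, a + 1) (p, q))"
    unfolding sum_distrib_left sum_subtractf[symmetric] by (intro sum.cong refl) (simp add: algebra_simps)
  then show ?thesis unfolding left_deg[OF assms] left_fst[OF assms] by (simp add: algebra_simps)
qed

text \<open>Every row of the double sum is an Euler relation at the interior point \<open>(i + m, 2)\<close>, except the row
  \<open>i = m\<close> if \<open>m\<close> is an end point; \<open>sum_square_diff\<close> removes that row.\<close>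

lemma hessian_constant:
  assumes m: "m \<in> {0..N}" and k: "0 \<le> k" "k \<le> N * a"
  shows "(\<Sum>i\<in>{0..N}. \<Sum>j\<in>{0..N}. (of_int (i - j))\<^sup>2 * x i * x j * X (k, a) (i + j + m, 3))
       + 2 * (\<Sum>j\<in>{0..N}. (of_int (j - m))\<^sup>2 * x j * X (k, a) (m + j, 2)) = 0"
proof -
  (* With this end point c, the point (i + m, 2) is interior for all i different from c. *)
  define c where "c = (if m = N then N else 0)"
  have "(\<Sum>j\<in>{0..N}. of_int (i - j) * x j * X (k, a) (i + j + m, 3)) = of_int (m - i) * X (k, a) (i + m, 2)"
    if "i \<in> {0..N}" "i \<noteq> c" for i
    using right_diff[OF k, of "i + m" 2 i] that m by (auto simp: c_def algebra_simps split: if_splits)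
  then have "(\<Sum>i\<in>{0..N}. of_int (i - c) * x i * (\<Sum>j\<in>{0..N}. of_int (i - j) * x j * X (k, a) (i + j + m, 3)))
     = (\<Sum>i\<in>{0..N}. of_int (i - c) * x i * (of_int (m - i) * X (k, a) (i + m, 2)))"
    by (intro sum.cong refl) force
  then have "(\<Sum>i\<in>{0..N}. \<Sum>j\<in>{0..N}. (of_int (i - j))\<^sup>2 * x i * x j * X (k, a) (i + j + m, 3)) =
    2 * (\<Sum>i\<in>{0..N}. of_int (i - c) * x i * (of_int (m - i) * X (k, a) (i + m, 2)))"
    using sum_square_diff[of x "\<lambda>s. X (k, a) (s + m, 3)" "{0..N}" c] by simp
  then have "?thesis \<longleftrightarrow> (\<Sum>i\<in>{0..N}. of_int (i - c) * x i * (of_int (m - i) * X (k, a) (i + m, 2)))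
       + (\<Sum>j\<in>{0..N}. (of_int (j - m))\<^sup>2 * x j * X (k, a) (m + j, 2)) = 0"
    by algebra
  also have "(\<Sum>i\<in>{0..N}. of_int (i - c) * x i * (of_int (m - i) * X (k, a) (i + m, 2)))
       + (\<Sum>j\<in>{0..N}. (of_int (j - m))\<^sup>2 * x j * X (k, a) (m + j, 2)) =
       of_int (m - c) * (\<Sum>j\<in>{0..N}. of_int (m - j) * x j * X (k, a) (m + j, 2))"
    unfolding sum.distrib[symmetric] sum_distrib_left
    by (intro sum.cong refl) (simp add: algebra_simps power2_eq_square)
  also have "\<dots> = 0"
  proof (cases "m = c")
    case False
    then have "0 < m" "m < N" using m by (auto simp: c_def split: if_splits)
    then show ?thesis using right_diff[OF k, of m 1 m] by simp
  qed simp
  finally show ?thesis by blast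
qed

text \<open>Here the rows are Euler relations at \<open>(i, 1)\<close>, which is interior only for \<open>0 < i < N\<close>. The two remaining
  rows survive and are the boundary terms that the second sum of the pairing has to cancel.\<close>

lemma hessian_boundary:
  assumes k: "0 \<le> k" "k \<le> N * a"
  shows "(\<Sum>i\<in>{0..N}. \<Sum>j\<in>{0..N}. (of_int (i - j))\<^sup>2 * x i * x j * X (k, a) (i + j, 2)) =
     of_int N * (x 0 * (\<Sum>j\<in>{0..N}. of_int j * x j * X (k, a) (j, 2))
               + x N * (\<Sum>j\<in>{0..N}. of_int (N - j) * x j * X (k, a) (N + j, 2)))"
proof -
  define f where "f i = (\<Sum>j\<in>{0..N}. of_int (i - j) * x j * X (k, a) (i + j, 2))" for i
  have f0: "f i = 0" if "i \<in> {0<..<N}" for i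
    using right_diff[OF k, of i 1 i] that by (simp add: f_def)
  have split: "(\<Sum>i\<in>{0..N}. g i) = g 0 + g N" if "\<And>i. i \<in> {0<..<N} \<Longrightarrow> g i = 0" for g :: "int \<Rightarrow> complex"
  proof -
    have "(\<Sum>i\<in>{0..N}. g i) = (\<Sum>i\<in>{0, N}. g i)"
      using that N_pos by (intro sum.mono_neutral_right) auto
    then show ?thesis using N_pos by simp
  qed
  let ?L = "\<Sum>i\<in>{0..N}. \<Sum>j\<in>{0..N}. (of_int (i - j))\<^sup>2 * x i * x j * X (k, a) (i + j, 2)"
  have "?L = 2 * (\<Sum>i\<in>{0..N}. of_int (i - c) * x i * f i)" for c
    unfolding f_def by (rule sum_square_diff[of x "\<lambda>s. X (k, a) (s, 2)"])
  then have L: "?L = 2 * (of_int (- c) * x 0 * f 0 + of_int (N - c) * x N * f N)" for c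
    by (subst (asm) split) (auto simp: f0)
  have "f 0 = - (\<Sum>j\<in>{0..N}. of_int j * x j * X (k, a) (j, 2))"
    by (simp add: f_def sum_negf)
  moreover have "f N = (\<Sum>j\<in>{0..N}. of_int (N - j) * x j * X (k, a) (N + j, 2))"
    by (simp add: f_def)
  (* c = 0 leaves only the row N and c = N only the row 0; the claim is the mean of the two. *)
  ultimately show ?thesis using L[of 0] L[of N] by (simp add: algebra_simps)
qed

text \<open>The values of \<open>X\<close> extended by zero to splittings whose right part is not an interior point; in \<open>Yl\<close> and
  \<open>Yr\<close> the left, respectively the right, argument has been moved by some \<open>v\<^sub>m\<close>.\<close>

abbreviation Y :: "int \<Rightarrow> int \<Rightarrow> complex" where
  "Y k p \<equiv> (if 0 < p \<and> p < N then X (k, 1) (p, 1) else 0)"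

abbreviation Yl :: "int \<Rightarrow> int \<Rightarrow> complex" where
  "Yl k p \<equiv> (if 0 < p \<and> p < N then X (k, 2) (p, 1) else 0)"

abbreviation Yr :: "int \<Rightarrow> int \<Rightarrow> complex" where
  "Yr k p \<equiv> (if 0 < p \<and> p < 2 * N then X (k, 1) (p, 2) else 0)"

text \<open>By \<open>sign_kernel_shift\<close> the inner sum is antisymmetric in \<open>i, j\<close> with one half depending on \<open>j\<close> only
  through the left argument \<open>(k + j, 2)\<close>; the sum over \<open>j\<close> is then an Euler relation on the left.\<close>

lemma kernel_left_shift:
  assumes m: "m \<in> {0..N}"
  shows "(\<Sum>i\<in>{0..N}. \<Sum>j\<in>{0..N}. of_int (j - i) * x i * x j *
            (\<Sum>k\<in>{0..N}. sign_kernel j i k * Yl (k + m) (i + j - k))) =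
         2 * (\<Sum>i\<in>{0..N}. x i * (\<Sum>k\<in>{0..N}. sign_kernel m i k * (of_int (i - k) * Y k (m + i - k))))"
proof -
  define f where "f i j = (\<Sum>k\<in>{0..N}. sign_kernel m i k * Yl (k + j) (m + i - k))" for i j
  have 1: "(\<Sum>k\<in>{0..N}. sign_kernel j i k * Yl (k + m) (i + j - k)) = f i j - f j i"
    if ij: "i \<in> {0..N}" "j \<in> {0..N}" for i j
  proof -
    define G where "G K = Yl K (m + i + j - K)" for K
    have "(\<Sum>k\<in>{0..N}. sign_kernel j i k * Yl (k + m) (i + j - k)) = (\<Sum>k\<in>{0..N}. sign_kernel j i k * G (k + m))"
      by (intro sum.cong refl) (simp add: G_def algebra_simps)
    also have "\<dots> = (\<Sum>K\<in>{0..2*N}. sign_kernel j i (K - m) * G K)"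
      using ij m by (intro sum_sign_kernel_shift)
    also have "\<dots> = (\<Sum>K\<in>{0..2*N}. sign_kernel m i (K - j) * G K) - (\<Sum>K\<in>{0..2*N}. sign_kernel m j (K - i) * G K)"
      unfolding sum_subtractf[symmetric] by (intro sum.cong refl) (simp add: sign_kernel_shift[of j i] algebra_simps)
    also have "(\<Sum>K\<in>{0..2*N}. sign_kernel m i (K - j) * G K) = (\<Sum>k\<in>{0..N}. sign_kernel m i k * G (k + j))"
      using ij m by (intro sum_sign_kernel_shift[symmetric])
    also have "\<dots> = f i j"
      unfolding f_def by (intro sum.cong refl) (simp add: G_def algebra_simps)
    also have "(\<Sum>K\<in>{0..2*N}. sign_kernel m j (K - i) * G K) = (\<Sum>k\<in>{0..N}. sign_kernel m j k * G (k + i))"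
      using ij m by (intro sum_sign_kernel_shift[symmetric])
    also have "\<dots> = f j i"
      unfolding f_def by (intro sum.cong refl) (simp add: G_def algebra_simps)
    finally show ?thesis .
  qed
  have 2: "(\<Sum>j\<in>{0..N}. of_int (j - i) * x i * x j * f i j) =
        x i * (\<Sum>k\<in>{0..N}. sign_kernel m i k * (of_int (i - k) * Y k (m + i - k)))" if i: "i \<in> {0..N}" for i
  proof -
    have "(\<Sum>j\<in>{0..N}. of_int (j - i) * x i * x j * f i j) =
        x i * (\<Sum>k\<in>{0..N}. sign_kernel m i k * (\<Sum>j\<in>{0..N}. of_int (j - i) * x j * Yl (k + j) (m + i - k)))"
      unfolding f_def sum_distrib_left
      by (subst sum.swap) (intro sum.cong refl, simp add: algebra_simps)
    also have "(\<Sum>j\<in>{0..N}. of_int (j - i) * x j * Yl (k + j) (m + i - k)) = of_int (i - k) * Y k (m + i - k)"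
      if k: "k \<in> {0..N}" for k
    proof (cases "0 < m + i - k \<and> m + i - k < N")
      case True
      have "(\<Sum>j\<in>{0..N}. of_int (j - i) * x j * X (k + j, 2) (m + i - k, 1)) =
         - (\<Sum>j\<in>{0..N}. of_int (i - j) * x j * X (k + j, 2) (m + i - k, 1))"
        unfolding sum_negf[symmetric] by (intro sum.cong refl) (simp add: algebra_simps)
      then show ?thesis using left_diff[of k 1 "m + i - k" 1 i] True k by (simp add: algebra_simps)
    qed auto
    then have "(\<Sum>k\<in>{0..N}. sign_kernel m i k * (\<Sum>j\<in>{0..N}. of_int (j - i) * x j * Yl (k + j) (m + i - k))) =
        (\<Sum>k\<in>{0..N}. sign_kernel m i k * (of_int (i - k) * Y k (m + i - k)))"
      by (intro sum.cong refl arg_cong2[of _ _ _ _ "(*)"]) 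
    finally show ?thesis .
  qed
  have "(\<Sum>i\<in>{0..N}. \<Sum>j\<in>{0..N}. of_int (j - i) * x i * x j *
            (\<Sum>k\<in>{0..N}. sign_kernel j i k * Yl (k + m) (i + j - k))) =
     (\<Sum>i\<in>{0..N}. \<Sum>j\<in>{0..N}. of_int (j - i) * x i * x j * (f i j - f j i))"
    by (intro sum.cong refl arg_cong2[of _ _ _ _ "(*)"] 1)
  also have "\<dots> = 2 * (\<Sum>i\<in>{0..N}. \<Sum>j\<in>{0..N}. of_int (j - i) * x i * x j * f i j)"
    by (rule sum_antisym)
  also have "(\<Sum>i\<in>{0..N}. \<Sum>j\<in>{0..N}. of_int (j - i) * x i * x j * f i j) =
     (\<Sum>i\<in>{0..N}. x i * (\<Sum>k\<in>{0..N}. sign_kernel m i k * (of_int (i - k) * Y k (m + i - k))))"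
    by (intro sum.cong refl 2)
  finally show ?thesis .
qed

text \<open>After the right argument has moved by \<open>v\<^sub>m\<close> it may be interior although the original one was not, so
  \<open>Yr\<close> counts terms that are absent from the derivative. They come from splittings whose right part is \<open>(0, 1)\<close>
  or \<open>(N, 1)\<close>, and they add up to Euler relations at the origin on the left, where the degree is zero.\<close>

lemma boundary_vanishes:
  assumes m: "m \<in> {0..N}"
  shows "(\<Sum>i\<in>{0..N}. \<Sum>j\<in>{0..N}. of_int (j - i) * x i * x j *
            (\<Sum>k\<in>{0..N}. sign_kernel j i k * (if 0 < i + j - k \<and> i + j - k < N then 0 else Yr k (i + j - k + m)))) = 0"
proof -
  define f where "f i j = (if i = 0 then Yr j m else 0) + (if j = N then Yr i (N + m) else 0)" for i j
  have 1: "(\<Sum>k\<in>{0..N}. sign_kernel j i k * (if 0 < i + j - k \<and> i + j - k < N then 0 else Yr k (i + j - k + m)))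
       = f i j - f j i" if ij: "i \<in> {0..N}" "j \<in> {0..N}" for i j
  proof -
    have "(\<Sum>k\<in>{0..N}. sign_kernel j i k * (if 0 < i + j - k \<and> i + j - k < N then 0 else Yr k (i + j - k + m))) =
       (\<Sum>k\<in>{0..N}. (if k = i + j then sign_kernel j i (i + j) * Yr (i + j) m else 0) +
          (if k = i + j - N then sign_kernel j i (i + j - N) * Yr (i + j - N) (N + m) else 0))"
      using ij N_pos by (intro sum.cong refl) (auto simp: sign_kernel_def sgn_if)
    also have "\<dots> = (if i + j \<le> N then sign_kernel j i (i + j) * Yr (i + j) m else 0) +
        (if N \<le> i + j then sign_kernel j i (i + j - N) * Yr (i + j - N) (N + m) else 0)"
      using ij by (subst sum.distrib) (auto simp: sum.delta)
    also have "\<dots> = f i j - f j i"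
      using ij N_pos unfolding f_def by (auto simp: sign_kernel_def sgn_if)
    finally show ?thesis .
  qed
  have "(\<Sum>i\<in>{0..N}. \<Sum>j\<in>{0..N}. of_int (j - i) * x i * x j *
            (\<Sum>k\<in>{0..N}. sign_kernel j i k * (if 0 < i + j - k \<and> i + j - k < N then 0 else Yr k (i + j - k + m)))) =
     (\<Sum>i\<in>{0..N}. \<Sum>j\<in>{0..N}. of_int (j - i) * x i * x j * (f i j - f j i))"
    by (intro sum.cong refl arg_cong2[of _ _ _ _ "(*)"] 1)
  also have "\<dots> = 2 * (\<Sum>i\<in>{0..N}. \<Sum>j\<in>{0..N}. of_int (j - i) * x i * x j * f i j)"
    by (rule sum_antisym)
  also have "(\<Sum>i\<in>{0..N}. \<Sum>j\<in>{0..N}. of_int (j - i) * x i * x j * f i j) =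
     (\<Sum>i\<in>{0..N}. \<Sum>j\<in>{0..N}. if i = 0 then x 0 * (of_int j * x j * Yr j m) else 0) +
     (\<Sum>i\<in>{0..N}. \<Sum>j\<in>{0..N}. if j = N then x N * (of_int (N - i) * x i * Yr i (N + m)) else 0)"
    unfolding sum.distrib[symmetric] f_def by (intro sum.cong refl) (simp add: distrib_left)
  also have "\<dots> = x 0 * (\<Sum>j\<in>{0..N}. of_int j * x j * Yr j m) +
      x N * (\<Sum>i\<in>{0..N}. of_int (N - i) * x i * Yr i (N + m))"
    using N_pos by (subst sum.swap) (simp add: sum.delta sum_distrib_left)
  also have "(\<Sum>j\<in>{0..N}. of_int j * x j * Yr j m) = 0"
    using left_fst[of 0 0 m 2] m N_pos by (cases "m = 0") auto
  also have "(\<Sum>i\<in>{0..N}. of_int (N - i) * x i * Yr i (N + m)) = 0"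
    using left_diff[of 0 0 "N + m" 2 N] m N_pos by (cases "m = N") auto
  finally show ?thesis by simp
qed

text \<open>By \<open>sign_kernel_chain\<close> the kernel for \<open>(i, j)\<close> splits at \<open>m\<close>, which again gives an antisymmetric summand,
  and the sum over \<open>j\<close> is an Euler relation on the right at \<open>(m + i - k, 1)\<close>. For the two values of \<open>k\<close> for
  which this point lies on the boundary there is no such relation, and these produce the boundary terms.\<close>

lemma kernel_right_shift:
  assumes m: "m \<in> {0..N}"
  shows "(\<Sum>i\<in>{0..N}. \<Sum>j\<in>{0..N}. of_int (j - i) * x i * x j *
            (\<Sum>k\<in>{0..N}. sign_kernel j i k * Yr k (i + j - k + m))) =
         2 * (\<Sum>i\<in>{0..N}. x i * (\<Sum>k\<in>{0..N}. sign_kernel m i k * (of_int (k - m) * Y k (m + i - k)))) +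
         2 * (x 0 * (\<Sum>j\<in>{0..N}. of_int j * x j * X (m, 1) (j, 2)) +
              x N * (\<Sum>j\<in>{0..N}. of_int (N - j) * x j * X (m, 1) (N + j, 2)))"
proof -
  define f where "f i j = (\<Sum>k\<in>{0..N}. sign_kernel m i k * Yr k (m + i - k + j))" for i j
  define W where "W i k = (\<Sum>j\<in>{0..N}. of_int (j - i) * x j * Yr k (m + i - k + j))" for i k
  have 1: "(\<Sum>k\<in>{0..N}. sign_kernel j i k * Yr k (i + j - k + m)) = f i j - f j i" for i j
    unfolding f_def sum_subtractf[symmetric]
    by (intro sum.cong refl) (simp add: sign_kernel_chain[of j i _ m] sign_kernel_swap[of j m] algebra_simps)
  have W_int: "W i k = of_int (k - m) * X (k, 1) (m + i - k, 1)"
    if "k \<in> {0..N}" "0 < m + i - k" "m + i - k < N" for i k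
  proof -
    have "W i k = - (\<Sum>j\<in>{0..N}. of_int (i - j) * x j * X (k, 1) (m + i - k + j, 2))"
      unfolding W_def sum_negf[symmetric] using that by (intro sum.cong refl) (auto simp: algebra_simps)
    then show ?thesis using right_diff[of k 1 "m + i - k" 1 i] that by (simp add: algebra_simps)
  qed
  have 2: "(\<Sum>k\<in>{0..N}. sign_kernel m i k * W i k) =
       (\<Sum>k\<in>{0..N}. sign_kernel m i k * (of_int (k - m) * Y k (m + i - k))) +
       (if m + i \<le> N then sign_kernel m i (m + i) * W i (m + i) else 0) +
       (if N \<le> m + i then sign_kernel m i (m + i - N) * W i (m + i - N) else 0)" if i: "i \<in> {0..N}" for i
  proof -
    have "(\<Sum>k\<in>{0..N}. sign_kernel m i k * W i k) =
      (\<Sum>k\<in>{0..N}. sign_kernel m i k * (of_int (k - m) * Y k (m + i - k)) +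
         ((if k = m + i then sign_kernel m i (m + i) * W i (m + i) else 0) +
         (if k = m + i - N then sign_kernel m i (m + i - N) * W i (m + i - N) else 0)))"
    proof (intro sum.cong refl)
      fix k assume k: "k \<in> {0..N}"
      consider "0 < m + i - k \<and> m + i - k < N" | "m + i - k = 0" | "m + i - k = N"
        | "m + i - k < 0 \<or> m + i - k > N" by linarith
      then show "sign_kernel m i k * W i k = sign_kernel m i k * (of_int (k - m) * Y k (m + i - k)) +
         ((if k = m + i then sign_kernel m i (m + i) * W i (m + i) else 0) +
         (if k = m + i - N then sign_kernel m i (m + i - N) * W i (m + i - N) else 0))"
      proof cases
        case 1 then show ?thesis using W_int[OF k] by auto
      next
        case 2 then have "k = m + i" by simp
        then show ?thesis using N_pos by simp
      next
        case 3 then have "k = m + i - N" by simp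
        then show ?thesis using N_pos by simp
      next
        case 4
        then have "sign_kernel m i k = 0" using m i by (intro sign_kernel_outside) auto
        then show ?thesis using 4 by auto
      qed
    qed
    also have "\<dots> = (\<Sum>k\<in>{0..N}. sign_kernel m i k * (of_int (k - m) * Y k (m + i - k))) +
       ((if m + i \<le> N then sign_kernel m i (m + i) * W i (m + i) else 0) +
       (if N \<le> m + i then sign_kernel m i (m + i - N) * W i (m + i - N) else 0))"
      unfolding sum.distrib using m i by (simp add: sum.delta)
    finally show ?thesis by simp
  qed
  (* For m = 0 and m = N all rows i contribute a boundary term. Their total vanishes by the Euler relation
     on the left at the origin, so all of them can be traded for the single row i = m. *)
  have Wsum: "(\<Sum>i\<in>{0..N}. x i * (\<Sum>j\<in>{0..N}. of_int (j - i) * x j * Yr i (s + j))) = 0" for s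
  proof -
    have "(\<Sum>i\<in>{0..N}. x i * (\<Sum>j\<in>{0..N}. of_int (j - i) * x j * Yr i (s + j))) =
      (\<Sum>j\<in>{0..N}. x j * (\<Sum>i\<in>{0..N}. of_int (j - i) * x i * Yr i (s + j)))"
      unfolding sum_distrib_left by (subst sum.swap) (intro sum.cong refl, simp add: algebra_simps)
    also have "\<dots> = (\<Sum>j\<in>{0..N}. 0)"
    proof (intro sum.cong refl)
      fix j
      show "x j * (\<Sum>i\<in>{0..N}. of_int (j - i) * x i * Yr i (s + j)) = 0"
        using left_diff[of 0 0 "s + j" 2 j] N_pos by (cases "0 < s + j \<and> s + j < 2 * N") auto
    qed
    finally show ?thesis by simp
  qed
  have split0: "(\<Sum>i\<in>{0..N}. g i) = g a + (\<Sum>i\<in>{0..N} - {a}. g i)" if "a \<in> {0..N}" for g :: "int \<Rightarrow> complex" and a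
    using that by (subst sum.remove[of _ a]) auto
  have 3: "(\<Sum>i\<in>{0..N}. x i * (if m + i \<le> N then sign_kernel m i (m + i) * W i (m + i) else 0)) =
      x 0 * (\<Sum>j\<in>{0..N}. of_int j * x j * X (m, 1) (j, 2))"
  proof -
    have W0: "W 0 m = (\<Sum>j\<in>{0..N}. of_int j * x j * X (m, 1) (j, 2))"
      unfolding W_def using N_pos by (intro sum.cong refl) auto
    have "(\<Sum>i\<in>{0..N}. x i * (if m + i \<le> N then sign_kernel m i (m + i) * W i (m + i) else 0)) = x 0 * W 0 m"
    proof (cases "m = 0")
      case True
      have "(\<Sum>i\<in>{0..N} - {0}. x i * (if m + i \<le> N then sign_kernel m i (m + i) * W i (m + i) else 0)) =
        - (\<Sum>i\<in>{0..N} - {0}. x i * (\<Sum>j\<in>{0..N}. of_int (j - i) * x j * Yr i (0 + j)))"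
      proof (unfold sum_negf[symmetric], intro sum.cong refl)
        fix i assume i: "i \<in> {0..N} - {0}"
        have "W i (m + i) = (\<Sum>j\<in>{0..N}. of_int (j - i) * x j * Yr i (0 + j))"
          unfolding W_def True by (simp only: add_0_left diff_self)
        then show "x i * (if m + i \<le> N then sign_kernel m i (m + i) * W i (m + i) else 0) =
            - (x i * (\<Sum>j\<in>{0..N}. of_int (j - i) * x j * Yr i (0 + j)))"
          using i by (simp add: True sign_kernel_def)
      qed
      also have "\<dots> = x 0 * (\<Sum>j\<in>{0..N}. of_int (j - 0) * x j * Yr 0 (0 + j))"
        using Wsum[of 0] split0[of 0 "\<lambda>i. x i * (\<Sum>j\<in>{0..N}. of_int (j - i) * x j * Yr i (0 + j))"] N_pos
        by (simp add: add_eq_0_iff2)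
      also have "(\<Sum>j\<in>{0..N}. of_int (j - 0) * x j * Yr 0 (0 + j)) = W 0 m"
        unfolding W_def True by (simp only: add_0_left diff_self)
      finally show ?thesis
        using split0[of 0] N_pos by (simp add: True sign_kernel_def)
    next
      case False
      have "(\<Sum>i\<in>{0..N} - {0}. x i * (if m + i \<le> N then sign_kernel m i (m + i) * W i (m + i) else 0)) = 0"
        using m False by (intro sum.neutral) (auto simp: sign_kernel_def sgn_if)
      then show ?thesis using split0[of 0] N_pos m False by (simp add: sign_kernel_def sgn_if)
    qed
    then show ?thesis unfolding W0[symmetric] by simp
  qed
  have 4: "(\<Sum>i\<in>{0..N}. x i * (if N \<le> m + i then sign_kernel m i (m + i - N) * W i (m + i - N) else 0)) =
      x N * (\<Sum>j\<in>{0..N}. of_int (N - j) * x j * X (m, 1) (N + j, 2))"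
  proof -
    have WN: "- W N m = (\<Sum>j\<in>{0..N}. of_int (N - j) * x j * X (m, 1) (N + j, 2))"
      unfolding W_def sum_negf[symmetric] using N_pos by (intro sum.cong refl) (auto simp: algebra_simps)
    have "(\<Sum>i\<in>{0..N}. x i * (if N \<le> m + i then sign_kernel m i (m + i - N) * W i (m + i - N) else 0)) = - (x N * W N m)"
    proof (cases "m = N")
      case True
      have "(\<Sum>i\<in>{0..N} - {N}. x i * (if N \<le> m + i then sign_kernel m i (m + i - N) * W i (m + i - N) else 0)) =
        (\<Sum>i\<in>{0..N} - {N}. x i * (\<Sum>j\<in>{0..N}. of_int (j - i) * x j * Yr i (N + j)))"
      proof (intro sum.cong refl)
        fix i assume i: "i \<in> {0..N} - {N}"
        have e: "m + i - N = i" "m + i - i = N" using True by auto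
        have "W i (m + i - N) = (\<Sum>j\<in>{0..N}. of_int (j - i) * x j * Yr i (N + j))"
          unfolding e(1) W_def e(2) by (rule refl)
        then show "x i * (if N \<le> m + i then sign_kernel m i (m + i - N) * W i (m + i - N) else 0) =
            x i * (\<Sum>j\<in>{0..N}. of_int (j - i) * x j * Yr i (N + j))"
          using i by (simp add: True sign_kernel_def)
      qed
      also have "\<dots> = - (x N * (\<Sum>j\<in>{0..N}. of_int (j - N) * x j * Yr N (N + j)))"
        using Wsum[of N] split0[of N "\<lambda>i. x i * (\<Sum>j\<in>{0..N}. of_int (j - i) * x j * Yr i (N + j))"] N_pos
        by (simp add: add_eq_0_iff)
      also have "(\<Sum>j\<in>{0..N}. of_int (j - N) * x j * Yr N (N + j)) = W N m"
        unfolding W_def True by (simp only: add_diff_cancel_right')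
      finally show ?thesis
        using split0[of N] N_pos by (simp add: True sign_kernel_def)
    next
      case False
      have "(\<Sum>i\<in>{0..N} - {N}. x i * (if N \<le> m + i then sign_kernel m i (m + i - N) * W i (m + i - N) else 0)) = 0"
        using m False by (intro sum.neutral) (auto simp: sign_kernel_def sgn_if)
      then show ?thesis using split0[of N] N_pos m False by (simp add: sign_kernel_def sgn_if)
    qed
    then show ?thesis unfolding WN[symmetric] by simp
  qed
  have "(\<Sum>i\<in>{0..N}. \<Sum>j\<in>{0..N}. of_int (j - i) * x i * x j * (\<Sum>k\<in>{0..N}. sign_kernel j i k * Yr k (i + j - k + m))) =
     2 * (\<Sum>i\<in>{0..N}. \<Sum>j\<in>{0..N}. of_int (j - i) * x i * x j * f i j)"
    unfolding 1 by (rule sum_antisym)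
  also have "(\<Sum>i\<in>{0..N}. \<Sum>j\<in>{0..N}. of_int (j - i) * x i * x j * f i j) =
     (\<Sum>i\<in>{0..N}. x i * (\<Sum>k\<in>{0..N}. sign_kernel m i k * W i k))"
  proof (intro sum.cong refl)
    fix i
    show "(\<Sum>j\<in>{0..N}. of_int (j - i) * x i * x j * f i j) = x i * (\<Sum>k\<in>{0..N}. sign_kernel m i k * W i k)"
      unfolding f_def W_def sum_distrib_left
      by (subst sum.swap) (intro sum.cong refl, simp add: algebra_simps)
  qed
  also have "\<dots> = (\<Sum>i\<in>{0..N}. x i * ((\<Sum>k\<in>{0..N}. sign_kernel m i k * (of_int (k - m) * Y k (m + i - k))) +
       (if m + i \<le> N then sign_kernel m i (m + i) * W i (m + i) else 0) +
       (if N \<le> m + i then sign_kernel m i (m + i - N) * W i (m + i - N) else 0)))"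
    by (intro sum.cong refl arg_cong2[of _ _ _ _ "(*)"] 2)
  also have "\<dots> = (\<Sum>i\<in>{0..N}. x i * (\<Sum>k\<in>{0..N}. sign_kernel m i k * (of_int (k - m) * Y k (m + i - k)))) +
      (\<Sum>i\<in>{0..N}. x i * (if m + i \<le> N then sign_kernel m i (m + i) * W i (m + i) else 0)) +
      (\<Sum>i\<in>{0..N}. x i * (if N \<le> m + i then sign_kernel m i (m + i - N) * W i (m + i - N) else 0))"
    by (simp only: sum.distrib distrib_left)
  finally show ?thesis unfolding 3 4 by (simp only: distrib_left add.assoc)
qed

text \<open>The two shifts contribute \<open>i - k\<close> and \<open>k - m\<close>, whose sum \<open>i - m\<close> cancels the derivative of the
  factors \<open>x\<^sub>i x\<^sub>j\<close>. Only the boundary terms remain.\<close>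

lemma kernel_derivative:
  assumes m: "m \<in> {0..N}"
  shows "(\<Sum>i\<in>{0..N}. \<Sum>j\<in>{0..N}. of_int (j - i) * x i * x j * (\<Sum>k\<in>{0..N}. sign_kernel j i k *
            (if 0 < i + j - k \<and> i + j - k < N then X (k + m, 2) (i + j - k, 1) + X (k, 1) (i + j - k + m, 2) else 0)))
       + 2 * (\<Sum>j\<in>{0..N}. of_int (j - m) * x j * (\<Sum>k\<in>{0..N}. sign_kernel j m k * Y k (m + j - k))) =
         2 * (x 0 * (\<Sum>j\<in>{0..N}. of_int j * x j * X (m, 1) (j, 2)) +
              x N * (\<Sum>j\<in>{0..N}. of_int (N - j) * x j * X (m, 1) (N + j, 2)))"
    (is "?A + 2 * ?B = 2 * ?C")
proof -
  have "?A = (\<Sum>i\<in>{0..N}. \<Sum>j\<in>{0..N}. of_int (j - i) * x i * x j *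
            (\<Sum>k\<in>{0..N}. sign_kernel j i k * Yl (k + m) (i + j - k))) +
       (\<Sum>i\<in>{0..N}. \<Sum>j\<in>{0..N}. of_int (j - i) * x i * x j *
            (\<Sum>k\<in>{0..N}. sign_kernel j i k * Yr k (i + j - k + m))) -
       (\<Sum>i\<in>{0..N}. \<Sum>j\<in>{0..N}. of_int (j - i) * x i * x j *
            (\<Sum>k\<in>{0..N}. sign_kernel j i k * (if 0 < i + j - k \<and> i + j - k < N then 0 else Yr k (i + j - k + m))))"
    unfolding sum.distrib[symmetric] sum_subtractf[symmetric] distrib_left[symmetric] right_diff_distrib[symmetric]
    using m by (intro sum.cong refl arg_cong2[of _ _ _ _ "(*)"]) auto
  also have "\<dots> = 2 * ((\<Sum>i\<in>{0..N}. x i * (\<Sum>k\<in>{0..N}. sign_kernel m i k * (of_int (i - k) * Y k (m + i - k)))) +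
       (\<Sum>i\<in>{0..N}. x i * (\<Sum>k\<in>{0..N}. sign_kernel m i k * (of_int (k - m) * Y k (m + i - k))))) + 2 * ?C"
    unfolding kernel_left_shift[OF m] kernel_right_shift[OF m] boundary_vanishes[OF m] by (simp add: algebra_simps)
  also have "(\<Sum>i\<in>{0..N}. x i * (\<Sum>k\<in>{0..N}. sign_kernel m i k * (of_int (i - k) * Y k (m + i - k)))) +
       (\<Sum>i\<in>{0..N}. x i * (\<Sum>k\<in>{0..N}. sign_kernel m i k * (of_int (k - m) * Y k (m + i - k)))) = - ?B"
    unfolding sum.distrib[symmetric] sum_negf[symmetric] distrib_left[symmetric] sum_distrib_left
    by (intro sum.cong refl) (auto simp: sign_kernel_swap[of m] algebra_simps)
  finally show ?thesis by simp
qed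

text \<open>The derivative of the pairing in the direction \<open>w\<close>, if \<open>x\<^sub>i\<close> has the derivative \<open>w\<^sub>i x\<^sub>i\<close> and \<open>X(c, d)\<close>
  has the derivative \<open>\<Sum>\<^sub>m w\<^sub>m x\<^sub>m (X(c + v\<^sub>m, d) + X(c, d + v\<^sub>m))\<close>.\<close>

definition pairing_deriv :: "(int \<Rightarrow> complex) \<Rightarrow> complex" where
  "pairing_deriv w =
    (let dX = (\<lambda>c d. \<Sum>m\<in>{0..N}. w m * x m * (X (fst c + m, snd c + 1) d + X c (fst d + m, snd d + 1))) in
      1/2 * (\<Sum>i\<in>{0..N}. \<Sum>j\<in>{0..N}. (of_int (i - j))\<^sup>2 * x i * x j *
              ((w i + w j) * X (0, 0) (i + j, 2) + dX (0, 0) (i + j, 2)))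
    - of_int N / 4 * (\<Sum>i\<in>{0..N}. \<Sum>j\<in>{0..N}. of_int (j - i) * x i * x j * (\<Sum>k\<in>{0..N}. sign_kernel j i k *
         (if 0 < i + j - k \<and> i + j - k < N
          then (w i + w j) * X (k, 1) (i + j - k, 1) + dX (k, 1) (i + j - k, 1) else 0))))"

lemma sum_weights:
  fixes a :: "int \<Rightarrow> int \<Rightarrow> complex"
  assumes "\<And>i j. a i j = a j i"
  shows "(\<Sum>i\<in>I. \<Sum>j\<in>I. (w i + w j) * x i * x j * a i j) = (\<Sum>m\<in>I. w m * x m * (2 * (\<Sum>j\<in>I. x j * a m j)))"
proof -
  have "(\<Sum>i\<in>I. \<Sum>j\<in>I. (w i + w j) * x i * x j * a i j) =
     (\<Sum>i\<in>I. \<Sum>j\<in>I. w i * x i * x j * a i j) + (\<Sum>i\<in>I. \<Sum>j\<in>I. w j * x j * x i * a j i)"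
    unfolding sum.distrib[symmetric] using assms by (intro sum.cong refl) (simp add: algebra_simps)
  also have "(\<Sum>i\<in>I. \<Sum>j\<in>I. w j * x j * x i * a j i) = (\<Sum>i\<in>I. \<Sum>j\<in>I. w i * x i * x j * a i j)"
    by (rule sum.swap)
  also have "(\<Sum>i\<in>I. \<Sum>j\<in>I. w i * x i * x j * a i j) = (\<Sum>m\<in>I. w m * x m * (\<Sum>j\<in>I. x j * a m j))"
    unfolding sum_distrib_left by (intro sum.cong refl) (simp add: algebra_simps)
  finally show ?thesis by (simp add: sum_distrib_left algebra_simps flip: sum.distrib)
qed

lemma sum_out:
  fixes b :: "int \<Rightarrow> int \<Rightarrow> int \<Rightarrow> complex"
  shows "(\<Sum>i\<in>I. \<Sum>j\<in>I. a i j * (\<Sum>m\<in>I. v m * b i j m)) = (\<Sum>m\<in>I. v m * (\<Sum>i\<in>I. \<Sum>j\<in>I. a i j * b i j m))"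
proof -
  have "(\<Sum>i\<in>I. \<Sum>j\<in>I. a i j * (\<Sum>m\<in>I. v m * b i j m)) = (\<Sum>i\<in>I. \<Sum>m\<in>I. \<Sum>j\<in>I. v m * (a i j * b i j m))"
    unfolding sum_distrib_left
    by (rule sum.cong[OF refl], subst sum.swap, intro sum.cong refl) (simp add: mult_ac)
  also have "\<dots> = (\<Sum>m\<in>I. \<Sum>i\<in>I. \<Sum>j\<in>I. v m * (a i j * b i j m))" by (rule sum.swap)
  finally show ?thesis by (simp add: sum_distrib_left)
qed

text \<open>The coefficient of \<open>w\<^sub>m x\<^sub>m\<close> is \<open>N B\<close> in the first sum, by \<open>hessian_constant\<close> and \<open>hessian_boundary\<close>, and
  \<open>2 B\<close> in the second one, by \<open>kernel_derivative\<close>, with the same boundary expression \<open>B\<close>. The prefactors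
  \<open>1/2\<close> and \<open>N/4\<close> make them cancel.\<close>

lemma pairing_deriv_zero: "pairing_deriv w = 0"
proof -
  let ?I = "{0..N}"
  define H where "H m = (\<Sum>i\<in>?I. \<Sum>j\<in>?I. (of_int (i - j))\<^sup>2 * x i * x j * (X (m, 1) (i + j, 2) + X (0, 0) (i + j + m, 3)))
      + 2 * (\<Sum>j\<in>?I. x j * ((of_int (m - j))\<^sup>2 * X (0, 0) (m + j, 2)))" for m
  define K where "K m = (\<Sum>i\<in>?I. \<Sum>j\<in>?I. of_int (j - i) * x i * x j * (\<Sum>k\<in>?I. sign_kernel j i k *
            (if 0 < i + j - k \<and> i + j - k < N then X (k + m, 2) (i + j - k, 1) + X (k, 1) (i + j - k + m, 2) else 0)))
       + 2 * (\<Sum>j\<in>?I. x j * (of_int (j - m) * (\<Sum>k\<in>?I. sign_kernel j m k * Y k (m + j - k))))" for m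
  have "(\<Sum>i\<in>?I. \<Sum>j\<in>?I. (of_int (i - j))\<^sup>2 * x i * x j *
              ((w i + w j) * X (0, 0) (i + j, 2) + (\<Sum>m\<in>?I. w m * x m * (X (m, 1) (i + j, 2) + X (0, 0) (i + j + m, 3))))) =
     (\<Sum>i\<in>?I. \<Sum>j\<in>?I. (of_int (i - j))\<^sup>2 * x i * x j * (\<Sum>m\<in>?I. (w m * x m) * (X (m, 1) (i + j, 2) + X (0, 0) (i + j + m, 3)))) +
     (\<Sum>i\<in>?I. \<Sum>j\<in>?I. (w i + w j) * x i * x j * ((of_int (i - j))\<^sup>2 * X (0, 0) (i + j, 2)))"
    unfolding sum.distrib[symmetric] by (intro sum.cong refl) (simp add: distrib_left distrib_right)
  also have "(\<Sum>i\<in>?I. \<Sum>j\<in>?I. (w i + w j) * x i * x j * ((of_int (i - j))\<^sup>2 * X (0, 0) (i + j, 2))) =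
     (\<Sum>m\<in>?I. w m * x m * (2 * (\<Sum>j\<in>?I. x j * ((of_int (m - j))\<^sup>2 * X (0, 0) (m + j, 2)))))"
    by (rule sum_weights) (simp add: add.commute power2_commute)
  finally have 1: "(\<Sum>i\<in>?I. \<Sum>j\<in>?I. (of_int (i - j))\<^sup>2 * x i * x j *
              ((w i + w j) * X (0, 0) (i + j, 2) + (\<Sum>m\<in>?I. w m * x m * (X (m, 1) (i + j, 2) + X (0, 0) (i + j + m, 3))))) =
      (\<Sum>m\<in>?I. w m * x m * H m)"
    unfolding sum_out H_def by (simp only: sum.distrib distrib_left)
  have "(\<Sum>i\<in>?I. \<Sum>j\<in>?I. of_int (j - i) * x i * x j * (\<Sum>k\<in>?I. sign_kernel j i k *
         (if 0 < i + j - k \<and> i + j - k < N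
          then (w i + w j) * X (k, 1) (i + j - k, 1) +
            (\<Sum>m\<in>?I. w m * x m * (X (k + m, 2) (i + j - k, 1) + X (k, 1) (i + j - k + m, 2))) else 0))) =
     (\<Sum>i\<in>?I. \<Sum>j\<in>?I. of_int (j - i) * x i * x j * (\<Sum>m\<in>?I. (w m * x m) * (\<Sum>k\<in>?I. sign_kernel j i k *
            (if 0 < i + j - k \<and> i + j - k < N then X (k + m, 2) (i + j - k, 1) + X (k, 1) (i + j - k + m, 2) else 0)))) +
     (\<Sum>i\<in>?I. \<Sum>j\<in>?I. (w i + w j) * x i * x j * (of_int (j - i) * (\<Sum>k\<in>?I. sign_kernel j i k * Y k (i + j - k))))"
    (is "?L = _ + _")
  proof (unfold sum.distrib[symmetric], intro sum.cong refl)
    fix i j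
    have distr: "a * p * q * (v * s + t) = a * p * q * t + v * p * q * (a * s)" for a p q v s t :: complex
      by (simp add: algebra_simps)
    have "(\<Sum>k\<in>?I. sign_kernel j i k * (if 0 < i + j - k \<and> i + j - k < N
          then (w i + w j) * X (k, 1) (i + j - k, 1) +
            (\<Sum>m\<in>?I. w m * x m * (X (k + m, 2) (i + j - k, 1) + X (k, 1) (i + j - k + m, 2))) else 0)) =
       (\<Sum>k\<in>?I. (w i + w j) * (sign_kernel j i k * Y k (i + j - k)) +
        (\<Sum>m\<in>?I. (w m * x m) * (sign_kernel j i k * (if 0 < i + j - k \<and> i + j - k < N then X (k + m, 2) (i + j - k, 1) + X (k, 1) (i + j - k + m, 2) else 0))))"
      by (intro sum.cong refl) (auto simp: distrib_left sum_distrib_left mult_ac)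
    also have "\<dots> = (w i + w j) * (\<Sum>k\<in>?I. sign_kernel j i k * Y k (i + j - k)) + (\<Sum>m\<in>?I. (w m * x m) * (\<Sum>k\<in>?I. sign_kernel j i k *
            (if 0 < i + j - k \<and> i + j - k < N then X (k + m, 2) (i + j - k, 1) + X (k, 1) (i + j - k + m, 2) else 0)))"
      unfolding sum.distrib sum_distrib_left by (subst (2) sum.swap) (rule refl)
    finally show "of_int (j - i) * x i * x j * (\<Sum>k\<in>?I. sign_kernel j i k * (if 0 < i + j - k \<and> i + j - k < N
          then (w i + w j) * X (k, 1) (i + j - k, 1) +
            (\<Sum>m\<in>?I. w m * x m * (X (k + m, 2) (i + j - k, 1) + X (k, 1) (i + j - k + m, 2))) else 0)) =
      of_int (j - i) * x i * x j * (\<Sum>m\<in>?I. (w m * x m) * (\<Sum>k\<in>?I. sign_kernel j i k *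
            (if 0 < i + j - k \<and> i + j - k < N then X (k + m, 2) (i + j - k, 1) + X (k, 1) (i + j - k + m, 2) else 0))) +
      (w i + w j) * x i * x j * (of_int (j - i) * (\<Sum>k\<in>?I. sign_kernel j i k * Y k (i + j - k)))"
      by (simp only: distr)
  qed
  also have "(\<Sum>i\<in>?I. \<Sum>j\<in>?I. (w i + w j) * x i * x j * (of_int (j - i) * (\<Sum>k\<in>?I. sign_kernel j i k * Y k (i + j - k)))) =
     (\<Sum>m\<in>?I. w m * x m * (2 * (\<Sum>j\<in>?I. x j * (of_int (j - m) * (\<Sum>k\<in>?I. sign_kernel j m k * Y k (m + j - k))))))"
  proof (rule sum_weights)
    fix i j
    have "(\<Sum>k\<in>?I. sign_kernel j i k * Y k (i + j - k)) = - (\<Sum>k\<in>?I. sign_kernel i j k * Y k (j + i - k))"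
      unfolding sum_negf[symmetric] by (intro sum.cong refl) (simp add: sign_kernel_swap[of j i] add.commute)
    then show "of_int (j - i) * (\<Sum>k\<in>?I. sign_kernel j i k * Y k (i + j - k)) =
        of_int (i - j) * (\<Sum>k\<in>?I. sign_kernel i j k * Y k (j + i - k))"
      by (simp add: algebra_simps)
  qed
  finally have 2: "?L = (\<Sum>m\<in>?I. w m * x m * K m)"
    unfolding sum_out K_def by (simp only: sum.distrib distrib_left)
  have HK: "1/2 * H m = of_int N / 4 * K m" if m: "m \<in> ?I" for m
  proof -
    define B where "B = x 0 * (\<Sum>j\<in>?I. of_int j * x j * X (m, 1) (j, 2)) +
              x N * (\<Sum>j\<in>?I. of_int (N - j) * x j * X (m, 1) (N + j, 2))"
    have sq: "(\<Sum>j\<in>?I. x j * ((of_int (m - j))\<^sup>2 * X (0, 0) (m + j, 2))) =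
      (\<Sum>j\<in>?I. (of_int (j - m))\<^sup>2 * x j * X (0, 0) (m + j, 2))"
      by (intro sum.cong refl) (simp add: power2_commute[of "of_int m"])
    have "H m = of_int N * B"
      unfolding H_def sq distrib_left sum.distrib
      using hessian_constant[OF m, of 0 0] hessian_boundary[of m 1] m unfolding B_def by (simp add: add.assoc)
    moreover have "K m = 2 * B"
      using kernel_derivative[OF m] unfolding K_def B_def by (simp add: mult_ac)
    ultimately show ?thesis by simp
  qed
  have "pairing_deriv w = 1/2 * (\<Sum>m\<in>?I. w m * x m * H m) - of_int N / 4 * (\<Sum>m\<in>?I. w m * x m * K m)"
    unfolding pairing_deriv_def Let_def 1[symmetric] 2[symmetric] fst_conv snd_conv
    using one_plus_numeral[of num.One, where 'a = int] by (simp only: add_0_left one_add_one numeral_plus_one) simp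
  also have "\<dots> = (\<Sum>m\<in>?I. w m * x m * (1/2 * H m - of_int N / 4 * K m))"
    unfolding sum_distrib_left sum_subtractf[symmetric] by (intro sum.cong refl) (simp add: algebra_simps)
  also have "\<dots> = 0" using HK by (intro sum.neutral) auto
  finally show ?thesis .
qed

end

section \<open>Taylor coefficients of the Gamma factors\<close>

lemma of_rat_complex: "(of_rat r :: complex) = of_real (of_rat r)"
  by (cases r) (simp add: of_rat_rat)

definition rgamma_fps :: "rat \<Rightarrow> complex fps" where
  "rgamma_fps l = fps_expansion (\<lambda>z. rGamma (1 + of_rat l + z / (2 * of_real pi * \<i>))) 0"

lemma rgamma_fps_expansion:
  "(\<lambda>z. rGamma (1 + of_rat l + z / (2 * of_real pi * \<i>))) has_fps_expansion rgamma_fps l"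
  unfolding rgamma_fps_def
  by (intro analytic_at_imp_has_fps_expansion_0 analytic_intros) auto

lemma rgamma_fps_0: "fps_nth (rgamma_fps l) 0 = rGamma (1 + of_rat l)"
  using has_fps_expansion_imp_0_eq_fps_nth_0[OF rgamma_fps_expansion[of l]] by simp

text \<open>The functional equation \<open>1/\<Gamma>(u) = u \<sqdot> 1/\<Gamma>(1 + u)\<close> at \<open>u = l + z/(2\<pi>i)\<close>.\<close>

lemma rgamma_fps_shift:
  "rgamma_fps (l - 1) = (fps_const (of_rat l) + fps_const (1 / (2 * of_real pi * \<i>)) * fps_X) * rgamma_fps l"
proof (rule fps_expansion_unique_complex)
  show "(\<lambda>z. rGamma (1 + of_rat (l - 1) + z / (2 * of_real pi * \<i>))) has_fps_expansion rgamma_fps (l - 1)"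
    by (rule rgamma_fps_expansion)
  have "(\<lambda>z. (of_rat l + 1 / (2 * of_real pi * \<i>) * z) * rGamma (1 + of_rat l + z / (2 * of_real pi * \<i>)))
    has_fps_expansion (fps_const (of_rat l) + fps_const (1 / (2 * of_real pi * \<i>)) * fps_X) * rgamma_fps l"
    by (intro fps_expansion_intros rgamma_fps_expansion)
  also have "(\<lambda>z. (of_rat l + 1 / (2 * of_real pi * \<i>) * z) * rGamma (1 + of_rat l + z / (2 * of_real pi * \<i>)))
     = (\<lambda>z. rGamma (1 + of_rat (l - 1) + z / (2 * of_real pi * \<i>)))"
  proof
    fix z :: complex
    show "(of_rat l + 1 / (2 * of_real pi * \<i>) * z) * rGamma (1 + of_rat l + z / (2 * of_real pi * \<i>)) =
       rGamma (1 + of_rat (l - 1) + z / (2 * of_real pi * \<i>))"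
      using rGamma_plus1[of "of_rat l + z / (2 * of_real pi * \<i>)"] by (simp add: of_rat_diff algebra_simps)
  qed
  finally show "(\<lambda>z. rGamma (1 + of_rat (l - 1) + z / (2 * of_real pi * \<i>))) has_fps_expansion
      (fps_const (of_rat l) + fps_const (1 / (2 * of_real pi * \<i>)) * fps_X) * rgamma_fps l" .
qed

lemma gamma_factor_eq:
  "gamma_factor y l = fps_const (exp (of_rat l * y)) * (fps_exp (y / (2 * of_real pi * \<i>)) * rgamma_fps l)"
  unfolding gamma_factor_def
proof (rule fps_expansion_eqI)
  have "(\<lambda>z. exp (of_rat l * y) * (exp (y / (2 * of_real pi * \<i>) * z) * rGamma (1 + of_rat l + z / (2 * of_real pi * \<i>))))
    has_fps_expansion fps_const (exp (of_rat l * y)) * (fps_exp (y / (2 * of_real pi * \<i>)) * rgamma_fps l)"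
    by (intro fps_expansion_intros rgamma_fps_expansion)
  moreover have "exp (of_rat l * y) * (exp (y / (2 * of_real pi * \<i>) * z) * g) = exp ((of_rat l + z / (2 * of_real pi * \<i>)) * y) * g" for z g
  proof -
    have "(of_rat l + z / (2 * of_real pi * \<i>)) * y = of_rat l * y + y / (2 * of_real pi * \<i>) * z"
      by (simp add: distrib_right)
    then show ?thesis by (simp add: exp_add)
  qed
  ultimately show "(\<lambda>z. exp ((of_rat l + z / (2 * of_real pi * \<i>)) * y) * rGamma (1 + of_rat l + z / (2 * of_real pi * \<i>)))
    has_fps_expansion fps_const (exp (of_rat l * y)) * (fps_exp (y / (2 * of_real pi * \<i>)) * rgamma_fps l)"
    by (simp only:)
qed

lemma gamma_factor_nth:
  "fps_nth (gamma_factor y l) j = exp (of_rat l * y) *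
     (\<Sum>i\<le>j. (y / (2 * of_real pi * \<i>)) ^ i / fact i * fps_nth (rgamma_fps l) (j - i))"
  unfolding gamma_factor_eq fps_mult_left_const_nth by (simp add: fps_mult_nth fps_exp_def atLeast0AtMost)

lemma gamma_factor_shift:
  "fps_const (exp y) * gamma_factor y (l - 1) =
     (fps_const (of_rat l) + fps_const (1 / (2 * of_real pi * \<i>)) * fps_X) * gamma_factor y l"
proof -
  have "exp y * exp (of_rat (l - 1) * y) = exp (of_rat l * y)"
    by (simp add: exp_add[symmetric] of_rat_diff algebra_simps)
  then have "fps_const (exp y) * fps_const (exp (of_rat (l - 1) * y)) = fps_const (exp (of_rat l * y))"
    by simp
  then show ?thesis
    unfolding gamma_factor_eq rgamma_fps_shift mult.assoc[symmetric] by (simp add: mult_ac)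
qed

lemma gamma_factor_shift_nth:
  "exp y * fps_nth (gamma_factor y (l - 1)) j = of_rat l * fps_nth (gamma_factor y l) j +
     (if j = 0 then 0 else fps_nth (gamma_factor y l) (j - 1) / (2 * of_real pi * \<i>))"
  using arg_cong[OF gamma_factor_shift[of y l], of "\<lambda>f. fps_nth f j"]
  by (simp add: distrib_right mult.assoc)

text \<open>Differentiating \<open>exp ((l + z/(2\<pi>i)) y)\<close> multiplies it by \<open>l + z/(2\<pi>i)\<close>, and this factor turns
  \<open>1/\<Gamma>(1 + l + z/(2\<pi>i))\<close> into the reciprocal Gamma function for \<open>l - 1\<close>.\<close>

lemma gamma_factor_deriv:
  "((\<lambda>y. fps_nth (gamma_factor y l) j) has_field_derivative exp y * fps_nth (gamma_factor y (l - 1)) j) (at y)"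
proof -
  define c where "c = 1 / (2 * of_real pi * \<i>)"
  define p where "p j y = (\<Sum>i\<le>j. (y * c) ^ i / fact i * fps_nth (rgamma_fps l) (j - i))" for j y
  have nth: "fps_nth (gamma_factor y l) j = exp (of_rat l * y) * p j y" for y j
    by (simp add: gamma_factor_nth p_def c_def)
  have p: "(p j has_field_derivative (if j = 0 then 0 else c * p (j - 1) y)) (at y)"
  proof (cases j)
    case 0
    then show ?thesis by (simp add: p_def[abs_def])
  next
    case (Suc j')
    have pj: "p j = (\<lambda>y. fps_nth (rgamma_fps l) j + (\<Sum>i\<le>j'. (y * c) ^ Suc i / fact (Suc i) * fps_nth (rgamma_fps l) (j' - i)))"
      by (simp add: p_def[abs_def] Suc sum.atMost_Suc_shift del: sum.atMost_Suc)
    have "(p j has_field_derivative (\<Sum>i\<le>j'. c * ((y * c) ^ i / fact i * fps_nth (rgamma_fps l) (j' - i)))) (at y)"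
    proof -
      have "((\<lambda>y. (y * c) ^ Suc i / fact (Suc i) * r) has_field_derivative c * ((y * c) ^ i / fact i * r)) (at y)" for i r
      proof -
        have f: "(fact (Suc i) :: complex) = of_nat (Suc i) * fact i" by simp
        have "((\<lambda>y. (y * c) ^ Suc i) has_field_derivative of_nat (Suc i) * (y * c) ^ i * c) (at y)"
          by (rule derivative_eq_intros refl | simp)+
        then have "((\<lambda>y. (y * c) ^ Suc i / fact (Suc i) * r) has_field_derivative
            (of_nat (Suc i) * (y * c) ^ i * c) / fact (Suc i) * r) (at y)"
          by (intro DERIV_cmult_right DERIV_cdivide)
        also have "(of_nat (Suc i) * (y * c) ^ i * c) / fact (Suc i) * r = c * ((y * c) ^ i / fact i * r)"
          unfolding f by (simp del: of_nat_Suc)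
        finally show ?thesis .
      qed
      then have "((\<lambda>y. fps_nth (rgamma_fps l) j + (\<Sum>i\<le>j'. (y * c) ^ Suc i / fact (Suc i) * fps_nth (rgamma_fps l) (j' - i)))
        has_field_derivative 0 + (\<Sum>i\<le>j'. c * ((y * c) ^ i / fact i * fps_nth (rgamma_fps l) (j' - i)))) (at y)"
        by (intro DERIV_add DERIV_const DERIV_sum)
      then show ?thesis unfolding pj by simp
    qed
    then show ?thesis by (simp add: Suc p_def sum_distrib_left)
  qed
  have "((\<lambda>y. exp (of_rat l * y) * p j y) has_field_derivative
     of_rat l * (exp (of_rat l * y) * p j y) + exp (of_rat l * y) * (if j = 0 then 0 else c * p (j - 1) y)) (at y)"
    by (rule derivative_eq_intros p refl | simp)+
  also have "of_rat l * (exp (of_rat l * y) * p j y) + exp (of_rat l * y) * (if j = 0 then 0 else c * p (j - 1) y)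
     = exp y * fps_nth (gamma_factor y (l - 1)) j"
    unfolding gamma_factor_shift_nth nth by (simp add: c_def)
  finally show ?thesis by (simp add: nth)
qed

lemma gamma_factor_0: "fps_nth (gamma_factor y l) 0 = exp (of_rat l * y) * rGamma (1 + of_rat l)"
  by (simp add: gamma_factor_nth rgamma_fps_0)

lemma gamma_factor_neg_int:
  assumes "l \<in> \<int>" "l < 0"
  shows "fps_nth (gamma_factor y l) 0 = 0"
proof -
  obtain m where m: "l = of_int m" using assms(1) by (elim Ints_cases)
  then have "1 + of_rat l \<in> (\<int>\<^sub>\<le>\<^sub>0 :: complex set)"
    using assms(2) by (simp add: nonpos_Ints_def) (metis of_int_1 of_int_add add.commute add1_zle_eq add_le_same_cancel2 zless_imp_add1_zle)
  then show ?thesis by (simp add: gamma_factor_0 rGamma_eq_zero_iff)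
qed

text \<open>Euler's constant; it enters as a translation of the logarithms \<open>y\<^sub>k\<close>.\<close>

definition gamma_const :: complex where
  "gamma_const = 2 * of_real pi * \<i> * fps_nth (rgamma_fps 0) 1"

lemma gamma_factor_zero_1: "fps_nth (gamma_factor y 0) (Suc 0) = (y + gamma_const) / (2 * of_real pi * \<i>)"
  by (simp add: gamma_factor_nth gamma_const_def rgamma_fps_0 field_simps)

lemma gamma_factor_minus_one:
  "fps_nth (gamma_factor y (-1)) 0 = 0"
  "fps_nth (gamma_factor y (-1)) (Suc 0) = exp (- y) / (2 * of_real pi * \<i>)"
  "fps_nth (gamma_factor y (-1)) 2 = exp (- y) * (y + gamma_const) / (2 * of_real pi * \<i>)\<^sup>2"
proof -
  show "fps_nth (gamma_factor y (-1)) 0 = 0" by (rule gamma_factor_neg_int) auto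
  have "exp (-y) * (exp y * fps_nth (gamma_factor y (-1)) (Suc j)) = exp (-y) * (fps_nth (gamma_factor y 0) j / (2 * of_real pi * \<i>))" for j
    using gamma_factor_shift_nth[of y 0 "Suc j"] by simp
  then have *: "fps_nth (gamma_factor y (-1)) (Suc j) = exp (-y) * fps_nth (gamma_factor y 0) j / (2 * of_real pi * \<i>)" for j
    by (simp add: mult.assoc[symmetric] exp_add[symmetric])
  show "fps_nth (gamma_factor y (-1)) (Suc 0) = exp (- y) / (2 * of_real pi * \<i>)"
    unfolding * by (simp add: gamma_factor_0)
  show "fps_nth (gamma_factor y (-1)) 2 = exp (- y) * (y + gamma_const) / (2 * of_real pi * \<i>)\<^sup>2"
    unfolding numeral_2_eq_2 * by (simp add: gamma_factor_zero_1 power2_eq_square)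
qed

section \<open>Growth of the Taylor coefficients\<close>

lemma power_le_fact_exp:
  fixes T :: real assumes "0 \<le> T" shows "T ^ m \<le> fact m * exp T"
proof -
  have "(\<Sum>i\<in>{m}. T ^ i /\<^sub>R fact i) \<le> exp T"
    unfolding exp_def using assms
    by (intro sum_le_suminf summable_exp_generic) (auto simp: divide_inverse)
  then show ?thesis by (simp add: field_simps)
qed

text \<open>Translation by the integer part of \<open>Re u\<close> moves \<open>u\<close> into a compact set, at the price of a Pochhammer
  symbol. It is at least a factorial or at most a power of \<open>T\<close>, according to the direction of the translation, and
  \<open>T\<^sup>p \<le> p! exp T\<close> compares the two. The bound has the form of a power of \<open>T\<close> so that, for a common \<open>T\<close>, the
  factors of a product with bounded \<open>\<Sum>\<^sub>k l\<^sub>k\<close> compensate each other.\<close>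

lemma rGamma_bound:
  "\<exists>C\<ge>1. \<forall>u T. \<bar>Im u\<bar> \<le> 1 \<longrightarrow> cmod u + 3 \<le> T \<longrightarrow> cmod (rGamma (1 + u)) \<le> C * exp (2 * T) * T powr (- Re u)"
proof -
  (* The rectangle of width 1 and height 2 into which u is translated. *)
  define R where "R = cbox 0 (Complex 1 1) \<union> cbox (Complex 0 (-1)) 1"
  have "compact ((\<lambda>w. rGamma (1 + w)) ` R)"
    unfolding R_def
    by (intro compact_continuous_image compact_Un compact_cbox holomorphic_on_imp_continuous_on holomorphic_intros)
  then obtain C0 where C0: "\<And>w. w \<in> R \<Longrightarrow> cmod (rGamma (1 + w)) \<le> C0"
    by (meson bounded_iff compact_imp_bounded imageI)
  define C where "C = max 1 C0"
  have "cmod (rGamma (1 + u)) \<le> C * exp (2 * T) * T powr (- Re u)"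
    if u: "\<bar>Im u\<bar> \<le> 1" "cmod u + 3 \<le> T" for u T
  proof -
    define m where "m = \<lfloor>Re u\<rfloor>"
    define w where "w = u - of_int m"
    have T: "T \<ge> 3" using u(2) norm_ge_zero[of u] by linarith
    have w: "0 \<le> Re w" "Re w \<le> 1" "\<bar>Im w\<bar> \<le> 1" using u(1) unfolding w_def m_def by (auto; linarith)+
    have "w \<in> R" using w unfolding R_def by (auto simp: in_cbox_complex_iff)
    then have C: "cmod (rGamma (1 + w)) \<le> C" using C0 by (force simp: C_def)
    have T_exp: "T \<le> exp T" using exp_ge_add_one_self[of T] by linarith
    show ?thesis
    proof (cases "0 \<le> m")
      case True
      define p where "p = nat m"
      have uw: "u = w + of_nat p" using True by (simp add: w_def p_def)
      have poch: "fact p \<le> cmod (pochhammer (1 + w) p)"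
      proof -
        have "fact p = (\<Prod>i<p. 1 + real i)" by (simp add: fact_prod_Suc lessThan_atLeast0 add.commute)
        also have "\<dots> \<le> (\<Prod>i<p. cmod (1 + w + of_nat i))"
        proof (intro prod_mono conjI)
          fix i
          show "1 + real i \<le> cmod (1 + w + of_nat i)"
            using complex_Re_le_cmod[of "1 + w + of_nat i"] w(1) by simp
        qed simp
        finally show ?thesis by (simp add: pochhammer_prod prod_norm lessThan_atLeast0)
      qed
      have "fact p * cmod (rGamma (1 + u)) \<le> cmod (pochhammer (1 + w) p) * cmod (rGamma (1 + u))"
        using poch by (intro mult_right_mono) auto
      also have "\<dots> = cmod (rGamma (1 + w))"
        using pochhammer_rGamma[of "1 + w" p] by (simp add: uw norm_mult add.assoc)
      finally have 1: "fact p * cmod (rGamma (1 + u)) \<le> C" using C by linarith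
      have "T powr Re u \<le> T powr (p + 1)"
        using T w(2) by (intro powr_mono) (auto simp: uw)
      also have "\<dots> = T * T ^ p" using T by (simp add: powr_add powr_realpow)
      also have "\<dots> \<le> exp T * (fact p * exp T)"
        using T T_exp by (intro mult_mono power_le_fact_exp) auto
      finally have 2: "T powr Re u \<le> fact p * exp (2 * T)" by (simp add: exp_add[symmetric] mult_ac)
      have "fact p * (cmod (rGamma (1 + u)) * T powr Re u) \<le> C * (fact p * exp (2 * T))"
        using mult_mono[OF 1 2] by (simp add: C_def mult_ac)
      then have "cmod (rGamma (1 + u)) * T powr Re u \<le> C * exp (2 * T)"
        by (simp add: mult.left_commute)
      then show ?thesis using T by (simp add: powr_minus field_simps)
    next
      case False
      define p where "p = nat (- m)"
      have wu: "w = u + of_nat p" using False by (simp add: w_def p_def)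
      have "cmod (pochhammer (1 + u) p) \<le> T ^ p"
      proof -
        have "cmod (pochhammer (1 + u) p) = (\<Prod>i<p. cmod (1 + u + of_nat i))"
          by (simp add: pochhammer_prod prod_norm lessThan_atLeast0)
        also have "\<dots> \<le> (\<Prod>i<p. T)"
        proof (intro prod_mono conjI)
          fix i assume i: "i \<in> {..<p}"
          have "cmod (1 + u + of_nat i) \<le> \<bar>1 + Re u + real i\<bar> + \<bar>Im u\<bar>"
            using cmod_le[of "1 + u + of_nat i"] by simp
          moreover have "real i + 1 \<le> real p" using i by simp
          then have "\<bar>1 + Re u + real i\<bar> \<le> cmod u + 1"
            using w(2) abs_Re_le_cmod[of u] norm_ge_zero[of u] wu by (auto simp: abs_if split: if_splits)
          ultimately show "cmod (1 + u + of_nat i) \<le> T" using u by linarith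
        qed simp
        finally show ?thesis by simp
      qed
      moreover have "cmod (rGamma (1 + u)) = cmod (pochhammer (1 + u) p) * cmod (rGamma (1 + w))"
        using pochhammer_rGamma[of "1 + u" p] by (simp add: wu norm_mult add.assoc)
      ultimately have b: "cmod (rGamma (1 + u)) \<le> T ^ p * C"
        using C T by (simp add: mult_mono)
      have "T ^ p \<le> exp (2 * T) * T powr (- Re u)"
      proof -
        have "T ^ p = T powr p" using T by (simp add: powr_realpow)
        also have "\<dots> \<le> T powr (1 - Re u)" using T w(2) by (intro powr_mono) (auto simp: wu)
        also have "\<dots> = T * T powr (- Re u)" using T by (simp add: powr_diff powr_minus field_simps)
        also have "\<dots> \<le> exp (2 * T) * T powr (- Re u)"
        proof (rule mult_right_mono)
          have "exp T \<le> exp (2 * T)" using T by simp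
          then show "T \<le> exp (2 * T)" using T_exp by linarith
        qed simp
        finally show ?thesis .
      qed
      then have "T ^ p * C \<le> exp (2 * T) * T powr (- Re u) * C"
        by (intro mult_right_mono) (auto simp: C_def)
      with b show ?thesis by (simp only: mult_ac)
    qed
  qed
  then show ?thesis by (intro exI[of _ C]) (auto simp: C_def)
qed

text \<open>Cauchy's inequality on the unit circle, where the argument differs from \<open>1 + l\<close> by at most \<open>1/(2\<pi>)\<close>.\<close>

lemma rgamma_fps_bound:
  "\<exists>C\<ge>1. \<forall>l T j. real_of_rat \<bar>l\<bar> + 5 \<le> T \<longrightarrow> cmod (fps_nth (rgamma_fps l) j) \<le> C * exp (3 * T) * T powr (- real_of_rat l)"
proof -
  obtain C where C: "C \<ge> 1" "\<And>u T. \<bar>Im u\<bar> \<le> 1 \<Longrightarrow> cmod u + 3 \<le> T \<Longrightarrow> cmod (rGamma (1 + u)) \<le> C * exp (2 * T) * T powr (- Re u)"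
    using rGamma_bound by blast
  have "cmod (fps_nth (rgamma_fps l) j) \<le> C * exp (3 * T) * T powr (- real_of_rat l)"
    if T: "real_of_rat \<bar>l\<bar> + 5 \<le> T" for l T j
  proof -
    define f where "f z = rGamma (1 + of_rat l + z / (2 * of_real pi * \<i>))" for z
    note rat = of_rat_complex[of l]
    have T0: "5 \<le> T" using T zero_le_of_rat_iff[of "\<bar>l\<bar>", where 'a = real] by (simp del: zero_le_of_rat_iff abs_of_rat)
    have "cmod (f z) \<le> C * exp (3 * T) * T powr (- real_of_rat l)" if z: "cmod (0 - z) = 1" for z
    proof -
      define u where "u = of_rat l + z / (2 * of_real pi * \<i>)"
      have "cmod (z / (2 * of_real pi * \<i>)) = 1 / (2 * pi)" using z by (simp add: norm_divide norm_mult)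
      also have "\<dots> \<le> 1" using pi_gt3 by (simp add: field_simps)
      finally have small: "cmod (z / (2 * of_real pi * \<i>)) \<le> 1" .
      have Im: "\<bar>Im u\<bar> \<le> 1"
        using abs_Im_le_cmod[of "z / (2 * of_real pi * \<i>)"] small by (simp add: u_def rat)
      have Re: "real_of_rat l - 1 \<le> Re u"
        using abs_Re_le_cmod[of "z / (2 * of_real pi * \<i>)"] small by (simp add: u_def rat)
      have "cmod u \<le> cmod (of_rat l) + 1" unfolding u_def using small norm_triangle_ineq[of "of_rat l" "z / (2 * of_real pi * \<i>)"] by linarith
      then have "cmod u + 3 \<le> T" using T by (simp add: rat)
      from C(2)[OF Im this] have "cmod (f z) \<le> C * exp (2 * T) * T powr (- Re u)"
        by (simp add: f_def u_def add.assoc)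
      also have "\<dots> \<le> C * exp (2 * T) * (exp T * T powr (- real_of_rat l))"
      proof (rule mult_left_mono)
        have "T powr (- Re u) \<le> T powr (1 - real_of_rat l)" using Re T0 by (intro powr_mono) auto
        also have "\<dots> = T * T powr (- real_of_rat l)" using T0 by (simp add: powr_diff powr_minus field_simps)
        also have "\<dots> \<le> exp T * T powr (- real_of_rat l)"
          using exp_ge_add_one_self[of T] by (intro mult_right_mono) (linarith, simp)
        finally show "T powr (- Re u) \<le> exp T * T powr (- real_of_rat l)" .
      qed (use C(1) in simp)
      also have "\<dots> = C * (exp (2 * T) * exp T) * T powr (- real_of_rat l)" by (simp only: mult_ac)
      also have "exp (2 * T) * exp T = exp (3 * T)" by (simp add: exp_add[symmetric])
      finally show ?thesis .
    qed
    then have "cmod ((deriv ^^ j) f 0) \<le> fact j * (C * exp (3 * T) * T powr (- real_of_rat l)) / 1 ^ j"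
      by (intro Cauchy_inequality)
         (auto simp: f_def[abs_def] intro!: holomorphic_on_imp_continuous_on holomorphic_intros)
    then show ?thesis
      unfolding rgamma_fps_def f_def[abs_def] fps_expansion_def by (simp add: norm_divide field_simps)
  qed
  then show ?thesis using C(1) by blast
qed

text \<open>The coefficient of \<open>\<Prod>\<^sub>k D\<^sub>k\<^bsup>count M k\<^esup>\<close> in the product of the Gamma factors with exponents \<open>l\<close>.\<close>

definition jet :: "nat \<Rightarrow> nat multiset \<Rightarrow> (nat \<Rightarrow> complex) \<Rightarrow> (nat \<Rightarrow> rat) \<Rightarrow> complex" where
  "jet n M y l = (\<Prod>k\<le>n. fps_nth (gamma_factor (y k) (l k)) (count M k))"

lemma sum_pow_fact_le:
  fixes a :: real assumes "0 \<le> a" shows "(\<Sum>i\<le>j. a ^ i / fact i) \<le> (1 + a) ^ j"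
proof -
  have "(\<Sum>i\<le>j. a ^ i / fact i) \<le> (\<Sum>i\<le>j. of_nat (j choose i) * a ^ i * 1 ^ (j - i))"
  proof (rule sum_mono)
    fix i assume i: "i \<in> {..j}"
    have "a ^ i / fact i \<le> a ^ i / 1" using assms by (intro divide_left_mono) auto
    also have "\<dots> = 1 * a ^ i" by simp
    also have "\<dots> \<le> of_nat (j choose i) * a ^ i"
      using i assms by (intro mult_right_mono) (auto simp: Suc_le_eq)
    finally show "a ^ i / fact i \<le> of_nat (j choose i) * a ^ i * 1 ^ (j - i)" by simp
  qed
  also have "\<dots> = (a + 1) ^ j" by (rule binomial_ring[symmetric])
  finally show ?thesis by (simp add: add.commute)
qed

text \<open>With one \<open>T\<close> for all factors the powers \<open>T\<^bsup>- l\<^sub>k\<^esup>\<close> multiply to \<open>T\<^sup>D\<close>, so that the factorials in the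
  numerator and in the denominator balance and only exponential growth in \<open>\<Sum>\<^sub>k |l\<^sub>k|\<close> remains.\<close>

lemma jet_bound:
  fixes n D :: nat
  shows "\<exists>C>0. \<forall>M y l. (\<Sum>k\<le>n. l k) = - of_nat D \<longrightarrow>
     cmod (jet n M y l) \<le> C * (\<Prod>k\<le>n. (1 + cmod (y k)) ^ count M k) * exp (\<Sum>k\<le>n. of_rat (l k) * Re (y k))
        * exp ((3 * n + 4) * (\<Sum>k\<le>n. \<bar>of_rat (l k)\<bar>))"
proof -
  obtain C where C: "C \<ge> 1" "\<And>l T j. real_of_rat \<bar>l\<bar> + 5 \<le> T \<Longrightarrow> cmod (fps_nth (rgamma_fps l) j) \<le> C * exp (3 * T) * T powr (- real_of_rat l)"
    using rgamma_fps_bound by blast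
  have "cmod (jet n M y l) \<le> (C ^ (n + 1) * fact D * exp (5 * (3 * n + 4))) * (\<Prod>k\<le>n. (1 + cmod (y k)) ^ count M k)
       * exp (\<Sum>k\<le>n. of_rat (l k) * Re (y k)) * exp ((3 * n + 4) * (\<Sum>k\<le>n. \<bar>of_rat (l k)\<bar>))"
    if l: "(\<Sum>k\<le>n. l k) = - of_nat D" for M y l
  proof -
    (* The same T for all factors, at least 5 more than each |l k|. *)
    define T where "T = (\<Sum>k\<le>n. real_of_rat \<bar>l k\<bar>) + 5"
    have T5: "T \<ge> 5" unfolding T_def by (simp add: sum_nonneg)
    have "cmod (jet n M y l) = (\<Prod>k\<le>n. cmod (fps_nth (gamma_factor (y k) (l k)) (count M k)))"
      by (simp add: jet_def prod_norm)
    also have "\<dots> \<le> (\<Prod>k\<le>n. exp (of_rat (l k) * Re (y k)) * ((1 + cmod (y k)) ^ count M k * (C * exp (3 * T) * T powr (- real_of_rat (l k)))))"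
    proof (intro prod_mono conjI)
      fix k assume k: "k \<in> {..n}"
      have "real_of_rat \<bar>l k\<bar> \<le> (\<Sum>k\<le>n. real_of_rat \<bar>l k\<bar>)"
        using k by (intro member_le_sum) auto
      then have "real_of_rat \<bar>l k\<bar> + 5 \<le> T" by (simp add: T_def)
      note rb = C(2)[OF this]
      define a where "a = cmod (y k) / (2 * pi)"
      have "cmod (y k) / (2 * pi) \<le> cmod (y k) / 1" using pi_gt3 by (intro divide_left_mono) auto
      then have a: "0 \<le> a" "a \<le> cmod (y k)" by (auto simp: a_def)
      let ?B = "C * exp (3 * T) * T powr (- real_of_rat (l k))"
      have "cmod (\<Sum>i\<le>count M k. (y k / (2 * of_real pi * \<i>)) ^ i / fact i * fps_nth (rgamma_fps (l k)) (count M k - i))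
         \<le> (\<Sum>i\<le>count M k. a ^ i / fact i * ?B)"
      proof (rule sum_norm_le)
        fix i
        have "cmod ((y k / (2 * of_real pi * \<i>)) ^ i / fact i) = a ^ i / fact i"
          by (simp add: a_def norm_divide norm_power norm_mult)
        then show "cmod ((y k / (2 * of_real pi * \<i>)) ^ i / fact i * fps_nth (rgamma_fps (l k)) (count M k - i)) \<le> a ^ i / fact i * ?B"
          unfolding norm_mult using a rb by (simp only:) (intro mult_left_mono, auto)
      qed
      also have "\<dots> = (\<Sum>i\<le>count M k. a ^ i / fact i) * ?B" by (simp add: sum_distrib_right)
      also have "(\<Sum>i\<le>count M k. a ^ i / fact i) \<le> (1 + cmod (y k)) ^ count M k"
        using sum_pow_fact_le[OF a(1)] a by (meson add_left_mono add_nonneg_nonneg order_trans power_mono zero_le_one)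
      finally have "cmod (\<Sum>i\<le>count M k. (y k / (2 * of_real pi * \<i>)) ^ i / fact i * fps_nth (rgamma_fps (l k)) (count M k - i))
         \<le> (1 + cmod (y k)) ^ count M k * ?B" using C(1) by (simp add: mult_right_mono)
      moreover have "cmod (exp (of_rat (l k) * y k)) = exp (of_rat (l k) * Re (y k))"
        by (simp add: norm_exp_eq_Re) (simp add: of_rat_complex)
      ultimately show "cmod (fps_nth (gamma_factor (y k) (l k)) (count M k)) \<le>
          exp (of_rat (l k) * Re (y k)) * ((1 + cmod (y k)) ^ count M k * ?B)"
        unfolding gamma_factor_nth norm_mult by (simp add: mult_left_mono)
    qed simp
    also have "\<dots> = exp (\<Sum>k\<le>n. of_rat (l k) * Re (y k)) * (\<Prod>k\<le>n. (1 + cmod (y k)) ^ count M k)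
        * C ^ (n + 1) * exp (3 * T) ^ (n + 1) * (\<Prod>k\<le>n. T powr (- real_of_rat (l k)))"
      by (simp add: prod.distrib exp_sum power_mult_distrib)
    also have "(\<Prod>k\<le>n. T powr (- real_of_rat (l k))) = T powr (\<Sum>k\<le>n. - real_of_rat (l k))"
      using T5 by (simp add: powr_sum)
    also have "(\<Sum>k\<le>n. - real_of_rat (l k)) = D"
      using arg_cong[OF l, of real_of_rat] by (simp add: of_rat_sum of_rat_minus sum_negf)
    also have "T powr D = T ^ D" using T5 by (simp add: powr_realpow)
    also have "exp (\<Sum>k\<le>n. of_rat (l k) * Re (y k)) * (\<Prod>k\<le>n. (1 + cmod (y k)) ^ count M k)
        * C ^ (n + 1) * exp (3 * T) ^ (n + 1) * T ^ D \<le>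
      exp (\<Sum>k\<le>n. of_rat (l k) * Re (y k)) * (\<Prod>k\<le>n. (1 + cmod (y k)) ^ count M k)
        * C ^ (n + 1) * exp (3 * T) ^ (n + 1) * (fact D * exp T)"
      using T5 C(1) by (intro mult_left_mono power_le_fact_exp mult_nonneg_nonneg prod_nonneg) auto
    also have "exp (3 * T) ^ (n + 1) = exp (T * (3 * n + 3))"
      unfolding exp_of_nat_mult[symmetric] by (simp add: algebra_simps)
    also have "exp (\<Sum>k\<le>n. of_rat (l k) * Re (y k)) * (\<Prod>k\<le>n. (1 + cmod (y k)) ^ count M k)
        * C ^ (n + 1) * exp (T * (3 * n + 3)) * (fact D * exp T) =
       C ^ (n + 1) * fact D * (\<Prod>k\<le>n. (1 + cmod (y k)) ^ count M k) * exp (\<Sum>k\<le>n. of_rat (l k) * Re (y k)) * (exp (T * (3 * n + 3)) * exp T)"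
      by (simp only: mult_ac)
    also have "exp (T * (3 * n + 3)) * exp T = exp (5 * (3 * n + 4)) * exp ((3 * n + 4) * (\<Sum>k\<le>n. \<bar>of_rat (l k)\<bar>))"
      unfolding exp_add[symmetric] by (simp add: T_def algebra_simps)
    finally show ?thesis by (simp only: mult_ac)
  qed
  moreover have "C ^ (n + 1) * fact D * exp (5 * (3 * n + 4)) > 0" using C(1) by simp
  ultimately show ?thesis by blast
qed

section \<open>Convergence of the scalar series\<close>

text \<open>The linear function on the plane that takes the values \<open>h i\<close> and \<open>h j\<close> at \<open>v\<^sub>i\<close> and \<open>v\<^sub>j\<close>.\<close>

definition chord :: "(nat \<Rightarrow> real) \<Rightarrow> nat \<Rightarrow> nat \<Rightarrow> real \<Rightarrow> real \<Rightarrow> real" where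
  "chord h i j a b = (h j - h i) / (real j - real i) * (a - real i * b) + h i * b"

text \<open>The height cone consists of the \<open>h\<close> for which all margins off the cones of \<open>\<Sigma>\<close> are positive.\<close>

definition margin :: "(nat \<Rightarrow> real) \<Rightarrow> nat \<Rightarrow> nat \<Rightarrow> nat \<Rightarrow> real" where
  "margin h i j k = h k - chord h i j (real k) 1"

lemma chord_left: "chord h i j (real i) 1 = h i"
  by (simp add: chord_def)

lemma chord_right: "i < j \<Longrightarrow> chord h i j (real j) 1 = h j"
  by (simp add: chord_def)

lemma chord_sum: "chord h i j (\<Sum>k\<in>K. l k * a k) (\<Sum>k\<in>K. l k * b k) = (\<Sum>k\<in>K. l k * chord h i j (a k) (b k))"
proof -
  define r where "r = (h j - h i) / (real j - real i)"
  show ?thesis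
    unfolding chord_def r_def[symmetric]
    by (simp add: sum_distrib_left sum_subtractf[symmetric] sum.distrib[symmetric] algebra_simps)
qed

lemma chord_add: "chord h i j (a + a') (b + b') = chord h i j a b + chord h i j a' b'"
proof -
  define r where "r = (h j - h i) / (real j - real i)"
  show ?thesis unfolding chord_def r_def[symmetric] by (simp add: algebra_simps)
qed

lemma chord_minus: "chord h i j (- a) (- b) = - chord h i j a b"
  using chord_add[of h i j a "- a" b "- b"] by (simp add: chord_def)

lemma chord_linear: "chord (\<lambda>k. s * h k + t * h' k) i j a b = s * chord h i j a b + t * chord h' i j a b"
proof -
  define r where "r = (h j - h i) / (real j - real i)"
  define r' where "r' = (h' j - h' i) / (real j - real i)"
  have "(s * h j + t * h' j - (s * h i + t * h' i)) / (real j - real i) = s * r + t * r'"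
    by (simp add: r_def r'_def diff_divide_distrib add_divide_distrib right_diff_distrib)
  then show ?thesis unfolding chord_def r_def[symmetric] r'_def[symmetric] by (simp add: algebra_simps)
qed

lemma margin_linear: "margin (\<lambda>k. s * h k + t * h' k) i j m = s * margin h i j m + t * margin h' i j m"
  unfolding margin_def chord_linear by (simp add: algebra_simps)

definition add_vertex :: "int \<times> int \<Rightarrow> nat \<Rightarrow> int \<times> int" where
  "add_vertex c k = (fst c + int k, snd c + 1)"

locale fan =
  fixes n :: nat and S :: "nat set"
  assumes n_pos: "1 \<le> n" and S_sub: "S \<subseteq> {0..n}" and zero_S: "0 \<in> S" and n_S: "n \<in> S"
begin

text \<open>The product of the rate \<open>3 n + 4\<close> in \<open>jet_bound\<close> and the factor \<open>4 n + 2\<close> in \<open>supported_size\<close> pays for the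
  growth of the coefficients; the additional 1 leaves a summable geometric factor.\<close>

definition decay :: real where
  "decay = (3 * real n + 4) * (4 * real n + 2) + 1"

definition deep :: "(nat \<Rightarrow> complex) \<Rightarrow> bool" where
  "deep y \<longleftrightarrow> (\<forall>i j k. i < j \<and> adjacent S i j \<and> k \<le> n \<and> k \<noteq> i \<and> k \<noteq> j \<longrightarrow>
      decay < margin (\<lambda>k. - Re (y k)) i j k)"

definition off :: "nat \<Rightarrow> nat \<Rightarrow> nat set" where
  "off i j = {..n} - {i, j}"

text \<open>The sector \<open>\<gamma>\<close> and the indices in \<open>M\<close> belong to the cone \<open>\<sigma>\<^sub>i\<^sub>j\<close>. The functionals of \<open>H\<close> and
  \<open>H\<^sup>c\<close> vanish on all monomials that are not admissible for some cone, and for admissible ones the series converge.\<close>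

definition admissible :: "nat \<Rightarrow> nat \<Rightarrow> int \<times> int \<Rightarrow> nat multiset \<Rightarrow> bool" where
  "admissible i j \<gamma> M \<longleftrightarrow> i < j \<and> adjacent S i j \<and> (\<forall>k\<in>off i j. box_coord S \<gamma> k = 0) \<and> set_mset M \<subseteq> {i, j}"

text \<open>The index set that remains after the zeros of \<open>1/\<Gamma>\<close> have been taken into account: all exponents off the
  cone are natural numbers.\<close>

definition supported :: "nat \<Rightarrow> nat \<Rightarrow> int \<times> int \<Rightarrow> int \<times> int \<Rightarrow> (nat \<Rightarrow> rat) set" where
  "supported i j c \<gamma> = {l \<in> Lset n S c \<gamma>. \<forall>k\<in>off i j. l k \<in> \<nat>}"

lemma adjacentD: "adjacent S i j \<Longrightarrow> i \<le> n \<and> j \<le> n \<and> i \<in> S \<and> j \<in> S"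
  using S_sub by (auto simp: adjacent_def)

lemma height_cone_iff:
  "h \<in> height_cone n S \<longleftrightarrow> (\<forall>i j k. i < j \<and> adjacent S i j \<and> k \<le> n \<and> k \<noteq> i \<and> k \<noteq> j \<longrightarrow> 0 < margin h i j k)"
proof -
  have "(\<exists>p q. p * real i + q = h i \<and> p * real j + q = h j \<and> (\<forall>m\<le>n. m \<noteq> i \<and> m \<noteq> j \<longrightarrow> p * real m + q < h m)) \<longleftrightarrow>
     (\<forall>k\<le>n. k \<noteq> i \<and> k \<noteq> j \<longrightarrow> 0 < margin h i j k)" if ij: "i < j" for i j
  proof
    assume "\<exists>p q. p * real i + q = h i \<and> p * real j + q = h j \<and> (\<forall>m\<le>n. m \<noteq> i \<and> m \<noteq> j \<longrightarrow> p * real m + q < h m)"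
    then obtain p q where pq: "h i = p * real i + q" "h j = p * real j + q"
        "\<forall>m\<le>n. m \<noteq> i \<and> m \<noteq> j \<longrightarrow> p * real m + q < h m" by metis
    have "h j - h i = p * (real j - real i)" using pq by (simp add: algebra_simps)
    then have p: "(h j - h i) / (real j - real i) = p" using ij by simp
    have "margin h i j k = h k - (p * real k + q)" for k
      unfolding margin_def chord_def p using pq(1) by (simp add: algebra_simps)
    then show "\<forall>k\<le>n. k \<noteq> i \<and> k \<noteq> j \<longrightarrow> 0 < margin h i j k" using pq(3) by simp
  next
    assume *: "\<forall>k\<le>n. k \<noteq> i \<and> k \<noteq> j \<longrightarrow> 0 < margin h i j k"
    define p where "p = (h j - h i) / (real j - real i)"
    define q where "q = h i - p * real i"
    have c: "chord h i j (real k) 1 = p * real k + q" for k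
      unfolding chord_def p_def[symmetric] q_def by (simp add: algebra_simps)
    show "\<exists>p q. p * real i + q = h i \<and> p * real j + q = h j \<and> (\<forall>m\<le>n. m \<noteq> i \<and> m \<noteq> j \<longrightarrow> p * real m + q < h m)"
      using * chord_left[of h i j] chord_right[OF ij, of h] unfolding margin_def c
      by (intro exI[of _ p] exI[of _ q]) auto
  qed
  then show ?thesis unfolding height_cone_def by auto
qed

lemma sum_split:
  fixes f :: "nat \<Rightarrow> 'a::comm_monoid_add"
  assumes "i < j" "i \<le> n" "j \<le> n"
  shows "(\<Sum>k\<le>n. f k) = f i + f j + (\<Sum>k\<in>off i j. f k)"
proof -
  have "{..n} = insert i (insert j (off i j))" using assms by (auto simp: off_def)
  then have "sum f {..n} = sum f (insert i (insert j (off i j)))" by simp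
  also have "\<dots> = f i + f j + sum f (off i j)" using assms by (simp add: off_def add.assoc)
  finally show ?thesis .
qed

lemma finite_off: "finite (off i j)" by (simp add: off_def)

lemma Lset_sums:
  assumes "l \<in> Lset n S c \<gamma>"
  shows "(\<Sum>k\<le>n. l k) = - of_int (snd c)" "(\<Sum>k\<le>n. l k * of_nat k) = - of_int (fst c)"
    "(\<Sum>k\<le>n. real_of_rat (l k)) = - of_int (snd c)" "(\<Sum>k\<le>n. real_of_rat (l k) * real k) = - of_int (fst c)"
proof -
  show 1: "(\<Sum>k\<le>n. l k) = - of_int (snd c)" "(\<Sum>k\<le>n. l k * of_nat k) = - of_int (fst c)"
    using assms by (auto simp: Lset_def vlat_def)
  show "(\<Sum>k\<le>n. real_of_rat (l k)) = - of_int (snd c)"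
    using arg_cong[OF 1(1), of real_of_rat] by (simp add: of_rat_sum of_rat_minus)
  show "(\<Sum>k\<le>n. real_of_rat (l k) * real k) = - of_int (fst c)"
    using arg_cong[OF 1(2), of real_of_rat] by (simp add: of_rat_sum of_rat_minus of_rat_mult)
qed

text \<open>Subtracting from \<open>h\<close> the linear function through \<open>h i\<close> and \<open>h j\<close> changes the exponent by an amount that
  depends on \<open>c\<close> alone, since \<open>l\<close> has prescribed moments.\<close>

lemma exponent_split:
  assumes "i < j" "adjacent S i j" "l \<in> Lset n S c \<gamma>"
  shows "(\<Sum>k\<le>n. real_of_rat (l k) * h k) =
    - chord h i j (of_int (fst c)) (of_int (snd c)) + (\<Sum>k\<in>off i j. real_of_rat (l k) * margin h i j k)"
proof -
  have "(\<Sum>k\<le>n. real_of_rat (l k) * h k) =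
     (\<Sum>k\<le>n. real_of_rat (l k) * chord h i j (real k) 1) + (\<Sum>k\<le>n. real_of_rat (l k) * margin h i j k)"
    by (simp add: sum.distrib[symmetric] margin_def algebra_simps)
  also have "(\<Sum>k\<le>n. real_of_rat (l k) * chord h i j (real k) 1) =
     chord h i j (\<Sum>k\<le>n. real_of_rat (l k) * real k) (\<Sum>k\<le>n. real_of_rat (l k) * 1)"
    by (rule chord_sum[symmetric])
  also have "\<dots> = - chord h i j (of_int (fst c)) (of_int (snd c))"
    using Lset_sums[OF assms(3)] by (simp add: chord_minus)
  also have "(\<Sum>k\<le>n. real_of_rat (l k) * margin h i j k) = (\<Sum>k\<in>off i j. real_of_rat (l k) * margin h i j k)"
    using assms adjacentD[of i j] by (subst sum_split[of i j]) (auto simp: margin_def chord_left chord_right)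
  finally show ?thesis .
qed

lemma supported_nonneg: "l \<in> supported i j c \<gamma> \<Longrightarrow> k \<in> off i j \<Longrightarrow> 0 \<le> l k"
  by (auto simp: supported_def Nats_def)

text \<open>The two moment equations determine \<open>l i\<close> and \<open>l j\<close> from the other entries, which are nonnegative.\<close>

lemma supported_size:
  assumes ij: "i < j" "adjacent S i j" and l: "l \<in> supported i j c \<gamma>"
  shows "(\<Sum>k\<le>n. \<bar>real_of_rat (l k)\<bar>) \<le> (4 * real n + 2) * (\<Sum>k\<in>off i j. real_of_rat (l k))
     + ((2 * real n + 1) * \<bar>of_int (snd c)\<bar> + 2 * \<bar>of_int (fst c)\<bar>)"
proof -
  define W where "W = (\<Sum>k\<in>off i j. real_of_rat (l k))"
  define V where "V = (\<Sum>k\<in>off i j. real_of_rat (l k) * real k)"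
  define a where "a = real_of_rat (l i)"
  define b where "b = real_of_rat (l j)"
  have nn: "0 \<le> real_of_rat (l k)" if "k \<in> off i j" for k
    using supported_nonneg[OF l that] by simp
  have le: "i \<le> n" "j \<le> n" using adjacentD[OF ij(2)] by auto
  have L: "l \<in> Lset n S c \<gamma>" using l by (simp add: supported_def)
  have e1: "a + b + W = - of_int (snd c)" and e2: "a * real i + b * real j + V = - of_int (fst c)"
    unfolding Lset_sums(3,4)[OF L, symmetric] sum_split[OF ij(1) le] by (simp_all add: a_def b_def W_def V_def)
  have W0: "0 \<le> W" unfolding W_def using nn by (intro sum_nonneg)
  have V: "0 \<le> V" "V \<le> n * W"
  proof -
    show "0 \<le> V" unfolding V_def by (rule sum_nonneg, rule mult_nonneg_nonneg, erule nn) simp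
    have "V \<le> (\<Sum>k\<in>off i j. real_of_rat (l k) * real n)"
      unfolding V_def by (rule sum_mono, rule mult_left_mono[OF _ nn]) (simp_all add: off_def)
    also have "\<dots> = n * W" unfolding W_def sum_distrib_left by (intro sum.cong refl mult.commute)
    finally show "V \<le> n * W" .
  qed
  have "b * (real j - real i) = - of_int (fst c) - V + real i * of_int (snd c) + real i * W"
  proof -
    have "real i * (a + b + W) = real i * - of_int (snd c)" using e1 by simp
    then show ?thesis using e2 by (simp add: algebra_simps)
  qed
  then have "\<bar>b\<bar> * (real j - real i) = \<bar>- of_int (fst c) - V + real i * of_int (snd c) + real i * W\<bar>"
    using ij abs_mult[of b "real j - real i"] by simp
  also have "\<dots> \<le> \<bar>of_int (fst c)\<bar> + V + real i * \<bar>of_int (snd c)\<bar> + real i * W"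
  proof -
    have "0 \<le> real i * W" using W0 by simp
    moreover have "\<bar>real i * of_int (snd c)\<bar> = real i * \<bar>of_int (snd c)\<bar>" by (simp add: abs_mult)
    ultimately show ?thesis using V by linarith
  qed
  also have "\<dots> \<le> \<bar>of_int (fst c)\<bar> + real n * W + real n * \<bar>real_of_int (snd c)\<bar> + real n * W"
  proof -
    have "real i * t \<le> real n * t" if "0 \<le> t" for t :: real using le that by (intro mult_right_mono) auto
    from this[OF W0] this[OF abs_ge_zero[of "of_int (snd c)"]] show ?thesis using V W0 by linarith
  qed
  finally have "\<bar>b\<bar> * (real j - real i) \<le> \<bar>of_int (fst c)\<bar> + real n * W + real n * \<bar>real_of_int (snd c)\<bar> + real n * W" .
  moreover have "\<bar>b\<bar> * 1 \<le> \<bar>b\<bar> * (real j - real i)" using ij by (intro mult_left_mono) auto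
  ultimately have b: "\<bar>b\<bar> \<le> \<bar>of_int (fst c)\<bar> + real n * W + real n * \<bar>real_of_int (snd c)\<bar> + real n * W" by linarith
  have a: "\<bar>a\<bar> \<le> \<bar>of_int (snd c)\<bar> + W + \<bar>b\<bar>" using e1 W0 by linarith
  have "(\<Sum>k\<le>n. \<bar>real_of_rat (l k)\<bar>) = \<bar>a\<bar> + \<bar>b\<bar> + (\<Sum>k\<in>off i j. \<bar>real_of_rat (l k)\<bar>)"
    unfolding a_def b_def by (rule sum_split[OF ij(1) le])
  also have "(\<Sum>k\<in>off i j. \<bar>real_of_rat (l k)\<bar>) = W"
    unfolding W_def using nn by (intro sum.cong refl) (simp only: abs_of_nonneg)
  also have "\<bar>a\<bar> + \<bar>b\<bar> + W \<le> (4 * real n + 2) * W + ((2 * real n + 1) * \<bar>of_int (snd c)\<bar> + 2 * \<bar>of_int (fst c)\<bar>)"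
    using a b by (simp add: algebra_simps)
  finally show ?thesis unfolding W_def .
qed

text \<open>By \<open>exponent_split\<close> the exponential of the real part is governed by the margins, and by \<open>supported_size\<close> and
  \<open>jet_bound\<close> the coefficient costs at most \<open>decay - 1\<close> per unit of the exponents off the cone.\<close>

lemma jet_decay:
  assumes "0 \<le> snd c"
  shows "\<exists>C>0. \<forall>i j \<gamma> M y l. i < j \<and> adjacent S i j \<and> l \<in> supported i j c \<gamma> \<longrightarrow>
     cmod (jet n M y l) \<le> C * (\<Prod>k\<le>n. (1 + cmod (y k)) ^ count M k)
        * exp (chord (\<lambda>k. - Re (y k)) i j (of_int (fst c)) (of_int (snd c)))
        * exp (- (\<Sum>k\<in>off i j. real_of_rat (l k) * (margin (\<lambda>k. - Re (y k)) i j k - decay)))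
        * exp (- (\<Sum>k\<in>off i j. real_of_rat (l k)))"
proof -
  define D where "D = nat (snd c)"
  obtain C where C: "C > 0" "\<And>M y l. (\<Sum>k\<le>n. l k) = - of_nat D \<Longrightarrow>
     cmod (jet n M y l) \<le> C * (\<Prod>k\<le>n. (1 + cmod (y k)) ^ count M k) * exp (\<Sum>k\<le>n. of_rat (l k) * Re (y k))
        * exp ((3 * n + 4) * (\<Sum>k\<le>n. \<bar>of_rat (l k)\<bar>))"
    using jet_bound[where n = n and D = D] by blast
  define c' where "c' = (3 * n + 4) * ((2 * real n + 1) * \<bar>of_int (snd c)\<bar> + 2 * \<bar>of_int (fst c)\<bar>)"
  have "cmod (jet n M y l) \<le> (C * exp c') * (\<Prod>k\<le>n. (1 + cmod (y k)) ^ count M k)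
        * exp (chord (\<lambda>k. - Re (y k)) i j (of_int (fst c)) (of_int (snd c)))
        * exp (- (\<Sum>k\<in>off i j. real_of_rat (l k) * (margin (\<lambda>k. - Re (y k)) i j k - decay)))
        * exp (- (\<Sum>k\<in>off i j. real_of_rat (l k)))"
    if ij: "i < j" "adjacent S i j" and l: "l \<in> supported i j c \<gamma>" for i j \<gamma> M y l
  proof -
    define W where "W = (\<Sum>k\<in>off i j. real_of_rat (l k))"
    define P where "P = (\<Prod>k\<le>n. (1 + cmod (y k)) ^ count M k)"
    define h where "h k = - Re (y k)" for k
    have L: "l \<in> Lset n S c \<gamma>" using l by (simp add: supported_def)
    have P0: "0 \<le> P" unfolding P_def by (intro prod_nonneg) auto
    have "(\<Sum>k\<le>n. l k) = - of_nat D" using Lset_sums(1)[OF L] assms by (simp add: D_def)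
    from C(2)[OF this, of M y] have
      "cmod (jet n M y l) \<le> C * P * exp (\<Sum>k\<le>n. of_rat (l k) * Re (y k)) * exp ((3 * n + 4) * (\<Sum>k\<le>n. \<bar>of_rat (l k)\<bar>))"
      by (simp add: P_def)
    also have "\<dots> \<le> C * P * exp (\<Sum>k\<le>n. of_rat (l k) * Re (y k)) * exp ((decay - 1) * W + c')"
    proof (intro mult_left_mono)
      have "(3 * n + 4) * (\<Sum>k\<le>n. \<bar>real_of_rat (l k)\<bar>) \<le> (3 * n + 4) * ((4 * real n + 2) * W
        + ((2 * real n + 1) * \<bar>of_int (snd c)\<bar> + 2 * \<bar>of_int (fst c)\<bar>))"
        using supported_size[OF ij l] unfolding W_def by (intro mult_left_mono) auto
      also have "\<dots> = (decay - 1) * W + c'" by (simp add: decay_def c'_def algebra_simps)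
      finally show "exp ((3 * n + 4) * (\<Sum>k\<le>n. \<bar>of_rat (l k)\<bar>)) \<le> exp ((decay - 1) * W + c')" by simp
    qed (use C(1) P0 in auto)
    also have "(\<Sum>k\<le>n. of_rat (l k) * Re (y k)) = - (\<Sum>k\<le>n. real_of_rat (l k) * h k)"
      by (simp add: h_def sum_negf)
    also have "\<dots> = chord h i j (of_int (fst c)) (of_int (snd c)) - (\<Sum>k\<in>off i j. real_of_rat (l k) * margin h i j k)"
      unfolding exponent_split[OF ij L] by simp
    also have "C * P * exp (chord h i j (of_int (fst c)) (of_int (snd c)) - (\<Sum>k\<in>off i j. real_of_rat (l k) * margin h i j k))
        * exp ((decay - 1) * W + c') =
      (C * exp c') * P * exp (chord h i j (of_int (fst c)) (of_int (snd c)))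
        * exp (- (\<Sum>k\<in>off i j. real_of_rat (l k) * (margin h i j k - decay))) * exp (- W)"
    proof -
      have "- (\<Sum>k\<in>off i j. real_of_rat (l k) * (margin h i j k - decay)) =
         decay * W - (\<Sum>k\<in>off i j. real_of_rat (l k) * margin h i j k)"
        unfolding W_def sum_distrib_left sum_subtractf[symmetric] sum_negf[symmetric]
        by (intro sum.cong refl) (simp add: algebra_simps)
      then have "exp (chord h i j (of_int (fst c)) (of_int (snd c)) - (\<Sum>k\<in>off i j. real_of_rat (l k) * margin h i j k)) * exp ((decay - 1) * W + c') =
         exp c' * (exp (chord h i j (of_int (fst c)) (of_int (snd c))) * (exp (- (\<Sum>k\<in>off i j. real_of_rat (l k) * (margin h i j k - decay))) * exp (- W)))"
        by (simp only: exp_add[symmetric]) (simp add: algebra_simps)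
      then show ?thesis by (simp only: mult_ac)
    qed
    finally show ?thesis unfolding h_def P_def W_def .
  qed
  then show ?thesis using C(1) by (intro exI[of _ "C * exp c'"]) auto
qed

lemma geometric_summable: "(\<lambda>f. \<Prod>k\<in>K. exp (- real (f k))) summable_on (K \<rightarrow>\<^sub>E UNIV)" if "finite K" for K :: "nat set"
proof (rule ccontr)
  have g: "((\<lambda>m. exp (- real m)) has_sum (1 / (1 - exp (-1)))) UNIV"
  proof -
    have "(\<lambda>m. exp (-1) ^ m) sums (1 / (1 - exp (-1 :: real)))" by (rule geometric_sums) simp
    moreover have "exp (-1) ^ m = exp (- real m)" for m
      by (simp flip: exp_of_nat_mult)
    ultimately have "(\<lambda>m. exp (- real m)) sums (1 / (1 - exp (-1 :: real)))" by simp
    then show ?thesis by (rule sums_nonneg_imp_has_sum) simp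
  qed
  assume "\<not> ?thesis"
  then have "infsum (\<lambda>f. \<Prod>k\<in>K. exp (- real (f k))) (K \<rightarrow>\<^sub>E UNIV) = 0" by (rule infsum_not_exists)
  moreover have "infsum (\<lambda>f. \<Prod>k\<in>K. exp (- real (f k))) (K \<rightarrow>\<^sub>E UNIV) = (\<Prod>k\<in>K. infsum (\<lambda>m. exp (- real m)) UNIV)"
    using that g by (intro infsum_prod_PiE_abs) (auto simp: has_sum_imp_summable)
  ultimately show False using infsumI[OF g] that by simp
qed

lemma supported_determined:
  assumes ij: "i < j" "adjacent S i j" and l: "l \<in> Lset n S c \<gamma>" and l': "l' \<in> Lset n S c \<gamma>'"
    and eq: "\<And>k. k \<in> off i j \<Longrightarrow> l k = l' k"
  shows "l = l'"
proof
  fix k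
  have le: "i \<le> n" "j \<le> n" using adjacentD[OF ij(2)] by auto
  have "(\<Sum>k\<in>off i j. l k) = (\<Sum>k\<in>off i j. l' k)" "(\<Sum>k\<in>off i j. l k * of_nat k) = (\<Sum>k\<in>off i j. l' k * of_nat k)"
    using eq by (auto intro: sum.cong)
  then have e: "l i + l j = l' i + l' j" "l i * of_nat i + l j * of_nat j = l' i * of_nat i + l' j * of_nat j"
    using Lset_sums(1,2)[OF l] Lset_sums(1,2)[OF l'] unfolding sum_split[OF ij(1) le] by auto
  have "(l j - l' j) * (of_nat j - of_nat i) = 0"
  proof -
    have "(l j - l' j) * (of_nat j - of_nat i) = (l i * of_nat i + l j * of_nat j) - (l' i * of_nat i + l' j * of_nat j)
       - of_nat i * ((l i + l j) - (l' i + l' j))" by (simp add: algebra_simps)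
    then show ?thesis using e by simp
  qed
  then have "l j = l' j" using ij(1) by simp
  moreover then have "l i = l' i" using e(1) by simp
  moreover have "k > n \<Longrightarrow> l k = l' k" using l l' by (auto simp: Lset_def)
  ultimately show "l k = l' k" using eq[of k] by (cases "k \<le> n") (auto simp: off_def)
qed

lemma supported_summable:
  assumes ij: "i < j" "adjacent S i j"
  shows "(\<lambda>l. exp (- (\<Sum>k\<in>off i j. real_of_rat (l k)))) summable_on supported i j c \<gamma>"
proof -
  define f where "f l = restrict (\<lambda>k. nat \<lfloor>l k\<rfloor>) (off i j)" for l :: "nat \<Rightarrow> rat"
  have fl: "of_nat (f l k) = l k" if "l \<in> supported i j c \<gamma>" "k \<in> off i j" for l k
    using that by (auto simp: f_def supported_def Nats_def)
  have inj: "inj_on f (supported i j c \<gamma>)"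
  proof (rule inj_onI)
    fix l l' assume l: "l \<in> supported i j c \<gamma>" "l' \<in> supported i j c \<gamma>" and eq: "f l = f l'"
    show "l = l'"
      using l fl[OF l(1)] fl[OF l(2)] eq
      by (intro supported_determined[OF ij, of l c \<gamma> l' \<gamma>]) (auto simp: supported_def)
  qed
  have "(\<lambda>g. \<Prod>k\<in>off i j. exp (- real (g k))) summable_on (f ` supported i j c \<gamma>)"
    by (rule summable_on_subset_banach[OF geometric_summable[OF finite_off]]) (auto simp: f_def)
  then have "(\<lambda>l. \<Prod>k\<in>off i j. exp (- real (f l k))) summable_on supported i j c \<gamma>"
    by (subst (asm) summable_on_reindex[OF inj]) (simp add: o_def)
  moreover have "(\<Prod>k\<in>off i j. exp (- real (f l k))) = exp (- (\<Sum>k\<in>off i j. real_of_rat (l k)))"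
    if "l \<in> supported i j c \<gamma>" for l
  proof -
    have "real (f l k) = real_of_rat (l k)" if "k \<in> off i j" for k
      using fl[OF \<open>l \<in> _\<close> that] by (metis of_rat_of_nat_eq)
    then show ?thesis by (simp add: exp_sum[OF finite_off] sum_negf[symmetric])
  qed
  ultimately show ?thesis by (simp cong: summable_on_cong)
qed

text \<open>A negative integer exponent whose index is not in \<open>M\<close> contributes the value of \<open>1/\<Gamma>\<close> at a pole of
  \<open>\<Gamma>\<close>.\<close>

lemma jet_supported:
  assumes "admissible i j \<gamma> M" "l \<in> Lset n S c \<gamma>" "jet n M y l \<noteq> 0"
  shows "l \<in> supported i j c \<gamma>"
proof -
  have "l k \<in> \<nat>" if k: "k \<in> off i j" for k
  proof -
    have kn: "k \<le> n" using k by (auto simp: off_def)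
    have "l k - box_coord S \<gamma> k \<in> \<int>" using assms(2) kn unfolding Lset_def by blast
    moreover have "box_coord S \<gamma> k = 0" using assms(1) k unfolding admissible_def by blast
    ultimately have int: "l k \<in> \<int>" by simp
    have "k \<notin># M" using assms(1) k unfolding admissible_def off_def by blast
    then have count: "count M k = 0" by (simp add: not_in_iff)
    have "\<not> l k < 0"
    proof
      assume "l k < 0"
      then have "fps_nth (gamma_factor (y k) (l k)) (count M k) = 0"
        using gamma_factor_neg_int[OF int] by (simp add: count)
      then have "jet n M y l = 0"
        unfolding jet_def using kn by (intro prod_zero) auto
      then show False using assms(3) by simp
    qed
    then show ?thesis using int by (simp add: Nats_altdef2)
  qed
  then show ?thesis using assms(2) by (auto simp: supported_def)
qed

definition series :: "int \<times> int \<Rightarrow> nat multiset \<Rightarrow> int \<times> int \<Rightarrow> (nat \<Rightarrow> complex) \<Rightarrow> complex" where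
  "series \<gamma> M c y = infsum (jet n M y) (Lset n S c \<gamma>)"

lemma deep_decay:
  assumes "deep y" "i < j" "adjacent S i j" "l \<in> supported i j c \<gamma>"
  shows "exp (- (\<Sum>k\<in>off i j. real_of_rat (l k) * (margin (\<lambda>k. - Re (y k)) i j k - decay))) \<le> 1"
proof -
  have "0 \<le> (\<Sum>k\<in>off i j. real_of_rat (l k) * (margin (\<lambda>k. - Re (y k)) i j k - decay))"
  proof (intro sum_nonneg mult_nonneg_nonneg)
    fix k assume k: "k \<in> off i j"
    show "0 \<le> real_of_rat (l k)" using supported_nonneg[OF assms(4) k] by simp
    show "0 \<le> margin (\<lambda>k. - Re (y k)) i j k - decay"
    proof -
      have "i < j \<and> adjacent S i j \<and> k \<le> n \<and> k \<noteq> i \<and> k \<noteq> j"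
        using assms(2,3) k by (auto simp: off_def)
      then have "decay < margin (\<lambda>k. - Re (y k)) i j k"
        using assms(1) unfolding deep_def by blast
      then show ?thesis by simp
    qed
  qed
  then show ?thesis by simp
qed

lemma jet_bound_deep:
  assumes "0 \<le> snd c"
  shows "\<exists>C>0. \<forall>i j \<gamma> M y l. admissible i j \<gamma> M \<and> deep y \<and> l \<in> Lset n S c \<gamma> \<longrightarrow>
     cmod (jet n M y l) \<le> C * (\<Prod>k\<le>n. (1 + cmod (y k)) ^ count M k)
        * exp (chord (\<lambda>k. - Re (y k)) i j (of_int (fst c)) (of_int (snd c)))
        * (if l \<in> supported i j c \<gamma> then exp (- (\<Sum>k\<in>off i j. real_of_rat (l k))) else 0)"
proof -
  obtain C where C: "C > 0" "\<And>i j \<gamma> M y l. i < j \<Longrightarrow> adjacent S i j \<Longrightarrow> l \<in> supported i j c \<gamma> \<Longrightarrow>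
     cmod (jet n M y l) \<le> C * (\<Prod>k\<le>n. (1 + cmod (y k)) ^ count M k)
        * exp (chord (\<lambda>k. - Re (y k)) i j (of_int (fst c)) (of_int (snd c)))
        * exp (- (\<Sum>k\<in>off i j. real_of_rat (l k) * (margin (\<lambda>k. - Re (y k)) i j k - decay)))
        * exp (- (\<Sum>k\<in>off i j. real_of_rat (l k)))"
    using jet_decay[OF assms] by blast
  have "cmod (jet n M y l) \<le> C * (\<Prod>k\<le>n. (1 + cmod (y k)) ^ count M k)
        * exp (chord (\<lambda>k. - Re (y k)) i j (of_int (fst c)) (of_int (snd c)))
        * (if l \<in> supported i j c \<gamma> then exp (- (\<Sum>k\<in>off i j. real_of_rat (l k))) else 0)"
    if a: "admissible i j \<gamma> M" "deep y" "l \<in> Lset n S c \<gamma>" for i j \<gamma> M y l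
  proof (cases "l \<in> supported i j c \<gamma>")
    case True
    have ij: "i < j" "adjacent S i j" using a(1) by (auto simp: admissible_def)
    have "cmod (jet n M y l) \<le> C * (\<Prod>k\<le>n. (1 + cmod (y k)) ^ count M k)
        * exp (chord (\<lambda>k. - Re (y k)) i j (of_int (fst c)) (of_int (snd c)))
        * exp (- (\<Sum>k\<in>off i j. real_of_rat (l k) * (margin (\<lambda>k. - Re (y k)) i j k - decay)))
        * exp (- (\<Sum>k\<in>off i j. real_of_rat (l k)))"
      by (rule C(2)[OF ij True])
    also have "\<dots> \<le> C * (\<Prod>k\<le>n. (1 + cmod (y k)) ^ count M k)
        * exp (chord (\<lambda>k. - Re (y k)) i j (of_int (fst c)) (of_int (snd c))) * 1
        * exp (- (\<Sum>k\<in>off i j. real_of_rat (l k)))"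
      using C(1) by (intro mult_right_mono mult_left_mono deep_decay[OF a(2) ij True] mult_nonneg_nonneg prod_nonneg) auto
    finally show ?thesis using True by simp
  next
    case False
    then show ?thesis using jet_supported[OF a(1,3)] by auto
  qed
  then show ?thesis using C(1) by (intro exI[of _ C]) auto
qed

lemma supported_indicator_summable:
  assumes ij: "i < j" "adjacent S i j"
  shows "(\<lambda>l. B * (if l \<in> supported i j c \<gamma> then exp (- (\<Sum>k\<in>off i j. real_of_rat (l k))) else 0)) summable_on Lset n S c \<gamma>"
proof (rule summable_on_cmult_right)
  show "(\<lambda>l. if l \<in> supported i j c \<gamma> then exp (- (\<Sum>k\<in>off i j. real_of_rat (l k))) else 0) summable_on Lset n S c \<gamma>"
    by (rule iffD1[OF summable_on_cong_neutral supported_summable[OF ij, of c \<gamma>]])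
       (auto simp: supported_def)
qed

text \<open>The exponents off the cone determine \<open>l\<close>, so the bound is a product of geometric series.\<close>

lemma series_has_sum:
  assumes "0 \<le> snd c" "admissible i j \<gamma> M" "deep y"
  shows "(jet n M y has_sum series \<gamma> M c y) (Lset n S c \<gamma>)"
proof -
  have ij: "i < j" "adjacent S i j" using assms(2) by (auto simp: admissible_def)
  obtain C where C: "C > 0" "\<And>i j \<gamma> M y l. admissible i j \<gamma> M \<Longrightarrow> deep y \<Longrightarrow> l \<in> Lset n S c \<gamma> \<Longrightarrow>
     cmod (jet n M y l) \<le> C * (\<Prod>k\<le>n. (1 + cmod (y k)) ^ count M k)
        * exp (chord (\<lambda>k. - Re (y k)) i j (of_int (fst c)) (of_int (snd c)))
        * (if l \<in> supported i j c \<gamma> then exp (- (\<Sum>k\<in>off i j. real_of_rat (l k))) else 0)"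
    using jet_bound_deep[OF assms(1)] by blast
  define B where "B = C * (\<Prod>k\<le>n. (1 + cmod (y k)) ^ count M k)
        * exp (chord (\<lambda>k. - Re (y k)) i j (of_int (fst c)) (of_int (snd c)))"
  have "(\<lambda>l. cmod (jet n M y l)) summable_on Lset n S c \<gamma>"
  proof (rule summable_on_comparison_test[OF supported_indicator_summable[OF ij, where B = B]])
    fix l assume "l \<in> Lset n S c \<gamma>"
    then show "cmod (jet n M y l) \<le> B * (if l \<in> supported i j c \<gamma> then exp (- (\<Sum>k\<in>off i j. real_of_rat (l k))) else 0)"
      unfolding B_def by (rule C(2)[OF assms(2,3)])
  qed simp
  then show ?thesis unfolding series_def
    by (rule has_sum_infsum[OF abs_summable_summable])
qed

end

section \<open>Euler relations and derivatives of the scalar series\<close>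

lemma has_sum_finite_sum:
  fixes f :: "'i \<Rightarrow> 'l \<Rightarrow> complex"
  assumes "finite I" "\<And>i. i \<in> I \<Longrightarrow> (f i has_sum s i) A"
  shows "((\<lambda>l. \<Sum>i\<in>I. f i l) has_sum (\<Sum>i\<in>I. s i)) A"
  using assms by (induction I rule: finite_induct) (auto intro: has_sum_add)

lemma has_sum_divide_const:
  fixes f :: "'l \<Rightarrow> complex"
  assumes "(f has_sum s) A" shows "((\<lambda>l. f l / c) has_sum s / c) A"
  using has_sum_cmult_left[OF assms, of "inverse c"] by (simp add: divide_inverse)

context fan begin

definition lower :: "nat \<Rightarrow> (nat \<Rightarrow> rat) \<Rightarrow> (nat \<Rightarrow> rat)" where
  "lower k l = l(k := l k - 1)"

lemma bij_lower:
  assumes "k \<le> n"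
  shows "bij_betw (lower k) (Lset n S c \<gamma>) (Lset n S (add_vertex c k) \<gamma>)"
proof (rule bij_betwI[where g = "\<lambda>l. l(k := l k + 1)"])
  have sum_upd: "(\<Sum>m\<le>n. (l(k := v)) m * a m) = (\<Sum>m\<le>n. l m * a m) + (v - l k) * a k" for l a :: "nat \<Rightarrow> rat" and v
  proof -
    have "(\<Sum>m\<le>n. (l(k := v)) m * a m) = (\<Sum>m\<le>n. l m * a m + (if m = k then (v - l k) * a k else 0))"
      by (intro sum.cong refl) (simp add: algebra_simps)
    then show ?thesis using assms by (simp add: sum.distrib)
  qed
  have upd: "l(k := v) \<in> Lset n S d \<gamma>" if "l \<in> Lset n S c \<gamma>" "v - l k \<in> \<int>"
      "of_int (snd d) = of_int (snd c) - (v - l k)" "of_int (fst d) = of_int (fst c) - (v - l k) * of_nat k" for l v c d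
  proof -
    have "(\<Sum>m\<le>n. (l(k := v)) m) = - of_int (snd d)"
      using sum_upd[of l v "\<lambda>_. 1"] Lset_sums(1)[OF that(1)] that(3) by (simp only: mult_1_right)
    moreover have "(\<Sum>m\<le>n. (l(k := v)) m * of_nat m) = - of_int (fst d)"
      using sum_upd[of l v of_nat] Lset_sums(2)[OF that(1)] that(4) by simp
    moreover have "v - box_coord S \<gamma> k \<in> \<int>"
    proof -
      have "l k - box_coord S \<gamma> k \<in> \<int>" using that(1) assms unfolding Lset_def by blast
      from Ints_add[OF that(2) this] show ?thesis by simp
    qed
    ultimately show ?thesis
      using that(1) assms unfolding Lset_def vlat_def by simp
  qed
  show "lower k \<in> Lset n S c \<gamma> \<rightarrow> Lset n S (add_vertex c k) \<gamma>"
  proof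
    fix l assume "l \<in> Lset n S c \<gamma>"
    then show "lower k l \<in> Lset n S (add_vertex c k) \<gamma>"
      unfolding lower_def by (rule upd) (auto simp: add_vertex_def)
  qed
  show "(\<lambda>l. l(k := l k + 1)) \<in> Lset n S (add_vertex c k) \<gamma> \<rightarrow> Lset n S c \<gamma>"
  proof
    fix l assume "l \<in> Lset n S (add_vertex c k) \<gamma>"
    then show "l(k := l k + 1) \<in> Lset n S c \<gamma>"
      by (rule upd) (auto simp: add_vertex_def)
  qed
qed (auto simp: lower_def)

text \<open>The functional equation of \<open>\<Gamma>\<close>: multiplication of the factor for \<open>k\<close> by \<open>l\<^sub>k + D\<^sub>k/(2\<pi>i)\<close> lowers \<open>l\<^sub>k\<close>; the
  summand with \<open>D\<^sub>k\<close> takes one copy of \<open>k\<close> out of \<open>M\<close>.\<close>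

lemma jet_lower:
  assumes "k \<le> n"
  shows "exp (y k) * jet n M y (lower k l) = of_rat (l k) * jet n M y l +
     (if k \<in># M then jet n (M - {#k#}) y l / (2 * of_real pi * \<i>) else 0)"
proof -
  define P where "P = (\<Prod>m\<in>{..n} - {k}. fps_nth (gamma_factor (y m) (l m)) (count M m))"
  have split: "(\<Prod>m\<le>n. f m) = f k * (\<Prod>m\<in>{..n} - {k}. f m)" for f :: "nat \<Rightarrow> complex"
    using assms by (intro prod.remove) auto
  have 1: "jet n M y (lower k l) = fps_nth (gamma_factor (y k) (l k - 1)) (count M k) * P"
    unfolding jet_def split P_def lower_def by (simp cong: prod.cong_simp)
  have 2: "jet n M y l = fps_nth (gamma_factor (y k) (l k)) (count M k) * P"
    unfolding jet_def split P_def by simp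
  have 3: "jet n (M - {#k#}) y l = fps_nth (gamma_factor (y k) (l k)) (count M k - 1) * P"
    unfolding jet_def split P_def by (simp cong: prod.cong_simp)
  have "exp (y k) * jet n M y (lower k l) = (exp (y k) * fps_nth (gamma_factor (y k) (l k - 1)) (count M k)) * P"
    by (simp add: 1)
  also have "\<dots> = of_rat (l k) * jet n M y l + (if count M k = 0 then 0 else jet n (M - {#k#}) y l / (2 * of_real pi * \<i>))"
  proof (cases "count M k = 0")
    case True
    show ?thesis unfolding gamma_factor_shift_nth 2 3 by (simp only: True if_True add_0_right simp_thms mult.assoc)
  next
    case False
    show ?thesis unfolding gamma_factor_shift_nth 2 3
      by (simp only: False if_False distrib_right times_divide_eq_left mult.assoc)
  qed
  also have "(if count M k = 0 then 0 else jet n (M - {#k#}) y l / (2 * of_real pi * \<i>)) =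
      (if k \<in># M then jet n (M - {#k#}) y l / (2 * of_real pi * \<i>) else 0)"
    by (cases "k \<in># M") (simp_all only: count_eq_zero_iff if_True if_False simp_thms)
  finally show ?thesis .
qed

lemma admissible_diff: "admissible i j \<gamma> M \<Longrightarrow> admissible i j \<gamma> (M - {#k#})"
  by (auto simp: admissible_def dest: in_diffD)

lemma series_shift_has_sum:
  assumes "0 \<le> snd c" "admissible i j \<gamma> M" "deep y" "k \<le> n"
  shows "((\<lambda>l. jet n M y (lower k l)) has_sum series \<gamma> M (add_vertex c k) y) (Lset n S c \<gamma>)"
  using series_has_sum[of "add_vertex c k" i j \<gamma> M y] assms has_sum_reindex_bij_betw[OF bij_lower[OF assms(4), of c \<gamma>], of "jet n M y"]
  by (simp add: add_vertex_def)

text \<open>Used with \<open>a\<^sub>k = 1\<close> and \<open>a\<^sub>k = k\<close>, for which \<open>\<Sum>\<^sub>k a\<^sub>k l\<^sub>k\<close> is constant on the index set. The additional sum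
  over \<open>M\<close> disappears later, because \<open>\<Sum>\<^sub>k a\<^sub>k D\<^sub>k\<close> is a relation.\<close>

lemma series_euler:
  assumes c: "0 \<le> snd c" and adm: "admissible i j \<gamma> M" and y: "deep y"
    and A: "\<And>l. l \<in> Lset n S c \<gamma> \<Longrightarrow> (\<Sum>k\<le>n. a k * of_rat (l k)) = A"
  shows "(\<Sum>k\<le>n. a k * exp (y k) * series \<gamma> M (add_vertex c k) y) =
     A * series \<gamma> M c y + (\<Sum>k\<in>set_mset M. a k * series \<gamma> (M - {#k#}) c y) / (2 * of_real pi * \<i>)"
proof -
  have M: "set_mset M \<subseteq> {..n}" using adm adjacentD[of i j] by (auto simp: admissible_def)
  have "((\<lambda>l. \<Sum>k\<le>n. a k * exp (y k) * jet n M y (lower k l)) has_sum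
      (\<Sum>k\<le>n. a k * exp (y k) * series \<gamma> M (add_vertex c k) y)) (Lset n S c \<gamma>)"
    by (intro has_sum_finite_sum has_sum_cmult_right series_shift_has_sum[OF c adm y]) auto
  moreover have "((\<lambda>l. \<Sum>k\<le>n. a k * exp (y k) * jet n M y (lower k l)) has_sum
      A * series \<gamma> M c y + (\<Sum>k\<in>set_mset M. a k * series \<gamma> (M - {#k#}) c y) / (2 * of_real pi * \<i>)) (Lset n S c \<gamma>)"
  proof -
    have "((\<lambda>l. A * jet n M y l + (\<Sum>k\<in>set_mset M. a k * jet n (M - {#k#}) y l) / (2 * of_real pi * \<i>)) has_sum
      A * series \<gamma> M c y + (\<Sum>k\<in>set_mset M. a k * series \<gamma> (M - {#k#}) c y) / (2 * of_real pi * \<i>)) (Lset n S c \<gamma>)"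
      by (intro has_sum_add has_sum_finite_sum has_sum_cmult_right has_sum_divide_const finite_set_mset
          series_has_sum[OF c adm y] series_has_sum[OF c admissible_diff[OF adm] y])
    moreover have "(\<Sum>k\<le>n. a k * exp (y k) * jet n M y (lower k l)) =
       A * jet n M y l + (\<Sum>k\<in>set_mset M. a k * jet n (M - {#k#}) y l) / (2 * of_real pi * \<i>)"
      if l: "l \<in> Lset n S c \<gamma>" for l
    proof -
      have "(\<Sum>k\<le>n. a k * exp (y k) * jet n M y (lower k l)) =
        (\<Sum>k\<le>n. a k * of_rat (l k) * jet n M y l + (if k \<in># M then a k * jet n (M - {#k#}) y l / (2 * of_real pi * \<i>) else 0))"
        by (intro sum.cong refl) (simp add: mult.assoc jet_lower distrib_left)
      also have "\<dots> = (\<Sum>k\<le>n. a k * of_rat (l k)) * jet n M y l +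
         (\<Sum>k\<le>n. if k \<in> set_mset M then a k * jet n (M - {#k#}) y l / (2 * of_real pi * \<i>) else 0)"
        by (simp add: sum.distrib sum_distrib_right)
      also have "(\<Sum>k\<le>n. if k \<in> set_mset M then a k * jet n (M - {#k#}) y l / (2 * of_real pi * \<i>) else 0) =
         (\<Sum>k\<in>set_mset M. a k * jet n (M - {#k#}) y l / (2 * of_real pi * \<i>))"
        using M by (subst sum.inter_restrict[symmetric]) (auto simp: Int_absorb1)
      finally show ?thesis using A[OF l] by (simp add: sum_divide_distrib)
    qed
    ultimately show ?thesis by (simp cong: has_sum_cong)
  qed
  ultimately show ?thesis by (rule has_sum_unique)
qed

text \<open>The part of a complex line in the region of convergence. It is open and convex, so a function on it with zero
  derivative is constant.\<close>

definition deep_times :: "(nat \<Rightarrow> complex) \<Rightarrow> (nat \<Rightarrow> complex) \<Rightarrow> complex set" where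
  "deep_times y w = {s. deep (\<lambda>k. y k + s * w k)}"

lemma continuous_chord:
  assumes "i < j"
  shows "continuous_on A (\<lambda>s. chord (\<lambda>k. - Re (y k + s * w k)) i j a b)"
  unfolding chord_def using assms by (auto intro!: continuous_intros)

lemma open_deep_times: "open (deep_times y w)"
proof -
  define T where "T = {(i, j, k). i < j \<and> adjacent S i j \<and> k \<le> n \<and> k \<noteq> i \<and> k \<noteq> j}"
  have "T \<subseteq> {..n} \<times> {..n} \<times> {..n}" unfolding T_def using adjacentD by auto
  then have fin: "finite T" by (rule finite_subset) auto
  have "deep_times y w = (\<Inter>(i, j, k)\<in>T. {s. decay < margin (\<lambda>k. - Re (y k + s * w k)) i j k})"
    unfolding deep_times_def deep_def T_def by auto
  also have "open \<dots>"
  proof (intro open_INT fin ballI)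
    fix t assume t: "t \<in> T"
    obtain i j k where [simp]: "t = (i, j, k)" by (cases t)
    have "i < j" using t by (auto simp: T_def)
    then have "open {s. decay < margin (\<lambda>k. - Re (y k + s * w k)) i j k}"
      unfolding margin_def by (intro open_Collect_less continuous_intros continuous_chord)
    then show "open (case t of (i, j, k) \<Rightarrow> {s. decay < margin (\<lambda>k. - Re (y k + s * w k)) i j k})" by simp
  qed
  finally show ?thesis .
qed

lemma convex_deep_times: "convex (deep_times y w)"
proof (rule convexI)
  fix s t :: complex and u v :: real
  assume st: "s \<in> deep_times y w" "t \<in> deep_times y w" and uv: "0 \<le> u" "0 \<le> v" "u + v = 1"
  have eq: "(\<lambda>k. - Re (y k + (u *\<^sub>R s + v *\<^sub>R t) * w k)) = (\<lambda>k. u * - Re (y k + s * w k) + v * - Re (y k + t * w k))"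
  proof
    fix k
    have "Re (y k) = u * Re (y k) + v * Re (y k)" using uv by (simp flip: distrib_right)
    then show "- Re (y k + (u *\<^sub>R s + v *\<^sub>R t) * w k) = u * - Re (y k + s * w k) + v * - Re (y k + t * w k)"
      by (simp add: algebra_simps)
  qed
  have "decay < u * p + v * q" if "decay < p" "decay < q" for p q
  proof -
    have "decay = u * decay + v * decay" using uv by (simp flip: distrib_right)
    also have "\<dots> < u * p + v * q"
      using uv that by (cases "u = 0") (auto intro!: add_less_le_mono mult_strict_left_mono mult_left_mono)
    finally show ?thesis .
  qed
  then show "u *\<^sub>R s + v *\<^sub>R t \<in> deep_times y w"
    using st unfolding deep_times_def deep_def mem_Collect_eq eq margin_linear by blast
qed

lemma jet_deriv:
  "((\<lambda>s. jet n M (\<lambda>k. y k + s * w k) l) has_field_derivative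
     (\<Sum>k\<le>n. w k * (exp (y k + s * w k) * jet n M (\<lambda>k. y k + s * w k) (lower k l)))) (at s)"
proof -
  have "((\<lambda>s. jet n M (\<lambda>k. y k + s * w k) l) has_field_derivative
     (\<Sum>k\<le>n. exp (y k + s * w k) * fps_nth (gamma_factor (y k + s * w k) (l k - 1)) (count M k) * w k *
       (\<Prod>m\<in>{..n} - {k}. fps_nth (gamma_factor (y m + s * w m) (l m)) (count M m)))) (at s)"
    unfolding jet_def
  proof (rule has_field_derivative_prod)
    fix k
    have "((\<lambda>s. y k + s * w k) has_field_derivative w k) (at s)"
      by (rule derivative_eq_intros refl | simp)+
    from DERIV_chain2[OF gamma_factor_deriv this, of "l k" "count M k"]
    show "((\<lambda>s. fps_nth (gamma_factor (y k + s * w k) (l k)) (count M k)) has_field_derivative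
      exp (y k + s * w k) * fps_nth (gamma_factor (y k + s * w k) (l k - 1)) (count M k) * w k) (at s)" .
  qed
  also have "(\<Sum>k\<le>n. exp (y k + s * w k) * fps_nth (gamma_factor (y k + s * w k) (l k - 1)) (count M k) * w k *
       (\<Prod>m\<in>{..n} - {k}. fps_nth (gamma_factor (y m + s * w m) (l m)) (count M m))) =
     (\<Sum>k\<le>n. w k * (exp (y k + s * w k) * jet n M (\<lambda>k. y k + s * w k) (lower k l)))"
  proof (intro sum.cong refl)
    fix k assume k: "k \<in> {..n}"
    have "jet n M (\<lambda>k. y k + s * w k) (lower k l) =
      fps_nth (gamma_factor (y k + s * w k) (l k - 1)) (count M k) *
       (\<Prod>m\<in>{..n} - {k}. fps_nth (gamma_factor (y m + s * w m) (l m)) (count M m))"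
      unfolding jet_def using k by (subst prod.remove[of _ k]) (auto simp: lower_def cong: prod.cong_simp)
    then show "exp (y k + s * w k) * fps_nth (gamma_factor (y k + s * w k) (l k - 1)) (count M k) * w k *
       (\<Prod>m\<in>{..n} - {k}. fps_nth (gamma_factor (y m + s * w m) (l m)) (count M m)) =
       w k * (exp (y k + s * w k) * jet n M (\<lambda>k. y k + s * w k) (lower k l))"
      by (simp only: mult_ac)
  qed
  finally show ?thesis .
qed

text \<open>The bound of \<open>jet_bound_deep\<close> is locally uniform in \<open>y\<close>, so the series converges uniformly near 0 and may be
  differentiated term by term.\<close>

lemma series_deriv_0:
  assumes c: "0 \<le> snd c" and adm: "admissible i j \<gamma> M" and y: "deep y"
  shows "((\<lambda>s. series \<gamma> M c (\<lambda>k. y k + s * w k)) has_field_derivative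
     (\<Sum>k\<le>n. w k * (exp (y k) * series \<gamma> M (add_vertex c k) y))) (at 0)"
proof -
  have ij: "i < j" "adjacent S i j" using adm by (auto simp: admissible_def)
  have "0 \<in> deep_times y w" using y by (simp add: deep_times_def)
  then obtain r where r: "r > 0" "cball 0 r \<subseteq> deep_times y w"
    using open_deep_times open_contains_cball by blast
  have deep: "deep (\<lambda>k. y k + s * w k)" if "s \<in> cball 0 r" for s
    using r(2) that by (auto simp: deep_times_def)
  obtain C where C: "C > 0" "\<And>i j \<gamma> M y l. admissible i j \<gamma> M \<Longrightarrow> deep y \<Longrightarrow> l \<in> Lset n S c \<gamma> \<Longrightarrow>
     cmod (jet n M y l) \<le> C * (\<Prod>k\<le>n. (1 + cmod (y k)) ^ count M k)
        * exp (chord (\<lambda>k. - Re (y k)) i j (of_int (fst c)) (of_int (snd c)))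
        * (if l \<in> supported i j c \<gamma> then exp (- (\<Sum>k\<in>off i j. real_of_rat (l k))) else 0)"
    using jet_bound_deep[OF c] by blast
  define g where "g s = C * (\<Prod>k\<le>n. (1 + cmod (y k + s * w k)) ^ count M k)
        * exp (chord (\<lambda>k. - Re (y k + s * w k)) i j (of_int (fst c)) (of_int (snd c)))" for s
  have "continuous_on (cball 0 r) g"
    unfolding g_def by (intro continuous_intros continuous_chord ij)
  then have "bounded (g ` cball 0 r)"
    by (intro compact_imp_bounded compact_continuous_image) auto
  then obtain B where "\<forall>x\<in>g ` cball 0 r. norm x \<le> B" unfolding bounded_iff by blast
  then have B: "g s \<le> B" if "s \<in> cball 0 r" for s
    using that abs_ge_self[of "g s"] by (force intro: order_trans)
  define W where "W l = (if l \<in> supported i j c \<gamma> then exp (- (\<Sum>k\<in>off i j. real_of_rat (l k))) else 0)" for l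
  have dom: "cmod (jet n M (\<lambda>k. y k + s * w k) l) \<le> B * W l" if "l \<in> Lset n S c \<gamma>" "s \<in> cball 0 r" for l s
  proof -
    have "cmod (jet n M (\<lambda>k. y k + s * w k) l) \<le> g s * W l"
      using C(2)[OF adm deep[OF that(2)] that(1)] unfolding g_def W_def .
    also have "\<dots> \<le> B * W l" by (intro mult_right_mono B that) (simp add: W_def)
    finally show ?thesis .
  qed
  (* The summable bound is uniform on the disc. *)
  have ulim: "uniform_limit (cball 0 r) (\<lambda>X s. \<Sum>l\<in>X. jet n M (\<lambda>k. y k + s * w k) l)
     (\<lambda>s. series \<gamma> M c (\<lambda>k. y k + s * w k)) (finite_subsets_at_top (Lset n S c \<gamma>))"
    unfolding series_def W_def using dom unfolding W_def
    by (rule Weierstrass_m_test_general[OF _ supported_indicator_summable[OF ij]])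
  have derivs: "\<forall>\<^sub>F X in finite_subsets_at_top (Lset n S c \<gamma>).
     continuous_on (cball 0 r) (\<lambda>s. \<Sum>l\<in>X. jet n M (\<lambda>k. y k + s * w k) l) \<and>
     (\<forall>s\<in>ball 0 r. ((\<lambda>s. \<Sum>l\<in>X. jet n M (\<lambda>k. y k + s * w k) l) has_field_derivative
        (\<Sum>l\<in>X. \<Sum>k\<le>n. w k * (exp (y k + s * w k) * jet n M (\<lambda>k. y k + s * w k) (lower k l)))) (at s))"
  proof (intro always_eventually allI)
    fix X
    have d: "((\<lambda>s. \<Sum>l\<in>X. jet n M (\<lambda>k. y k + s * w k) l) has_field_derivative
        (\<Sum>l\<in>X. \<Sum>k\<le>n. w k * (exp (y k + s * w k) * jet n M (\<lambda>k. y k + s * w k) (lower k l)))) (at s)" for s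
      by (intro DERIV_sum jet_deriv)
    then show "continuous_on (cball 0 r) (\<lambda>s. \<Sum>l\<in>X. jet n M (\<lambda>k. y k + s * w k) l) \<and>
     (\<forall>s\<in>ball 0 r. ((\<lambda>s. \<Sum>l\<in>X. jet n M (\<lambda>k. y k + s * w k) l) has_field_derivative
        (\<Sum>l\<in>X. \<Sum>k\<le>n. w k * (exp (y k + s * w k) * jet n M (\<lambda>k. y k + s * w k) (lower k l)))) (at s))"
      by (meson DERIV_isCont continuous_at_imp_continuous_on)
  qed
  have "\<exists>g'. \<forall>s\<in>ball 0 r. ((\<lambda>s. series \<gamma> M c (\<lambda>k. y k + s * w k)) has_field_derivative g' s) (at s) \<and>
     ((\<lambda>X. \<Sum>l\<in>X. \<Sum>k\<le>n. w k * (exp (y k + s * w k) * jet n M (\<lambda>k. y k + s * w k) (lower k l))) \<longlongrightarrow> g' s)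
        (finite_subsets_at_top (Lset n S c \<gamma>))"
  proof (rule has_complex_derivative_uniform_limit[OF derivs ulim finite_subsets_at_top_neq_bot r(1)], goal_cases)
    case (1 g')
    show ?case by (rule exI[of _ g'], rule ballI, rule 1(2))
  qed
  then obtain g' where g'_all: "\<forall>s\<in>ball 0 r. ((\<lambda>s. series \<gamma> M c (\<lambda>k. y k + s * w k)) has_field_derivative g' s) (at s) \<and>
     ((\<lambda>X. \<Sum>l\<in>X. \<Sum>k\<le>n. w k * (exp (y k + s * w k) * jet n M (\<lambda>k. y k + s * w k) (lower k l))) \<longlongrightarrow> g' s)
        (finite_subsets_at_top (Lset n S c \<gamma>))" ..
  have r0: "0 \<in> ball (0 :: complex) r" using r(1) by simp
  have g': "((\<lambda>s. series \<gamma> M c (\<lambda>k. y k + s * w k)) has_field_derivative g' 0) (at 0)"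
     "((\<lambda>X. \<Sum>l\<in>X. \<Sum>k\<le>n. w k * (exp (y k + 0 * w k) * jet n M (\<lambda>k. y k + 0 * w k) (lower k l))) \<longlongrightarrow> g' 0)
        (finite_subsets_at_top (Lset n S c \<gamma>))"
    using bspec[OF g'_all r0] by (rule conjunct1, rule conjunct2)
  have "((\<lambda>l. \<Sum>k\<le>n. w k * (exp (y k) * jet n M y (lower k l))) has_sum
     (\<Sum>k\<le>n. w k * (exp (y k) * series \<gamma> M (add_vertex c k) y))) (Lset n S c \<gamma>)"
    by (intro has_sum_finite_sum has_sum_cmult_right series_shift_has_sum[OF c adm y]) auto
  moreover have "((\<lambda>l. \<Sum>k\<le>n. w k * (exp (y k) * jet n M y (lower k l))) has_sum g' 0) (Lset n S c \<gamma>)"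
    using g'(2) unfolding has_sum_def by simp
  ultimately have "(\<Sum>k\<le>n. w k * (exp (y k) * series \<gamma> M (add_vertex c k) y)) = g' 0" by (rule has_sum_unique)
  then show ?thesis using g'(1) by simp
qed

lemma series_deriv:
  assumes c: "0 \<le> snd c" and adm: "admissible i j \<gamma> M" and s: "s \<in> deep_times y w"
  shows "((\<lambda>s. series \<gamma> M c (\<lambda>k. y k + s * w k)) has_field_derivative
     (\<Sum>k\<le>n. w k * (exp (y k + s * w k) * series \<gamma> M (add_vertex c k) (\<lambda>k. y k + s * w k)))) (at s)"
proof -
  have "deep (\<lambda>k. y k + s * w k)" using s by (simp add: deep_times_def)
  note deriv = series_deriv_0[OF c adm this, of w]
  have shift: "(\<lambda>t. series \<gamma> M c (\<lambda>k. y k + s * w k + t * w k)) = (\<lambda>t. series \<gamma> M c (\<lambda>k. y k + (t + s) * w k))"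
  proof
    fix t
    have "(\<lambda>k. y k + s * w k + t * w k) = (\<lambda>k. y k + (t + s) * w k)"
      by (rule ext) (simp only: distrib_right add_ac)
    then show "series \<gamma> M c (\<lambda>k. y k + s * w k + t * w k) = series \<gamma> M c (\<lambda>k. y k + (t + s) * w k)"
      by (rule arg_cong)
  qed
  show ?thesis
    using deriv unfolding shift DERIV_shift[of "\<lambda>s. series \<gamma> M c (\<lambda>k. y k + s * w k)" _ 0 s, symmetric] by (simp only: add_0_left)
qed

end

section \<open>Functionals and bilinear forms on presented modules\<close>

text \<open>The linear functionals on the quotient by \<open>W\<close>, as functionals on the free module.\<close>

definition functional :: "('g \<Rightarrow>\<^sub>0 dpoly) set \<Rightarrow> (('g \<Rightarrow>\<^sub>0 dpoly) \<Rightarrow> complex) \<Rightarrow> bool" where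
  "functional W \<phi> \<longleftrightarrow> Vector_Spaces.linear cscale (*) \<phi> \<and> (\<forall>w\<in>W. \<phi> w = 0)"

lemma vector_space_complex: "vector_space ((*) :: complex \<Rightarrow> complex \<Rightarrow> complex)"
  by unfold_locales (simp_all add: algebra_simps)

lemma vector_space_pm_scale: "vector_space (pm_scale :: complex \<Rightarrow> ('g \<Rightarrow>\<^sub>0 complex) \<Rightarrow> _)"
  using module_pm_scale[where 'r = complex] by (simp add: module_def vector_space_def)

lemma module_mult: "module ((*) :: 'r::comm_ring_1 \<Rightarrow> 'r \<Rightarrow> 'r)"
  by unfold_locales (simp_all add: algebra_simps)

lemma functional_iff:
  "functional W \<phi> \<longleftrightarrow> (\<forall>u v. \<phi> (u + v) = \<phi> u + \<phi> v) \<and> (\<forall>a u. \<phi> (cscale a u) = a * \<phi> u) \<and> (\<forall>w\<in>W. \<phi> w = 0)"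
  unfolding functional_def Vector_Spaces.linear_iff using vector_space_complex vector_space_cscale by blast

lemma functional_add: "functional W \<phi> \<Longrightarrow> \<phi> (u + v) = \<phi> u + \<phi> v"
  and functional_scale: "functional W \<phi> \<Longrightarrow> \<phi> (cscale a u) = a * \<phi> u"
  and functional_rel: "functional W \<phi> \<Longrightarrow> w \<in> W \<Longrightarrow> \<phi> w = 0"
  by (auto simp: functional_iff)

lemma functional_zero: "functional W \<phi> \<Longrightarrow> \<phi> 0 = 0"
  using functional_add[of W \<phi> 0 0] by simp

lemma functional_sum: "functional W \<phi> \<Longrightarrow> \<phi> (\<Sum>i\<in>I. f i) = (\<Sum>i\<in>I. \<phi> (f i))"
  by (induction I rule: infinite_finite_induct) (simp_all add: functional_zero functional_add)

lemma functional_diff_rel: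
  assumes "functional W \<phi>" "u - v \<in> W" shows "\<phi> u = \<phi> v"
  using functional_add[OF assms(1), of "u - v" v] functional_rel[OF assms] by simp

lemma quot_has_sum_iff:
  "quot_has_sum W f A s \<longleftrightarrow> (\<forall>\<phi>. functional W \<phi> \<longrightarrow> ((\<lambda>l. \<phi> (f l)) has_sum \<phi> s) A)"
  unfolding quot_has_sum_def functional_def by simp

text \<open>A basis of the span together with \<open>t\<close> is linearly independent and extends to a basis of the whole space.\<close>

lemma separating_functional:
  fixes t :: "'g \<Rightarrow>\<^sub>0 complex"
  assumes "t \<notin> module.span pm_scale G"
  shows "\<exists>\<Lambda>. Vector_Spaces.linear pm_scale (*) \<Lambda> \<and> (\<forall>g\<in>G. \<Lambda> g = 0) \<and> \<Lambda> t \<noteq> (0 :: complex)"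
proof -
  interpret V: vector_space "pm_scale :: complex \<Rightarrow> ('g \<Rightarrow>\<^sub>0 complex) \<Rightarrow> _" by (rule vector_space_pm_scale)
  interpret C: vector_space "(*) :: complex \<Rightarrow> complex \<Rightarrow> complex" by (rule vector_space_complex)
  interpret P: vector_space_pair "pm_scale :: complex \<Rightarrow> ('g \<Rightarrow>\<^sub>0 complex) \<Rightarrow> _" "(*) :: complex \<Rightarrow> complex \<Rightarrow> complex"
    by unfold_locales
  obtain B where B: "B \<subseteq> G" "V.independent B" "G \<subseteq> V.span B"
    using V.maximal_independent_subset[of G] by blast
  have "t \<notin> V.span B" using assms V.span_mono[OF B(1)] by blast
  then have ind: "V.independent (insert t B)" using B(2) by (simp add: V.independent_insertI)
  obtain \<Lambda> where \<Lambda>: "Vector_Spaces.linear pm_scale (*) \<Lambda>" "\<forall>x\<in>insert t B. \<Lambda> x = (if x = t then 1 else 0)"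
    using P.linear_independent_extend[OF ind, of "\<lambda>x. if x = t then 1 else 0"] by blast
  have "t \<notin> B" using \<open>t \<notin> V.span B\<close> V.span_base by blast
  interpret L: Vector_Spaces.linear "pm_scale :: complex \<Rightarrow> ('g \<Rightarrow>\<^sub>0 complex) \<Rightarrow> _" "(*)" \<Lambda> by (rule \<Lambda>(1))
  have "\<Lambda> g = 0" if "g \<in> G" for g
  proof (rule L.eq_0_on_span[of B])
    show "\<Lambda> b = 0" if "b \<in> B" for b using \<Lambda>(2) that \<open>t \<notin> B\<close> by auto
    show "g \<in> V.span B" using B(3) \<open>g \<in> G\<close> by blast
  qed
  then show ?thesis using \<Lambda> by (intro exI[of _ \<Lambda>]) auto
qed

definition bilinear_form ::
    "('g \<Rightarrow>\<^sub>0 dpoly) set \<Rightarrow> ('h \<Rightarrow>\<^sub>0 dpoly) set \<Rightarrow> (('g \<Rightarrow>\<^sub>0 dpoly) \<Rightarrow> ('h \<Rightarrow>\<^sub>0 dpoly) \<Rightarrow> complex) \<Rightarrow> bool" where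
  "bilinear_form W W' B \<longleftrightarrow> (\<forall>v. functional W (\<lambda>u. B u v)) \<and> (\<forall>u. functional W' (B u))"

text \<open>If the difference were not a relation, a linear form on the free tensors could separate it from all
  relations, and a linear form that kills the relations is exactly a bilinear form on the quotients.\<close>

lemma tensor_class_eqI:
  assumes "\<And>\<Lambda>. Vector_Spaces.linear pm_scale (*) \<Lambda> \<Longrightarrow> bilinear_form W W' (\<lambda>u v. \<Lambda> (u \<otimes> v)) \<Longrightarrow> \<Lambda> s = \<Lambda> t"
  shows "tensor_class W W' s = tensor_class W W' t"
proof -
  have rel: "s - t \<in> tensor_rel W W'"
  proof (rule ccontr)
    assume not_in: "s - t \<notin> tensor_rel W W'"
    define G where "G = {(u + u') \<otimes> v - u \<otimes> v - u' \<otimes> v | (u :: 'a \<Rightarrow>\<^sub>0 dpoly) u' (v :: 'b \<Rightarrow>\<^sub>0 dpoly). True} \<union>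
        {u \<otimes> (v + v') - u \<otimes> v - u \<otimes> v' | u v v'. True} \<union>
        {cscale a u \<otimes> v - pm_scale a (u \<otimes> v) | a u v. True} \<union>
        {u \<otimes> cscale a v - pm_scale a (u \<otimes> v) | a u v. True} \<union>
        {w \<otimes> v | w v. w \<in> W} \<union> {u \<otimes> w' | u w'. w' \<in> W'}"
    have "s - t \<notin> module.span pm_scale G"
      using not_in unfolding tensor_rel_def G_def .
    from separating_functional[OF this]
    obtain \<Lambda> :: "('a, 'b) free_tensor \<Rightarrow> complex" where \<Lambda>: "Vector_Spaces.linear pm_scale (*) \<Lambda>"
      and G: "\<forall>g\<in>G. \<Lambda> g = 0" and ne: "\<Lambda> (s - t) \<noteq> 0"
      by blast
    interpret L: Vector_Spaces.linear "pm_scale :: complex \<Rightarrow> ('a, 'b) free_tensor \<Rightarrow> _" "(*)" \<Lambda> by (rule \<Lambda>)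
    have gen: "\<Lambda> ((u + u') \<otimes> v - u \<otimes> v - u' \<otimes> v) = 0" "\<Lambda> (u \<otimes> (v + v') - u \<otimes> v - u \<otimes> v') = 0"
       "\<Lambda> (cscale a u \<otimes> v - pm_scale a (u \<otimes> v)) = 0" "\<Lambda> (u \<otimes> cscale a v - pm_scale a (u \<otimes> v)) = 0"
       "w \<in> W \<Longrightarrow> \<Lambda> (w \<otimes> v) = 0" "w' \<in> W' \<Longrightarrow> \<Lambda> (u \<otimes> w') = 0" for u u' v v' a w w'
      subgoal by (rule bspec[OF G], unfold G_def, rule UnI1, rule UnI1, rule UnI1, rule UnI1, rule UnI1, rule CollectI, rule exI[of _ u], rule exI[of _ u'], rule exI[of _ v], rule conjI[OF refl TrueI])
      subgoal by (rule bspec[OF G], unfold G_def, rule UnI1, rule UnI1, rule UnI1, rule UnI1, rule UnI2, rule CollectI, rule exI[of _ u], rule exI[of _ v], rule exI[of _ v'], rule conjI[OF refl TrueI])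
      subgoal by (rule bspec[OF G], unfold G_def, rule UnI1, rule UnI1, rule UnI1, rule UnI2, rule CollectI, rule exI[of _ a], rule exI[of _ u], rule exI[of _ v], rule conjI[OF refl TrueI])
      subgoal by (rule bspec[OF G], unfold G_def, rule UnI1, rule UnI1, rule UnI2, rule CollectI, rule exI[of _ a], rule exI[of _ u], rule exI[of _ v], rule conjI[OF refl TrueI])
      subgoal by (rule bspec[OF G], unfold G_def, rule UnI1, rule UnI2, rule CollectI, rule exI[of _ w], rule exI[of _ v], rule conjI[OF refl], assumption)
      subgoal by (rule bspec[OF G], unfold G_def, rule UnI2, rule CollectI, rule exI[of _ u], rule exI[of _ w'], rule conjI[OF refl], assumption)
      done
    have "\<Lambda> ((u + u') \<otimes> v) = \<Lambda> (u \<otimes> v) + \<Lambda> (u' \<otimes> v)" for u u' v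
      using gen(1)[of u u' v] unfolding L.diff by (simp only: diff_diff_eq right_minus_eq)
    moreover have "\<Lambda> (u \<otimes> (v + v')) = \<Lambda> (u \<otimes> v) + \<Lambda> (u \<otimes> v')" for u v v'
      using gen(2)[of u v v'] unfolding L.diff by (simp only: diff_diff_eq right_minus_eq)
    moreover have "\<Lambda> (cscale a u \<otimes> v) = a * \<Lambda> (u \<otimes> v)" for a u v
      using gen(3)[of a u v] unfolding L.diff L.scale by (simp only: right_minus_eq)
    moreover have "\<Lambda> (u \<otimes> cscale a v) = a * \<Lambda> (u \<otimes> v)" for a u v
      using gen(4)[of u a v] unfolding L.diff L.scale by (simp only: right_minus_eq)
    ultimately have "bilinear_form W W' (\<lambda>u v. \<Lambda> (u \<otimes> v))"
      unfolding bilinear_form_def functional_iff using gen(5,6) by blast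
    from assms[OF \<Lambda> this] have "\<Lambda> (s - t) = 0" unfolding L.diff by (simp only: diff_self)
    with ne show False by blast
  qed
  interpret V: vector_space "pm_scale :: complex \<Rightarrow> ('a, 'b) free_tensor \<Rightarrow> _" by (rule vector_space_pm_scale)
  have "u - s \<in> tensor_rel W W' \<longleftrightarrow> u - t \<in> tensor_rel W W'" for u
  proof -
    have "u - t = (u - s) + (s - t)" "u - s = (u - t) - (s - t)" by simp_all
    note split = this
    show ?thesis
    proof
      assume "u - s \<in> tensor_rel W W'"
      then show "u - t \<in> tensor_rel W W'"
        using rel unfolding split(1) tensor_rel_def by (rule V.span_add)
    next
      assume "u - t \<in> tensor_rel W W'"
      then show "u - s \<in> tensor_rel W W'"
        using rel unfolding split(2) tensor_rel_def by (rule V.span_diff)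
    qed
  qed
  then show ?thesis unfolding tensor_class_def by blast
qed

lemma Cst_1: "Cst 1 = 1"
  by (simp add: Cst_def single_one)

text \<open>Modulo the products \<open>D\<^sub>i D\<^sub>j\<close> only the constant and the linear terms of the product survive.\<close>

lemma prod_truncated:
  fixes Q :: "dpoly \<Rightarrow> complex"
  assumes "finite K" and "\<And>p q. Q (p + q) = Q p + Q q" and "\<And>a p. Q (Cst a * p) = a * Q p"
    and "\<And>i j p. Q (D i * D j * p) = 0"
  shows "Q (\<Prod>k\<in>K. Cst (a k) + Cst (b k) * D k) =
    (\<Prod>k\<in>K. a k) * Q 1 + (\<Sum>m\<in>K. b m * (\<Prod>k\<in>K - {m}. a k) * Q (D m))"
  using assms
proof (induction K arbitrary: Q rule: finite_induct)
  case (insert x K)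
  note add = insert.prems(1) and cst = insert.prems(2) and nil = insert.prems(3)
  define Q' where "Q' p = Q ((Cst (a x) + Cst (b x) * D x) * p)" for p
  have Q': "Q' p = a x * Q p + b x * Q (D x * p)" for p
    unfolding Q'_def by (simp add: distrib_right add mult.assoc cst)
  have "Q (\<Prod>k\<in>insert x K. Cst (a k) + Cst (b k) * D k) = Q' (\<Prod>k\<in>K. Cst (a k) + Cst (b k) * D k)"
    using insert.hyps by (simp add: Q'_def)
  also have "\<dots> = (\<Prod>k\<in>K. a k) * Q' 1 + (\<Sum>m\<in>K. b m * (\<Prod>k\<in>K - {m}. a k) * Q' (D m))"
  proof (rule insert.IH)
    show "Q' (p + q) = Q' p + Q' q" for p q by (simp add: Q' distrib_left add algebra_simps)
    show "Q' (Cst c * p) = c * Q' p" for c p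
      by (simp add: Q' cst mult.left_commute[of "D x"] distrib_left)
    show "Q' (D i * D j * p) = 0" for i j p
      using nil[of i j p] nil[of i j "D x * p"] by (simp add: Q' mult.left_commute[of "D x"] mult.assoc)
  qed
  also have "Q' 1 = a x * Q 1 + b x * Q (D x)" by (simp add: Q')
  also have "(\<Sum>m\<in>K. b m * (\<Prod>k\<in>K - {m}. a k) * Q' (D m)) =
     (\<Sum>m\<in>K. b m * (\<Prod>k\<in>insert x K - {m}. a k) * Q (D m))"
  proof (intro sum.cong refl)
    fix m assume m: "m \<in> K"
    have "Q' (D m) = a x * Q (D m)" using nil[of x m 1] by (simp add: Q')
    moreover have "insert x K - {m} = insert x (K - {m})" using m insert.hyps by auto
    ultimately show "b m * (\<Prod>k\<in>K - {m}. a k) * Q' (D m) = b m * (\<Prod>k\<in>insert x K - {m}. a k) * Q (D m)"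
      using insert.hyps by simp
  qed
  finally show ?case using insert.hyps by (simp add: algebra_simps)
qed simp

lemma pm_scale_scale: "pm_scale p (pm_scale q u) = pm_scale (p * q) u" for p :: "'r::comm_ring_1"
  using module.scale_scale[OF module_pm_scale] .

lemma pm_scale_add: "pm_scale (p + q) u = pm_scale p u + pm_scale q u" for p :: "'r::comm_ring_1"
  using module.scale_left_distrib[OF module_pm_scale] .

lemma pm_scale_1: "pm_scale (1 :: 'r::comm_ring_1) u = u"
  using module.scale_one[OF module_pm_scale] .

lemma pm_scale_sum: "pm_scale (\<Sum>i\<in>I. p i) u = (\<Sum>i\<in>I. pm_scale (p i) u)" for p :: "'i \<Rightarrow> 'r::comm_ring_1"
  using module.scale_sum_left[OF module_pm_scale] .

lemma functional_prod:
  assumes \<phi>: "functional W \<phi>" and nil: "\<And>i j p. pm_scale (p * (D i * D j)) u \<in> W"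
  shows "\<phi> (pm_scale (\<Prod>k\<le>n. Cst (a k) + Cst (b k) * D k) u) =
     (\<Prod>k\<le>n. a k) * \<phi> u + (\<Sum>m\<le>n. b m * (\<Prod>k\<in>{..n} - {m}. a k) * \<phi> (pm_scale (D m) u))"
proof -
  have "\<phi> (pm_scale (\<Prod>k\<le>n. Cst (a k) + Cst (b k) * D k) u) =
     (\<Prod>k\<le>n. a k) * \<phi> (pm_scale 1 u) + (\<Sum>m\<le>n. b m * (\<Prod>k\<in>{..n} - {m}. a k) * \<phi> (pm_scale (D m) u))"
  proof (rule prod_truncated)
    show "\<phi> (pm_scale (p + q) u) = \<phi> (pm_scale p u) + \<phi> (pm_scale q u)" for p q
      by (simp add: pm_scale_add functional_add[OF \<phi>])
    show "\<phi> (pm_scale (Cst c * p) u) = c * \<phi> (pm_scale p u)" for c p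
      using functional_scale[OF \<phi>, of c "pm_scale p u"] by (simp add: cscale_def pm_scale_scale)
    show "\<phi> (pm_scale (D i * D j * p) u) = 0" for i j p
      using functional_rel[OF \<phi> nil[of p i j]] by (simp add: mult.commute)
  qed simp
  then show ?thesis by (simp add: pm_scale_1)
qed

section \<open>Gamma series in coordinates\<close>

context fan begin

lemma relH_base:
  "\<gamma> \<notin> Box S \<Longrightarrow> oneH \<gamma> \<in> relH n S"
  "p \<in> untwisted_ideal n S \<Longrightarrow> pm_scale p (oneH (0, 0)) \<in> relH n S"
  "\<gamma> \<in> Box S \<Longrightarrow> \<gamma> \<noteq> (0, 0) \<Longrightarrow> pm_scale (D k) (oneH \<gamma>) \<in> relH n S"
  unfolding relH_def
  subgoal by (rule module.span_base[OF module_pm_scale], rule UnI1, rule UnI1, rule CollectI, rule exI[of _ \<gamma>], intro conjI refl, assumption+)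
  subgoal by (rule module.span_base[OF module_pm_scale], rule UnI1, rule UnI2, rule CollectI, rule exI[of _ p], intro conjI refl, assumption+)
  subgoal by (rule module.span_base[OF module_pm_scale], rule UnI2, rule CollectI, rule exI[of _ k], rule exI[of _ \<gamma>], intro conjI refl, assumption+)
  done

lemma relH_scale: "w \<in> relH n S \<Longrightarrow> pm_scale p w \<in> relH n S"
  unfolding relH_def by (rule module.span_scale[OF module_pm_scale])

lemma relHc_base:
  "\<sigma> \<notin> gen_cones n S \<Longrightarrow> Fcone \<sigma> \<in> relHc n S"
  "\<gamma> \<notin> Box S - {(0, 0)} \<Longrightarrow> Ftw \<gamma> \<in> relHc n S"
  "p \<in> untwisted_ideal n S \<Longrightarrow> pm_scale p (Fcone \<sigma>) \<in> relHc n S"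
  "adjacent S i j \<Longrightarrow> j \<in> inner_rays n S \<Longrightarrow> pm_scale (D i) (Fcone {j}) - Fcone {i, j} \<in> relHc n S"
  "j \<in> inner_rays n S \<Longrightarrow> i \<noteq> j \<Longrightarrow> \<not> adjacent S i j \<Longrightarrow> pm_scale (D i) (Fcone {j}) \<in> relHc n S"
  "adjacent S i j \<Longrightarrow> pm_scale (D k) (Fcone {i, j}) \<in> relHc n S"
  "\<gamma> \<in> Box S \<Longrightarrow> \<gamma> \<noteq> (0, 0) \<Longrightarrow> pm_scale (D k) (Ftw \<gamma>) \<in> relHc n S"
  unfolding relHc_def
  subgoal by (rule module.span_base[OF module_pm_scale], rule UnI1, rule UnI1, rule UnI1, rule UnI1, rule UnI1, rule UnI1, rule CollectI, rule exI[of _ \<sigma>], intro conjI refl, assumption+)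
  subgoal by (rule module.span_base[OF module_pm_scale], rule UnI1, rule UnI1, rule UnI1, rule UnI1, rule UnI1, rule UnI2, rule CollectI, rule exI[of _ \<gamma>], intro conjI refl, assumption+)
  subgoal by (rule module.span_base[OF module_pm_scale], rule UnI1, rule UnI1, rule UnI1, rule UnI1, rule UnI2, rule CollectI, rule exI[of _ p], rule exI[of _ \<sigma>], intro conjI refl, assumption+)
  subgoal by (rule module.span_base[OF module_pm_scale], rule UnI1, rule UnI1, rule UnI1, rule UnI2, rule CollectI, rule exI[of _ i], rule exI[of _ j], intro conjI refl, assumption+)
  subgoal by (rule module.span_base[OF module_pm_scale], rule UnI1, rule UnI1, rule UnI2, rule CollectI, rule exI[of _ i], rule exI[of _ j], intro conjI refl, assumption+)
  subgoal by (rule module.span_base[OF module_pm_scale], rule UnI1, rule UnI2, rule CollectI, rule exI[of _ k], rule exI[of _ i], rule exI[of _ j], intro conjI refl, assumption+)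
  subgoal by (rule module.span_base[OF module_pm_scale], rule UnI2, rule CollectI, rule exI[of _ k], rule exI[of _ \<gamma>], intro conjI refl, assumption+)
  done

lemma relHc_scale: "w \<in> relHc n S \<Longrightarrow> pm_scale p w \<in> relHc n S"
  unfolding relHc_def by (rule module.span_scale[OF module_pm_scale])

lemma ideal_base:
  "i \<notin> S \<Longrightarrow> D i \<in> untwisted_ideal n S" "D i * D j \<in> untwisted_ideal n S"
  "(\<Sum>i\<le>n. D i) \<in> untwisted_ideal n S" "(\<Sum>i\<le>n. of_nat i * D i) \<in> untwisted_ideal n S"
  unfolding untwisted_ideal_def
  subgoal by (rule module.span_base[OF module_mult], rule UnI1, rule UnI1, rule UnI1, rule CollectI, rule exI[of _ i], intro conjI refl, assumption+)
  subgoal by (rule module.span_base[OF module_mult], rule UnI1, rule UnI1, rule UnI2, rule CollectI, rule exI[of _ i], rule exI[of _ j], rule conjI[OF refl TrueI])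
  subgoal by (rule module.span_base[OF module_mult], rule UnI1, rule UnI2, rule singletonI)
  subgoal by (rule module.span_base[OF module_mult], rule UnI2, rule singletonI)
  done

lemma ideal_scale: "p \<in> untwisted_ideal n S \<Longrightarrow> q * p \<in> untwisted_ideal n S"
  unfolding untwisted_ideal_def by (rule module.span_scale[OF module_mult])

text \<open>The class of the monomial in the \<open>D\<^sub>k\<close> given by \<open>M\<close>, in the sector \<open>\<gamma>\<close>.\<close>

definition eH :: "int \<times> int \<Rightarrow> nat multiset \<Rightarrow> freeH" where
  "eH \<gamma> M = pm_scale (\<Prod>k\<in>#M. D k) (oneH \<gamma>)"

text \<open>The class that the monomial of \<open>M\<close> yields in \<open>H\<^sup>c\<close>. In the untwisted sector one factor \<open>D\<^sub>k\<close> for each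
  \<open>k \<in> \<sigma> = set_mset M\<close> is spent on forming \<open>(\<Prod>\<^sub>k D\<^sub>k\<^sup>-\<^sup>1) F\<^sub>\<sigma>\<close>. This \<open>\<sigma>\<close> need not be the set of negative
  exponents of the term, but the relations \<open>D\<^sub>i F\<^sub>j = F\<^bsub>{i, j}\<^esub>\<close> make the two choices agree
  (\<open>functional_D_ray\<close>). Thus the generators are indexed by \<open>M\<close> alone, independently of \<open>l\<close>.\<close>

definition eC :: "int \<times> int \<Rightarrow> nat multiset \<Rightarrow> freeHc" where
  "eC \<gamma> M = (if \<gamma> = (0, 0) then pm_scale (\<Prod>k\<in>#M - mset_set (set_mset M). D k) (Fcone (set_mset M))
     else pm_scale (\<Prod>k\<in>#M. D k) (Ftw \<gamma>))"

text \<open>Monomials of degree at most 2 suffice: products of two \<open>D\<^sub>k\<close> vanish in \<open>H\<close>, and a larger \<open>M\<close> gives in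
  \<open>H\<^sup>c\<close> either \<open>F\<^sub>\<sigma>\<close> for a set \<open>\<sigma>\<close> of three or more indices, or a multiple of \<open>D\<^sub>k F\<^bsub>{i, j}\<^esub>\<close> or of
  \<open>D\<^sub>k\<^sup>2 F\<^sub>k\<close>, all of which vanish.\<close>

definition indices :: "nat multiset set" where
  "indices = {M. set_mset M \<subseteq> {..n} \<and> size M \<le> 2}"

lemma indices_eq: "indices = insert {#} ((\<lambda>m. {#m#}) ` {..n} \<union> (\<lambda>(i, j). {#i, j#}) ` ({..n} \<times> {..n}))"
proof
  show "indices \<subseteq> insert {#} ((\<lambda>m. {#m#}) ` {..n} \<union> (\<lambda>(i, j). {#i, j#}) ` ({..n} \<times> {..n}))"
  proof
    fix M assume M: "M \<in> indices"
    then have "size M \<le> 2" by (simp add: indices_def)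
    then have "size M = 0 \<or> size M = 1 \<or> size M = 2" by linarith
    then consider "size M = 0" | "size M = 1" | "size M = 2" by blast
    then show "M \<in> insert {#} ((\<lambda>m. {#m#}) ` {..n} \<union> (\<lambda>(i, j). {#i, j#}) ` ({..n} \<times> {..n}))"
    proof cases
      case 2
      then obtain m where "M = {#m#}" using size_1_singleton_mset by blast
      then show ?thesis using M by (auto simp: indices_def)
    next
      case 3
      then obtain i N where iN: "M = add_mset i N" using size_eq_Suc_imp_eq_union[of M 1] by auto
      then obtain j where "N = {#j#}" using 3 size_1_singleton_mset[of N] by auto
      then have "M = {#i, j#}" using iN by simp
      then show ?thesis using M by (auto simp: indices_def)
    qed simp
  qed
qed (auto simp: indices_def)

lemma finite_indices: "finite indices"
  unfolding indices_eq by simp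

lemma sum_indices_le1:
  fixes f :: "nat multiset \<Rightarrow> complex"
  assumes "\<And>i j. i \<le> n \<Longrightarrow> j \<le> n \<Longrightarrow> f {#i, j#} = 0"
  shows "(\<Sum>M\<in>indices. f M) = f {#} + (\<Sum>m\<le>n. f {#m#})"
proof -
  have "(\<Sum>M\<in>indices. f M) = (\<Sum>M\<in>insert {#} ((\<lambda>m. {#m#}) ` {..n}). f M)"
    unfolding indices_eq using assms by (intro sum.mono_neutral_right) auto
  also have "\<dots> = f {#} + (\<Sum>m\<le>n. f {#m#})"
    by (subst sum.insert) (auto simp: sum.reindex inj_on_def)
  finally show ?thesis .
qed

lemma eH_pair_rel:
  assumes "\<gamma> \<in> Box S" shows "pm_scale (p * (D i * D j)) (oneH \<gamma>) \<in> relH n S"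
proof (cases "\<gamma> = (0, 0)")
  case True
  then show ?thesis using relH_base(2)[OF ideal_scale[OF ideal_base(2)]] by simp
next
  case False
  from relH_scale[OF relH_base(3)[OF assms False, of j], of "p * D i"]
  show ?thesis by (simp add: pm_scale_scale mult.assoc)
qed

lemma jet_single:
  assumes "m \<le> n"
  shows "jet n (add_mset m M) y l = fps_nth (gamma_factor (y m) (l m)) (Suc (count M m)) *
     (\<Prod>k\<in>{..n} - {m}. fps_nth (gamma_factor (y k) (l k)) (count M k))"
  unfolding jet_def using assms by (subst prod.remove[of _ m]) (auto cong: prod.cong_simp)

text \<open>The monomials of degree 2 are included although they vanish in \<open>H\<close>, so that both series have
  coefficients over the same index set.\<close>

lemma functional_Gamma_term:
  assumes \<phi>: "functional (relH n S) \<phi>" and \<gamma>: "\<gamma> \<in> Box S"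
  shows "\<phi> (Gamma_term n y \<gamma> l) = (\<Sum>M\<in>indices. \<phi> (eH \<gamma> M) * jet n M y l)"
proof -
  define f where "f k = gamma_factor (y k) (l k)" for k
  have "\<phi> (Gamma_term n y \<gamma> l) = (\<Prod>k\<le>n. fps_nth (f k) 0) * \<phi> (oneH \<gamma>) +
      (\<Sum>m\<le>n. fps_nth (f m) 1 * (\<Prod>k\<in>{..n} - {m}. fps_nth (f k) 0) * \<phi> (pm_scale (D m) (oneH \<gamma>)))"
    unfolding Gamma_term_def fps_at_D_def f_def[symmetric] by (rule functional_prod[OF \<phi> eH_pair_rel[OF \<gamma>]])
  also have "\<dots> = \<phi> (eH \<gamma> {#}) * jet n {#} y l + (\<Sum>m\<le>n. \<phi> (eH \<gamma> {#m#}) * jet n {#m#} y l)"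
    by (simp add: eH_def pm_scale_1 jet_single f_def) (simp add: jet_def mult_ac)
  also have "\<dots> = (\<Sum>M\<in>indices. \<phi> (eH \<gamma> M) * jet n M y l)"
  proof (rule sum_indices_le1[symmetric])
    fix i j
    have "eH \<gamma> {#i, j#} \<in> relH n S" using eH_pair_rel[OF \<gamma>, of 1 i j] by (simp add: eH_def)
    then show "\<phi> (eH \<gamma> {#i, j#}) * jet n {#i, j#} y l = 0" using functional_rel[OF \<phi>] by simp
  qed
  finally show ?thesis .
qed

lemma adjacent_commute: "adjacent S i j \<longleftrightarrow> adjacent S j i"
  by (auto simp: adjacent_def min.commute max.commute)

lemma gen_cones_card: "\<sigma> \<in> gen_cones n S \<Longrightarrow> \<sigma> \<noteq> {} \<and> card \<sigma> \<le> 2"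
  unfolding gen_cones_def by (auto simp: card_insert_if)

lemma Fcone_pair_rel: "i \<noteq> j \<Longrightarrow> \<not> adjacent S i j \<Longrightarrow> Fcone {i, j} \<in> relHc n S"
proof (rule relHc_base(1))
  assume "i \<noteq> j" "\<not> adjacent S i j"
  then have "\<not> adjacent S j i" using adjacent_commute by blast
  with \<open>i \<noteq> j\<close> \<open>\<not> adjacent S i j\<close> show "{i, j} \<notin> gen_cones n S"
    by (auto simp: gen_cones_def doubleton_eq_iff)
qed

lemma Fcone_ray_rel: "k \<notin> inner_rays n S \<Longrightarrow> Fcone {k} \<in> relHc n S"
  by (rule relHc_base(1)) (auto simp: gen_cones_def adjacent_def)

lemma eC_pair: "i \<noteq> j \<Longrightarrow> eC (0, 0) {#i, j#} = Fcone {i, j}"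
  by (simp add: eC_def pm_scale_1)

lemma eC_square: "eC (0, 0) {#k, k#} = pm_scale (D k) (Fcone {k})"
  by (simp add: eC_def)

lemma eC_ray: "eC (0, 0) {#k#} = Fcone {k}"
  by (simp add: eC_def pm_scale_1)

text \<open>For \<open>m = k\<close> both sides are the same by definition. If \<open>m\<close> and \<open>k\<close> are adjacent this is the relation between
  \<open>F\<^sub>k\<close> and \<open>F\<^bsub>{m, k}\<^esub>\<close>, and if not, both sides are zero. It fails for the boundary rays \<open>k = 0\<close> and \<open>k = n\<close>, where the left side is zero and the right side need not be.\<close>

lemma functional_D_ray:
  assumes \<psi>: "functional (relHc n S) \<psi>" and k: "k \<in> inner_rays n S \<or> k \<notin> S"
  shows "\<psi> (pm_scale (D m) (Fcone {k})) = \<psi> (eC (0, 0) {#m, k#})"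
proof (cases "m = k")
  case True then show ?thesis by (simp add: eC_square)
next
  case False
  show ?thesis
  proof (cases "k \<in> inner_rays n S")
    case True
    show ?thesis
    proof (cases "adjacent S m k")
      case True
      from functional_diff_rel[OF \<psi> relHc_base(4)[OF this \<open>k \<in> inner_rays n S\<close>]] show ?thesis
        by (simp add: eC_pair[OF False])
    next
      case nadj: False
      from relHc_base(5)[OF True False nadj] Fcone_pair_rel[OF False nadj] show ?thesis
        by (simp add: eC_pair[OF False] functional_rel[OF \<psi>])
    qed
  next
    case nin: False
    then have "\<not> adjacent S m k" using k by (auto simp: adjacent_def)
    then show ?thesis
      using relHc_scale[OF Fcone_ray_rel[OF nin]] Fcone_pair_rel[OF False]
      by (simp add: eC_pair[OF False] functional_rel[OF \<psi>])
  qed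
qed

text \<open>If no exponent or only that of one boundary ray were negative, the moments would force \<open>d\<close> out of the
  interior of the cone. This is where the interior is needed for \<open>\<Gamma>\<degree>\<close>: by this fact the
  generators \<open>F\<^sub>0\<close>, \<open>F\<^sub>n\<close> and \<open>F\<^sub>\<emptyset>\<close> do not occur.\<close>

lemma neg_set_interior:
  assumes d: "0 < fst d" "fst d < int n * snd d" and l: "l \<in> Lset n S d \<gamma>" and int: "\<And>k. k \<le> n \<Longrightarrow> l k \<in> \<int>"
  shows "neg_set n l \<noteq> {}" "neg_set n l \<noteq> {0}" "neg_set n l \<noteq> {n}"
proof -
  have nn: "0 \<le> l k" if "k \<le> n" "k \<notin> neg_set n l" for k
    using that int[OF that(1)] by (auto simp: neg_set_def)
  have d0: "0 < snd d"
  proof (rule ccontr)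
    assume "\<not> 0 < snd d"
    then have "int n * snd d \<le> 0" by (simp add: mult_nonneg_nonpos)
    then show False using d by simp
  qed
  note sums = Lset_sums(1,2)[OF l]
  show "neg_set n l \<noteq> {}"
  proof
    assume "neg_set n l = {}"
    then have "0 \<le> (\<Sum>k\<le>n. l k)" using nn by (intro sum_nonneg) auto
    then show False using sums(1) d0 by simp
  qed
  show "neg_set n l \<noteq> {0}"
  proof
    assume "neg_set n l = {0}"
    then have "0 \<le> l k * of_nat k" if "k \<le> n" for k using nn[OF that] by (cases "k = 0") auto
    then have "0 \<le> (\<Sum>k\<le>n. l k * of_nat k)" by (intro sum_nonneg) auto
    then show False using sums(2) d by simp
  qed
  show "neg_set n l \<noteq> {n}"
  proof
    assume "neg_set n l = {n}"
    then have "0 \<le> l k * (of_nat n - of_nat k)" if "k \<le> n" for k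
      using nn[OF that] that by (cases "k = n") (auto intro!: mult_nonneg_nonneg)
    then have "0 \<le> (\<Sum>k\<le>n. l k * (of_nat n - of_nat k))" by (intro sum_nonneg) auto
    also have "\<dots> = of_nat n * (\<Sum>k\<le>n. l k) - (\<Sum>k\<le>n. l k * of_nat k)"
      by (simp add: sum_distrib_left sum_subtractf[symmetric] algebra_simps)
    also have "\<dots> = of_int (fst d - int n * snd d)" unfolding sums by simp
    finally have "0 \<le> fst d - int n * snd d" by (simp only: of_int_0_le_iff)
    then show False using d by linarith
  qed
qed

lemma jet_neg_set: "jet n M y l \<noteq> 0 \<Longrightarrow> neg_set n l \<subseteq> set_mset M"
proof
  fix k assume jet: "jet n M y l \<noteq> 0" and k: "k \<in> neg_set n l"
  then have k': "k \<le> n" "l k \<in> \<int>" "l k < 0" by (auto simp: neg_set_def)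
  show "k \<in># M"
  proof (rule ccontr)
    assume "k \<notin># M"
    then have "fps_nth (gamma_factor (y k) (l k)) (count M k) = 0"
      using gamma_factor_neg_int[OF k'(2,3)] by (simp add: not_in_iff)
    then have "jet n M y l = 0" unfolding jet_def using k'(1) by (intro prod_zero) auto
    then show False using jet by simp
  qed
qed

lemma Lset_untwisted_int: "l \<in> Lset n S d (0, 0) \<Longrightarrow> k \<le> n \<Longrightarrow> l k \<in> \<int>"
  by (force simp: Lset_def box_coord_def)

lemma sum_indices_containing:
  fixes f :: "nat multiset \<Rightarrow> complex"
  assumes f: "\<And>M. k \<notin># M \<Longrightarrow> f M = 0" and k: "k \<le> n"
  shows "(\<Sum>M\<in>indices. f M) = f {#k#} + (\<Sum>m\<le>n. f {#m, k#})"
proof -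
  have "(\<Sum>M\<in>indices. f M) = (\<Sum>M\<in>insert {#k#} ((\<lambda>m. {#m, k#}) ` {..n}). f M)"
  proof (rule sum.mono_neutral_right)
    show "insert {#k#} ((\<lambda>m. {#m, k#}) ` {..n}) \<subseteq> indices" using k by (auto simp: indices_def)
    show "\<forall>M\<in>indices - insert {#k#} ((\<lambda>m. {#m, k#}) ` {..n}). f M = 0"
    proof
      fix M assume M: "M \<in> indices - insert {#k#} ((\<lambda>m. {#m, k#}) ` {..n})"
      show "f M = 0"
      proof (rule f, rule notI)
        assume "k \<in># M"
        then obtain N where N: "M = add_mset k N" by (meson multi_member_split)
        have "size N \<le> 1" "set_mset N \<subseteq> {..n}" using M by (auto simp: N indices_def)
        then consider "N = {#}" | m where "N = {#m#}" "m \<le> n"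
          using size_1_singleton_mset[of N] by (cases "size N = 0") (auto simp: le_Suc_eq)
        then show False using M by cases (auto simp: N add_mset_commute)
      qed
    qed
  qed (rule finite_indices)
  also have "\<dots> = f {#k#} + (\<Sum>M\<in>(\<lambda>m. {#m, k#}) ` {..n}. f M)"
    by (rule sum.insert) auto
  also have "(\<Sum>M\<in>(\<lambda>m. {#m, k#}) ` {..n}. f M) = (\<Sum>m\<le>n. f {#m, k#})"
    by (subst sum.reindex) (auto simp: inj_on_def)
  finally show ?thesis .
qed

lemma functional_Gammao_twisted:
  assumes \<psi>: "functional (relHc n S) \<psi>" and \<gamma>: "\<gamma> \<in> Box S" "\<gamma> \<noteq> (0, 0)"
  shows "\<psi> (Gammao_term n y \<gamma> l) = (\<Sum>M\<in>indices. \<psi> (eC \<gamma> M) * jet n M y l)"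
proof -
  have nil: "\<psi> (pm_scale (p * D m) (Ftw \<gamma>)) = 0" for p m
    using functional_rel[OF \<psi> relHc_scale[OF relHc_base(7)[OF \<gamma>]], of p m] by (simp add: pm_scale_scale)
  have "(\<Sum>M\<in>indices. \<psi> (eC \<gamma> M) * jet n M y l) =
     \<psi> (eC \<gamma> {#}) * jet n {#} y l + (\<Sum>m\<le>n. \<psi> (eC \<gamma> {#m#}) * jet n {#m#} y l)"
    by (rule sum_indices_le1) (use \<gamma>(2) nil in \<open>simp add: eC_def\<close>)
  also have "\<dots> = \<psi> (Ftw \<gamma>) * jet n {#} y l"
    using \<gamma>(2) nil[of 1] by (simp add: eC_def pm_scale_1)
  finally have R: "(\<Sum>M\<in>indices. \<psi> (eC \<gamma> M) * jet n M y l) = \<psi> (Ftw \<gamma>) * jet n {#} y l" .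
  show ?thesis
  proof (cases "neg_set n l = {}")
    case True
    have "\<psi> (Gammao_term n y \<gamma> l) = \<psi> (pm_scale (\<Prod>k\<le>n. Cst (fps_nth (gamma_factor (y k) (l k)) 0) + Cst (fps_nth (gamma_factor (y k) (l k)) 1) * D k) (Ftw \<gamma>))"
      using \<gamma>(2) by (simp add: Gammao_term_def F_sector_def True fps_at_D_def)
    also have "\<dots> = jet n {#} y l * \<psi> (Ftw \<gamma>)"
    proof (subst functional_prod[OF \<psi>])
      show "pm_scale (p * (D i * D j)) (Ftw \<gamma>) \<in> relHc n S" for i j p
        using relHc_scale[OF relHc_base(7)[OF \<gamma>], of "p * D i" j] by (simp add: pm_scale_scale mult.assoc)
      show "(\<Prod>k\<le>n. fps_nth (gamma_factor (y k) (l k)) 0) * \<psi> (Ftw \<gamma>) +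
        (\<Sum>m\<le>n. fps_nth (gamma_factor (y m) (l m)) 1 * (\<Prod>k\<in>{..n} - {m}. fps_nth (gamma_factor (y k) (l k)) 0) * \<psi> (pm_scale (D m) (Ftw \<gamma>)))
        = jet n {#} y l * \<psi> (Ftw \<gamma>)"
        using nil[of 1] by (simp add: jet_def)
    qed
    finally show ?thesis unfolding R by (simp add: mult.commute)
  next
    case False
    then have "jet n {#} y l = 0" using jet_neg_set[of "{#}" y l] by auto
    moreover have "Gammao_term n y \<gamma> l = pm_scale (\<Prod>k\<le>n. fps_at_D k (if k \<in> neg_set n l then fps_shift 1 (gamma_factor (y k) (l k)) else gamma_factor (y k) (l k))) 0"
      using False \<gamma>(2) by (simp add: Gammao_term_def F_sector_def)
    then have "Gammao_term n y \<gamma> l = 0" by (simp only: module.scale_zero_right[OF module_pm_scale])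
    ultimately show ?thesis unfolding R using functional_zero[OF \<psi>] by simp
  qed
qed

text \<open>The set \<open>\<sigma>\<close> of negative exponents is a single index other than 0 and \<open>n\<close>, a pair, or larger. In the first
  case \<open>functional_D_ray\<close> identifies the linear terms, in the second the linear terms vanish, and in the last one both
  sides are zero.\<close>

lemma functional_Gammao_untwisted:
  assumes \<psi>: "functional (relHc n S) \<psi>" and d: "0 < fst d" "fst d < int n * snd d" and l: "l \<in> Lset n S d (0, 0)"
  shows "\<psi> (Gammao_term n y (0, 0) l) = (\<Sum>M\<in>indices. \<psi> (eC (0, 0) M) * jet n M y l)"
proof -
  define \<sigma> where "\<sigma> = neg_set n l"
  have fin: "finite \<sigma>" "\<sigma> \<subseteq> {..n}" unfolding \<sigma>_def neg_set_def by auto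
  note neg = neg_set_interior[OF d l Lset_untwisted_int[OF l], folded \<sigma>_def]
  define N where "N = mset_set \<sigma>"
  define g where "g k = (if k \<in> \<sigma> then fps_shift 1 (gamma_factor (y k) (l k)) else gamma_factor (y k) (l k))" for k
  have g: "fps_nth (g k) 0 = fps_nth (gamma_factor (y k) (l k)) (count N k)"
    "fps_nth (g k) 1 = fps_nth (gamma_factor (y k) (l k)) (Suc (count N k))" for k
    using fin(1) by (auto simp: g_def N_def count_mset_set' numeral_2_eq_2)
  have L: "\<psi> (Gammao_term n y (0, 0) l) = jet n N y l * \<psi> (Fcone \<sigma>) +
      (\<Sum>m\<le>n. jet n (add_mset m N) y l * \<psi> (pm_scale (D m) (Fcone \<sigma>)))"
  proof -
    have "\<psi> (Gammao_term n y (0, 0) l) = \<psi> (pm_scale (\<Prod>k\<le>n. Cst (fps_nth (g k) 0) + Cst (fps_nth (g k) 1) * D k) (Fcone \<sigma>))"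
      by (simp add: Gammao_term_def F_sector_def g_def \<sigma>_def fps_at_D_def)
    also have "\<dots> = (\<Prod>k\<le>n. fps_nth (g k) 0) * \<psi> (Fcone \<sigma>) +
       (\<Sum>m\<le>n. fps_nth (g m) 1 * (\<Prod>k\<in>{..n} - {m}. fps_nth (g k) 0) * \<psi> (pm_scale (D m) (Fcone \<sigma>)))"
      by (rule functional_prod[OF \<psi>]) (rule relHc_base(3)[OF ideal_scale[OF ideal_base(2)]])
    also have "\<dots> = jet n N y l * \<psi> (Fcone \<sigma>) + (\<Sum>m\<le>n. jet n (add_mset m N) y l * \<psi> (pm_scale (D m) (Fcone \<sigma>)))"
      unfolding g by (simp add: jet_single) (simp add: jet_def)
    finally show ?thesis .
  qed
  have jet0: "jet n M y l = 0" if "\<not> \<sigma> \<subseteq> set_mset M" for M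
    using jet_neg_set[of M y l] that unfolding \<sigma>_def by blast
  consider k where "\<sigma> = {k}" | i j where "\<sigma> = {i, j}" "i \<noteq> j" | "card \<sigma> \<ge> 3"
  proof -
    have "card \<sigma> \<noteq> 0" using fin(1) neg(1) by simp
    then consider "card \<sigma> = 1" | "card \<sigma> = 2" | "card \<sigma> \<ge> 3" by linarith
    then show ?thesis
    proof cases
      case 1 then show ?thesis using that(1) card_1_singletonE by metis
    next
      case 2 then show ?thesis using that(2) card_2_iff by metis
    qed (rule that(3))
  qed
  then show ?thesis
  proof cases
    case (1 k)
    have k: "k \<in> inner_rays n S \<or> k \<notin> S" using neg(2,3) 1 by (auto simp: inner_rays_def)
    have kn: "k \<le> n" using 1 fin by auto
    have "(\<Sum>M\<in>indices. \<psi> (eC (0, 0) M) * jet n M y l) = \<psi> (eC (0, 0) {#k#}) * jet n {#k#} y l +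
       (\<Sum>m\<le>n. \<psi> (eC (0, 0) {#m, k#}) * jet n {#m, k#} y l)"
      by (rule sum_indices_containing[OF _ kn]) (simp add: jet0 1)
    then show ?thesis unfolding L by (simp add: N_def 1 eC_ray functional_D_ray[OF \<psi> k] mult.commute)
  next
    case (2 i j)
    have ij: "i \<le> n" "j \<le> n" using 2 fin by auto
    have D0: "\<psi> (pm_scale (D m) (Fcone \<sigma>)) = 0" for m
    proof (rule functional_rel[OF \<psi>])
      show "pm_scale (D m) (Fcone \<sigma>) \<in> relHc n S"
        unfolding 2(1)
      proof (cases "adjacent S i j")
        case True then show "pm_scale (D m) (Fcone {i, j}) \<in> relHc n S" by (rule relHc_base(6))
      next
        case False then show "pm_scale (D m) (Fcone {i, j}) \<in> relHc n S" by (intro relHc_scale Fcone_pair_rel 2(2))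
      qed
    qed
    have "(\<Sum>M\<in>indices. \<psi> (eC (0, 0) M) * jet n M y l) = (\<Sum>M\<in>{{#i, j#}}. \<psi> (eC (0, 0) M) * jet n M y l)"
    proof (rule sum.mono_neutral_right[OF finite_indices])
      show "{{#i, j#}} \<subseteq> indices" using ij by (auto simp: indices_def)
      show "\<forall>M\<in>indices - {{#i, j#}}. \<psi> (eC (0, 0) M) * jet n M y l = 0"
      proof
        fix M assume M: "M \<in> indices - {{#i, j#}}"
        have "\<not> \<sigma> \<subseteq> set_mset M"
        proof
          assume "\<sigma> \<subseteq> set_mset M"
          then have "i \<in># M" "j \<in># M" using 2 by auto
          then obtain N where N: "M = add_mset i N" by (meson multi_member_split)
          then have "j \<in># N" using \<open>j \<in># M\<close> 2(2) by auto
          then obtain N' where N': "N = add_mset j N'" by (meson multi_member_split)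
          have "size M \<le> 2" using M by (simp add: indices_def)
          then have "N' = {#}" by (simp add: N N')
          then show False using M by (simp add: N N')
        qed
        then show "\<psi> (eC (0, 0) M) * jet n M y l = 0" by (simp add: jet0)
      qed
    qed
    also have "\<dots> = \<psi> (Fcone \<sigma>) * jet n N y l"
      using 2 by (simp add: eC_pair N_def)
    finally show ?thesis unfolding L D0 by (simp add: mult.commute)
  next
    case 3
    have rel: "Fcone \<sigma> \<in> relHc n S" by (rule relHc_base(1)) (use gen_cones_card[of \<sigma>] 3 in auto)
    have "\<psi> (Fcone \<sigma>) = 0" "\<psi> (pm_scale (D m) (Fcone \<sigma>)) = 0" for m
      using functional_rel[OF \<psi> rel] functional_rel[OF \<psi> relHc_scale[OF rel]] by simp_all
    moreover have "\<not> \<sigma> \<subseteq> set_mset M" if "M \<in> indices" for M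
    proof
      assume "\<sigma> \<subseteq> set_mset M"
      then have "card \<sigma> \<le> card (set_mset M)" by (intro card_mono) auto
      also have "\<dots> \<le> size M"
        unfolding size_multiset_overloaded_eq using sum_mono[of "set_mset M" "\<lambda>_. 1" "count M"] by simp
      also have "\<dots> \<le> 2" using that by (simp add: indices_def)
      finally show False using 3 by simp
    qed
    then have "(\<Sum>M\<in>indices. \<psi> (eC (0, 0) M) * jet n M y l) = 0"
      by (intro sum.neutral ballI) (simp add: jet0)
    ultimately show ?thesis unfolding L by simp
  qed
qed

lemma functional_Gammao_term:
  assumes "functional (relHc n S) \<psi>" "0 < fst d" "fst d < int n * snd d" "\<gamma> \<in> Box S" "l \<in> Lset n S d \<gamma>"
  shows "\<psi> (Gammao_term n y \<gamma> l) = (\<Sum>M\<in>indices. \<psi> (eC \<gamma> M) * jet n M y l)"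
  using functional_Gammao_twisted[OF assms(1,4)] functional_Gammao_untwisted[OF assms(1-3)] assms(5)
  by (cases "\<gamma> = (0, 0)") auto

section \<open>Twisted sectors and adjacent rays\<close>

text \<open>The coefficients of \<open>(k, 1)\<close> in terms of \<open>v\<^sub>i\<close> and \<open>v\<^sub>j\<close>.\<close>

definition bary :: "nat \<Rightarrow> nat \<Rightarrow> nat \<Rightarrow> nat \<Rightarrow> rat" where
  "bary i j k = (\<lambda>m. if m = i then of_nat (j - k) / of_nat (j - i) else if m = j then of_nat (k - i) / of_nat (j - i) else 0)"

lemma twistedD:
  assumes "twisted S \<gamma> i j g"
  shows "\<exists>k. i < k \<and> k < j \<and> adjacent S i j \<and> \<gamma> = (int k, 1) \<and> g = bary i j k"
proof -
  have t: "i < j" "adjacent S i j" "0 < g i" "g i < 1" "0 < g j" "g j < 1" "\<And>k. k \<noteq> i \<Longrightarrow> k \<noteq> j \<Longrightarrow> g k = 0"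
    "of_int (fst \<gamma>) = g i * of_nat i + g j * of_nat j" "of_int (snd \<gamma>) = g i + g j"
    using assms by (auto simp: twisted_def vlat_def)
  have "(0 :: rat) < of_int (snd \<gamma>)" "of_int (snd \<gamma>) < (2 :: rat)" unfolding t(9) using t by linarith+
  then have s1: "snd \<gamma> = 1" by simp
  then have gi: "g i = 1 - g j" using t(9) by simp
  have f: "of_int (fst \<gamma>) = of_nat i + g j * (of_nat j - of_nat i)"
    unfolding t(8) gi by (simp add: algebra_simps)
  have pos: "(0 :: rat) < of_nat j - of_nat i" using t(1) by simp
  have "g j * (of_nat j - of_nat i) < 1 * (of_nat j - of_nat i)" using t(6) pos by (rule mult_strict_right_mono)
  then have "of_int (int i) < (of_int (fst \<gamma>) :: rat)" "(of_int (fst \<gamma>) :: rat) < of_int (int j)"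
    unfolding f using mult_pos_pos[OF t(5) pos] by auto
  then have b: "int i < fst \<gamma>" "fst \<gamma> < int j" by (simp_all only: of_int_less_iff)
  define k where "k = nat (fst \<gamma>)"
  have k: "fst \<gamma> = int k" "i < k" "k < j" using b by (auto simp: k_def)
  have gj: "g j = of_nat (k - i) / of_nat (j - i)"
    using f pos k t(1) by (simp add: of_nat_diff field_simps)
  have gi': "g i = of_nat (j - k) / of_nat (j - i)"
    unfolding gi gj using k t(1) by (simp add: of_nat_diff field_simps)
  have "g = bary i j k"
    using gi' gj t(1,7) by (auto simp: bary_def)
  then show ?thesis using k t s1 by (intro exI[of _ k]) (auto simp: prod_eq_iff)
qed

lemma bary_sums:
  assumes "i < k" "k < j"
  shows "bary i j k i + bary i j k j = 1" "bary i j k i * of_nat i + bary i j k j * of_nat j = of_nat k"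
proof -
  have d: "(of_nat (j - i) :: rat) \<noteq> 0" "i \<noteq> j" using assms by auto
  have "(of_nat (j - k) + of_nat (k - i) :: rat) = of_nat (j - i)"
    "(of_nat (j - k) * of_nat i + of_nat (k - i) * of_nat j :: rat) = of_nat k * of_nat (j - i)"
    using assms by (simp_all add: of_nat_diff algebra_simps)
  then show "bary i j k i + bary i j k j = 1" "bary i j k i * of_nat i + bary i j k j * of_nat j = of_nat k"
    using d by (simp_all add: bary_def add_divide_distrib[symmetric])
qed

lemma bary_bounds:
  assumes "i < k" "k < j"
  shows "0 < bary i j k i" "bary i j k i < 1" "0 < bary i j k j" "bary i j k j < 1"
  using assms by (auto simp: bary_def divide_less_eq)

lemma twisted_bary:
  assumes "adjacent S i j" "i < k" "k < j"
  shows "twisted S (int k, 1) i j (bary i j k)"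
proof -
  have "m \<noteq> i \<Longrightarrow> m \<noteq> j \<Longrightarrow> bary i j k m = 0" for m by (simp add: bary_def)
  then show ?thesis
    using assms bary_sums[OF assms(2,3)] bary_bounds[OF assms(2,3)] unfolding twisted_def vlat_def by simp
qed

lemma bracket_unique:
  assumes "adjacent S i j" "i < k" "k < j" "adjacent S i' j'" "i' < k" "k < j'"
  shows "i = i'" "j = j'"
proof -
  have ij: "i \<in> S" "j \<in> S" "\<And>m. m \<in> S \<Longrightarrow> \<not> (i < m \<and> m < j)"
    using assms(1-3) unfolding adjacent_def by (auto simp: min_def max_def split: if_splits)
  have ij': "i' \<in> S" "j' \<in> S" "\<And>m. m \<in> S \<Longrightarrow> \<not> (i' < m \<and> m < j')"
    using assms(4-6) unfolding adjacent_def by (auto simp: min_def max_def split: if_splits)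
  show "i = i'" using ij(3)[OF ij'(1)] ij'(3)[OF ij(1)] assms by linarith
  show "j = j'" using ij(3)[OF ij'(2)] ij'(3)[OF ij(2)] assms by linarith
qed

lemma next_ray:
  assumes "k < n" shows "\<exists>j\<in>S. k < j \<and> (\<forall>m\<in>S. k < m \<longrightarrow> j \<le> m)"
proof -
  have fin: "finite {s \<in> S. k < s}" by (rule finite_subset[of _ "{0..n}"]) (use S_sub in auto)
  have ne: "{s \<in> S. k < s} \<noteq> {}" using n_S assms by auto
  show ?thesis using Min_in[OF fin ne] Min_le[OF fin] by (intro bexI[of _ "Min {s \<in> S. k < s}"]) auto
qed

lemma prev_ray:
  assumes "0 < k" shows "\<exists>i\<in>S. i < k \<and> (\<forall>m\<in>S. m < k \<longrightarrow> m \<le> i)"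
proof -
  have fin: "finite {s \<in> S. s < k}" by (rule finite_subset[of _ "{0..n}"]) (use S_sub in auto)
  have ne: "{s \<in> S. s < k} \<noteq> {}" using zero_S assms by auto
  show ?thesis using Max_in[OF fin ne] Max_ge[OF fin] by (intro bexI[of _ "Max {s \<in> S. s < k}"]) auto
qed

lemma adjacentI:
  "i \<in> S \<Longrightarrow> j \<in> S \<Longrightarrow> i < j \<Longrightarrow> (\<And>m. m \<in> S \<Longrightarrow> i < m \<Longrightarrow> m < j \<Longrightarrow> False) \<Longrightarrow> adjacent S i j"
  unfolding adjacent_def by auto

lemma bracket_exists:
  assumes "k \<le> n" "k \<notin> S" shows "\<exists>i j. i < k \<and> k < j \<and> adjacent S i j"
proof -
  have "0 < k" "k < n" using assms zero_S n_S by (metis gr0I, metis le_neq_implies_less)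
  obtain i where i: "i \<in> S" "i < k" "\<forall>m\<in>S. m < k \<longrightarrow> m \<le> i" using prev_ray[OF \<open>0 < k\<close>] by blast
  obtain j where j: "j \<in> S" "k < j" "\<forall>m\<in>S. k < m \<longrightarrow> j \<le> m" using next_ray[OF \<open>k < n\<close>] by blast
  have "adjacent S i j"
  proof (rule adjacentI[OF i(1) j(1)])
    fix m assume m: "m \<in> S" "i < m" "m < j"
    then have "m \<noteq> k" using assms(2) by auto
    then show False using i(3) j(3) m by (meson linorder_neqE_nat not_le)
  qed (use i j in simp)
  then show ?thesis using i j by blast
qed

lemma adjacent_at:
  assumes "m \<in> S" shows "\<exists>i j. i < j \<and> adjacent S i j \<and> (m = i \<or> m = j)"
proof (cases "m < n")
  case True
  then obtain j where j: "j \<in> S" "m < j" "\<forall>s\<in>S. m < s \<longrightarrow> j \<le> s" using next_ray by blast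
  have "adjacent S m j" by (rule adjacentI[OF assms j(1,2)]) (use j(3) in fastforce)
  then show ?thesis using j by blast
next
  case False
  then have "0 < m" using n_pos by linarith
  then obtain i where i: "i \<in> S" "i < m" "\<forall>s\<in>S. s < m \<longrightarrow> s \<le> i" using prev_ray by blast
  have "adjacent S i m" by (rule adjacentI[OF i(1) assms i(2)]) (use i(3) in fastforce)
  then show ?thesis using i by blast
qed

text \<open>The twisted sectors are the lattice points \<open>(k, 1)\<close> between adjacent rays, that is, those with \<open>k \<notin> S\<close>.\<close>

lemma Box_eq: "Box S = insert ((0, 0) :: int \<times> int) ((\<lambda>k. (int k, 1 :: int)) ` ({..n} - S))"
proof
  show "Box S \<subseteq> insert ((0, 0) :: int \<times> int) ((\<lambda>k. (int k, 1 :: int)) ` ({..n} - S))"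
  proof
    fix \<gamma> assume "\<gamma> \<in> Box S"
    then consider "\<gamma> = (0, 0)" | i j g where "twisted S \<gamma> i j g" by (auto simp: Box_def)
    then show "\<gamma> \<in> insert ((0, 0) :: int \<times> int) ((\<lambda>k. (int k, 1 :: int)) ` ({..n} - S))"
    proof cases
      case 2
      from twistedD[OF this] obtain k where k: "i < k" "k < j" "adjacent S i j" "\<gamma> = (int k, 1)" by blast
      then have "k \<notin> S" "k \<le> n" using adjacentD[OF k(3)] unfolding adjacent_def by (auto simp: min_def max_def)
      then show ?thesis using k by auto
    qed simp
  qed
  show "insert ((0, 0) :: int \<times> int) ((\<lambda>k. (int k, 1 :: int)) ` ({..n} - S)) \<subseteq> Box S"
  proof
    fix \<gamma> assume "\<gamma> \<in> insert ((0, 0) :: int \<times> int) ((\<lambda>k. (int k, 1 :: int)) ` ({..n} - S))"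
    then consider "\<gamma> = (0, 0)" | k where "k \<le> n" "k \<notin> S" "\<gamma> = (int k, 1)" by auto
    then show "\<gamma> \<in> Box S"
    proof cases
      case (2 k)
      then obtain i j where "i < k" "k < j" "adjacent S i j" using bracket_exists by blast
      from twisted_bary[OF this(3,1,2)] show ?thesis unfolding Box_def 2(3) by blast
    qed (simp add: Box_def)
  qed
qed

lemma finite_Box: "finite (Box S)"
  unfolding Box_eq by simp

lemma sector_data:
  assumes ij: "adjacent S i j" "i < k" "k < j"
  shows "box_coord S (int k, 1) = bary i j k" "sector_cone S (int k, 1) = (i, j)"
    "box_dual S (int k, 1) = (int (i + j - k), 1)"
proof -
  note tw = twisted_bary[OF ij]
  have uniq: "i' = i \<and> j' = j \<and> g = bary i j k" if "twisted S (int k, 1) i' j' g" for i' j' g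
  proof -
    from twistedD[OF that] have k: "i' < k" "k < j'" "adjacent S i' j'" "g = bary i' j' k" by auto
    then show ?thesis using bracket_unique[OF ij k(3,1,2)] by simp
  qed
  have "(THE g. \<exists>i j. twisted S (int k, 1) i j g) = bary i j k"
  proof (rule the_equality)
    show "\<exists>i' j'. twisted S (int k, 1) i' j' (bary i j k)" by (rule exI[of _ i], rule exI[of _ j], rule tw)
    fix g assume "\<exists>i j. twisted S (int k, 1) i j g"
    then obtain i' j' where "twisted S (int k, 1) i' j' g" by (elim exE)
    from uniq[OF this] show "g = bary i j k" by (elim conjE)
  qed
  then show bc: "box_coord S (int k, 1) = bary i j k" by (simp add: box_coord_def)
  show sc: "sector_cone S (int k, 1) = (i, j)"
    unfolding sector_cone_def
  proof (rule the_equality)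
    show "case (i, j) of (i, j) \<Rightarrow> \<exists>g. twisted S (int k, 1) i j g" unfolding prod.case by (rule exI, rule tw)
    fix p :: "nat \<times> nat" assume p: "case p of (i, j) \<Rightarrow> \<exists>g. twisted S (int k, 1) i j g"
    obtain i' j' where [simp]: "p = (i', j')" by (cases p)
    from p obtain g where "twisted S (int k, 1) i' j' g" unfolding \<open>p = (i', j')\<close> prod.case by (elim exE)
    from uniq[OF this] show "p = (i, j)" by simp
  qed
  have b: "(1 - bary i j k i) + (1 - bary i j k j) = 1" "(1 - bary i j k i) * of_nat i + (1 - bary i j k j) * of_nat j = of_nat (i + j - k)"
  proof -
    note bs = bary_sums[OF ij(2,3)]
    show "(1 - bary i j k i) + (1 - bary i j k j) = 1" using bs(1) by linarith
    have "(1 - bary i j k i) * of_nat i + (1 - bary i j k j) * of_nat j =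
       of_nat i + of_nat j - (bary i j k i * of_nat i + bary i j k j * of_nat j)"
      by (simp add: algebra_simps)
    also have "\<dots> = of_nat (i + j - k)" unfolding bs(2) using ij by (simp add: of_nat_diff)
    finally show "(1 - bary i j k i) * of_nat i + (1 - bary i j k j) * of_nat j = of_nat (i + j - k)" .
  qed
  show "box_dual S (int k, 1) = (int (i + j - k), 1)"
    unfolding box_dual_def sc bc prod.case vlat_def fst_conv snd_conv
  proof (rule the_equality)
    fix \<delta> :: "int \<times> int"
    assume a: "of_int (fst \<delta>) = (1 - bary i j k i) * of_int (int i) + (1 - bary i j k j) * of_int (int j) \<and>
       of_int (snd \<delta>) = (1 - bary i j k i) * of_int 1 + (1 - bary i j k j) * of_int 1"
    then have "(of_int (fst \<delta>) :: rat) = of_int (int (i + j - k))" "(of_int (snd \<delta>) :: rat) = of_int 1"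
      using b by auto
    then show "\<delta> = (int (i + j - k), 1)" by (simp only: of_int_eq_iff) (simp add: prod_eq_iff)
  qed (use b in simp)
qed

lemma admissible_untwisted:
  assumes "i < j" "adjacent S i j" "set_mset M \<subseteq> {i, j}" shows "admissible i j (0, 0) M"
  using assms by (simp add: admissible_def box_coord_def)

lemma admissible_twisted:
  assumes "adjacent S i j" "i < k" "k < j" shows "admissible i j (int k, 1) {#}"
  using assms sector_data(1)[OF assms] by (auto simp: admissible_def bary_def off_def)

lemma twisted_admissible_exists:
  assumes "\<gamma> \<in> Box S" "\<gamma> \<noteq> (0, 0)" shows "\<exists>i j. admissible i j \<gamma> {#}"
proof -
  obtain k where k: "k \<le> n" "k \<notin> S" "\<gamma> = (int k, 1)" using assms unfolding Box_eq by auto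
  obtain i j where "i < k" "k < j" "adjacent S i j" using bracket_exists[OF k(1,2)] by (elim exE conjE)
  from admissible_twisted[OF this(3,1,2)] show ?thesis unfolding k(3) by (intro exI)
qed

lemma admissible_ray:
  assumes "m \<in> S" "set_mset M \<subseteq> {m}" shows "\<exists>i j. admissible i j (0, 0) M"
proof -
  obtain i j where ij: "i < j" "adjacent S i j" "m = i \<or> m = j" using adjacent_at[OF assms(1)] by (elim exE conjE)
  have "admissible i j (0, 0) M" by (rule admissible_untwisted[OF ij(1,2)]) (use ij(3) assms(2) in auto)
  then show ?thesis by (intro exI)
qed

text \<open>A nonzero value forces \<open>M\<close> to be empty or, in the untwisted sector, a single ray of \<open>\<Sigma>\<close>.\<close>

lemma functional_eH_admissible:
  assumes \<phi>: "functional (relH n S) \<phi>" and \<gamma>: "\<gamma> \<in> Box S" and M: "M \<in> indices" and ne: "\<phi> (eH \<gamma> M) \<noteq> 0"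
  shows "\<exists>i j. admissible i j \<gamma> M"
proof -
  consider "M = {#}" | m where "M = {#m#}" "m \<le> n" | i j where "M = {#i, j#}"
    using M unfolding indices_eq by auto
  then show ?thesis
  proof cases
    case 1
    obtain i j where "i < j" "adjacent S i j" using adjacent_at[OF zero_S] by (elim exE conjE)
    then have "admissible i j (0, 0) {#}" by (rule admissible_untwisted) simp
    then show ?thesis unfolding 1 using twisted_admissible_exists[OF \<gamma>] by (cases "\<gamma> = (0, 0)") (simp, rule exI, rule exI, assumption, blast)
  next
    case (2 m)
    have "\<gamma> = (0, 0)"
    proof (rule ccontr)
      assume "\<gamma> \<noteq> (0, 0)"
      from functional_rel[OF \<phi> relH_base(3)[OF \<gamma> this, of m]] show False using ne by (simp add: 2 eH_def)
    qed
    moreover have "m \<in> S"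
    proof (rule ccontr)
      assume "m \<notin> S"
      from functional_rel[OF \<phi> relH_base(2)[OF ideal_base(1)[OF this]]] show False
        using ne by (simp add: 2 eH_def calculation)
    qed
    ultimately show ?thesis using admissible_ray[of m M] 2 by simp
  next
    case (3 i j)
    have "\<phi> (eH \<gamma> M) = 0"
      using functional_rel[OF \<phi> eH_pair_rel[OF \<gamma>, of 1 i j]] by (simp add: 3 eH_def)
    then show ?thesis using ne by simp
  qed
qed

text \<open>A nonzero value forces \<open>M\<close> to be empty in a twisted sector and to have a cone of \<open>\<Sigma>\<close> as its set of
  indices in the untwisted one.\<close>

lemma functional_eC_admissible:
  assumes \<psi>: "functional (relHc n S) \<psi>" and \<gamma>: "\<gamma> \<in> Box S" and M: "M \<in> indices" and ne: "\<psi> (eC \<gamma> M) \<noteq> 0"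
  shows "\<exists>i j. admissible i j \<gamma> M"
proof (cases "\<gamma> = (0, 0)")
  case False
  have "M = {#}"
  proof (rule ccontr)
    assume "M \<noteq> {#}"
    then obtain k N where "M = add_mset k N" by (meson multiset_cases)
    then have "eC \<gamma> M = pm_scale (\<Prod>k\<in>#N. D k) (pm_scale (D k) (Ftw \<gamma>))"
      using False by (simp add: eC_def pm_scale_scale mult.commute)
    then show False using ne functional_rel[OF \<psi> relHc_scale[OF relHc_base(7)[OF \<gamma> False]]] by simp
  qed
  then show ?thesis using twisted_admissible_exists[OF \<gamma> False] by simp
next
  case True
  consider "M = {#}" | m where "M = {#m#}" | m where "M = {#m, m#}" | i j where "M = {#i, j#}" "i \<noteq> j"
    using M unfolding indices_eq by auto
  then show ?thesis
  proof cases
    case 1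
    have "Fcone {} \<in> relHc n S" by (rule relHc_base(1)) (use gen_cones_card in blast)
    then show ?thesis using ne functional_rel[OF \<psi>] by (simp add: 1 True eC_def pm_scale_1)
  next
    case (2 m)
    have "m \<in> S" using ne Fcone_ray_rel[of m] functional_rel[OF \<psi>] by (auto simp: 2 True eC_ray inner_rays_def)
    then show ?thesis using admissible_ray[of m M] 2 True by simp
  next
    case (3 m)
    have "m \<in> S" using ne relHc_scale[OF Fcone_ray_rel[of m]] functional_rel[OF \<psi>] by (auto simp: 3 True eC_square inner_rays_def)
    then show ?thesis using admissible_ray[of m M] 3 True by simp
  next
    case (4 i j)
    have adj: "adjacent S i j" using ne Fcone_pair_rel[OF 4(2)] functional_rel[OF \<psi>] by (auto simp: 4 True eC_pair)
    have adj': "adjacent S j i" using adj adjacent_commute[of i j] by simp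
    show ?thesis
    proof (cases "i < j")
      case True
      have "admissible i j (0, 0) M" by (rule admissible_untwisted[OF True adj]) (simp add: 4)
      then show ?thesis unfolding \<open>\<gamma> = (0, 0)\<close> by (intro exI)
    next
      case False
      then have "j < i" using 4(2) by simp
      then have "admissible j i (0, 0) M" by (rule admissible_untwisted[OF _ adj']) (simp add: 4)
      then show ?thesis unfolding \<open>\<gamma> = (0, 0)\<close> by (intro exI)
    qed
  qed
qed

end

section \<open>Euler relations for the Gamma series\<close>

context fan begin

text \<open>The value of a functional on a Gamma series, where \<open>w \<gamma> M\<close> is its value on the generators
  \<open>eH \<gamma> M\<close> or \<open>eC \<gamma> M\<close>.\<close>

definition combination :: "(int \<times> int \<Rightarrow> nat multiset \<Rightarrow> complex) \<Rightarrow> int \<times> int \<Rightarrow> (nat \<Rightarrow> complex) \<Rightarrow> complex" where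
  "combination w c y = (\<Sum>\<gamma>\<in>Box S. \<Sum>M\<in>indices. w \<gamma> M * series \<gamma> M c y)"

text \<open>Only convergent series occur in the combination.\<close>

definition tame :: "(int \<times> int \<Rightarrow> nat multiset \<Rightarrow> complex) \<Rightarrow> bool" where
  "tame w \<longleftrightarrow> (\<forall>\<gamma>\<in>Box S. \<forall>M\<in>indices. w \<gamma> M \<noteq> 0 \<longrightarrow> (\<exists>i j. admissible i j \<gamma> M))"

lemma tame_eH: "functional (relH n S) \<phi> \<Longrightarrow> tame (\<lambda>\<gamma> M. \<phi> (eH \<gamma> M))"
  unfolding tame_def using functional_eH_admissible by blast

lemma tame_eC: "functional (relHc n S) \<psi> \<Longrightarrow> tame (\<lambda>\<gamma> M. \<psi> (eC \<gamma> M))"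
  unfolding tame_def using functional_eC_admissible by blast

lemma sum_lower_indices:
  fixes F :: "nat multiset \<Rightarrow> nat \<Rightarrow> complex"
  shows "(\<Sum>M\<in>indices. \<Sum>k\<in>set_mset M. F M k) = (\<Sum>M\<in>{M \<in> indices. size M \<le> 1}. \<Sum>k\<le>n. F (add_mset k M) k)"
proof -
  have fin: "finite {M \<in> indices. size M \<le> 1}" using finite_indices by simp
  have "(\<Sum>M\<in>indices. \<Sum>k\<in>set_mset M. F M k) = (\<Sum>(M, k)\<in>(SIGMA M:indices. set_mset M). F M k)"
    by (rule sum.Sigma[OF finite_indices]) simp
  also have "\<dots> = (\<Sum>(M, k)\<in>{M \<in> indices. size M \<le> 1} \<times> {..n}. F (add_mset k M) k)"
  proof (rule sum.reindex_bij_witness[where i = "\<lambda>(M, k). (add_mset k M, k)" and j = "\<lambda>(M, k). (M - {#k#}, k)"])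
    fix p assume p: "p \<in> (SIGMA M:indices. set_mset M)"
    obtain M k where [simp]: "p = (M, k)" by (cases p)
    have M: "M \<in> indices" "k \<in># M" using p by auto
    then obtain N where N: "M = add_mset k N" by (meson multi_member_split)
    show "(case (case p of (M, k) \<Rightarrow> (M - {#k#}, k)) of (M, k) \<Rightarrow> (add_mset k M, k)) = p" by (simp add: N)
    show "(case p of (M, k) \<Rightarrow> (M - {#k#}, k)) \<in> {M \<in> indices. size M \<le> 1} \<times> {..n}"
      using M(1) by (auto simp: N indices_def)
    show "(case (case p of (M, k) \<Rightarrow> (M - {#k#}, k)) of (M, k) \<Rightarrow> F (add_mset k M) k) = (case p of (M, k) \<Rightarrow> F M k)"
      by (simp add: N)
  next
    fix p assume p: "p \<in> {M \<in> indices. size M \<le> 1} \<times> {..n}"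
    obtain M k where [simp]: "p = (M, k)" by (cases p)
    show "(case (case p of (M, k) \<Rightarrow> (add_mset k M, k)) of (M, k) \<Rightarrow> (M - {#k#}, k)) = p" by simp
    show "(case p of (M, k) \<Rightarrow> (add_mset k M, k)) \<in> (SIGMA M:indices. set_mset M)"
      using p by (auto simp: indices_def)
  qed
  also have "\<dots> = (\<Sum>M\<in>{M \<in> indices. size M \<le> 1}. \<Sum>k\<le>n. F (add_mset k M) k)"
    by (rule sum.Sigma[symmetric, OF fin]) simp
  finally show ?thesis .
qed

text \<open>Summing \<open>series_euler\<close> with the weights \<open>w\<close>, the terms with a smaller \<open>M\<close> collect to
  \<open>\<Sum>\<^sub>k a\<^sub>k w(M + k)\<close>, the value of the functional on a multiple of the relation \<open>\<Sum>\<^sub>k a\<^sub>k D\<^sub>k\<close>.\<close>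

lemma combination_euler:
  assumes c: "0 \<le> snd c" and y: "deep y" and w: "tame w"
    and A: "\<And>\<gamma> l. l \<in> Lset n S c \<gamma> \<Longrightarrow> (\<Sum>k\<le>n. a k * of_rat (l k)) = A"
    and rel: "\<And>\<gamma> M. \<gamma> \<in> Box S \<Longrightarrow> M \<in> indices \<Longrightarrow> size M \<le> 1 \<Longrightarrow>
        series \<gamma> M c y = 0 \<or> (\<Sum>k\<le>n. a k * w \<gamma> (add_mset k M)) = 0"
  shows "(\<Sum>k\<le>n. a k * exp (y k) * combination w (add_vertex c k) y) = A * combination w c y"
proof -
  have "(\<Sum>k\<le>n. a k * exp (y k) * combination w (add_vertex c k) y) =
     (\<Sum>k\<le>n. \<Sum>\<gamma>\<in>Box S. \<Sum>M\<in>indices. w \<gamma> M * (a k * exp (y k) * series \<gamma> M (add_vertex c k) y))"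
    unfolding combination_def sum_distrib_left by (intro sum.cong refl) (simp only: mult_ac)
  also have "\<dots> = (\<Sum>\<gamma>\<in>Box S. \<Sum>M\<in>indices. w \<gamma> M * (\<Sum>k\<le>n. a k * exp (y k) * series \<gamma> M (add_vertex c k) y))"
    unfolding sum_distrib_left
    by (subst sum.swap, rule sum.cong[OF refl], subst sum.swap, rule refl)
  also have "\<dots> = (\<Sum>\<gamma>\<in>Box S. \<Sum>M\<in>indices. A * (w \<gamma> M * series \<gamma> M c y) +
      (\<Sum>k\<in>set_mset M. a k * w \<gamma> M * series \<gamma> (M - {#k#}) c y) / (2 * of_real pi * \<i>))"
  proof (intro sum.cong refl)
    fix \<gamma> M assume gM: "\<gamma> \<in> Box S" "M \<in> indices"
    show "w \<gamma> M * (\<Sum>k\<le>n. a k * exp (y k) * series \<gamma> M (add_vertex c k) y) = A * (w \<gamma> M * series \<gamma> M c y) +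
      (\<Sum>k\<in>set_mset M. a k * w \<gamma> M * series \<gamma> (M - {#k#}) c y) / (2 * of_real pi * \<i>)"
    proof (cases "w \<gamma> M = 0")
      case False
      then obtain i j where adm: "admissible i j \<gamma> M" using w gM unfolding tame_def by blast
      have s: "(\<Sum>k\<in>set_mset M. a k * w \<gamma> M * series \<gamma> (M - {#k#}) c y) = w \<gamma> M * (\<Sum>k\<in>set_mset M. a k * series \<gamma> (M - {#k#}) c y)"
        unfolding sum_distrib_left by (intro sum.cong refl) (simp only: mult_ac)
      have e: "(\<Sum>k\<le>n. a k * exp (y k) * series \<gamma> M (add_vertex c k) y) =
          A * series \<gamma> M c y + (\<Sum>k\<in>set_mset M. a k * series \<gamma> (M - {#k#}) c y) / (2 * of_real pi * \<i>)"
        by (rule series_euler[OF c adm y A])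
      show ?thesis unfolding e s distrib_left times_divide_eq_right by (simp only: mult_ac)
    qed simp
  qed
  also have "\<dots> = A * combination w c y + (\<Sum>\<gamma>\<in>Box S. (\<Sum>M\<in>indices. \<Sum>k\<in>set_mset M. a k * w \<gamma> M * series \<gamma> (M - {#k#}) c y)) / (2 * of_real pi * \<i>)"
    unfolding combination_def by (simp add: sum.distrib sum_distrib_left sum_divide_distrib)
  also have "(\<Sum>\<gamma>\<in>Box S. (\<Sum>M\<in>indices. \<Sum>k\<in>set_mset M. a k * w \<gamma> M * series \<gamma> (M - {#k#}) c y)) = 0"
  proof (rule sum.neutral, rule ballI)
    fix \<gamma> assume g: "\<gamma> \<in> Box S"
    have "(\<Sum>M\<in>indices. \<Sum>k\<in>set_mset M. a k * w \<gamma> M * series \<gamma> (M - {#k#}) c y) =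
       (\<Sum>M\<in>{M \<in> indices. size M \<le> 1}. series \<gamma> M c y * (\<Sum>k\<le>n. a k * w \<gamma> (add_mset k M)))"
      unfolding sum_lower_indices sum_distrib_left by (intro sum.cong refl) (simp add: mult_ac)
    also have "\<dots> = 0" using rel[OF g] by (intro sum.neutral) auto
    finally show "(\<Sum>M\<in>indices. \<Sum>k\<in>set_mset M. a k * w \<gamma> M * series \<gamma> (M - {#k#}) c y) = 0" .
  qed
  finally show ?thesis by simp
qed

lemma euler_weights:
  assumes "l \<in> Lset n S c \<gamma>"
  shows "(\<Sum>k\<le>n. 1 * (of_rat (l k) :: complex)) = - of_int (snd c)"
    "(\<Sum>k\<le>n. of_nat k * (of_rat (l k) :: complex)) = - of_int (fst c)"
  using arg_cong[OF Lset_sums(1)[OF assms], of "of_rat :: rat \<Rightarrow> complex"]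
    arg_cong[OF Lset_sums(2)[OF assms], of "of_rat :: rat \<Rightarrow> complex"]
  by (simp_all add: of_rat_sum of_rat_mult of_rat_minus mult.commute)

lemma functional_weighted_sum:
  assumes \<phi>: "functional W \<phi>"
  shows "(\<Sum>k\<le>n. of_nat (a k) * \<phi> (pm_scale (D k) u)) = \<phi> (pm_scale (\<Sum>k\<le>n. of_nat (a k) * D k) u)"
proof -
  have "pm_scale (of_nat m * p) u = cscale (of_nat m) (pm_scale p u)" for m p
  proof -
    have "Cst (of_nat m) = (of_nat m :: dpoly)"
    proof (induction m)
      case (Suc m)
      have "Cst (of_nat (Suc m)) = Cst 1 + Cst (of_nat m)" by (simp add: Cst_def single_add)
      then show ?case by (simp add: Suc Cst_1)
    qed (simp add: Cst_def)
    then show ?thesis by (simp add: cscale_def pm_scale_scale)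
  qed
  then show ?thesis
    by (simp add: pm_scale_sum functional_sum[OF \<phi>] functional_scale[OF \<phi>])
qed

lemma eH_relations:
  assumes \<phi>: "functional (relH n S) \<phi>" and \<gamma>: "\<gamma> \<in> Box S"
  shows "(\<Sum>k\<le>n. 1 * \<phi> (eH \<gamma> (add_mset k M))) = 0" "(\<Sum>k\<le>n. of_nat k * \<phi> (eH \<gamma> (add_mset k M))) = 0"
proof -
  have eH_add: "eH \<gamma> (add_mset k M) = pm_scale (D k) (eH \<gamma> M)" for k
    by (simp add: eH_def pm_scale_scale)
  have rel: "pm_scale p (eH \<gamma> M) \<in> relH n S" if "p \<in> untwisted_ideal n S" "\<gamma> = (0, 0)" for p
    using relH_scale[OF relH_base(2)[OF that(1)], of "\<Prod>k\<in>#M. D k"] that(2) by (simp add: eH_def pm_scale_scale mult.commute)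
  have tw: "\<phi> (pm_scale (D k) (eH \<gamma> M)) = 0" if "\<gamma> \<noteq> (0, 0)" for k
    using functional_rel[OF \<phi> relH_scale[OF relH_base(3)[OF \<gamma> that, of k], of "\<Prod>k\<in>#M. D k"]]
    by (simp add: eH_def pm_scale_scale mult.commute)
  show "(\<Sum>k\<le>n. 1 * \<phi> (eH \<gamma> (add_mset k M))) = 0"
    using functional_weighted_sum[OF \<phi>, of "\<lambda>_. 1" "eH \<gamma> M"] functional_rel[OF \<phi> rel[OF ideal_base(3)]] tw
    unfolding eH_add by (cases "\<gamma> = (0, 0)") simp_all
  show "(\<Sum>k\<le>n. of_nat k * \<phi> (eH \<gamma> (add_mset k M))) = 0"
    using functional_weighted_sum[OF \<phi>, of "\<lambda>k. k" "eH \<gamma> M"] functional_rel[OF \<phi> rel[OF ideal_base(4)]] tw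
    unfolding eH_add by (cases "\<gamma> = (0, 0)") simp_all
qed

lemma series_vanish:
  assumes "\<And>l. l \<in> Lset n S c \<gamma> \<Longrightarrow> jet n M y l = 0"
  shows "series \<gamma> M c y = 0"
  unfolding series_def using assms by (rule infsum_0)

text \<open>For \<open>M = {m}\<close> with \<open>m\<close> not on the boundary the sums are values on multiples of \<open>\<Sum>\<^sub>k D\<^sub>k\<close> and
  \<open>\<Sum>\<^sub>k k D\<^sub>k\<close>. For empty \<open>M\<close> and for \<open>m = 0\<close> or \<open>m = n\<close> they are not, but there the series itself vanishes,
  since \<open>d\<close> is interior.\<close>

lemma eC_relations:
  assumes \<psi>: "functional (relHc n S) \<psi>" and \<gamma>: "\<gamma> \<in> Box S" and M: "M \<in> indices" "size M \<le> 1"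
    and d: "0 < fst d" "fst d < int n * snd d"
  shows "series \<gamma> M d y = 0 \<or> ((\<Sum>k\<le>n. 1 * \<psi> (eC \<gamma> (add_mset k M))) = 0 \<and> (\<Sum>k\<le>n. of_nat k * \<psi> (eC \<gamma> (add_mset k M))) = 0)"
proof (cases "\<gamma> = (0, 0)")
  case False
  have "\<psi> (eC \<gamma> (add_mset k M)) = 0" for k
  proof -
    have "eC \<gamma> (add_mset k M) = pm_scale (\<Prod>k\<in>#M. D k) (pm_scale (D k) (Ftw \<gamma>))"
      using False by (simp add: eC_def pm_scale_scale mult.commute)
    then show ?thesis using functional_rel[OF \<psi> relHc_scale[OF relHc_base(7)[OF \<gamma> False]]] by simp
  qed
  then show ?thesis by simp
next
  case True
  consider "M = {#}" | m where "M = {#m#}" "m \<in> {0, n}" | m where "M = {#m#}" "m \<in> inner_rays n S \<or> m \<notin> S"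
  proof -
    have "size M = 0 \<or> size M = 1" using M(2) by linarith
    then consider (a) "M = {#}" | (b) m where "M = {#m#}" using size_1_singleton_mset[of M] by auto
    then show ?thesis
    proof cases
      case (b m)
      show ?thesis
      proof (cases "m \<in> {0, n}")
        case False
        then have "m \<in> inner_rays n S \<or> m \<notin> S" by (auto simp: inner_rays_def)
        with b show ?thesis by (rule that(3))
      qed (rule that(2)[OF b])
    qed (rule that(1))
  qed
  then show ?thesis
  proof cases
    case 1
    have "series \<gamma> M d y = 0"
    proof (rule series_vanish, rule ccontr)
      fix l assume l: "l \<in> Lset n S d \<gamma>" "jet n M y l \<noteq> 0"
      then have "neg_set n l = {}" using jet_neg_set[OF l(2)] 1 by simp
      then show False using neg_set_interior(1)[OF d l(1)] Lset_untwisted_int[of l d] l(1) True by simp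
    qed
    then show ?thesis ..
  next
    case (2 m)
    have "series \<gamma> M d y = 0"
    proof (rule series_vanish, rule ccontr)
      fix l assume l: "l \<in> Lset n S d \<gamma>" "jet n M y l \<noteq> 0"
      then have "neg_set n l \<subseteq> {m}" using jet_neg_set[OF l(2)] 2 by simp
      then have "neg_set n l = {} \<or> neg_set n l = {0} \<or> neg_set n l = {n}" using 2(2) by (auto simp: subset_singleton_iff)
      then show False using neg_set_interior[OF d l(1)] Lset_untwisted_int[of l d] l(1) True by simp
    qed
    then show ?thesis ..
  next
    case (3 m)
    have eq: "\<psi> (eC \<gamma> (add_mset k M)) = \<psi> (pm_scale (D k) (Fcone {m}))" for k
      using functional_D_ray[OF \<psi> 3(2), of k] by (simp add: 3(1) True)
    show ?thesis
      using functional_weighted_sum[OF \<psi>, of "\<lambda>_. 1" "Fcone {m}"] functional_rel[OF \<psi> relHc_base(3)[OF ideal_base(3)]]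
        functional_weighted_sum[OF \<psi>, of "\<lambda>k. k" "Fcone {m}"] functional_rel[OF \<psi> relHc_base(3)[OF ideal_base(4)]]
      by (simp add: eq)
  qed
qed

lemma functional_combination:
  assumes "\<And>\<gamma> M. functional W (\<lambda>u. B u (f \<gamma> M))"
  shows "functional W (\<lambda>u. combination (\<lambda>\<gamma> M. B u (f \<gamma> M)) d y)"
  using assms unfolding functional_iff combination_def
  by (simp add: distrib_right sum.distrib sum_distrib_left mult.assoc)

text \<open>The number \<open>B(\<Gamma>\<^sub>c, \<Gamma>\<degree>\<^sub>d)\<close> in terms of the scalar series.\<close>

definition X :: "(freeH \<Rightarrow> freeHc \<Rightarrow> complex) \<Rightarrow> (nat \<Rightarrow> complex) \<Rightarrow> int \<times> int \<Rightarrow> int \<times> int \<Rightarrow> complex" where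
  "X B y c d = combination (\<lambda>\<gamma> M. combination (\<lambda>\<gamma>' M'. B (eH \<gamma> M) (eC \<gamma>' M')) d y) c y"

lemma combination_pairs:
  "combination w c y = (\<Sum>p\<in>Box S \<times> indices. w (fst p) (snd p) * series (fst p) (snd p) c y)"
  unfolding combination_def sum.cartesian_product by (simp add: case_prod_unfold)

lemma X_swap: "X B y c d = combination (\<lambda>\<gamma>' M'. combination (\<lambda>\<gamma> M. B (eH \<gamma> M) (eC \<gamma>' M')) c y) d y"
proof -
  have "X B y c d = (\<Sum>p\<in>Box S \<times> indices. \<Sum>q\<in>Box S \<times> indices.
      B (eH (fst p) (snd p)) (eC (fst q) (snd q)) * series (fst q) (snd q) d y * series (fst p) (snd p) c y)"
    unfolding X_def combination_pairs sum_distrib_right ..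
  also have "\<dots> = (\<Sum>q\<in>Box S \<times> indices. \<Sum>p\<in>Box S \<times> indices.
      B (eH (fst p) (snd p)) (eC (fst q) (snd q)) * series (fst p) (snd p) c y * series (fst q) (snd q) d y)"
    by (subst sum.swap) (simp add: mult_ac)
  also have "\<dots> = combination (\<lambda>\<gamma>' M'. combination (\<lambda>\<gamma> M. B (eH \<gamma> M) (eC \<gamma>' M')) c y) d y"
    unfolding combination_pairs sum_distrib_right ..
  finally show ?thesis .
qed

context
  fixes B assumes B: "bilinear_form (relH n S) (relHc n S) B"
begin

lemma B_left: "functional (relH n S) (\<lambda>u. B u v)" and B_right: "functional (relHc n S) (B u)"
  using B unfolding bilinear_form_def by auto

lemma X_left_functional: "functional (relH n S) (\<lambda>u. combination (\<lambda>\<gamma>' M'. B u (eC \<gamma>' M')) d y)"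
  by (rule functional_combination[OF B_left])

lemma X_right_functional: "functional (relHc n S) (\<lambda>v. combination (\<lambda>\<gamma> M. B (eH \<gamma> M) v) c y)"
  by (rule functional_combination[where B = "\<lambda>v u. B u v", OF B_right])

lemma X_left_euler:
  assumes c: "0 \<le> snd c" and y: "deep y"
  shows "(\<Sum>k\<le>n. exp (y k) * X B y (add_vertex c k) d) = - of_int (snd c) * X B y c d"
    "(\<Sum>k\<le>n. of_nat k * exp (y k) * X B y (add_vertex c k) d) = - of_int (fst c) * X B y c d"
  using combination_euler[OF c y tame_eH[OF X_left_functional], of "\<lambda>_. 1", OF euler_weights(1)]
    combination_euler[OF c y tame_eH[OF X_left_functional], of of_nat, OF euler_weights(2)]
    eH_relations[OF X_left_functional]
  unfolding X_def by simp_all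

lemma X_right_euler:
  assumes d: "0 < fst d" "fst d < int n * snd d" and y: "deep y"
  shows "(\<Sum>k\<le>n. exp (y k) * X B y c (add_vertex d k)) = - of_int (snd d) * X B y c d"
    "(\<Sum>k\<le>n. of_nat k * exp (y k) * X B y c (add_vertex d k)) = - of_int (fst d) * X B y c d"
proof -
  have "0 \<le> snd d"
  proof (rule ccontr)
    assume "\<not> 0 \<le> snd d"
    then have "int n * snd d \<le> 0" by (simp add: mult_nonneg_nonpos)
    then show False using d by simp
  qed
  note e = combination_euler[OF this y tame_eC[OF X_right_functional]]
  have "(\<Sum>k\<le>n. 1 * exp (y k) * X B y c (add_vertex d k)) = - of_int (snd d) * X B y c d"
    unfolding X_swap by (rule e[OF euler_weights(1)]) (use eC_relations[OF X_right_functional _ _ _ d] in blast)+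
  then show "(\<Sum>k\<le>n. exp (y k) * X B y c (add_vertex d k)) = - of_int (snd d) * X B y c d" by simp
  show "(\<Sum>k\<le>n. of_nat k * exp (y k) * X B y c (add_vertex d k)) = - of_int (fst d) * X B y c d"
    unfolding X_swap by (rule e[OF euler_weights(2)]) (use eC_relations[OF X_right_functional _ _ _ d] in blast)+
qed

end

end

section \<open>The pairing is constant\<close>

text \<open>The pairing as a sum over ordered pairs \<open>(i, j)\<close>, which halves both sums; in the second one another
  factor \<open>1/2\<close> is the normalisation of the sign kernel.\<close>

definition sym_pairing :: "int \<Rightarrow> (int \<Rightarrow> complex) \<Rightarrow> (int \<times> int \<Rightarrow> int \<times> int \<Rightarrow> complex) \<Rightarrow> complex" where
  "sym_pairing N x X =
      1/2 * (\<Sum>i\<in>{0..N}. \<Sum>j\<in>{0..N}. (of_int (i - j))\<^sup>2 * x i * x j * X (0, 0) (i + j, 2))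
    - of_int N / 4 * (\<Sum>i\<in>{0..N}. \<Sum>j\<in>{0..N}. of_int (j - i) * x i * x j * (\<Sum>k\<in>{0..N}. sign_kernel j i k *
         (if 0 < i + j - k \<and> i + j - k < N then X (k, 1) (i + j - k, 1) else 0)))"

lemma sum_int: "(\<Sum>j\<in>{0..int n}. g j) = (\<Sum>k\<le>n. g (int k))"
  by (rule sum.reindex_bij_witness[of _ int nat]) auto

lemma sum_rotate: "(\<Sum>p\<in>P. \<Sum>q\<in>Q. \<Sum>k\<in>K. f p q k) = (\<Sum>k\<in>K. \<Sum>p\<in>P. \<Sum>q\<in>Q. f p q k)"
proof -
  have "(\<Sum>p\<in>P. \<Sum>q\<in>Q. \<Sum>k\<in>K. f p q k) = (\<Sum>p\<in>P. \<Sum>k\<in>K. \<Sum>q\<in>Q. f p q k)"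
    by (rule sum.cong[OF refl], rule sum.swap)
  also have "\<dots> = (\<Sum>k\<in>K. \<Sum>p\<in>P. \<Sum>q\<in>Q. f p q k)" by (rule sum.swap)
  finally show ?thesis .
qed

lemma pull_into_sum:
  fixes a p q :: complex
  shows "a * p * q * (\<Sum>k\<in>K. c k * (if P k then F k else 0)) = a * (\<Sum>k\<in>K. c k * (if P k then p * q * F k else 0))"
proof -
  have "a * (\<Sum>k\<in>K. c k * (if P k then p * q * F k else 0)) = a * (\<Sum>k\<in>K. p * q * (c k * (if P k then F k else 0)))"
    by (rule arg_cong[where f = "\<lambda>t. a * t"], rule sum.cong[OF refl]) simp
  also have "\<dots> = a * p * q * (\<Sum>k\<in>K. c k * (if P k then F k else 0))"
    unfolding sum_distrib_left[symmetric] by (simp only: mult.assoc)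
  finally show ?thesis ..
qed

lemma cone2_iff:
  assumes "i < j"
  shows "(p, q) \<in> cone2 i j \<longleftrightarrow> real i * q \<le> p \<and> p \<le> real j * q"
proof
  define T where "T = {x :: real \<times> real. real i * snd x \<le> fst x \<and> fst x \<le> real j * snd x}"
  have "convex T"
  proof (rule convexI)
    fix x y u v assume xy: "x \<in> T" "y \<in> T" and uv: "0 \<le> (u :: real)" "0 \<le> v" "u + v = 1"
    have "u * (real i * snd x) \<le> u * fst x" "v * (real i * snd y) \<le> v * fst y"
      "u * fst x \<le> u * (real j * snd x)" "v * fst y \<le> v * (real j * snd y)"
      using xy uv by (auto simp: T_def intro!: mult_left_mono)
    then show "u *\<^sub>R x + v *\<^sub>R y \<in> T" by (simp add: T_def algebra_simps)
  qed
  moreover have "conic T"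
    unfolding conic_def
  proof (intro allI impI)
    fix x c assume x: "x \<in> T" and c: "0 \<le> (c :: real)"
    have "c * (real i * snd x) \<le> c * fst x" "c * fst x \<le> c * (real j * snd x)"
      using x c by (auto simp: T_def intro!: mult_left_mono)
    then show "c *\<^sub>R x \<in> T" by (simp add: T_def algebra_simps)
  qed
  moreover have "T \<noteq> {}" by (auto simp: T_def intro!: exI[of _ 0])
  ultimately have "convex_cone T" by (simp add: convex_cone_def)
  moreover have "{embed (vlat i), embed (vlat j)} \<subseteq> T" using assms by (auto simp: T_def embed_def vlat_def)
  ultimately have sub: "cone2 i j \<subseteq> T" unfolding cone2_def by (intro hull_minimal)
  show "(p, q) \<in> cone2 i j \<Longrightarrow> real i * q \<le> p \<and> p \<le> real j * q" using sub by (auto simp: T_def)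
  assume pq: "real i * q \<le> p \<and> p \<le> real j * q"
  define b where "b = (p - real i * q) / (real j - real i)"
  define a where "a = q - b"
  have d: "0 < real j - real i" using assms by simp
  have bd: "b * (real j - real i) = p - real i * q" using d by (simp add: b_def)
  have b0: "0 \<le> b" using pq d by (simp add: b_def)
  have "a * (real j - real i) = real j * q - p" using bd by (simp add: a_def algebra_simps)
  then have a0: "0 \<le> a" using pq d by (metis diff_ge_0_iff_ge zero_le_mult_iff not_less)
  have "(p, q) = a *\<^sub>R embed (vlat i) + b *\<^sub>R embed (vlat j)"
    using bd by (simp add: embed_def vlat_def a_def algebra_simps)
  moreover have "a *\<^sub>R embed (vlat i) + b *\<^sub>R embed (vlat j) \<in> cone2 i j"
    unfolding cone2_def by (intro convex_cone_hull_add convex_cone_hull_mul a0 b0 hull_inc) auto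
  ultimately show "(p, q) \<in> cone2 i j" by simp
qed

lemma interior_cone2_iff:
  assumes "i < j"
  shows "(p, q) \<in> interior (cone2 i j) \<longleftrightarrow> real i * q < p \<and> p < real j * q"
proof -
  have "cone2 i j = {x. (1, - real i) \<bullet> x \<ge> 0} \<inter> {x. (- 1, real j) \<bullet> x \<ge> 0}"
    using cone2_iff[OF assms] by (auto simp: inner_prod_def)
  then have "interior (cone2 i j) = {x. (1, - real i) \<bullet> x > 0} \<inter> {x. (- 1, real j) \<bullet> x > 0}"
    by (simp add: interior_Int zero_prod_def)
  then show ?thesis by (auto simp: inner_prod_def)
qed

context fan begin

lemma cone_lattice: "c \<in> lattice_points (cone2 0 n) \<longleftrightarrow> 0 \<le> fst c \<and> fst c \<le> int n * snd c"
proof -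
  have "real_of_int (fst c) \<le> real n * real_of_int (snd c) \<longleftrightarrow> fst c \<le> int n * snd c"
    by (metis of_int_le_iff of_int_mult of_int_of_nat_eq)
  then show ?thesis using n_pos by (simp add: lattice_points_def embed_def cone2_iff)
qed

lemma interior_lattice: "c \<in> lattice_points (interior (cone2 0 n)) \<longleftrightarrow> 0 < fst c \<and> fst c < int n * snd c"
proof -
  have "real_of_int (fst c) < real n * real_of_int (snd c) \<longleftrightarrow> fst c < int n * snd c"
    by (metis of_int_less_iff of_int_mult of_int_of_nat_eq)
  then show ?thesis using n_pos by (simp add: lattice_points_def embed_def interior_cone2_iff)
qed

lemma snd_nonneg:
  assumes "0 \<le> p" "p \<le> int n * q" shows "0 \<le> q"
proof (rule ccontr)
  assume "\<not> 0 \<le> q"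
  then have "int n * q < 0" using n_pos by (simp add: mult_pos_neg)
  then show False using assms by linarith
qed

text \<open>The Euler relations for both arguments, from the relations of \<open>H\<close> and of \<open>H\<^sup>c\<close>.\<close>

lemma euler_pair_X:
  assumes B: "bilinear_form (relH n S) (relHc n S) B" and y: "deep y"
  shows "euler_pair (int n) (\<lambda>i. exp (y (nat i))) (X B y)"
proof
  show "1 \<le> int n" using n_pos by simp
  fix k a p q :: int assume k: "0 \<le> k" "k \<le> int n * a" and p: "0 < p" "p < int n * q"
  have a: "0 \<le> snd (k, a)" using snd_nonneg[OF k] by simp
  have p': "0 < fst (p, q)" "fst (p, q) < int n * snd (p, q)" using p by simp_all
  show "(\<Sum>j\<in>{0..int n}. exp (y (nat j)) * X B y (k + j, a + 1) (p, q)) = - of_int a * X B y (k, a) (p, q)"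
    using X_left_euler(1)[OF B a y, of "(p, q)"] by (simp add: sum_int add_vertex_def)
  show "(\<Sum>j\<in>{0..int n}. of_int j * exp (y (nat j)) * X B y (k + j, a + 1) (p, q)) = - of_int k * X B y (k, a) (p, q)"
    using X_left_euler(2)[OF B a y, of "(p, q)"] by (simp add: sum_int add_vertex_def)
  show "(\<Sum>j\<in>{0..int n}. exp (y (nat j)) * X B y (k, a) (p + j, q + 1)) = - of_int q * X B y (k, a) (p, q)"
    using X_right_euler(1)[OF B p' y, of "(k, a)"] by (simp add: sum_int add_vertex_def)
  show "(\<Sum>j\<in>{0..int n}. of_int j * exp (y (nat j)) * X B y (k, a) (p + j, q + 1)) = - of_int p * X B y (k, a) (p, q)"
    using X_right_euler(2)[OF B p' y, of "(k, a)"] by (simp add: sum_int add_vertex_def)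
qed

lemma X_pairs: "X B y c d = (\<Sum>p\<in>Box S \<times> indices. \<Sum>q\<in>Box S \<times> indices.
      B (eH (fst p) (snd p)) (eC (fst q) (snd q)) * (series (fst p) (snd p) c y * series (fst q) (snd q) d y))"
  unfolding X_def combination_pairs sum_distrib_right by (intro sum.cong refl) (simp only: mult_ac)

lemma X_deriv:
  assumes B: "bilinear_form (relH n S) (relHc n S) B" and c: "0 \<le> snd c" and d: "0 \<le> snd d" and s: "s \<in> deep_times y w"
  defines "ys \<equiv> (\<lambda>s k. y k + s * w k)"
  shows "((\<lambda>s. X B (ys s) c d) has_field_derivative
     (\<Sum>k\<le>n. w k * exp (ys s k) * (X B (ys s) (add_vertex c k) d + X B (ys s) c (add_vertex d k)))) (at s)"
proof -
  define b where "b p q = B (eH (fst p) (snd p)) (eC (fst q) (snd q))" for p q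
  define \<Phi> where "\<Phi> p c s = series (fst p) (snd p) c (ys s)" for p c s
  define \<Phi>' where "\<Phi>' p c = (\<Sum>k\<le>n. w k * exp (ys s k) * \<Phi> p (add_vertex c k) s)" for p c
  have Xb: "X B (ys s) c d = (\<Sum>p\<in>Box S \<times> indices. \<Sum>q\<in>Box S \<times> indices. b p q * (\<Phi> p c s * \<Phi> q d s))" for c d s
    unfolding X_pairs b_def \<Phi>_def ..
  have deriv: "((\<lambda>s. b p q * (\<Phi> p c s * \<Phi> q d s)) has_field_derivative b p q * (\<Phi>' p c * \<Phi> q d s + \<Phi> p c s * \<Phi>' q d)) (at s)"
    if pq: "p \<in> Box S \<times> indices" "q \<in> Box S \<times> indices" for p q
  proof (cases "b p q = 0")
    case False
    have p: "fst p \<in> Box S" "snd p \<in> indices" and q: "fst q \<in> Box S" "snd q \<in> indices" using pq by auto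
    obtain i j where adm: "admissible i j (fst p) (snd p)"
      using functional_eH_admissible[OF B_left[OF B] p] False unfolding b_def by blast
    obtain i' j' where adm': "admissible i' j' (fst q) (snd q)"
      using functional_eC_admissible[OF B_right[OF B] q] False unfolding b_def by blast
    have 1: "(\<Phi> p c has_field_derivative \<Phi>' p c) (at s)"
      using series_deriv[OF c adm s] unfolding \<Phi>_def[abs_def] \<Phi>'_def ys_def by (simp add: mult.assoc)
    have 2: "(\<Phi> q d has_field_derivative \<Phi>' q d) (at s)"
      using series_deriv[OF d adm' s] unfolding \<Phi>_def[abs_def] \<Phi>'_def ys_def by (simp add: mult.assoc)
    show ?thesis by (rule derivative_eq_intros 1 2 refl | simp)+
  qed simp
  have "((\<lambda>s. X B (ys s) c d) has_field_derivative
     (\<Sum>p\<in>Box S \<times> indices. \<Sum>q\<in>Box S \<times> indices. b p q * (\<Phi>' p c * \<Phi> q d s + \<Phi> p c s * \<Phi>' q d))) (at s)"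
    unfolding Xb by (intro DERIV_sum deriv)
  also have "(\<Sum>p\<in>Box S \<times> indices. \<Sum>q\<in>Box S \<times> indices. b p q * (\<Phi>' p c * \<Phi> q d s + \<Phi> p c s * \<Phi>' q d)) =
    (\<Sum>p\<in>Box S \<times> indices. \<Sum>q\<in>Box S \<times> indices. \<Sum>k\<le>n. w k * exp (ys s k) *
        (b p q * (\<Phi> p (add_vertex c k) s * \<Phi> q d s) + b p q * (\<Phi> p c s * \<Phi> q (add_vertex d k) s)))"
  proof (intro sum.cong refl)
    fix p q
    show "b p q * (\<Phi>' p c * \<Phi> q d s + \<Phi> p c s * \<Phi>' q d) = (\<Sum>k\<le>n. w k * exp (ys s k) *
        (b p q * (\<Phi> p (add_vertex c k) s * \<Phi> q d s) + b p q * (\<Phi> p c s * \<Phi> q (add_vertex d k) s)))"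
      unfolding \<Phi>'_def sum_distrib_left sum_distrib_right sum.distrib[symmetric]
      by (intro sum.cong refl) (simp add: algebra_simps)
  qed
  also have "\<dots> = (\<Sum>k\<le>n. w k * exp (ys s k) * (X B (ys s) (add_vertex c k) d + X B (ys s) c (add_vertex d k)))"
    unfolding Xb sum.distrib[symmetric] sum_distrib_left
    by (rule sum_rotate)
  finally show ?thesis .
qed

lemma sym_pairing_deriv:
  assumes B: "bilinear_form (relH n S) (relHc n S) B" and s: "s \<in> deep_times y w"
  defines "ys \<equiv> (\<lambda>s k. y k + s * w k)"
  shows "((\<lambda>s. sym_pairing (int n) (\<lambda>i. exp (ys s (nat i))) (X B (ys s))) has_field_derivative 0) (at s)"
proof -
  have "deep (ys s)" using s by (simp add: deep_times_def ys_def)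
  interpret E: euler_pair "int n" "\<lambda>i. exp (ys s (nat i))" "X B (ys s)"
    by (rule euler_pair_X[OF B \<open>deep (ys s)\<close>])
  define w' where "w' i = w (nat i)" for i :: int
  define dX where "dX c d = (\<Sum>m\<in>{0..int n}. w' m * exp (ys s (nat m)) *
      (X B (ys s) (fst c + m, snd c + 1) d + X B (ys s) c (fst d + m, snd d + 1)))" for c d
  have x: "((\<lambda>s. exp (ys s k)) has_field_derivative w k * exp (ys s k)) (at s)" for k
    unfolding ys_def by (rule derivative_eq_intros refl | simp)+
  have Xd: "((\<lambda>s. X B (ys s) c d) has_field_derivative dX c d) (at s)" if "0 \<le> snd c" "0 \<le> snd d" for c d
    using X_deriv[OF B that s] unfolding ys_def dX_def w'_def by (simp add: sum_int add_vertex_def)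
  have t: "((\<lambda>s. exp (ys s (nat i)) * exp (ys s (nat j)) * X B (ys s) c d) has_field_derivative
      exp (ys s (nat i)) * exp (ys s (nat j)) * ((w' i + w' j) * X B (ys s) c d + dX c d)) (at s)"
    if "0 \<le> snd c" "0 \<le> snd d" for i j c d
  proof (rule DERIV_cong[OF DERIV_mult[OF DERIV_mult[OF x x] Xd[OF that]]])
    have "((u * a) * b + (v * b) * a) * p + q * (a * b) = a * b * ((u + v) * p + q)" for a b u v p q :: complex
      by (simp add: algebra_simps)
    then show "(w (nat i) * exp (ys s (nat i)) * exp (ys s (nat j)) + w (nat j) * exp (ys s (nat j)) * exp (ys s (nat i))) * X B (ys s) c d +
       dX c d * (exp (ys s (nat i)) * exp (ys s (nat j))) =
       exp (ys s (nat i)) * exp (ys s (nat j)) * ((w' i + w' j) * X B (ys s) c d + dX c d)"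
      unfolding w'_def .
  qed
  have sym: "sym_pairing (int n) (\<lambda>i. exp (ys s (nat i))) (X B (ys s)) =
     1/2 * (\<Sum>i\<in>{0..int n}. \<Sum>j\<in>{0..int n}. (of_int (i - j))\<^sup>2 * (exp (ys s (nat i)) * exp (ys s (nat j)) * X B (ys s) (0, 0) (i + j, 2)))
     - of_int (int n) / 4 * (\<Sum>i\<in>{0..int n}. \<Sum>j\<in>{0..int n}. of_int (j - i) * (\<Sum>k\<in>{0..int n}. sign_kernel j i k *
         (if 0 < i + j - k \<and> i + j - k < int n then exp (ys s (nat i)) * exp (ys s (nat j)) * X B (ys s) (k, 1) (i + j - k, 1) else 0)))" for s
    unfolding sym_pairing_def pull_into_sum by (simp only: mult.assoc)
  define Der where "Der = 1/2 * (\<Sum>i\<in>{0..int n}. \<Sum>j\<in>{0..int n}. (of_int (i - j))\<^sup>2 * (exp (ys s (nat i)) * exp (ys s (nat j)) *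
          ((w' i + w' j) * X B (ys s) (0, 0) (i + j, 2) + dX (0, 0) (i + j, 2))))
     - of_int (int n) / 4 * (\<Sum>i\<in>{0..int n}. \<Sum>j\<in>{0..int n}. of_int (j - i) * (\<Sum>k\<in>{0..int n}. sign_kernel j i k *
         (if 0 < i + j - k \<and> i + j - k < int n then exp (ys s (nat i)) * exp (ys s (nat j)) *
            ((w' i + w' j) * X B (ys s) (k, 1) (i + j - k, 1) + dX (k, 1) (i + j - k, 1)) else 0)))"
  have deriv: "((\<lambda>s. sym_pairing (int n) (\<lambda>i. exp (ys s (nat i))) (X B (ys s))) has_field_derivative Der) (at s)"
    unfolding sym Der_def
  proof (rule DERIV_diff)
    have t1: "((\<lambda>s. exp (ys s (nat i)) * exp (ys s (nat j)) * X B (ys s) (0, 0) (i + j, 2)) has_field_derivative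
       exp (ys s (nat i)) * exp (ys s (nat j)) * ((w' i + w' j) * X B (ys s) (0, 0) (i + j, 2) + dX (0, 0) (i + j, 2))) (at s)" for i j
      by (rule t) simp_all
    show "((\<lambda>s. 1/2 * (\<Sum>i\<in>{0..int n}. \<Sum>j\<in>{0..int n}. (of_int (i - j))\<^sup>2 * (exp (ys s (nat i)) * exp (ys s (nat j)) * X B (ys s) (0, 0) (i + j, 2))))
      has_field_derivative 1/2 * (\<Sum>i\<in>{0..int n}. \<Sum>j\<in>{0..int n}. (of_int (i - j))\<^sup>2 * (exp (ys s (nat i)) * exp (ys s (nat j)) *
          ((w' i + w' j) * X B (ys s) (0, 0) (i + j, 2) + dX (0, 0) (i + j, 2))))) (at s)"
      by (rule DERIV_cmult, rule DERIV_sum, rule DERIV_sum, rule DERIV_cmult, rule t1)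
    have t2: "((\<lambda>s. if 0 < i + j - k \<and> i + j - k < int n then exp (ys s (nat i)) * exp (ys s (nat j)) * X B (ys s) (k, 1) (i + j - k, 1) else 0)
      has_field_derivative (if 0 < i + j - k \<and> i + j - k < int n then exp (ys s (nat i)) * exp (ys s (nat j)) *
            ((w' i + w' j) * X B (ys s) (k, 1) (i + j - k, 1) + dX (k, 1) (i + j - k, 1)) else 0)) (at s)" for i j k
    proof (cases "0 < i + j - k \<and> i + j - k < int n")
      case True
      show ?thesis unfolding if_P[OF True] by (rule t) simp_all
    next
      case False
      show ?thesis unfolding if_not_P[OF False] by (rule DERIV_const)
    qed
    show "((\<lambda>s. of_int (int n) / 4 * (\<Sum>i\<in>{0..int n}. \<Sum>j\<in>{0..int n}. of_int (j - i) * (\<Sum>k\<in>{0..int n}. sign_kernel j i k *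
         (if 0 < i + j - k \<and> i + j - k < int n then exp (ys s (nat i)) * exp (ys s (nat j)) * X B (ys s) (k, 1) (i + j - k, 1) else 0))))
      has_field_derivative of_int (int n) / 4 * (\<Sum>i\<in>{0..int n}. \<Sum>j\<in>{0..int n}. of_int (j - i) * (\<Sum>k\<in>{0..int n}. sign_kernel j i k *
         (if 0 < i + j - k \<and> i + j - k < int n then exp (ys s (nat i)) * exp (ys s (nat j)) *
            ((w' i + w' j) * X B (ys s) (k, 1) (i + j - k, 1) + dX (k, 1) (i + j - k, 1)) else 0)))) (at s)"
      by (rule DERIV_cmult, rule DERIV_sum, rule DERIV_sum, rule DERIV_cmult, rule DERIV_sum, rule DERIV_cmult, rule t2)
  qed
  have "Der = E.pairing_deriv w'"
  proof -
    have pd: "E.pairing_deriv w' = 1/2 * (\<Sum>i\<in>{0..int n}. \<Sum>j\<in>{0..int n}. (of_int (i - j))\<^sup>2 * exp (ys s (nat i)) * exp (ys s (nat j)) *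
          ((w' i + w' j) * X B (ys s) (0, 0) (i + j, 2) + dX (0, 0) (i + j, 2)))
     - of_int (int n) / 4 * (\<Sum>i\<in>{0..int n}. \<Sum>j\<in>{0..int n}. of_int (j - i) * exp (ys s (nat i)) * exp (ys s (nat j)) * (\<Sum>k\<in>{0..int n}. sign_kernel j i k *
         (if 0 < i + j - k \<and> i + j - k < int n then
            ((w' i + w' j) * X B (ys s) (k, 1) (i + j - k, 1) + dX (k, 1) (i + j - k, 1)) else 0)))"
      unfolding E.pairing_deriv_def Let_def dX_def by (rule refl)
    show ?thesis
      unfolding pd Der_def
      by (rule arg_cong2[where f = "(-)"]; rule arg_cong2[where f = "(*)", OF refl]; rule sum.cong[OF refl]; rule sum.cong[OF refl])
         (simp only: mult.assoc, rule pull_into_sum[symmetric])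
  qed
  then have "Der = 0" using E.pairing_deriv_zero by simp
  with deriv show ?thesis by (rule DERIV_cong)
qed

text \<open>The derivative is \<open>pairing_deriv\<close>, which is zero.\<close>

lemma sym_pairing_constant:
  assumes B: "bilinear_form (relH n S) (relHc n S) B" and st: "s \<in> deep_times y w" "t \<in> deep_times y w"
  shows "sym_pairing (int n) (\<lambda>i. exp (y (nat i) + s * w (nat i))) (X B (\<lambda>k. y k + s * w k)) =
         sym_pairing (int n) (\<lambda>i. exp (y (nat i) + t * w (nat i))) (X B (\<lambda>k. y k + t * w k))"
proof -
  have "\<exists>c. \<forall>s\<in>deep_times y w. sym_pairing (int n) (\<lambda>i. exp (y (nat i) + s * w (nat i))) (X B (\<lambda>k. y k + s * w k)) = c"
    by (rule has_field_derivative_zero_constant[OF convex_deep_times])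
       (rule has_field_derivative_at_within[OF sym_pairing_deriv[OF B]])
  then obtain c where c: "\<forall>s\<in>deep_times y w. sym_pairing (int n) (\<lambda>i. exp (y (nat i) + s * w (nat i))) (X B (\<lambda>k. y k + s * w k)) = c" ..
  show ?thesis by (rule trans[OF bspec[OF c st(1)] bspec[OF c st(2), symmetric]])
qed

end

section \<open>The Gamma pairing under a bilinear form\<close>

lemma sum_ordered_pairs:
  fixes f :: "nat \<Rightarrow> nat \<Rightarrow> complex"
  assumes "\<And>i j. f i j = f j i" "\<And>i. f i i = 0"
  shows "(\<Sum>(i, j) | i < j \<and> j \<le> n. f i j) = 1/2 * (\<Sum>i\<le>n. \<Sum>j\<le>n. f i j)"
proof -
  define A where "A = {(i, j). i < j \<and> j \<le> n}"
  define A' where "A' = {(i, j). j < i \<and> i \<le> n}"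
  define E where "E = {(i, j). i = j \<and> i \<le> n}"
  have un: "{..n} \<times> {..n} = A \<union> A' \<union> E" unfolding A_def A'_def E_def by auto
  have "finite ({..n} \<times> {..n})" by simp
  then have fin: "finite A" "finite A'" "finite E" unfolding un by auto
  have disj: "A \<inter> A' = {}" "(A \<union> A') \<inter> E = {}" unfolding A_def A'_def E_def by auto
  have "(\<Sum>i\<le>n. \<Sum>j\<le>n. f i j) = (\<Sum>(i, j)\<in>{..n} \<times> {..n}. f i j)" by (rule sum.cartesian_product)
  also have "\<dots> = (\<Sum>(i, j)\<in>A. f i j) + (\<Sum>(i, j)\<in>A'. f i j) + (\<Sum>(i, j)\<in>E. f i j)"
    unfolding un using fin disj by (simp add: sum.union_disjoint)
  also have "(\<Sum>(i, j)\<in>E. f i j) = 0" by (rule sum.neutral) (auto simp: E_def assms(2))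
  also have "(\<Sum>(i, j)\<in>A'. f i j) = (\<Sum>(i, j)\<in>A. f i j)"
    by (rule sum.reindex_bij_witness[of _ prod.swap prod.swap]) (auto simp: A_def A'_def assms(1))
  finally show ?thesis by (simp add: A_def)
qed

context fan begin

text \<open>The sum of the Gamma series in one sector.\<close>

definition gammaH :: "int \<times> int \<Rightarrow> (nat \<Rightarrow> complex) \<Rightarrow> int \<times> int \<Rightarrow> freeH" where
  "gammaH c y \<gamma> = (\<Sum>M\<in>indices. cscale (series \<gamma> M c y) (eH \<gamma> M))"

definition gammaC :: "int \<times> int \<Rightarrow> (nat \<Rightarrow> complex) \<Rightarrow> int \<times> int \<Rightarrow> freeHc" where
  "gammaC c y \<gamma> = (\<Sum>M\<in>indices. cscale (series \<gamma> M c y) (eC \<gamma> M))"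

lemma weighted_series_has_sum:
  assumes c: "0 \<le> snd c" and y: "deep y" and w: "tame w" and \<gamma>: "\<gamma> \<in> Box S"
  shows "((\<lambda>l. \<Sum>M\<in>indices. w \<gamma> M * jet n M y l) has_sum (\<Sum>M\<in>indices. w \<gamma> M * series \<gamma> M c y)) (Lset n S c \<gamma>)"
proof (rule has_sum_finite_sum[OF finite_indices])
  fix M assume M: "M \<in> indices"
  show "((\<lambda>l. w \<gamma> M * jet n M y l) has_sum w \<gamma> M * series \<gamma> M c y) (Lset n S c \<gamma>)"
  proof (cases "w \<gamma> M = 0")
    case False
    then obtain i j where "admissible i j \<gamma> M" using w \<gamma> M unfolding tame_def by blast
    from series_has_sum[OF c this y] show ?thesis by (rule has_sum_cmult_right)
  qed simp
qed

lemma quot_has_sum_gammaH: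
  assumes c: "0 \<le> snd c" and y: "deep y" and \<gamma>: "\<gamma> \<in> Box S"
  shows "quot_has_sum (relH n S) (Gamma_term n y \<gamma>) (Lset n S c \<gamma>) (gammaH c y \<gamma>)"
  unfolding quot_has_sum_iff
proof (intro allI impI)
  fix \<phi> assume \<phi>: "functional (relH n S) \<phi>"
  show "((\<lambda>l. \<phi> (Gamma_term n y \<gamma> l)) has_sum \<phi> (gammaH c y \<gamma>)) (Lset n S c \<gamma>)"
    using weighted_series_has_sum[OF c y tame_eH[OF \<phi>] \<gamma>]
    by (simp add: functional_Gamma_term[OF \<phi> \<gamma>] gammaH_def functional_sum[OF \<phi>] functional_scale[OF \<phi>] mult.commute)
qed

lemma quot_has_sum_gammaC:
  assumes d: "0 < fst d" "fst d < int n * snd d" and y: "deep y" and \<gamma>: "\<gamma> \<in> Box S"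
  shows "quot_has_sum (relHc n S) (Gammao_term n y \<gamma>) (Lset n S d \<gamma>) (gammaC d y \<gamma>)"
  unfolding quot_has_sum_iff
proof (intro allI impI)
  fix \<psi> assume \<psi>: "functional (relHc n S) \<psi>"
  have "0 \<le> snd d" by (rule snd_nonneg[of "fst d"]) (use d in auto)
  from weighted_series_has_sum[OF this y tame_eC[OF \<psi>] \<gamma>]
  have "((\<lambda>l. \<psi> (Gammao_term n y \<gamma> l)) has_sum (\<Sum>M\<in>indices. \<psi> (eC \<gamma> M) * series \<gamma> M d y)) (Lset n S d \<gamma>)"
    by (rule has_sum_cong[THEN iffD2, rotated]) (rule functional_Gammao_term[OF \<psi> d \<gamma>])
  then show "((\<lambda>l. \<psi> (Gammao_term n y \<gamma> l)) has_sum \<psi> (gammaC d y \<gamma>)) (Lset n S d \<gamma>)"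
    by (simp add: gammaC_def functional_sum[OF \<psi>] functional_scale[OF \<psi>] mult.commute)
qed

text \<open>Limits are unique under every functional, so the choice of a representative is immaterial.\<close>

lemma functional_quot_SOME:
  assumes "functional W \<phi>" "quot_has_sum W f A u"
  shows "\<phi> (SOME u. quot_has_sum W f A u) = \<phi> u"
proof -
  have "quot_has_sum W f A (SOME u. quot_has_sum W f A u)" using assms(2) by (rule someI)
  then show ?thesis using assms unfolding quot_has_sum_iff by (blast intro: has_sum_unique)
qed

lemma functional_Gamma_series:
  assumes c: "0 \<le> snd c" and y: "deep y" and \<phi>: "functional (relH n S) \<phi>"
  shows "\<phi> (Gamma_series n S y c) = combination (\<lambda>\<gamma> M. \<phi> (eH \<gamma> M)) c y"
proof -
  have "\<phi> (Gamma_series n S y c) = (\<Sum>\<gamma>\<in>Box S. \<phi> (gammaH c y \<gamma>))"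
    unfolding Gamma_series_def functional_sum[OF \<phi>]
    by (intro sum.cong refl functional_quot_SOME[OF \<phi> quot_has_sum_gammaH[OF c y]])
  then show ?thesis
    by (simp add: gammaH_def combination_def functional_sum[OF \<phi>] functional_scale[OF \<phi>] mult.commute)
qed

lemma functional_Gammao_series:
  assumes d: "0 < fst d" "fst d < int n * snd d" and y: "deep y" and \<psi>: "functional (relHc n S) \<psi>"
  shows "\<psi> (Gammao_series n S y d) = combination (\<lambda>\<gamma> M. \<psi> (eC \<gamma> M)) d y"
proof -
  have "\<psi> (Gammao_series n S y d) = (\<Sum>\<gamma>\<in>Box S. \<psi> (gammaC d y \<gamma>))"
    unfolding Gammao_series_def functional_sum[OF \<psi>]
    by (intro sum.cong refl functional_quot_SOME[OF \<psi> quot_has_sum_gammaC[OF d y]])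
  then show ?thesis
    by (simp add: gammaC_def combination_def functional_sum[OF \<psi>] functional_scale[OF \<psi>] mult.commute)
qed

lemma Gamma_series_pair:
  assumes B: "bilinear_form (relH n S) (relHc n S) B" and y: "deep y"
    and c: "0 \<le> snd c" and d: "0 < fst d" "fst d < int n * snd d"
  shows "B (Gamma_series n S y c) (Gammao_series n S y d) = X B y c d"
proof -
  have "B (Gamma_series n S y c) (Gammao_series n S y d) = combination (\<lambda>\<gamma> M. B (eH \<gamma> M) (Gammao_series n S y d)) c y"
    by (rule functional_Gamma_series[OF c y B_left[OF B]])
  also have "\<dots> = X B y c d"
    unfolding X_def by (simp only: functional_Gammao_series[OF d y B_right[OF B]])
  finally show ?thesis .
qed

lemma pair_splits_eq:
  assumes "i < j" "j \<le> n"
  shows "pair_splits n i j = (\<lambda>k. ((k, 1 :: int), (int i + int j - k, 1 :: int))) `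
      {k \<in> {int i..int j}. 0 < int i + int j - k \<and> int i + int j - k < int n}"
proof -
  have cone: "(a, 1) \<in> lattice_points (cone2 i j) \<longleftrightarrow> int i \<le> a \<and> a \<le> int j" for a
    using assms of_int_le_iff[of "int i" a, where 'a = real] of_int_le_iff[of a "int j", where 'a = real]
    by (simp add: lattice_points_def embed_def cone2_iff del: of_int_le_iff)
  have int: "(a, 1) \<in> lattice_points (interior (cone2 0 n)) \<longleftrightarrow> 0 < a \<and> a < int n" for a
    by (simp add: interior_lattice)
  show ?thesis
  proof (intro set_eqI iffI)
    fix p assume p: "p \<in> pair_splits n i j"
    obtain k e a b where [simp]: "p = ((k, e), (a, b))" by (metis surj_pair)
    have e: "e = 1" "b = 1" "a = int i + int j - k" using p by (auto simp: pair_splits_def vlat_def)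
    then show "p \<in> (\<lambda>k. ((k, 1 :: int), (int i + int j - k, 1 :: int))) ` {k \<in> {int i..int j}. 0 < int i + int j - k \<and> int i + int j - k < int n}"
      using p by (simp add: pair_splits_def cone int)
  next
    fix p assume "p \<in> (\<lambda>k. ((k, 1 :: int), (int i + int j - k, 1 :: int))) ` {k \<in> {int i..int j}. 0 < int i + int j - k \<and> int i + int j - k < int n}"
    then obtain k where k: "p = ((k, 1), (int i + int j - k, 1))" "int i \<le> k" "k \<le> int j" "0 < int i + int j - k" "int i + int j - k < int n" by auto
    then show "p \<in> pair_splits n i j" by (simp add: pair_splits_def cone int vlat_def)
  qed
qed

text \<open>The weight \<open>\<delta>\<close> of a splitting is half of the sign kernel, which also vanishes for \<open>k\<close> outside \<open>[i, j]\<close>.\<close>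

lemma sum_pair_splits:
  fixes f :: "int \<times> int \<Rightarrow> int \<times> int \<Rightarrow> complex"
  assumes ij: "i < j" "j \<le> n"
  shows "(\<Sum>(c, d)\<in>pair_splits n i j. pair_weight i j c * f c d) =
    1/2 * (\<Sum>k\<in>{0..int n}. sign_kernel (int j) (int i) k * (if 0 < int i + int j - k \<and> int i + int j - k < int n then f (k, 1) (int i + int j - k, 1) else 0))"
proof -
  let ?P = "\<lambda>k. 0 < int i + int j - k \<and> int i + int j - k < int n"
  have weight: "pair_weight i j (k, 1) = 1/2 * sign_kernel (int j) (int i) k" if "k \<in> {int i..int j}" for k
  proof -
    have "embed (k, 1) \<in> interior (cone2 i j) \<longleftrightarrow> int i < k \<and> k < int j"
      using ij of_int_less_iff[of "int i" k, where 'a = real] of_int_less_iff[of k "int j", where 'a = real]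
      by (simp add: embed_def interior_cone2_iff del: of_int_less_iff)
    then show ?thesis using that ij by (auto simp: pair_weight_def sign_kernel_def sgn_if)
  qed
  have "(\<Sum>(c, d)\<in>pair_splits n i j. pair_weight i j c * f c d) =
     (\<Sum>k\<in>{k \<in> {int i..int j}. ?P k}. pair_weight i j (k, 1) * f (k, 1) (int i + int j - k, 1))"
    unfolding pair_splits_eq[OF ij] by (subst sum.reindex) (auto simp: inj_on_def)
  also have "\<dots> = (\<Sum>k\<in>{int i..int j}. if ?P k then pair_weight i j (k, 1) * f (k, 1) (int i + int j - k, 1) else 0)"
    by (rule sum.inter_filter) simp
  also have "\<dots> = (\<Sum>k\<in>{int i..int j}. 1/2 * (sign_kernel (int j) (int i) k * (if ?P k then f (k, 1) (int i + int j - k, 1) else 0)))"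
    using weight by (intro sum.cong refl) simp
  also have "\<dots> = (\<Sum>k\<in>{0..int n}. 1/2 * (sign_kernel (int j) (int i) k * (if ?P k then f (k, 1) (int i + int j - k, 1) else 0)))"
    using ij by (intro sum.mono_neutral_left) (auto simp: sign_kernel_def sgn_if)
  finally show ?thesis unfolding sum_distrib_left .
qed

lemma linear_Gamma_pairing:
  assumes \<Lambda>: "Vector_Spaces.linear pm_scale (*) \<Lambda>" and B: "bilinear_form (relH n S) (relHc n S) (\<lambda>u v. \<Lambda> (u \<otimes> v))"
    and y: "deep y" and x: "\<And>k. k \<le> n \<Longrightarrow> x k = exp (y k)"
  shows "\<Lambda> (Gamma_pairing n S x y) = sym_pairing (int n) (\<lambda>i. exp (y (nat i))) (X (\<lambda>u v. \<Lambda> (u \<otimes> v)) y)"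
proof -
  interpret L: Vector_Spaces.linear "pm_scale :: complex \<Rightarrow> (int \<times> int, Hc_gen) free_tensor \<Rightarrow> _" "(*)" \<Lambda> by (rule \<Lambda>)
  define XX where "XX = X (\<lambda>u v. \<Lambda> (u \<otimes> v)) y"
  have pair: "\<Lambda> (Gamma_series n S y c \<otimes> Gammao_series n S y d) = XX c d"
    if "0 \<le> snd c" "0 < fst d" "fst d < int n * snd d" for c d
    using Gamma_series_pair[OF B y that] by (simp add: XX_def)
  define f where "f i j = (of_int (int i - int j))\<^sup>2 * exp (y i) * exp (y j) * XX (0, 0) (int i + int j, 2)" for i j
  define g where "g i j = of_int (int j - int i) * exp (y i) * exp (y j) * (\<Sum>k\<in>{0..int n}. sign_kernel (int j) (int i) k *
     (if 0 < int i + int j - k \<and> int i + int j - k < int n then XX (k, 1) (int i + int j - k, 1) else 0))" for i j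
  have "\<Lambda> (\<Sum>(i, j) | i < j \<and> j \<le> n. pm_scale ((of_nat j - of_nat i)\<^sup>2 * x i * x j)
          (Gamma_series n S y (0, 0) \<otimes> Gammao_series n S y (fst (vlat i) + fst (vlat j), snd (vlat i) + snd (vlat j)))) =
      (\<Sum>(i, j) | i < j \<and> j \<le> n. f i j)"
    unfolding L.sum
  proof (intro sum.cong refl)
    fix p assume p: "p \<in> {(i, j). i < j \<and> j \<le> n}"
    obtain i j where [simp]: "p = (i, j)" by (cases p)
    have ij: "i < j" "j \<le> n" using p by auto
    have "\<Lambda> (Gamma_series n S y (0, 0) \<otimes> Gammao_series n S y (int i + int j, 2)) = XX (0, 0) (int i + int j, 2)"
      by (rule pair) (use ij in auto)
    then show "\<Lambda> (case p of (i, j) \<Rightarrow> pm_scale ((of_nat j - of_nat i)\<^sup>2 * x i * x j)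
          (Gamma_series n S y (0, 0) \<otimes> Gammao_series n S y (fst (vlat i) + fst (vlat j), snd (vlat i) + snd (vlat j)))) =
       (case p of (i, j) \<Rightarrow> f i j)"
      using ij by (simp add: L.scale vlat_def f_def x power2_commute[of "of_nat j"])
  qed
  also have "\<dots> = 1/2 * (\<Sum>i\<le>n. \<Sum>j\<le>n. f i j)"
    by (rule sum_ordered_pairs) (simp_all add: f_def add.commute power2_commute mult_ac)
  finally have 1: "\<Lambda> (\<Sum>(i, j) | i < j \<and> j \<le> n. pm_scale ((of_nat j - of_nat i)\<^sup>2 * x i * x j)
          (Gamma_series n S y (0, 0) \<otimes> Gammao_series n S y (fst (vlat i) + fst (vlat j), snd (vlat i) + snd (vlat j)))) =
      1/2 * (\<Sum>i\<le>n. \<Sum>j\<le>n. f i j)" .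
  have "\<Lambda> (\<Sum>(i, j) | i < j \<and> j \<le> n. pm_scale (of_nat n * (of_nat j - of_nat i) * x i * x j)
          (\<Sum>(c, d)\<in>pair_splits n i j. pm_scale (pair_weight i j c) (Gamma_series n S y c \<otimes> Gammao_series n S y d))) =
      (\<Sum>(i, j) | i < j \<and> j \<le> n. of_int (int n) / 2 * g i j)"
    unfolding L.sum
  proof (intro sum.cong refl)
    fix p assume p: "p \<in> {(i, j). i < j \<and> j \<le> n}"
    obtain i j where [simp]: "p = (i, j)" by (cases p)
    have ij: "i < j" "j \<le> n" using p by auto
    have "\<Lambda> (\<Sum>(c, d)\<in>pair_splits n i j. pm_scale (pair_weight i j c) (Gamma_series n S y c \<otimes> Gammao_series n S y d)) =
       (\<Sum>(c, d)\<in>pair_splits n i j. pair_weight i j c * XX c d)"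
      unfolding L.sum
    proof (intro sum.cong refl)
      fix q assume q: "q \<in> pair_splits n i j"
      obtain c d where [simp]: "q = (c, d)" by (cases q)
      have "snd c = 1" "0 < fst d" "fst d < int n * snd d"
        using q interior_lattice[of d] by (auto simp: pair_splits_def)
      then have "\<Lambda> (Gamma_series n S y c \<otimes> Gammao_series n S y d) = XX c d" by (intro pair) auto
      then show "\<Lambda> (case q of (c, d) \<Rightarrow> pm_scale (pair_weight i j c) (Gamma_series n S y c \<otimes> Gammao_series n S y d)) =
          (case q of (c, d) \<Rightarrow> pair_weight i j c * XX c d)"
        by (simp add: L.scale)
    qed
    then show "\<Lambda> (case p of (i, j) \<Rightarrow> pm_scale (of_nat n * (of_nat j - of_nat i) * x i * x j)
          (\<Sum>(c, d)\<in>pair_splits n i j. pm_scale (pair_weight i j c) (Gamma_series n S y c \<otimes> Gammao_series n S y d))) =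
       (case p of (i, j) \<Rightarrow> of_int (int n) / 2 * g i j)"
      using ij unfolding sum_pair_splits[OF ij] by (simp add: L.scale g_def x)
  qed
  also have "\<dots> = 1/2 * (\<Sum>i\<le>n. \<Sum>j\<le>n. of_int (int n) / 2 * g i j)"
  proof (rule sum_ordered_pairs)
    fix i j
    have "(\<Sum>k\<in>{0..int n}. sign_kernel (int j) (int i) k * (if 0 < int i + int j - k \<and> int i + int j - k < int n then XX (k, 1) (int i + int j - k, 1) else 0)) =
      - (\<Sum>k\<in>{0..int n}. sign_kernel (int i) (int j) k * (if 0 < int j + int i - k \<and> int j + int i - k < int n then XX (k, 1) (int j + int i - k, 1) else 0))"
      unfolding sum_negf[symmetric] by (intro sum.cong refl) (simp add: sign_kernel_swap[of "int j"] add.commute)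
    then show "of_int (int n) / 2 * g i j = of_int (int n) / 2 * g j i"
      unfolding g_def by (simp add: algebra_simps)
    show "of_int (int n) / 2 * g i i = 0" by (simp add: g_def)
  qed
  finally have 2: "\<Lambda> (\<Sum>(i, j) | i < j \<and> j \<le> n. pm_scale (of_nat n * (of_nat j - of_nat i) * x i * x j)
          (\<Sum>(c, d)\<in>pair_splits n i j. pm_scale (pair_weight i j c) (Gamma_series n S y c \<otimes> Gammao_series n S y d))) =
      of_int (int n) / 4 * (\<Sum>i\<le>n. \<Sum>j\<le>n. g i j)"
    by (simp add: sum_distrib_left)
  show ?thesis
    unfolding Gamma_pairing_def L.diff 1 2 sym_pairing_def sum_int XX_def[symmetric] f_def g_def nat_int ..
qed

lemma Gamma_converges_deep:
  assumes "deep y" shows "c \<in> lattice_points (cone2 0 n) \<Longrightarrow> Gamma_converges n S y c"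
    "d \<in> lattice_points (interior (cone2 0 n)) \<Longrightarrow> Gammao_converges n S y d"
proof -
  assume c: "c \<in> lattice_points (cone2 0 n)"
  have "0 \<le> snd c" using c snd_nonneg unfolding cone_lattice by blast
  from quot_has_sum_gammaH[OF this assms] show "Gamma_converges n S y c"
    unfolding Gamma_converges_def by (intro ballI exI)
next
  assume d: "d \<in> lattice_points (interior (cone2 0 n))"
  have "0 < fst d" "fst d < int n * snd d" using d unfolding interior_lattice by auto
  from quot_has_sum_gammaC[OF this assms] show "Gammao_converges n S y d"
    unfolding Gammao_converges_def by (intro ballI exI)
qed

end

section \<open>Exponential growth along rays of the height cone\<close>

text \<open>Exponential growth of rate at most \<open>G\<close>, up to polynomial factors. The polynomial factors are due to the
  logarithms in the Taylor coefficients.\<close>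

definition grow :: "real \<Rightarrow> (real \<Rightarrow> complex) \<Rightarrow> bool" where
  "grow G f \<longleftrightarrow> (\<exists>C p. 0 \<le> C \<and> (\<forall>t\<ge>0. cmod (f t) \<le> C * (1 + t) ^ p * exp (G * t)))"

lemma growI: "0 \<le> C \<Longrightarrow> (\<And>t. 0 \<le> t \<Longrightarrow> cmod (f t) \<le> C * (1 + t) ^ p * exp (G * t)) \<Longrightarrow> grow G f"
  unfolding grow_def by blast

lemma grow_mono:
  assumes "grow G f" "G \<le> G'" shows "grow G' f"
proof -
  obtain C p where C: "0 \<le> C" "\<And>t. 0 \<le> t \<Longrightarrow> cmod (f t) \<le> C * (1 + t) ^ p * exp (G * t)"
    using assms(1) unfolding grow_def by blast
  show ?thesis
  proof (rule growI[OF C(1)])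
    fix t :: real assume t: "0 \<le> t"
    have "cmod (f t) \<le> C * (1 + t) ^ p * exp (G * t)" by (rule C(2)[OF t])
    also have "\<dots> \<le> C * (1 + t) ^ p * exp (G' * t)"
      using C(1) t assms(2) by (intro mult_left_mono) (auto intro!: mult_right_mono)
    finally show "cmod (f t) \<le> C * (1 + t) ^ p * exp (G' * t)" .
  qed
qed

lemma grow_add:
  assumes "grow G f" "grow G g" shows "grow G (\<lambda>t. f t + g t)"
proof -
  obtain C p where C: "0 \<le> C" "\<And>t. 0 \<le> t \<Longrightarrow> cmod (f t) \<le> C * (1 + t) ^ p * exp (G * t)"
    using assms(1) unfolding grow_def by blast
  obtain C' p' where C': "0 \<le> C'" "\<And>t. 0 \<le> t \<Longrightarrow> cmod (g t) \<le> C' * (1 + t) ^ p' * exp (G * t)"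
    using assms(2) unfolding grow_def by blast
  show ?thesis
  proof (rule growI[of "C + C'" _ "p + p'"])
    fix t :: real assume t: "0 \<le> t"
    have "cmod (f t + g t) \<le> C * (1 + t) ^ p * exp (G * t) + C' * (1 + t) ^ p' * exp (G * t)"
      by (rule order_trans[OF norm_triangle_ineq add_mono[OF C(2)[OF t] C'(2)[OF t]]])
    also have "\<dots> \<le> C * (1 + t) ^ (p + p') * exp (G * t) + C' * (1 + t) ^ (p + p') * exp (G * t)"
      using C(1) C'(1) t by (intro add_mono mult_right_mono mult_left_mono power_increasing) auto
    finally show "cmod (f t + g t) \<le> (C + C') * (1 + t) ^ (p + p') * exp (G * t)" by (simp add: distrib_right)
  qed (use C(1) C'(1) in simp)
qed

lemma grow_mult:
  assumes "grow G f" "grow G' g" shows "grow (G + G') (\<lambda>t. f t * g t)"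
proof -
  obtain C p where C: "0 \<le> C" "\<And>t. 0 \<le> t \<Longrightarrow> cmod (f t) \<le> C * (1 + t) ^ p * exp (G * t)"
    using assms(1) unfolding grow_def by blast
  obtain C' p' where C': "0 \<le> C'" "\<And>t. 0 \<le> t \<Longrightarrow> cmod (g t) \<le> C' * (1 + t) ^ p' * exp (G' * t)"
    using assms(2) unfolding grow_def by blast
  show ?thesis
  proof (rule growI[of "C * C'" _ "p + p'"])
    fix t :: real assume t: "0 \<le> t"
    have "cmod (f t * g t) \<le> (C * (1 + t) ^ p * exp (G * t)) * (C' * (1 + t) ^ p' * exp (G' * t))"
      unfolding norm_mult using C(1) t by (intro mult_mono C(2)[OF t] C'(2)[OF t]) auto
    also have "\<dots> = (C * C') * ((1 + t) ^ p * (1 + t) ^ p') * (exp (G * t) * exp (G' * t))" by (simp only: mult_ac)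
    also have "\<dots> = C * C' * (1 + t) ^ (p + p') * exp ((G + G') * t)"
      by (simp only: power_add distrib_right exp_add)
    finally show "cmod (f t * g t) \<le> C * C' * (1 + t) ^ (p + p') * exp ((G + G') * t)" .
  qed (use C(1) C'(1) in simp)
qed

lemma grow_const: "grow 0 (\<lambda>t. c)"
  by (rule growI[of "cmod c" _ 0]) auto

lemma grow_cmult: "grow G f \<Longrightarrow> grow G (\<lambda>t. c * f t)"
  using grow_mult[OF grow_const] by fastforce

lemma grow_minus: "grow G f \<Longrightarrow> grow G (\<lambda>t. - f t)"
  unfolding grow_def by simp

lemma grow_exp:
  assumes "\<And>t. Re (f t) = a - G * t" shows "grow (- G) (\<lambda>t. exp (f t))"
  by (rule growI[of "exp a" _ 0]) (simp_all add: assms exp_diff exp_minus divide_inverse)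

lemma grow_negative_tendsto:
  assumes "grow G f" "G < 0" shows "(f \<longlongrightarrow> 0) at_top"
proof -
  obtain C p where C: "0 \<le> C" "\<And>t. 0 \<le> t \<Longrightarrow> cmod (f t) \<le> C * (1 + t) ^ p * exp (G * t)"
    using assms(1) unfolding grow_def by blast
  have "((\<lambda>t. C * (1 + t) ^ p * exp (G * t)) \<longlongrightarrow> 0) at_top"
    using assms(2) by real_asymp
  moreover have "\<forall>\<^sub>F t in at_top. cmod (f t) \<le> C * (1 + t) ^ p * exp (G * t)"
    using eventually_ge_at_top[of "0 :: real"] by eventually_elim (rule C(2))
  ultimately show ?thesis by (rule Lim_null_comparison[rotated])
qed

context fan begin

text \<open>The logarithms of \<open>x\<^sub>k exp (- t h\<^sub>k)\<close>.\<close>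

definition ray :: "(nat \<Rightarrow> complex) \<Rightarrow> (nat \<Rightarrow> real) \<Rightarrow> real \<Rightarrow> nat \<Rightarrow> complex" where
  "ray y h t = (\<lambda>k. y k - of_real t * of_real (h k))"

lemma Re_ray: "(\<lambda>k. - Re (ray y h t k)) = (\<lambda>k. 1 * - Re (y k) + t * h k)"
  by (rule ext) (simp add: ray_def)

lemma deep_ray:
  assumes y: "deep y" and h: "h \<in> height_cone n S" and t: "0 \<le> t"
  shows "deep (ray y h t)"
  unfolding deep_def Re_ray margin_linear
proof (intro allI impI)
  fix i j k assume ijk: "i < j \<and> adjacent S i j \<and> k \<le> n \<and> k \<noteq> i \<and> k \<noteq> j"
  have "decay < margin (\<lambda>k. - Re (y k)) i j k" using y ijk unfolding deep_def by blast
  moreover have "0 < margin h i j k" using h ijk unfolding height_cone_iff by blast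
  then have "0 \<le> t * margin h i j k" using t by simp
  ultimately show "decay < 1 * margin (\<lambda>k. - Re (y k)) i j k + t * margin h i j k" by simp
qed

lemma grow_ray_product: "\<exists>Q p. 0 \<le> Q \<and> (\<forall>t\<ge>0. (\<Prod>k\<le>n. (1 + cmod (ray y h t k)) ^ count M k) \<le> Q * (1 + t) ^ p)"
proof (intro exI conjI allI impI)
  let ?Q = "\<Prod>k\<le>n. (1 + cmod (y k) + \<bar>h k\<bar>) ^ count M k"
  let ?p = "\<Sum>k\<le>n. count M k"
  show "0 \<le> ?Q" by (intro prod_nonneg) auto
  fix t :: real assume t: "0 \<le> t"
  have "(\<Prod>k\<le>n. (1 + cmod (ray y h t k)) ^ count M k) \<le> (\<Prod>k\<le>n. ((1 + cmod (y k) + \<bar>h k\<bar>) * (1 + t)) ^ count M k)"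
  proof (intro prod_mono conjI power_mono)
    fix k
    have "cmod (ray y h t k) \<le> cmod (y k) + t * \<bar>h k\<bar>"
      using norm_triangle_ineq4[of "y k" "of_real t * of_real (h k)"] t by (simp add: ray_def norm_mult)
    moreover have "(1 + cmod (y k) + \<bar>h k\<bar>) * (1 + t) = 1 + cmod (y k) + \<bar>h k\<bar> + t + cmod (y k) * t + t * \<bar>h k\<bar>"
      by (simp add: algebra_simps)
    moreover have "0 \<le> cmod (y k) * t" "0 \<le> \<bar>h k\<bar>" using t by simp_all
    ultimately show "1 + cmod (ray y h t k) \<le> (1 + cmod (y k) + \<bar>h k\<bar>) * (1 + t)" using t by linarith
  qed auto
  also have "\<dots> = ?Q * (1 + t) ^ ?p" by (simp add: power_mult_distrib prod.distrib power_sum)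
  finally show "(\<Prod>k\<le>n. (1 + cmod (ray y h t k)) ^ count M k) \<le> ?Q * (1 + t) ^ ?p" .
qed

text \<open>The exponents concentrated on the cone \<open>\<sigma>\<^sub>i\<^sub>j\<close>, which give the terms of largest growth.\<close>

definition leading :: "nat \<Rightarrow> nat \<Rightarrow> int \<times> int \<Rightarrow> int \<times> int \<Rightarrow> (nat \<Rightarrow> rat) set" where
  "leading i j c \<gamma> = {l \<in> Lset n S c \<gamma>. \<forall>k\<in>off i j. l k = 0}"

lemma finite_leading:
  assumes "i < j" "adjacent S i j" shows "finite (leading i j c \<gamma>)"
proof (cases "leading i j c \<gamma> = {}")
  case False
  then obtain l where l: "l \<in> leading i j c \<gamma>" by blast
  have "leading i j c \<gamma> \<subseteq> {l}"
  proof
    fix l' assume l': "l' \<in> leading i j c \<gamma>"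
    have "l' = l"
      by (rule supported_determined[OF assms, of l' c \<gamma> l \<gamma>]) (use l l' in \<open>auto simp: leading_def\<close>)
    then show "l' \<in> {l}" by simp
  qed
  then show ?thesis by (rule finite_subset) simp
qed simp

text \<open>Along the ray the bound of \<open>jet_decay\<close> improves by the factor \<open>exp (- t \<epsilon>)\<close>, where \<open>\<epsilon>\<close> is any lower bound of the
  total margin of \<open>l\<close> for \<open>h\<close>.\<close>

lemma jet_ray_bound:
  assumes c: "0 \<le> snd c" and y: "deep y" and adm: "admissible i j \<gamma> M"
  shows "\<exists>Q p. 0 \<le> Q \<and> (\<forall>t\<ge>0. \<forall>l\<in>supported i j c \<gamma>. \<forall>\<epsilon>. \<epsilon> \<le> (\<Sum>k\<in>off i j. real_of_rat (l k) * margin h i j k) \<longrightarrow>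
     cmod (jet n M (ray y h t) l) \<le> Q * (1 + t) ^ p * exp ((chord h i j (of_int (fst c)) (of_int (snd c)) - \<epsilon>) * t)
        * exp (- (\<Sum>k\<in>off i j. real_of_rat (l k))))"
proof -
  have ij: "i < j" "adjacent S i j" using adm unfolding admissible_def by auto
  obtain C where C: "C > 0" "\<And>i j \<gamma> M y l. i < j \<Longrightarrow> adjacent S i j \<Longrightarrow> l \<in> supported i j c \<gamma> \<Longrightarrow>
     cmod (jet n M y l) \<le> C * (\<Prod>k\<le>n. (1 + cmod (y k)) ^ count M k)
        * exp (chord (\<lambda>k. - Re (y k)) i j (of_int (fst c)) (of_int (snd c)))
        * exp (- (\<Sum>k\<in>off i j. real_of_rat (l k) * (margin (\<lambda>k. - Re (y k)) i j k - decay)))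
        * exp (- (\<Sum>k\<in>off i j. real_of_rat (l k)))"
    using jet_decay[OF c] by blast
  obtain Q p where Q: "0 \<le> Q" "\<And>t. 0 \<le> t \<Longrightarrow> (\<Prod>k\<le>n. (1 + cmod (ray y h t k)) ^ count M k) \<le> Q * (1 + t) ^ p"
    using grow_ray_product[of y h M] by blast
  define a where "a = chord (\<lambda>k. - Re (y k)) i j (of_int (fst c)) (of_int (snd c))"
  define b where "b = chord h i j (of_int (fst c)) (of_int (snd c))"
  show ?thesis
  proof (intro exI[of _ "C * Q * exp a"] exI[of _ p] conjI allI impI ballI)
    show "0 \<le> C * Q * exp a" using C(1) Q(1) by simp
    fix t \<epsilon> :: real and l
    assume t: "0 \<le> t" and l: "l \<in> supported i j c \<gamma>" and \<epsilon>: "\<epsilon> \<le> (\<Sum>k\<in>off i j. real_of_rat (l k) * margin h i j k)"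
    define W where "W = exp (- (\<Sum>k\<in>off i j. real_of_rat (l k)))"
    define P where "P = (\<Prod>k\<le>n. (1 + cmod (ray y h t k)) ^ count M k)"
    have ch: "chord (\<lambda>k. - Re (ray y h t k)) i j (of_int (fst c)) (of_int (snd c)) = a + t * b"
      unfolding Re_ray chord_linear a_def b_def by simp
    have mg: "(\<Sum>k\<in>off i j. real_of_rat (l k) * (margin (\<lambda>k. - Re (ray y h t k)) i j k - decay)) =
      (\<Sum>k\<in>off i j. real_of_rat (l k) * (margin (\<lambda>k. - Re (y k)) i j k - decay)) + t * (\<Sum>k\<in>off i j. real_of_rat (l k) * margin h i j k)"
      unfolding Re_ray margin_linear sum_distrib_left sum.distrib[symmetric] by (intro sum.cong refl) (simp add: algebra_simps)
    have e1: "exp (- (\<Sum>k\<in>off i j. real_of_rat (l k) * (margin (\<lambda>k. - Re (ray y h t k)) i j k - decay))) \<le> exp (- (t * \<epsilon>))"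
    proof -
      have "exp (- (\<Sum>k\<in>off i j. real_of_rat (l k) * (margin (\<lambda>k. - Re (y k)) i j k - decay))) \<le> 1"
        by (rule deep_decay[OF y ij l])
      then have "0 \<le> (\<Sum>k\<in>off i j. real_of_rat (l k) * (margin (\<lambda>k. - Re (y k)) i j k - decay))" by simp
      moreover have "t * \<epsilon> \<le> t * (\<Sum>k\<in>off i j. real_of_rat (l k) * margin h i j k)" using \<epsilon> t by (rule mult_left_mono)
      ultimately show ?thesis unfolding mg exp_le_cancel_iff by linarith
    qed
    have "cmod (jet n M (ray y h t) l) \<le> C * P * exp (a + t * b)
        * exp (- (\<Sum>k\<in>off i j. real_of_rat (l k) * (margin (\<lambda>k. - Re (ray y h t k)) i j k - decay))) * W"
      using C(2)[OF ij l, of M "ray y h t"] unfolding ch P_def W_def .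
    also have "\<dots> \<le> C * (Q * (1 + t) ^ p) * exp (a + t * b) * exp (- (t * \<epsilon>)) * W"
      using C(1) Q(1) t unfolding P_def W_def
      by (intro mult_right_mono mult_mono mult_left_mono Q(2)[OF t] e1 mult_nonneg_nonneg prod_nonneg) auto
    also have "\<dots> = C * Q * (1 + t) ^ p * (exp (a + t * b) * exp (- (t * \<epsilon>))) * W" by (simp only: mult_ac)
    also have "exp (a + t * b) * exp (- (t * \<epsilon>)) = exp a * exp ((b - \<epsilon>) * t)"
      by (simp only: exp_add[symmetric]) (simp add: algebra_simps)
    also have "C * Q * (1 + t) ^ p * (exp a * exp ((b - \<epsilon>) * t)) * W = C * Q * exp a * (1 + t) ^ p * exp ((b - \<epsilon>) * t) * W"
      by (simp only: mult_ac)
    finally show "cmod (jet n M (ray y h t) l) \<le> C * Q * exp a * (1 + t) ^ p * exp ((chord h i j (of_int (fst c)) (of_int (snd c)) - \<epsilon>) * t)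
        * exp (- (\<Sum>k\<in>off i j. real_of_rat (l k)))"
      unfolding b_def W_def .
  qed
qed

text \<open>A term that is not leading has a positive integer exponent off the cone, so its total margin is at least
  the smallest margin of \<open>h\<close>.\<close>

lemma series_leading:
  assumes c: "0 \<le> snd c" and y: "deep y" and adm: "admissible i j \<gamma> M" and h: "h \<in> height_cone n S"
  shows "\<exists>\<epsilon>>0. grow (chord h i j (of_int (fst c)) (of_int (snd c)) - \<epsilon>)
      (\<lambda>t. series \<gamma> M c (ray y h t) - (\<Sum>l\<in>leading i j c \<gamma>. jet n M (ray y h t) l))"
    and "grow (chord h i j (of_int (fst c)) (of_int (snd c))) (\<lambda>t. series \<gamma> M c (ray y h t))"
proof -
  have ij: "i < j" "adjacent S i j" using adm unfolding admissible_def by auto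
  let ?b = "chord h i j (of_int (fst c)) (of_int (snd c))"
  obtain Q p where Q: "0 \<le> Q" "\<forall>t\<ge>0. \<forall>l\<in>supported i j c \<gamma>. \<forall>\<epsilon>. \<epsilon> \<le> (\<Sum>k\<in>off i j. real_of_rat (l k) * margin h i j k) \<longrightarrow>
     cmod (jet n M (ray y h t) l) \<le> Q * (1 + t) ^ p * exp ((?b - \<epsilon>) * t) * exp (- (\<Sum>k\<in>off i j. real_of_rat (l k)))"
    using jet_ray_bound[OF c y adm] by blast
  have mpos: "0 < margin h i j k" if "k \<in> off i j" for k
  proof -
    have "i < j \<and> adjacent S i j \<and> k \<le> n \<and> k \<noteq> i \<and> k \<noteq> j" using ij that by (auto simp: off_def)
    then show ?thesis using h unfolding height_cone_iff by blast
  qed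
  (* The 1 only keeps the set nonempty if i and j are the only indices. *)
  define \<epsilon> where "\<epsilon> = Min (insert 1 (margin h i j ` off i j))"
  have fin: "finite (insert 1 (margin h i j ` off i j))" using finite_off by simp
  have \<epsilon>: "0 < \<epsilon>" "\<And>k. k \<in> off i j \<Longrightarrow> \<epsilon> \<le> margin h i j k"
    unfolding \<epsilon>_def using mpos fin by (auto simp: Min_gr_iff intro!: Min_le)
  define E where "E l = exp (- (\<Sum>k\<in>off i j. real_of_rat (l k)))" for l :: "nat \<Rightarrow> rat"
  have Esum: "E summable_on supported i j c \<gamma>" unfolding E_def by (rule supported_summable[OF ij])
  define Z where "Z = leading i j c \<gamma>"
  have Zs: "Z \<subseteq> supported i j c \<gamma>" "Z \<subseteq> Lset n S c \<gamma>" unfolding Z_def leading_def supported_def by auto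
  have finZ: "finite Z" unfolding Z_def by (rule finite_leading[OF ij])
  have big: "\<epsilon> \<le> (\<Sum>k\<in>off i j. real_of_rat (l k) * margin h i j k)" if l: "l \<in> supported i j c \<gamma> - Z" for l
  proof -
    have nn: "0 \<le> real_of_rat (l k) * margin h i j k" if "k \<in> off i j" for k
      using supported_nonneg[of l i j c \<gamma> k] l that mpos[OF that] by simp
    obtain k where k: "k \<in> off i j" "l k \<noteq> 0" using l unfolding Z_def leading_def supported_def by auto
    have "l k \<in> \<nat>" using l k(1) unfolding supported_def by auto
    then obtain m where m: "l k = of_nat m" by (elim Nats_cases)
    then have "1 \<le> real_of_rat (l k)" using k(2) by simp
    then have "1 * \<epsilon> \<le> real_of_rat (l k) * margin h i j k" using \<epsilon> k(1) by (intro mult_mono) auto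
    also have "\<dots> \<le> (\<Sum>k\<in>off i j. real_of_rat (l k) * margin h i j k)"
      using nn by (intro member_le_sum[OF k(1) _ finite_off]) auto
    finally show ?thesis by simp
  qed
  have split: "((jet n M (ray y h t)) has_sum (series \<gamma> M c (ray y h t) - (\<Sum>l\<in>Z. jet n M (ray y h t) l))) (Lset n S c \<gamma> - Z)"
    if t: "0 \<le> t" for t
    by (rule has_sum_Diff[OF series_has_sum[OF c adm deep_ray[OF y h t]] has_sum_finite[OF finZ] Zs(2)])
  have rest: "cmod (series \<gamma> M c (ray y h t) - (\<Sum>l\<in>Z. jet n M (ray y h t) l)) \<le>
      Q * infsum E (supported i j c \<gamma> - Z) * (1 + t) ^ p * exp ((?b - \<epsilon>) * t)" if t: "0 \<le> t" for t
  proof -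
    define K where "K = Q * (1 + t) ^ p * exp ((?b - \<epsilon>) * t)"
    have Esum': "E summable_on (supported i j c \<gamma> - Z)" by (rule summable_on_subset_banach[OF Esum]) auto
    have "((jet n M (ray y h t)) has_sum (series \<gamma> M c (ray y h t) - (\<Sum>l\<in>Z. jet n M (ray y h t) l))) (supported i j c \<gamma> - Z)"
      using split[OF t]
    proof (rule has_sum_cong_neutral[THEN iffD1, rotated -1])
      fix l assume "l \<in> Lset n S c \<gamma> - Z - (supported i j c \<gamma> - Z)"
      then show "jet n M (ray y h t) l = 0" using jet_supported[OF adm, of l c "ray y h t"] by blast
    next
      fix l assume "l \<in> supported i j c \<gamma> - Z - (Lset n S c \<gamma> - Z)"
      then show "jet n M (ray y h t) l = 0" unfolding supported_def by blast
    qed simp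
    moreover have "((\<lambda>l. K * E l) has_sum K * infsum E (supported i j c \<gamma> - Z)) (supported i j c \<gamma> - Z)"
      by (intro has_sum_cmult_right has_sum_infsum Esum')
    ultimately have "cmod (series \<gamma> M c (ray y h t) - (\<Sum>l\<in>Z. jet n M (ray y h t) l)) \<le> K * infsum E (supported i j c \<gamma> - Z)"
    proof (rule norm_infsum_le)
      fix l assume l: "l \<in> supported i j c \<gamma> - Z"
      then have "cmod (jet n M (ray y h t) l) \<le> Q * (1 + t) ^ p * exp ((?b - \<epsilon>) * t) * exp (- (\<Sum>k\<in>off i j. real_of_rat (l k)))"
        using Q(2) t big[OF l] by blast
      then show "cmod (jet n M (ray y h t) l) \<le> K * E l" unfolding K_def E_def .
    qed
    then show ?thesis unfolding K_def by (simp only: mult_ac)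
  qed
  have E0: "0 \<le> infsum E A" for A by (rule infsum_nonneg) (simp add: E_def)
  have gr: "grow (?b - \<epsilon>) (\<lambda>t. series \<gamma> M c (ray y h t) - (\<Sum>l\<in>Z. jet n M (ray y h t) l))"
    by (rule growI[of "Q * infsum E (supported i j c \<gamma> - Z)"]) (use Q(1) E0 rest in auto)
  then show "\<exists>\<epsilon>>0. grow (?b - \<epsilon>) (\<lambda>t. series \<gamma> M c (ray y h t) - (\<Sum>l\<in>leading i j c \<gamma>. jet n M (ray y h t) l))"
    using \<epsilon>(1) unfolding Z_def by blast
  have gl: "grow ?b (\<lambda>t. \<Sum>l\<in>Z. jet n M (ray y h t) l)"
  proof (rule growI[of "Q * (\<Sum>l\<in>Z. E l)" _ p])
    show "0 \<le> Q * (\<Sum>l\<in>Z. E l)" using Q(1) by (simp add: E_def sum_nonneg)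
    fix t :: real assume t: "0 \<le> t"
    have "cmod (\<Sum>l\<in>Z. jet n M (ray y h t) l) \<le> (\<Sum>l\<in>Z. Q * (1 + t) ^ p * exp (?b * t) * E l)"
    proof (rule sum_norm_le)
      fix l assume l: "l \<in> Z"
      have "0 \<le> (\<Sum>k\<in>off i j. real_of_rat (l k) * margin h i j k)" using l unfolding Z_def leading_def by simp
      then have "cmod (jet n M (ray y h t) l) \<le> Q * (1 + t) ^ p * exp ((?b - 0) * t) * exp (- (\<Sum>k\<in>off i j. real_of_rat (l k)))"
        using Q(2) t l Zs(1) by blast
      then show "cmod (jet n M (ray y h t) l) \<le> Q * (1 + t) ^ p * exp (?b * t) * E l" unfolding E_def by simp
    qed
    also have "\<dots> = Q * (\<Sum>l\<in>Z. E l) * (1 + t) ^ p * exp (?b * t)"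
      unfolding sum_distrib_left[symmetric] by (simp only: mult_ac)
    finally show "cmod (\<Sum>l\<in>Z. jet n M (ray y h t) l) \<le> Q * (\<Sum>l\<in>Z. E l) * (1 + t) ^ p * exp (?b * t)" .
  qed
  have "grow ?b (\<lambda>t. (series \<gamma> M c (ray y h t) - (\<Sum>l\<in>Z. jet n M (ray y h t) l)) + (\<Sum>l\<in>Z. jet n M (ray y h t) l))"
    using \<epsilon>(1) by (intro grow_add gl grow_mono[OF gr]) simp
  then show "grow ?b (\<lambda>t. series \<gamma> M c (ray y h t))" by simp
qed

end

section \<open>Leading terms\<close>

context fan begin

text \<open>The term with exponent \<open>l\<close>, if there is one in the sector.\<close>

definition lead :: "int \<times> int \<Rightarrow> nat multiset \<Rightarrow> int \<times> int \<Rightarrow> (nat \<Rightarrow> rat) \<Rightarrow> (nat \<Rightarrow> complex) \<Rightarrow> complex" where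
  "lead \<gamma> M c l y = (if l \<in> Lset n S c \<gamma> then jet n M y l else 0)"

text \<open>The growth rate of \<open>x\<^sup>l\<close> along the ray.\<close>

definition height :: "(nat \<Rightarrow> real) \<Rightarrow> (nat \<Rightarrow> rat) \<Rightarrow> real" where
  "height h l = - (\<Sum>k\<le>n. real_of_rat (l k) * h k)"

text \<open>For nonpositive \<open>l\<close> the growth rate of the series over the cone \<open>\<sigma>\<^sub>i\<^sub>j\<close> is \<open>height h l\<close> plus a sum of
  nonpositive multiples of margins. If \<open>l\<close> lies on the cone, it is the leading term; otherwise the series grows strictly
  more slowly than \<open>height h l\<close> and \<open>l\<close> does not occur in it. So the estimate is uniform in the cone.\<close>

lemma series_vertex:
  assumes c: "0 \<le> snd c" and y: "deep y" and adm: "admissible i j \<gamma> M" and h: "h \<in> height_cone n S"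
    and l: "l \<in> Lset n S c \<gamma>\<^sub>0" "\<And>k. k \<le> n \<Longrightarrow> l k \<le> 0"
  shows "\<exists>\<epsilon>>0. grow (height h l - \<epsilon>) (\<lambda>t. series \<gamma> M c (ray y h t) - lead \<gamma> M c l (ray y h t))"
    and "grow (height h l) (\<lambda>t. series \<gamma> M c (ray y h t))"
    and "grow (height h l) (\<lambda>t. lead \<gamma> M c l (ray y h t))"
proof -
  have ij: "i < j" "adjacent S i j" using adm unfolding admissible_def by auto
  let ?b = "chord h i j (of_int (fst c)) (of_int (snd c))"
  have b: "?b = height h l + (\<Sum>k\<in>off i j. real_of_rat (l k) * margin h i j k)"
    using exponent_split[OF ij l(1), of h] unfolding height_def by simp
  have mpos: "0 < margin h i j k" if "k \<in> off i j" for k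
  proof -
    have "i < j \<and> adjacent S i j \<and> k \<le> n \<and> k \<noteq> i \<and> k \<noteq> j" using ij that by (auto simp: off_def)
    then show ?thesis using h unfolding height_cone_iff by blast
  qed
  have np: "real_of_rat (l k) * margin h i j k \<le> 0" if "k \<in> off i j" for k
    using mpos[OF that] l(2)[of k] that by (auto simp: off_def mult_nonpos_nonneg)
  have b_le: "?b \<le> height h l" unfolding b using np by (simp add: sum_nonpos)
  note gr = series_leading[OF c y adm h]
  show g2: "grow (height h l) (\<lambda>t. series \<gamma> M c (ray y h t))" by (rule grow_mono[OF gr(2) b_le])
  have "\<exists>\<epsilon>>0. grow (height h l - \<epsilon>) (\<lambda>t. series \<gamma> M c (ray y h t) - lead \<gamma> M c l (ray y h t))"
  proof (cases "\<forall>k\<in>off i j. l k = 0")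
    case True
    then have "?b = height h l" unfolding b by simp
    moreover have "leading i j c \<gamma> = (if l \<in> Lset n S c \<gamma> then {l} else {})"
    proof -
      have "l' = l" if "l' \<in> leading i j c \<gamma>" for l'
        by (rule supported_determined[OF ij, of l' c \<gamma> l \<gamma>\<^sub>0]) (use that l(1) True in \<open>auto simp: leading_def\<close>)
      moreover have "l \<in> leading i j c \<gamma> \<longleftrightarrow> l \<in> Lset n S c \<gamma>" using True unfolding leading_def by blast
      ultimately show ?thesis by auto
    qed
    then have "(\<Sum>l\<in>leading i j c \<gamma>. jet n M z l) = lead \<gamma> M c l z" for z by (simp add: lead_def)
    ultimately show ?thesis using gr(1) by simp
  next
    case False
    then obtain k where k: "k \<in> off i j" "l k \<noteq> 0" by blast
    have kn: "k \<le> n" using k by (auto simp: off_def)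
    have neg: "l k < 0" using l(2)[OF kn] k(2) by simp
    have "real_of_rat (l k) * margin h i j k < 0" using mpos[OF k(1)] neg by (simp add: mult_neg_pos)
    then have lt: "?b < height h l"
      unfolding b using sum_strict_mono_ex1[OF finite_off, of i j "\<lambda>k. real_of_rat (l k) * margin h i j k" "\<lambda>_. 0"] np k(1) by fastforce
    have "lead \<gamma> M c l z = 0" for z
    proof (rule ccontr)
      assume ne: "lead \<gamma> M c l z \<noteq> 0"
      then have "l \<in> Lset n S c \<gamma>" "jet n M z l \<noteq> 0" unfolding lead_def by (auto split: if_splits)
      from jet_supported[OF adm this] have "l \<in> supported i j c \<gamma>" .
      from supported_nonneg[OF this k(1)] neg show False by simp
    qed
    then show ?thesis using gr(2) lt by (intro exI[of _ "height h l - ?b"]) simp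
  qed
  then show g1: "\<exists>\<epsilon>>0. grow (height h l - \<epsilon>) (\<lambda>t. series \<gamma> M c (ray y h t) - lead \<gamma> M c l (ray y h t))" .
  then obtain \<epsilon> where \<epsilon>: "\<epsilon> > 0" "grow (height h l - \<epsilon>) (\<lambda>t. series \<gamma> M c (ray y h t) - lead \<gamma> M c l (ray y h t))" by blast
  have "grow (height h l) (\<lambda>t. series \<gamma> M c (ray y h t) + - (series \<gamma> M c (ray y h t) - lead \<gamma> M c l (ray y h t)))"
    using \<epsilon> by (intro grow_add[OF g2] grow_minus grow_mono[OF \<epsilon>(2)]) simp
  then show "grow (height h l) (\<lambda>t. lead \<gamma> M c l (ray y h t))" by simp
qed

text \<open>The contribution of the exponents \<open>l\<close> and \<open>l'\<close> to \<open>X\<close>.\<close>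

definition leadX where
  "leadX B l l' c d y = (\<Sum>p\<in>Box S \<times> indices. \<Sum>q\<in>Box S \<times> indices.
      B (eH (fst p) (snd p)) (eC (fst q) (snd q)) * (lead (fst p) (snd p) c l y * lead (fst q) (snd q) d l' y))"

lemma grow_monomial: "grow (- (h i + h j)) (\<lambda>t. exp (ray y h t i) * exp (ray y h t j))"
proof -
  have "grow (- h k) (\<lambda>t. exp (ray y h t k))" for k
    by (rule grow_exp[of _ "Re (y k)"]) (simp add: ray_def mult.commute)
  from grow_mult[OF this this, of i j] show ?thesis by (simp add: algebra_simps)
qed

context
  fixes B assumes B: "bilinear_form (relH n S) (relHc n S) B"
begin

lemma admissible_pair:
  assumes "p \<in> Box S \<times> indices" "q \<in> Box S \<times> indices" "B (eH (fst p) (snd p)) (eC (fst q) (snd q)) \<noteq> 0"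
  obtains a b a' b' where "admissible a b (fst p) (snd p)" "admissible a' b' (fst q) (snd q)"
proof -
  have p: "fst p \<in> Box S" "snd p \<in> indices" and q: "fst q \<in> Box S" "snd q \<in> indices" using assms(1,2) by auto
  show ?thesis
    using that functional_eH_admissible[OF B_left[OF B] p assms(3)] functional_eC_admissible[OF B_right[OF B] q assms(3)] by blast
qed

text \<open>Replacing both series by one term each changes the product by two terms of smaller growth.\<close>

lemma X_vertex_limit:
  assumes c: "0 \<le> snd c" "0 \<le> snd d" and y: "deep y" and h: "h \<in> height_cone n S"
    and l: "l \<in> Lset n S c \<gamma>\<^sub>0" "\<And>k. k \<le> n \<Longrightarrow> l k \<le> 0" and l': "l' \<in> Lset n S d \<gamma>\<^sub>1" "\<And>k. k \<le> n \<Longrightarrow> l' k \<le> 0"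
    and eq: "height h l + height h l' = h i + h j"
  shows "((\<lambda>t. exp (ray y h t i) * exp (ray y h t j) * X B (ray y h t) c d
     - exp (ray y h t i) * exp (ray y h t j) * leadX B l l' c d (ray y h t)) \<longlongrightarrow> 0) at_top"
proof -
  let ?e = "\<lambda>t. exp (ray y h t i) * exp (ray y h t j)"
  have "((\<lambda>t. \<Sum>p\<in>Box S \<times> indices. \<Sum>q\<in>Box S \<times> indices. ?e t * (B (eH (fst p) (snd p)) (eC (fst q) (snd q)) *
      (series (fst p) (snd p) c (ray y h t) * series (fst q) (snd q) d (ray y h t) -
       lead (fst p) (snd p) c l (ray y h t) * lead (fst q) (snd q) d l' (ray y h t)))) \<longlongrightarrow> 0) at_top"
  proof (rule tendsto_null_sum, rule tendsto_null_sum)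
    fix p q assume pq: "p \<in> Box S \<times> indices" "q \<in> Box S \<times> indices"
    show "((\<lambda>t. ?e t * (B (eH (fst p) (snd p)) (eC (fst q) (snd q)) *
      (series (fst p) (snd p) c (ray y h t) * series (fst q) (snd q) d (ray y h t) -
       lead (fst p) (snd p) c l (ray y h t) * lead (fst q) (snd q) d l' (ray y h t)))) \<longlongrightarrow> 0) at_top"
    proof (cases "B (eH (fst p) (snd p)) (eC (fst q) (snd q)) = 0")
      case False
      obtain a b a' b' where adm: "admissible a b (fst p) (snd p)" "admissible a' b' (fst q) (snd q)"
        by (rule admissible_pair[OF pq False])
      note P = series_vertex[OF c(1) y adm(1) h l] and Q = series_vertex[OF c(2) y adm(2) h l']
      obtain \<epsilon> where \<epsilon>: "\<epsilon> > 0" "grow (height h l - \<epsilon>) (\<lambda>t. series (fst p) (snd p) c (ray y h t) - lead (fst p) (snd p) c l (ray y h t))"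
        using P(1) by blast
      obtain \<epsilon>' where \<epsilon>': "\<epsilon>' > 0" "grow (height h l' - \<epsilon>') (\<lambda>t. series (fst q) (snd q) d (ray y h t) - lead (fst q) (snd q) d l' (ray y h t))"
        using Q(1) by blast
      (* a b - a' b' = (a - a') b + a' (b - b') *)
      define \<delta> where "\<delta> = min \<epsilon> \<epsilon>'"
      have \<delta>: "\<delta> > 0" using \<epsilon> \<epsilon>' by (simp add: \<delta>_def)
      have \<delta>_le: "\<delta> \<le> \<epsilon>" "\<delta> \<le> \<epsilon>'" by (simp_all add: \<delta>_def)
      have le1: "height h l - \<epsilon> + height h l' \<le> h i + h j - \<delta>" using eq \<delta>_le(1) by linarith
      have le2: "height h l + (height h l' - \<epsilon>') \<le> h i + h j - \<delta>" using eq \<delta>_le(2) by linarith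
      have g1: "grow (h i + h j - \<delta>) (\<lambda>t. (series (fst p) (snd p) c (ray y h t) - lead (fst p) (snd p) c l (ray y h t)) * series (fst q) (snd q) d (ray y h t))"
        by (rule grow_mono[OF grow_mult[OF \<epsilon>(2) Q(2)] le1])
      have g2: "grow (h i + h j - \<delta>) (\<lambda>t. lead (fst p) (snd p) c l (ray y h t) * (series (fst q) (snd q) d (ray y h t) - lead (fst q) (snd q) d l' (ray y h t)))"
        by (rule grow_mono[OF grow_mult[OF P(3) \<epsilon>'(2)] le2])
      have "grow (- (h i + h j) + (h i + h j - \<delta>)) (\<lambda>t. ?e t * (B (eH (fst p) (snd p)) (eC (fst q) (snd q)) *
         ((series (fst p) (snd p) c (ray y h t) - lead (fst p) (snd p) c l (ray y h t)) * series (fst q) (snd q) d (ray y h t) +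
          lead (fst p) (snd p) c l (ray y h t) * (series (fst q) (snd q) d (ray y h t) - lead (fst q) (snd q) d l' (ray y h t)))))"
        by (intro grow_mult[OF grow_monomial] grow_cmult grow_add g1 g2)
      from grow_negative_tendsto[OF this] \<delta> show ?thesis by (simp add: algebra_simps)
    qed simp
  qed
  then show ?thesis
    unfolding X_pairs leadX_def right_diff_distrib[symmetric] sum_subtractf[symmetric] sum_distrib_left .
qed

text \<open>The growth of each series is bounded by a linear function on its cone; the hypothesis compares their sum with
  the decay of \<open>x\<^sub>i x\<^sub>j\<close>.\<close>

lemma X_negligible:
  assumes c: "0 \<le> snd c" "0 \<le> snd d" and y: "deep y" and h: "h \<in> height_cone n S"
    and lt: "\<And>a b a' b'. a < b \<Longrightarrow> adjacent S a b \<Longrightarrow> a' < b' \<Longrightarrow> adjacent S a' b' \<Longrightarrow>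
      chord h a b (of_int (fst c)) (of_int (snd c)) + chord h a' b' (of_int (fst d)) (of_int (snd d)) < h i + h j"
  shows "((\<lambda>t. exp (ray y h t i) * exp (ray y h t j) * X B (ray y h t) c d) \<longlongrightarrow> 0) at_top"
proof -
  let ?e = "\<lambda>t. exp (ray y h t i) * exp (ray y h t j)"
  have "((\<lambda>t. \<Sum>p\<in>Box S \<times> indices. \<Sum>q\<in>Box S \<times> indices. ?e t * (B (eH (fst p) (snd p)) (eC (fst q) (snd q)) *
      (series (fst p) (snd p) c (ray y h t) * series (fst q) (snd q) d (ray y h t)))) \<longlongrightarrow> 0) at_top"
  proof (rule tendsto_null_sum, rule tendsto_null_sum)
    fix p q assume pq: "p \<in> Box S \<times> indices" "q \<in> Box S \<times> indices"
    show "((\<lambda>t. ?e t * (B (eH (fst p) (snd p)) (eC (fst q) (snd q)) *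
      (series (fst p) (snd p) c (ray y h t) * series (fst q) (snd q) d (ray y h t)))) \<longlongrightarrow> 0) at_top"
    proof (cases "B (eH (fst p) (snd p)) (eC (fst q) (snd q)) = 0")
      case False
      obtain a b a' b' where adm: "admissible a b (fst p) (snd p)" "admissible a' b' (fst q) (snd q)"
        by (rule admissible_pair[OF pq False])
      have ab: "a < b" "adjacent S a b" "a' < b'" "adjacent S a' b'" using adm unfolding admissible_def by auto
      note P = series_leading(2)[OF c(1) y adm(1) h] and Q = series_leading(2)[OF c(2) y adm(2) h]
      show ?thesis
        by (rule grow_negative_tendsto[OF grow_mult[OF grow_monomial grow_cmult[OF grow_mult[OF P Q]]]])
           (use lt[OF ab] in simp)
    qed simp
  qed
  then show ?thesis unfolding X_pairs sum_distrib_left .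
qed

end

lemma chord_le:
  assumes h: "h \<in> height_cone n S" and ab: "a < b" "adjacent S a b" and k: "k \<le> n"
  shows "chord h a b (real k) 1 \<le> h k" "k \<noteq> a \<Longrightarrow> k \<noteq> b \<Longrightarrow> chord h a b (real k) 1 < h k"
proof -
  show lt: "chord h a b (real k) 1 < h k" if "k \<noteq> a" "k \<noteq> b"
  proof -
    have "a < b \<and> adjacent S a b \<and> k \<le> n \<and> k \<noteq> a \<and> k \<noteq> b" using ab k that by blast
    then have "0 < margin h a b k" using h unfolding height_cone_iff by blast
    then show ?thesis by (simp add: margin_def)
  qed
  show "chord h a b (real k) 1 \<le> h k"
  proof (cases "k = a \<or> k = b")
    case True then show ?thesis using chord_left[of h a b] chord_right[OF ab(1), of h] by auto
  next
    case False then show ?thesis using lt by simp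
  qed
qed

text \<open>A linear piece of the convex function \<open>h\<close> touches it only over its own end points, and \<open>i, j\<close> are not both
  end points of one piece.\<close>

lemma chord_ends_lt:
  assumes h: "h \<in> height_cone n S" and ab: "a < b" "adjacent S a b" and ij: "i < j" "j \<le> n" "\<not> adjacent S i j"
    and st: "0 < s" "0 < t"
  shows "s * chord h a b (real i) 1 + t * chord h a b (real j) 1 < s * h i + t * h j"
proof -
  have le: "s * chord h a b (real i) 1 \<le> s * h i" "t * chord h a b (real j) 1 \<le> t * h j"
    using chord_le(1)[OF h ab, of i] chord_le(1)[OF h ab, of j] ij st by (auto intro: mult_left_mono)
  have "\<not> (i = a \<and> j = b)" using ab(2) ij(3) by auto
  moreover have "\<not> (i = b \<and> j = a)" "\<not> (i = a \<and> j = a)" "\<not> (i = b \<and> j = b)" using ab(1) ij(1) by auto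
  ultimately consider "i \<noteq> a \<and> i \<noteq> b" | "j \<noteq> a \<and> j \<noteq> b" by blast
  then show ?thesis
  proof cases
    case 1
    then have "s * chord h a b (real i) 1 < s * h i" using chord_le(2)[OF h ab, of i] ij st by simp
    then show ?thesis using le by linarith
  next
    case 2
    then have "t * chord h a b (real j) 1 < t * h j" using chord_le(2)[OF h ab, of j] ij st by simp
    then show ?thesis using le by linarith
  qed
qed

lemma chord_interpolate:
  assumes "i < j"
  shows "(real j - real i) * chord h a b x 1 = (real j - x) * chord h a b (real i) 1 + (x - real i) * chord h a b (real j) 1"
proof -
  define r where "r = (h b - h a) / (real b - real a)"
  show ?thesis unfolding chord_def r_def[symmetric] by (simp add: algebra_simps)
qed

context
  fixes B assumes B: "bilinear_form (relH n S) (relHc n S) B"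
begin

lemma limit_nonadjacent_first:
  assumes y: "deep y" and h: "h \<in> height_cone n S" and ij: "i < j" "j \<le> n" "\<not> adjacent S i j"
  shows "((\<lambda>t. exp (ray y h t i) * exp (ray y h t j) * X B (ray y h t) (0, 0) (int i + int j, 2)) \<longlongrightarrow> 0) at_top"
proof (rule X_negligible[OF B _ _ y h])
  fix a b a' b' assume ab: "a < b" "adjacent S a b" "a' < b'" "adjacent S a' b'"
  have "chord h a' b' (real i + real j) (1 + 1) = chord h a' b' (real i) 1 + chord h a' b' (real j) 1" by (rule chord_add)
  then show "chord h a b (of_int (fst (0 :: int, 0 :: int))) (of_int (snd (0 :: int, 0 :: int))) +
      chord h a' b' (of_int (fst (int i + int j, 2 :: int))) (of_int (snd (int i + int j, 2 :: int))) < h i + h j"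
    using chord_ends_lt[OF h ab(3,4) ij, of 1 1] by (simp add: chord_def)
qed simp_all

lemma limit_outside:
  assumes y: "deep y" and h: "h \<in> height_cone n S" and ij: "i \<le> n" "j \<le> n" "\<not> (i \<in> S \<and> j \<in> S)"
  shows "((\<lambda>t. exp (ray y h t i) * exp (ray y h t j) * X B (ray y h t) (int i, 1) (int j, 1)) \<longlongrightarrow> 0) at_top"
proof (rule X_negligible[OF B _ _ y h])
  fix a b a' b' assume ab: "a < b" "adjacent S a b" "a' < b'" "adjacent S a' b'"
  have inS: "a \<in> S" "b \<in> S" "a' \<in> S" "b' \<in> S" using ab unfolding adjacent_def by auto
  note le = chord_le(1)[OF h ab(1,2) ij(1)] chord_le(1)[OF h ab(3,4) ij(2)]
  consider "i \<notin> S" | "j \<notin> S" using ij(3) by blast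
  then have "chord h a b (real i) 1 + chord h a' b' (real j) 1 < h i + h j"
  proof cases
    case 1
    then have "i \<noteq> a" "i \<noteq> b" using inS by auto
    from chord_le(2)[OF h ab(1,2) ij(1) this] le show ?thesis by linarith
  next
    case 2
    then have "j \<noteq> a'" "j \<noteq> b'" using inS by auto
    from chord_le(2)[OF h ab(3,4) ij(2) this] le show ?thesis by linarith
  qed
  then show "chord h a b (of_int (fst (int i, 1 :: int))) (of_int (snd (int i, 1 :: int))) +
      chord h a' b' (of_int (fst (int j, 1 :: int))) (of_int (snd (int j, 1 :: int))) < h i + h j" by simp
qed simp_all

text \<open>The chords are linear, so their values at \<open>k\<close> and \<open>i + j - k\<close> are interpolated from those at \<open>i\<close>
  and \<open>j\<close>, with complementary coefficients.\<close>

lemma limit_nonadjacent_between: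
  assumes y: "deep y" and h: "h \<in> height_cone n S" and ij: "i < j" "j \<le> n" "\<not> adjacent S i j" and k: "i < k" "k < j"
  shows "((\<lambda>t. exp (ray y h t i) * exp (ray y h t j) * X B (ray y h t) (int k, 1) (int (i + j - k), 1)) \<longlongrightarrow> 0) at_top"
proof (rule X_negligible[OF B _ _ y h])
  fix a b a' b' assume ab: "a < b" "adjacent S a b" "a' < b'" "adjacent S a' b'"
  have d: "0 < real j - real i" using ij by simp
  have k': "real (i + j - k) = real i + real j - real k" using k by (simp add: of_nat_diff)
  have "(real j - real i) * chord h a b (real k) 1 < (real j - real k) * h i + (real k - real i) * h j"
    unfolding chord_interpolate[OF ij(1)] by (rule chord_ends_lt[OF h ab(1,2) ij]) (use k in simp_all)
  moreover have "(real j - real i) * chord h a' b' (real (i + j - k)) 1 < (real k - real i) * h i + (real j - real k) * h j"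
    using chord_ends_lt[OF h ab(3,4) ij, of "real k - real i" "real j - real k"] k
    unfolding chord_interpolate[OF ij(1)] k' by simp
  ultimately have "(real j - real i) * (chord h a b (real k) 1 + chord h a' b' (real (i + j - k)) 1) < (real j - real i) * (h i + h j)"
    by (simp add: algebra_simps)
  then have "chord h a b (real k) 1 + chord h a' b' (real (i + j - k)) 1 < h i + h j" using d by simp
  then show "chord h a b (of_int (fst (int k, 1 :: int))) (of_int (snd (int k, 1 :: int))) +
      chord h a' b' (of_int (fst (int (i + j - k), 1 :: int))) (of_int (snd (int (i + j - k), 1 :: int))) < h i + h j" by simp
qed simp_all

end

end

section \<open>Values of the leading terms\<close>

context fan begin

abbreviation period :: complex where "period \<equiv> 2 * of_real pi * \<i>"

text \<open>The exponent \<open>- e\<^sub>i\<close>, which represents \<open>v\<^sub>i\<close>.\<close>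

definition vertex :: "nat \<Rightarrow> nat \<Rightarrow> rat" where
  "vertex i = (\<lambda>k. if k = i then - 1 else 0)"

lemma sum_vertex: "i \<le> n \<Longrightarrow> (\<Sum>k\<le>n. vertex i k * f k) = - f i"
proof -
  assume "i \<le> n"
  have "(\<Sum>k\<le>n. vertex i k * f k) = (\<Sum>k\<le>n. if k = i then - f k else 0)"
    by (intro sum.cong refl) (simp add: vertex_def)
  then show ?thesis using \<open>i \<le> n\<close> by simp
qed

lemma vertex_int: "vertex i k \<in> \<int>"
  by (simp add: vertex_def)

lemma LsetI:
  assumes "\<And>k. n < k \<Longrightarrow> l k = 0" "(\<Sum>k\<le>n. l k * of_nat k) = - of_int (fst c)" "(\<Sum>k\<le>n. l k * 1) = - of_int (snd c)"
    "\<And>k. k \<le> n \<Longrightarrow> l k - box_coord S \<gamma> k \<in> \<int>"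
  shows "l \<in> Lset n S c \<gamma>"
  using assms by (auto simp: Lset_def vlat_def)

lemma Lset_zero: "(\<lambda>_. 0) \<in> Lset n S (0, 0) (0, 0)"
  by (rule LsetI) (auto simp: box_coord_def)

lemma Lset_vertex: "i \<le> n \<Longrightarrow> vertex i \<in> Lset n S (int i, 1) (0, 0)"
  by (rule LsetI) (simp_all only: sum_vertex, auto simp: box_coord_def vertex_def)

lemma Lset_edge:
  assumes "i \<le> n" "j \<le> n" shows "(\<lambda>k. vertex i k + vertex j k) \<in> Lset n S (int i + int j, 2) (0, 0)"
proof (rule LsetI)
  show "(\<Sum>k\<le>n. (vertex i k + vertex j k) * of_nat k) = - of_int (fst (int i + int j, 2 :: int))"
    "(\<Sum>k\<le>n. (vertex i k + vertex j k) * 1) = - of_int (snd (int i + int j, 2 :: int))"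
    unfolding distrib_right sum.distrib sum_vertex[OF assms(1)] sum_vertex[OF assms(2)] by simp_all
  show "vertex i k + vertex j k - box_coord S (0, 0) k \<in> \<int>" for k
    using vertex_int by (simp add: box_coord_def)
qed (use assms in \<open>auto simp: vertex_def\<close>)

lemma bary_not_int:
  assumes "i < k" "k < j" shows "bary i j k i \<notin> \<int>" "bary i j k j \<notin> \<int>"
proof -
  have "q \<notin> \<int>" if "0 < q" "q < 1" for q :: rat
  proof
    assume "q \<in> \<int>"
    then obtain m where m: "q = of_int m" by (elim Ints_cases)
    then show False using that by simp
  qed
  then show "bary i j k i \<notin> \<int>" "bary i j k j \<notin> \<int>" using bary_bounds[OF assms] by auto
qed

lemma Box_cases:
  assumes "\<gamma> \<in> Box S"
  obtains "\<gamma> = (0, 0)" | a b k where "adjacent S a b" "a < k" "k < b" "\<gamma> = (int k, 1)"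
proof -
  consider "\<gamma> = (0, 0)" | k where "k \<le> n" "k \<notin> S" "\<gamma> = (int k, 1)" using assms unfolding Box_eq by auto
  then show ?thesis
  proof cases
    case (2 k)
    obtain a b where "a < k" "k < b" "adjacent S a b" using bracket_exists[OF 2(1,2)] by (elim exE conjE)
    then show ?thesis using that(2) 2(3) by blast
  qed (rule that(1))
qed

lemma Lset_integral:
  assumes "l \<in> Lset n S c \<gamma>" "\<gamma> \<in> Box S" "\<And>k. k \<le> n \<Longrightarrow> l k \<in> \<int>"
  shows "\<gamma> = (0, 0)"
  using assms(2)
proof (cases rule: Box_cases)
  case (2 a b k)
  have "a \<le> n" using adjacentD[OF 2(1)] by simp
  then have "l a - bary a b k a \<in> \<int>"
    using assms(1) sector_data(1)[OF 2(1-3)] unfolding Lset_def 2(4) by auto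
  then have "l a - (l a - bary a b k a) \<in> \<int>" using assms(3)[OF \<open>a \<le> n\<close>] by (rule Ints_diff[rotated])
  then show ?thesis using bary_not_int(1)[OF 2(2,3)] by simp
qed

lemma bary_reflect:
  assumes "i < k" "k < j"
  shows "bary i j (i + j - k) i = bary i j k j" "bary i j (i + j - k) j = bary i j k i"
  using assms by (auto simp: bary_def)

text \<open>The exponents are the negatives of the coordinates of \<open>(k, 1)\<close>, and they agree modulo 1 with the coordinates
  of the opposite point \<open>(i + j - k, 1)\<close>. So \<open>\<Gamma>\<^sub>c\<close> with \<open>c = \<gamma>\<^sup>*\<close> has its leading term in the sector \<open>\<gamma>\<close>.\<close>

lemma Lset_bary:
  assumes ij: "adjacent S i j" "i < k" "k < j" and \<gamma>: "\<gamma> \<in> Box S"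
  shows "(\<lambda>m. - bary i j k m) \<in> Lset n S (int k, 1) \<gamma> \<longleftrightarrow> \<gamma> = (int (i + j - k), 1)"
proof
  have le: "i \<le> n" "j \<le> n" using adjacentD[OF ij(1)] by auto
  have ij': "i < j" using ij by simp
  have k': "i < i + j - k" "i + j - k < j" using ij by auto
  note bs = bary_sums[OF ij(2,3)]
  {
    assume g: "\<gamma> = (int (i + j - k), 1)"
    have off0: "bary i j k m = 0" if "m \<in> off i j" for m using that by (simp add: bary_def off_def)
    show "(\<lambda>m. - bary i j k m) \<in> Lset n S (int k, 1) \<gamma>"
    proof (rule LsetI)
      have "(\<Sum>m\<le>n. - bary i j k m * of_nat m) = - (bary i j k i * of_nat i + bary i j k j * of_nat j)"
        unfolding sum_split[OF ij' le] using off0 by simp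
      then show "(\<Sum>m\<le>n. - bary i j k m * of_nat m) = - of_int (fst (int k, 1 :: int))" unfolding bs(2) by simp
      have "(\<Sum>m\<le>n. - bary i j k m * 1) = - (bary i j k i + bary i j k j)"
        unfolding sum_split[OF ij' le] using off0 by simp
      then show "(\<Sum>m\<le>n. - bary i j k m * 1) = - of_int (snd (int k, 1 :: int))" unfolding bs(1) by simp
      show "- bary i j k m = 0" if "n < m" for m using that le by (auto simp: bary_def)
      show "- bary i j k m - box_coord S \<gamma> m \<in> \<int>" for m
      proof -
        have "- bary i j k m - bary i j (i + j - k) m \<in> {0, - 1}"
        proof -
          have "- bary i j k i - bary i j (i + j - k) i = - 1" unfolding bary_reflect[OF ij(2,3)] using bs(1) by linarith
          moreover have "- bary i j k j - bary i j (i + j - k) j = - 1" unfolding bary_reflect[OF ij(2,3)] using bs(1) by linarith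
          moreover have "m \<noteq> i \<Longrightarrow> m \<noteq> j \<Longrightarrow> - bary i j k m - bary i j (i + j - k) m = 0" by (simp add: bary_def)
          ultimately show ?thesis by (metis insertI1 insertI2)
        qed
        then show ?thesis unfolding g sector_data(1)[OF ij(1) k'] by auto
      qed
    qed
  }
  assume L: "(\<lambda>m. - bary i j k m) \<in> Lset n S (int k, 1) \<gamma>"
  have int: "- bary i j k m - box_coord S \<gamma> m \<in> \<int>" if "m \<le> n" for m using L that unfolding Lset_def by auto
  from \<gamma> show "\<gamma> = (int (i + j - k), 1)"
  proof (cases rule: Box_cases)
    case 1
    have "- bary i j k i \<in> \<int>" using int[OF le(1)] by (simp add: 1 box_coord_def)
    then show ?thesis using bary_not_int(1)[OF ij(2,3)] by simp
  next
    case (2 a b k')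
    have bc: "- bary i j k m - bary a b k' m \<in> \<int>" if "m \<le> n" for m
      using int[OF that] sector_data(1)[OF 2(1-3)] by (simp add: 2(4))
    have abn: "a \<le> n" "b \<le> n" using adjacentD[OF 2(1)] by auto
    have mem: "m \<in> {i, j}" if "m \<le> n" "bary a b k' m \<notin> \<int>" for m
    proof (rule ccontr)
      assume "m \<notin> {i, j}"
      then have "bary i j k m = 0" by (simp add: bary_def)
      then show False using bc[OF that(1)] that(2) by simp
    qed
    have "a \<in> {i, j}" "b \<in> {i, j}" using mem[OF abn(1)] mem[OF abn(2)] bary_not_int[OF 2(2,3)] by auto
    then have ab: "a = i" "b = j" using 2(2,3) ij' by auto
    obtain z where z: "- bary i j k i - bary i j k' i = of_int z"
      using bc[OF le(1)] unfolding ab by (elim Ints_cases)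
    have "(of_int z :: rat) < 0" "- 2 < (of_int z :: rat)"
      unfolding z[symmetric] using bary_bounds[OF ij(2,3)] bary_bounds[OF 2(2,3)] unfolding ab by linarith+
    then have "z = - 1" by simp
    then have e: "bary i j k i + bary i j k' i = 1" using z by simp
    have d: "(of_nat (j - i) :: rat) \<noteq> 0" using ij' by simp
    have "of_nat (j - k) + of_nat (j - k') = (of_nat (j - i) :: rat)"
      using e d by (simp add: bary_def add_divide_distrib[symmetric])
    then have "j - k + (j - k') = j - i" by (metis of_nat_add of_nat_eq_iff)
    then have "k' = i + j - k" using ij 2(2,3) unfolding ab by linarith
    then show ?thesis using 2(4) by simp
  qed
qed

lemma sum_one_sector:
  fixes f :: "(int \<times> int) \<times> nat multiset \<Rightarrow> complex"
  assumes "\<gamma> \<in> Box S" "\<And>p. p \<in> Box S \<times> indices \<Longrightarrow> fst p \<noteq> \<gamma> \<Longrightarrow> f p = 0"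
  shows "(\<Sum>p\<in>Box S \<times> indices. f p) = (\<Sum>M\<in>indices. f (\<gamma>, M))"
proof -
  have "(\<Sum>p\<in>Box S \<times> indices. f p) = (\<Sum>\<gamma>'\<in>Box S. \<Sum>M\<in>indices. f (\<gamma>', M))"
    by (simp add: sum.cartesian_product)
  also have "\<dots> = (\<Sum>\<gamma>'\<in>{\<gamma>}. \<Sum>M\<in>indices. f (\<gamma>', M))"
    using assms by (intro sum.mono_neutral_right finite_Box) (auto intro!: sum.neutral)
  finally show ?thesis by simp
qed

lemma leadX_sector:
  assumes g: "\<gamma> \<in> Box S" "\<gamma>' \<in> Box S" and l: "l \<in> Lset n S c \<gamma>" "l' \<in> Lset n S d \<gamma>'"
    and u: "\<And>\<delta>. \<delta> \<in> Box S \<Longrightarrow> l \<in> Lset n S c \<delta> \<Longrightarrow> \<delta> = \<gamma>" "\<And>\<delta>. \<delta> \<in> Box S \<Longrightarrow> l' \<in> Lset n S d \<delta> \<Longrightarrow> \<delta> = \<gamma>'"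
  shows "leadX B l l' c d y = (\<Sum>M\<in>indices. jet n M y l * (\<Sum>M'\<in>indices. B (eH \<gamma> M) (eC \<gamma>' M') * jet n M' y l'))"
proof -
  have z: "lead \<delta> M c l y = 0" if "\<delta> \<in> Box S" "\<delta> \<noteq> \<gamma>" for \<delta> M using u(1)[OF that(1)] that(2) unfolding lead_def by auto
  have z': "lead \<delta> M d l' y = 0" if "\<delta> \<in> Box S" "\<delta> \<noteq> \<gamma>'" for \<delta> M using u(2)[OF that(1)] that(2) unfolding lead_def by auto
  have "leadX B l l' c d y = (\<Sum>M\<in>indices. \<Sum>q\<in>Box S \<times> indices.
      B (eH \<gamma> M) (eC (fst q) (snd q)) * (lead \<gamma> M c l y * lead (fst q) (snd q) d l' y))"
    unfolding leadX_def by (subst sum_one_sector[OF g(1)]) (auto intro!: sum.neutral simp: z)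
  also have "\<dots> = (\<Sum>M\<in>indices. \<Sum>M'\<in>indices. B (eH \<gamma> M) (eC \<gamma>' M') * (lead \<gamma> M c l y * lead \<gamma>' M' d l' y))"
    by (rule sum.cong[OF refl], subst sum_one_sector[OF g(2)]) (auto simp: z')
  also have "\<dots> = (\<Sum>M\<in>indices. jet n M y l * (\<Sum>M'\<in>indices. B (eH \<gamma> M) (eC \<gamma>' M') * jet n M' y l'))"
    unfolding sum_distrib_left using l by (intro sum.cong refl) (simp add: lead_def mult_ac)
  finally show ?thesis .
qed

lemma jet_restrict:
  assumes "A \<subseteq> {..n}" "\<And>k. k \<le> n \<Longrightarrow> k \<notin> A \<Longrightarrow> l k = 0 \<and> count M k = 0"
  shows "jet n M y l = (\<Prod>k\<in>A. fps_nth (gamma_factor (y k) (l k)) (count M k))"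
  unfolding jet_def
proof (rule prod.mono_neutral_right)
  show "\<forall>k\<in>{..n} - A. fps_nth (gamma_factor (y k) (l k)) (count M k) = 1"
  proof
    fix k assume "k \<in> {..n} - A"
    then have "l k = 0" "count M k = 0" using assms(2)[of k] by auto
    then show "fps_nth (gamma_factor (y k) (l k)) (count M k) = 1" by (simp add: gamma_factor_0)
  qed
qed (use assms(1) in auto)

lemma jets_zero:
  "jet n {#} y (\<lambda>_. 0) = 1" "m \<le> n \<Longrightarrow> jet n {#m#} y (\<lambda>_. 0) = (y m + gamma_const) / period"
proof -
  show "jet n {#} y (\<lambda>_. 0) = 1" by (subst jet_restrict[of "{}"]) auto
  show "m \<le> n \<Longrightarrow> jet n {#m#} y (\<lambda>_. 0) = (y m + gamma_const) / period"
    by (subst jet_restrict[of "{m}"]) (auto simp: gamma_factor_zero_1)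
qed

lemma jet_vertex: "i \<le> n \<Longrightarrow> jet n {#i#} y (vertex i) = exp (- y i) / period"
  by (subst jet_restrict[of "{i}"]) (auto simp: vertex_def gamma_factor_minus_one)

lemma jet_vertex_pair:
  assumes "j \<le> n" "m \<le> n" shows "jet n {#m, j#} y (vertex j) = exp (- y j) * (y m + gamma_const) / period\<^sup>2"
proof (cases "m = j")
  case True
  then show ?thesis using assms
    by (subst jet_restrict[of "{j}"]) (auto simp: vertex_def gamma_factor_minus_one(3)[unfolded numeral_2_eq_2] numeral_2_eq_2)
next
  case False
  then show ?thesis using assms
    by (subst jet_restrict[of "{m, j}"]) (auto simp: vertex_def gamma_factor_minus_one(2) gamma_factor_zero_1 power2_eq_square)
qed

lemma jet_edge:
  assumes "i \<le> n" "j \<le> n" "i \<noteq> j"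
  shows "jet n {#i, j#} y (\<lambda>k. vertex i k + vertex j k) = exp (- y i) * exp (- y j) / period\<^sup>2"
  using assms by (subst jet_restrict[of "{i, j}"]) (auto simp: vertex_def gamma_factor_minus_one(2) power2_eq_square)

lemma neg_set_vertex: "i \<le> n \<Longrightarrow> neg_set n (vertex i) = {i}"
  by (auto simp: neg_set_def vertex_def)

lemma neg_set_edge: "i \<le> n \<Longrightarrow> j \<le> n \<Longrightarrow> neg_set n (\<lambda>k. vertex i k + vertex j k) = {i, j}"
  by (auto simp: neg_set_def vertex_def)

lemma jet_neg_zero: "k \<in> neg_set n l \<Longrightarrow> k \<notin># M \<Longrightarrow> jet n M y l = 0"
  using jet_neg_set[of M y l] by blast

context
  fixes B assumes B: "bilinear_form (relH n S) (relHc n S) B"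
begin

lemma B_eH_pair: "B (eH (0, 0) {#i, j#}) v = 0"
  using functional_rel[OF B_left[OF B] eH_pair_rel[of "(0, 0)" 1 i j]] by (simp add: eH_def Box_eq)

lemma eH_ray: "eH (0, 0) {#m#} = pm_scale (D m) (oneH (0, 0))"
  by (simp add: eH_def)

text \<open>The limits of the three kinds of terms, where \<open>z\<close> stands for \<open>y + gamma_const\<close>. The dependence on \<open>z\<close> comes
  from the linear Taylor coefficient at the exponent 0 and the quadratic one at the exponent \<open>-1\<close>.\<close>

definition edge_limit :: "nat \<Rightarrow> nat \<Rightarrow> (nat \<Rightarrow> complex) \<Rightarrow> complex" where
  "edge_limit i j z = 1 / period\<^sup>2 * (B (oneH (0, 0)) (Fcone {i, j}) +
     (\<Sum>m\<le>n. B (pm_scale (D m) (oneH (0, 0))) (Fcone {i, j}) / period * z m))"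

definition ray_limit :: "nat \<Rightarrow> nat \<Rightarrow> (nat \<Rightarrow> complex) \<Rightarrow> complex" where
  "ray_limit i j z = 1 / period\<^sup>2 * (B (pm_scale (D i) (oneH (0, 0))) (Fcone {j}) +
     (\<Sum>m\<le>n. B (pm_scale (D i) (oneH (0, 0))) (eC (0, 0) {#m, j#}) / period * z m))"

definition twisted_limit :: "nat \<Rightarrow> nat \<Rightarrow> nat \<Rightarrow> complex" where
  "twisted_limit i j k = (sin (of_real pi * of_rat (bary i j (i + j - k) i)))\<^sup>2 / (of_real pi)\<^sup>2 *
     B (oneH (int (i + j - k), 1)) (Ftw (int k, 1))"

lemma Box_zero: "(0, 0) \<in> Box S" by (simp add: Box_eq)

lemma exp_cancel: "exp (a :: complex) * exp b * (exp (- a) * exp (- b) * u) = u"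
proof -
  have "exp a * exp b * (exp (- a) * exp (- b) * u) = (exp a * exp (- a)) * (exp b * exp (- b)) * u" by (simp only: mult_ac)
  then show ?thesis by (simp add: exp_minus)
qed

text \<open>On the right both indices of \<open>M'\<close> are used up by the poles at \<open>l\<^sub>i = l\<^sub>j = -1\<close>, which leaves \<open>F\<^bsub>{i, j}\<^esub>\<close>;
  on the left all exponents are 0, with linear terms in the \<open>D\<^sub>m\<close>.\<close>

lemma leadX_edge:
  assumes ij: "i \<le> n" "j \<le> n" "i \<noteq> j"
  shows "exp (y i) * exp (y j) * leadX B (\<lambda>_. 0) (\<lambda>k. vertex i k + vertex j k) (0, 0) (int i + int j, 2) y =
     edge_limit i j (\<lambda>m. y m + gamma_const)"
proof -
  let ?l = "\<lambda>k. vertex i k + vertex j k"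
  have "(\<Sum>M'\<in>indices. B (eH (0, 0) M) (eC (0, 0) M') * jet n M' y ?l) =
     (\<Sum>M'\<in>{{#i, j#}}. B (eH (0, 0) M) (eC (0, 0) M') * jet n M' y ?l)" for M
  proof (rule sum.mono_neutral_right[OF finite_indices])
    show "{{#i, j#}} \<subseteq> indices" using ij by (auto simp: indices_def)
    show "\<forall>M'\<in>indices - {{#i, j#}}. B (eH (0, 0) M) (eC (0, 0) M') * jet n M' y ?l = 0"
    proof
      fix M' assume M': "M' \<in> indices - {{#i, j#}}"
      have "i \<notin># M' \<or> j \<notin># M'"
      proof (rule ccontr)
        assume "\<not> ?thesis"
        then have m: "i \<in># M'" "j \<in># M'" by auto
        obtain N where N: "M' = add_mset i N" using m(1) by (meson multi_member_split)
        then have "j \<in># N" using m(2) ij(3) by auto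
        then obtain N' where N': "N = add_mset j N'" by (meson multi_member_split)
        have "size M' \<le> 2" using M' by (simp add: indices_def)
        then have "N' = {#}" by (simp add: N N')
        then show False using M' by (simp add: N N')
      qed
      then have "jet n M' y ?l = 0" using jet_neg_zero[of _ ?l M' y] neg_set_edge[OF ij(1,2)] by auto
      then show "B (eH (0, 0) M) (eC (0, 0) M') * jet n M' y ?l = 0" by simp
    qed
  qed
  then have inner: "(\<Sum>M'\<in>indices. B (eH (0, 0) M) (eC (0, 0) M') * jet n M' y ?l) =
     B (eH (0, 0) M) (Fcone {i, j}) * (exp (- y i) * exp (- y j) / period\<^sup>2)" for M
    using jet_edge[OF ij, of y] by (simp add: eC_pair[OF ij(3)])
  have "leadX B (\<lambda>_. 0) ?l (0, 0) (int i + int j, 2) y =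
    (\<Sum>M\<in>indices. jet n M y (\<lambda>_. 0) * (B (eH (0, 0) M) (Fcone {i, j}) * (exp (- y i) * exp (- y j) / period\<^sup>2)))"
    unfolding inner[symmetric]
  proof (rule leadX_sector[OF Box_zero Box_zero Lset_zero Lset_edge[OF ij(1,2)]])
    fix \<delta> assume "\<delta> \<in> Box S"
    then show "(\<lambda>_. 0) \<in> Lset n S (0, 0) \<delta> \<Longrightarrow> \<delta> = (0, 0)" by (rule Lset_integral[rotated]) auto
    show "?l \<in> Lset n S (int i + int j, 2) \<delta> \<Longrightarrow> \<delta> = (0, 0)" by (rule Lset_integral[OF _ \<open>\<delta> \<in> Box S\<close>], assumption, rule Ints_add[OF vertex_int vertex_int])
  qed
  also have "\<dots> = jet n {#} y (\<lambda>_. 0) * (B (eH (0, 0) {#}) (Fcone {i, j}) * (exp (- y i) * exp (- y j) / period\<^sup>2)) +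
    (\<Sum>m\<le>n. jet n {#m#} y (\<lambda>_. 0) * (B (eH (0, 0) {#m#}) (Fcone {i, j}) * (exp (- y i) * exp (- y j) / period\<^sup>2)))"
    by (rule sum_indices_le1) (simp add: B_eH_pair)
  also have "\<dots> = exp (- y i) * exp (- y j) * edge_limit i j (\<lambda>m. y m + gamma_const)"
    unfolding edge_limit_def distrib_left sum_distrib_left
    by (intro arg_cong2[where f = "(+)"] sum.cong refl)
       (simp_all add: jets_zero eH_ray eH_def[of _ "{#}"] pm_scale_1 mult_ac distrib_left distrib_right add_divide_distrib)
  finally have "leadX B (\<lambda>_. 0) ?l (0, 0) (int i + int j, 2) y = exp (- y i) * exp (- y j) * edge_limit i j (\<lambda>m. y m + gamma_const)" .
  then show ?thesis by (simp only: exp_cancel)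
qed

text \<open>The pole at \<open>l\<^sub>i = -1\<close> forces the monomial \<open>D\<^sub>i\<close> on the left, which exhausts the degree there; on the right it
  forces \<open>F\<^sub>j\<close>, possibly multiplied by another \<open>D\<^sub>m\<close>.\<close>

lemma leadX_ray:
  assumes ij: "i \<le> n" "j \<le> n"
  shows "exp (y i) * exp (y j) * leadX B (vertex i) (vertex j) (int i, 1) (int j, 1) y = ray_limit i j (\<lambda>m. y m + gamma_const)"
proof -
  have inner: "(\<Sum>M'\<in>indices. B (eH (0, 0) M) (eC (0, 0) M') * jet n M' y (vertex j)) =
     exp (- y j) * (B (eH (0, 0) M) (Fcone {j}) / period + (\<Sum>m\<le>n. B (eH (0, 0) M) (eC (0, 0) {#m, j#}) * (y m + gamma_const) / period\<^sup>2))" for M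
  proof -
    have "(\<Sum>M'\<in>indices. B (eH (0, 0) M) (eC (0, 0) M') * jet n M' y (vertex j)) =
       B (eH (0, 0) M) (eC (0, 0) {#j#}) * jet n {#j#} y (vertex j) +
       (\<Sum>m\<le>n. B (eH (0, 0) M) (eC (0, 0) {#m, j#}) * jet n {#m, j#} y (vertex j))"
      by (rule sum_indices_containing[OF _ ij(2)]) (simp add: jet_neg_zero[of j] neg_set_vertex[OF ij(2)])
    also have "\<dots> = exp (- y j) * (B (eH (0, 0) M) (Fcone {j}) / period + (\<Sum>m\<le>n. B (eH (0, 0) M) (eC (0, 0) {#m, j#}) * (y m + gamma_const) / period\<^sup>2))"
      unfolding distrib_left[of "exp (- y j)"] sum_distrib_left using ij(2)
      by (intro arg_cong2[where f = "(+)"] sum.cong refl) (simp_all add: jet_vertex jet_vertex_pair eC_ray mult_ac)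
    finally show ?thesis .
  qed
  define V where "V M = exp (- y j) * (B (eH (0, 0) M) (Fcone {j}) / period + (\<Sum>m\<le>n. B (eH (0, 0) M) (eC (0, 0) {#m, j#}) * (y m + gamma_const) / period\<^sup>2))" for M
  have "leadX B (vertex i) (vertex j) (int i, 1) (int j, 1) y = (\<Sum>M\<in>indices. jet n M y (vertex i) * V M)"
    unfolding V_def inner[symmetric]
  proof (rule leadX_sector[OF Box_zero Box_zero Lset_vertex[OF ij(1)] Lset_vertex[OF ij(2)]])
    fix \<delta> assume \<delta>: "\<delta> \<in> Box S"
    show "vertex i \<in> Lset n S (int i, 1) \<delta> \<Longrightarrow> \<delta> = (0, 0)" by (rule Lset_integral[OF _ \<delta>], assumption, rule vertex_int)
    show "vertex j \<in> Lset n S (int j, 1) \<delta> \<Longrightarrow> \<delta> = (0, 0)" by (rule Lset_integral[OF _ \<delta>], assumption, rule vertex_int)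
  qed
  also have "\<dots> = jet n {#i#} y (vertex i) * V {#i#} + (\<Sum>m\<le>n. jet n {#m, i#} y (vertex i) * V {#m, i#})"
    by (rule sum_indices_containing[OF _ ij(1)]) (simp add: jet_neg_zero[of i] neg_set_vertex[OF ij(1)])
  also have "(\<Sum>m\<le>n. jet n {#m, i#} y (vertex i) * V {#m, i#}) = 0"
    by (rule sum.neutral) (simp add: V_def B_eH_pair)
  also have "jet n {#i#} y (vertex i) * V {#i#} + 0 = exp (- y i) * exp (- y j) * ray_limit i j (\<lambda>m. y m + gamma_const)"
  proof -
    have r: "1 / period * (B (eH (0, 0) {#i#}) (Fcone {j}) / period + (\<Sum>m\<le>n. B (eH (0, 0) {#i#}) (eC (0, 0) {#m, j#}) * (y m + gamma_const) / period\<^sup>2))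
      = ray_limit i j (\<lambda>m. y m + gamma_const)"
      unfolding ray_limit_def distrib_left[of "1 / period"] distrib_left[of "1 / period\<^sup>2"] sum_distrib_left eH_ray
      by (intro arg_cong2[where f = "(+)"] sum.cong refl) (simp_all add: power2_eq_square)
    show ?thesis unfolding V_def jet_vertex[OF ij(1)] r[symmetric] by simp
  qed
  finally have "leadX B (vertex i) (vertex j) (int i, 1) (int j, 1) y = exp (- y i) * exp (- y j) * ray_limit i j (\<lambda>m. y m + gamma_const)" .
  then show ?thesis by (simp only: exp_cancel)
qed

lemma jet_bary:
  assumes ij: "adjacent S i j" "i < k" "k < j"
  shows "jet n {#} y (\<lambda>m. - bary i j k m) = exp (- of_rat (bary i j k i) * y i) * exp (- of_rat (bary i j k j) * y j) *
     (rGamma (1 - of_rat (bary i j k i)) * rGamma (1 - of_rat (bary i j k j)))"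
proof -
  have le: "i \<le> n" "j \<le> n" "i \<noteq> j" using adjacentD[OF ij(1)] ij by auto
  have "jet n {#} y (\<lambda>m. - bary i j k m) = (\<Prod>m\<in>{i, j}. fps_nth (gamma_factor (y m) (- bary i j k m)) (count {#} m))"
    by (rule jet_restrict) (use le in \<open>auto simp: bary_def\<close>)
  then show ?thesis using le(3) by (simp add: gamma_factor_0 of_rat_minus mult_ac)
qed

text \<open>The \<open>D\<^sub>k\<close> act as zero and there are four Gamma factors, at \<open>\<beta>\<close> and \<open>1 - \<beta>\<close> for each of the two series.
  The reflection formula \<open>1/(\<Gamma>(\<beta>) \<Gamma>(1 - \<beta>)) = sin (\<pi>\<beta>) / \<pi>\<close> applies twice.\<close>

lemma leadX_twisted:
  assumes ij: "adjacent S i j" "i < k" "k < j"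
  shows "exp (y i) * exp (y j) * leadX B (\<lambda>m. - bary i j k m) (\<lambda>m. - bary i j (i + j - k) m) (int k, 1) (int (i + j - k), 1) y = twisted_limit i j k"
proof -
  define k' where "k' = i + j - k"
  have k': "i < k'" "k' < j" "i + j - k' = k" using ij by (auto simp: k'_def)
  have bk: "bary i j k' i = bary i j k j" "bary i j k' j = bary i j k i" unfolding k'_def using bary_reflect[OF ij(2,3)] .
  have sum1: "bary i j k j = 1 - bary i j k i" using bary_sums(1)[OF ij(2,3)] by linarith
  have notS: "m \<notin> S" "m \<le> n" if "i < m" "m < j" for m
    using ij(1) that adjacentD[OF ij(1)] unfolding adjacent_def by (auto simp: min_def max_def split: if_splits)
  have g: "(int k', 1) \<in> Box S" "(int k, 1) \<in> Box S" unfolding Box_eq using notS k' ij(2,3) by auto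
  have eH0: "B (eH (int k', 1) M) v = 0" if "M \<noteq> {#}" for M v
  proof -
    obtain m where "m \<in># M" using \<open>M \<noteq> {#}\<close> by (meson multiset_nonemptyE)
    then obtain N where "M = add_mset m N" by (meson multi_member_split)
    then have "eH (int k', 1) M = pm_scale (\<Prod>k\<in>#N. D k) (pm_scale (D m) (oneH (int k', 1)))"
      by (simp add: eH_def pm_scale_scale mult.commute)
    then show ?thesis using functional_rel[OF B_left[OF B] relH_scale[OF relH_base(3)[OF g(1)]]] by simp
  qed
  have eC0: "B u (eC (int k, 1) M) = 0" if "M \<noteq> {#}" for M u
  proof -
    obtain m where "m \<in># M" using \<open>M \<noteq> {#}\<close> by (meson multiset_nonemptyE)
    then obtain N where "M = add_mset m N" by (meson multi_member_split)
    then have "eC (int k, 1) M = pm_scale (\<Prod>k\<in>#N. D k) (pm_scale (D m) (Ftw (int k, 1)))"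
      by (simp add: eC_def pm_scale_scale mult.commute)
    then show ?thesis using functional_rel[OF B_right[OF B] relHc_scale[OF relHc_base(7)[OF g(2)]]] by simp
  qed
  have ind: "{#} \<in> indices" by (simp add: indices_def)
  have only: "(\<Sum>M\<in>indices. f M) = f {#}" if "\<And>M. M \<noteq> {#} \<Longrightarrow> f M = 0" for f :: "nat multiset \<Rightarrow> complex"
    using sum.mono_neutral_right[OF finite_indices, of "{{#}}" f] ind that by auto
  have "leadX B (\<lambda>m. - bary i j k m) (\<lambda>m. - bary i j k' m) (int k, 1) (int k', 1) y =
     (\<Sum>M\<in>indices. jet n M y (\<lambda>m. - bary i j k m) * (\<Sum>M'\<in>indices. B (eH (int k', 1) M) (eC (int k, 1) M') * jet n M' y (\<lambda>m. - bary i j k' m)))"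
    by (rule leadX_sector[OF g])
       (use Lset_bary[OF ij] Lset_bary[OF ij(1) k'(1,2)] g in \<open>simp_all add: k'(3) k'_def[symmetric]\<close>)
  also have "\<dots> = jet n {#} y (\<lambda>m. - bary i j k m) * (\<Sum>M'\<in>indices. B (eH (int k', 1) {#}) (eC (int k, 1) M') * jet n M' y (\<lambda>m. - bary i j k' m))"
    by (rule only) (simp add: eH0)
  also have "(\<Sum>M'\<in>indices. B (eH (int k', 1) {#}) (eC (int k, 1) M') * jet n M' y (\<lambda>m. - bary i j k' m)) =
     B (oneH (int k', 1)) (Ftw (int k, 1)) * jet n {#} y (\<lambda>m. - bary i j k' m)"
  proof -
    have "(\<Sum>M'\<in>indices. B (eH (int k', 1) {#}) (eC (int k, 1) M') * jet n M' y (\<lambda>m. - bary i j k' m)) =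
      B (eH (int k', 1) {#}) (eC (int k, 1) {#}) * jet n {#} y (\<lambda>m. - bary i j k' m)"
      by (rule only) (simp add: eC0)
    then show ?thesis by (simp add: eH_def eC_def pm_scale_1)
  qed
  finally have L: "leadX B (\<lambda>m. - bary i j k m) (\<lambda>m. - bary i j k' m) (int k, 1) (int k', 1) y =
     jet n {#} y (\<lambda>m. - bary i j k m) * jet n {#} y (\<lambda>m. - bary i j k' m) * B (oneH (int k', 1)) (Ftw (int k, 1))"
    by (simp only: mult_ac)
  define \<beta> where "\<beta> = (of_rat (bary i j k j) :: complex)"
  have \<alpha>: "of_rat (bary i j k i) = 1 - \<beta>" unfolding \<beta>_def sum1 by (simp add: of_rat_diff)
  have e1: "exp (- (1 - \<beta>) * y i) * exp (- \<beta> * y j) * (exp (- \<beta> * y i) * exp (- (1 - \<beta>) * y j)) = exp (- y i) * exp (- y j)"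
    by (simp only: exp_add[symmetric]) (simp add: algebra_simps)
  have e2: "rGamma \<beta> * rGamma (1 - \<beta>) = sin (of_real pi * \<beta>) / of_real pi" by (rule rGamma_reflection_complex)
  have alg: "a * b * (r * s) * (c * d * (s * r)) = a * b * (c * d) * (r * s)\<^sup>2" for a b c d r s :: complex
    by (simp add: power2_eq_square)
  have "jet n {#} y (\<lambda>m. - bary i j k m) * jet n {#} y (\<lambda>m. - bary i j k' m) =
     exp (- y i) * exp (- y j) * (sin (of_real pi * \<beta>) / of_real pi)\<^sup>2"
    unfolding jet_bary[OF ij] jet_bary[OF ij(1) k'(1,2)] bk \<beta>_def[symmetric] \<alpha> diff_diff_eq2 add_diff_cancel_left'
    unfolding alg unfolding e1 e2 ..
  then have "leadX B (\<lambda>m. - bary i j k m) (\<lambda>m. - bary i j k' m) (int k, 1) (int k', 1) y = exp (- y i) * exp (- y j) * twisted_limit i j k"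
    unfolding L twisted_limit_def k'_def[symmetric] bk \<beta>_def[symmetric] power_divide by (simp only: mult.assoc)
  then show ?thesis unfolding k'_def[symmetric] by (simp only: exp_cancel)
qed

end

end

section \<open>The value of the pairing\<close>

text \<open>The kernel is 1 at the two ends and 2 in between. The conditions \<open>j < n\<close> and \<open>0 < i\<close> say that the right
  part of the splitting is an interior point.\<close>

lemma sum_kernel_split:
  fixes g :: "int \<Rightarrow> int \<Rightarrow> complex"
  assumes ij: "i < j" "j \<le> n"
  shows "(\<Sum>k\<in>{0..int n}. sign_kernel (int j) (int i) k * (if 0 < int i + int j - k \<and> int i + int j - k < int n then g k (int i + int j - k) else 0)) =
    (if j < n then g (int i) (int j) else 0) + (if 0 < i then g (int j) (int i) else 0) + 2 * (\<Sum>k\<in>{i<..<j}. g (int k) (int (i + j - k)))"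
proof -
  let ?f = "\<lambda>k. sign_kernel (int j) (int i) k * (if 0 < int i + int j - k \<and> int i + int j - k < int n then g k (int i + int j - k) else 0)"
  have "(\<Sum>k\<in>{0..int n}. ?f k) = (\<Sum>k\<le>n. ?f (int k))" by (rule sum_int)
  also have "\<dots> = (\<Sum>k\<in>insert i (insert j {i<..<j}). ?f (int k))"
    using ij by (intro sum.mono_neutral_right) (auto simp: sign_kernel_def sgn_if)
  also have "\<dots> = ?f (int i) + (?f (int j) + (\<Sum>k\<in>{i<..<j}. ?f (int k)))"
    using ij by simp
  also have "(\<Sum>k\<in>{i<..<j}. ?f (int k)) = 2 * (\<Sum>k\<in>{i<..<j}. g (int k) (int (i + j - k)))"
    unfolding sum_distrib_left
  proof (rule sum.cong[OF refl])
    fix k assume "k \<in> {i<..<j}"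
    then have k: "i < k" "k < j" by auto
    then have "int (i + j - k) = int i + int j - int k" by (simp add: of_nat_diff)
    then show "?f (int k) = 2 * g (int k) (int (i + j - k))" using k ij by (simp add: sign_kernel_def)
  qed
  also have "?f (int i) = (if j < n then g (int i) (int j) else 0)" using ij by (auto simp: sign_kernel_def)
  also have "?f (int j) = (if 0 < i then g (int j) (int i) else 0)" using ij by (auto simp: sign_kernel_def)
  finally show ?thesis by simp
qed

lemma finite_pairs: "finite {(i, j). i < j \<and> j \<le> (n :: nat)}"
  by (rule finite_subset[of _ "{..n} \<times> {..n}"]) auto

definition affine_in :: "nat \<Rightarrow> ((nat \<Rightarrow> complex) \<Rightarrow> complex) \<Rightarrow> bool" where
  "affine_in n F \<longleftrightarrow> (\<exists>R T. \<forall>z. F z = R + (\<Sum>m\<le>n. T m * z m))"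

lemma affine_const: "affine_in n (\<lambda>z. c)"
  unfolding affine_in_def by (intro exI[of _ c] exI[of _ "\<lambda>_. 0"]) simp

lemma affine_basic: "affine_in n (\<lambda>z. \<Sum>m\<le>n. T m * z m)"
  unfolding affine_in_def by (intro exI[of _ 0] exI[of _ T]) simp

lemma affine_add: "affine_in n F \<Longrightarrow> affine_in n G \<Longrightarrow> affine_in n (\<lambda>z. F z + G z)"
proof -
  assume "affine_in n F" "affine_in n G"
  then obtain R T R' T' where "\<forall>z. F z = R + (\<Sum>m\<le>n. T m * z m)" "\<forall>z. G z = R' + (\<Sum>m\<le>n. T' m * z m)"
    unfolding affine_in_def by blast
  then have "\<forall>z. F z + G z = (R + R') + (\<Sum>m\<le>n. (T m + T' m) * z m)"
    by (simp add: sum.distrib distrib_right)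
  then show ?thesis unfolding affine_in_def by (intro exI)
qed

lemma affine_cmult: "affine_in n F \<Longrightarrow> affine_in n (\<lambda>z. c * F z)"
proof -
  assume "affine_in n F"
  then obtain R T where "\<forall>z. F z = R + (\<Sum>m\<le>n. T m * z m)" unfolding affine_in_def by blast
  then have "\<forall>z. c * F z = c * R + (\<Sum>m\<le>n. (c * T m) * z m)"
    by (simp add: distrib_left sum_distrib_left mult.assoc)
  then show ?thesis unfolding affine_in_def by (intro exI)
qed

lemma affine_diff: "affine_in n F \<Longrightarrow> affine_in n G \<Longrightarrow> affine_in n (\<lambda>z. F z - G z)"
  using affine_add[OF _ affine_cmult[of n G "- 1"]] by simp

lemma affine_if: "affine_in n F \<Longrightarrow> affine_in n (\<lambda>z. if P then F z else 0)"
  using affine_const[of n 0] by (cases P) simp_all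

lemma affine_sum: "(\<And>i. i \<in> I \<Longrightarrow> affine_in n (F i)) \<Longrightarrow> affine_in n (\<lambda>z. \<Sum>i\<in>I. F i z)"
  by (induction I rule: infinite_finite_induct) (auto intro: affine_const affine_add)

context fan begin

context
  fixes B assumes B: "bilinear_form (relH n S) (relHc n S) B"
begin

definition pair_term :: "nat \<Rightarrow> nat \<Rightarrow> (nat \<Rightarrow> complex) \<Rightarrow> complex" where
  "pair_term i j y = (of_nat j - of_nat i)\<^sup>2 * (exp (y i) * exp (y j) * X B y (0, 0) (int i + int j, 2))
    - of_nat n / 2 * (of_nat j - of_nat i) *
      ((if j < n then exp (y i) * exp (y j) * X B y (int i, 1) (int j, 1) else 0)
     + (if 0 < i then exp (y j) * exp (y i) * X B y (int j, 1) (int i, 1) else 0)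
     + 2 * (\<Sum>k\<in>{i<..<j}. exp (y i) * exp (y j) * X B y (int k, 1) (int (i + j - k), 1)))"

text \<open>The limit of \<open>pair_term\<close>, with \<open>z = y + gamma_const\<close> along the ray.\<close>

definition pair_limit :: "nat \<Rightarrow> nat \<Rightarrow> (nat \<Rightarrow> complex) \<Rightarrow> complex" where
  "pair_limit i j z = (of_nat j - of_nat i)\<^sup>2 * (if adjacent S i j then edge_limit B i j z else 0)
    - of_nat n / 2 * (of_nat j - of_nat i) *
      ((if j < n then if i \<in> S \<and> j \<in> S then ray_limit B i j z else 0 else 0)
     + (if 0 < i then if j \<in> S \<and> i \<in> S then ray_limit B j i z else 0 else 0)
     + 2 * (\<Sum>k\<in>{i<..<j}. if adjacent S i j then twisted_limit B i j k else 0))"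

lemma sym_pairing_terms:
  "sym_pairing (int n) (\<lambda>i. exp (y (nat i))) (X B y) = (\<Sum>(i, j) | i < j \<and> j \<le> n. pair_term i j y)"
proof -
  define f where "f i j = (of_int (int i - int j))\<^sup>2 * exp (y i) * exp (y j) * X B y (0, 0) (int i + int j, 2)" for i j
  define g where "g i j = of_int (int j - int i) * exp (y i) * exp (y j) * (\<Sum>k\<in>{0..int n}. sign_kernel (int j) (int i) k *
     (if 0 < int i + int j - k \<and> int i + int j - k < int n then X B y (k, 1) (int i + int j - k, 1) else 0))" for i j
  have g_sym: "g i j = g j i" for i j
  proof -
    have "(\<Sum>k\<in>{0..int n}. sign_kernel (int j) (int i) k * (if 0 < int i + int j - k \<and> int i + int j - k < int n then X B y (k, 1) (int i + int j - k, 1) else 0)) =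
      - (\<Sum>k\<in>{0..int n}. sign_kernel (int i) (int j) k * (if 0 < int j + int i - k \<and> int j + int i - k < int n then X B y (k, 1) (int j + int i - k, 1) else 0))"
      unfolding sum_negf[symmetric] by (intro sum.cong refl) (simp add: sign_kernel_swap[of "int j"] add.commute)
    then show ?thesis unfolding g_def by (simp add: algebra_simps)
  qed
  have fs: "1/2 * (\<Sum>i\<le>n. \<Sum>j\<le>n. f i j) = (\<Sum>(i, j) | i < j \<and> j \<le> n. f i j)"
    by (rule sum_ordered_pairs[symmetric]) (simp_all add: f_def add.commute power2_commute mult_ac)
  have gs: "1/2 * (\<Sum>i\<le>n. \<Sum>j\<le>n. g i j) = (\<Sum>(i, j) | i < j \<and> j \<le> n. g i j)"
    by (rule sum_ordered_pairs[symmetric]) (rule g_sym, simp add: g_def)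
  have "sym_pairing (int n) (\<lambda>i. exp (y (nat i))) (X B y) =
     1/2 * (\<Sum>i\<le>n. \<Sum>j\<le>n. f i j) - of_nat n / 2 * (1/2 * (\<Sum>i\<le>n. \<Sum>j\<le>n. g i j))"
    unfolding sym_pairing_def sum_int f_def g_def nat_int by simp
  also have "\<dots> = (\<Sum>(i, j) | i < j \<and> j \<le> n. f i j - of_nat n / 2 * g i j)"
    unfolding fs gs unfolding sum_distrib_left sum_subtractf[symmetric] by (intro sum.cong refl) (simp add: case_prod_unfold)
  also have "\<dots> = (\<Sum>(i, j) | i < j \<and> j \<le> n. pair_term i j y)"
  proof (intro sum.cong refl)
    fix p assume p: "p \<in> {(i, j). i < j \<and> j \<le> n}"
    obtain i j where [simp]: "p = (i, j)" by (cases p)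
    have ij: "i < j" "j \<le> n" using p by auto
    have g: "g i j = of_int (int j - int i) * exp (y i) * exp (y j) *
      ((if j < n then X B y (int i, 1) (int j, 1) else 0) + (if 0 < i then X B y (int j, 1) (int i, 1) else 0)
       + 2 * (\<Sum>k\<in>{i<..<j}. X B y (int k, 1) (int (i + j - k), 1)))"
      unfolding g_def sum_kernel_split[OF ij, where g = "\<lambda>k m. X B y (k, 1) (m, 1)"] ..
    have "f i j - of_nat n / 2 * g i j = pair_term i j y"
      unfolding g f_def pair_term_def sum_distrib_left[symmetric]
      by (simp add: power2_commute[of "of_nat i"] mult_ac distrib_left)
    then show "(case p of (i, j) \<Rightarrow> f i j - of_nat n / 2 * g i j) = (case p of (i, j) \<Rightarrow> pair_term i j y)" by simp
  qed
  finally show ?thesis .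
qed

lemma height_vertex: "i \<le> n \<Longrightarrow> height h (vertex i) = h i"
proof -
  assume i: "i \<le> n"
  have "(\<Sum>k\<le>n. real_of_rat (vertex i k) * h k) = (\<Sum>k\<le>n. if k = i then - h k else 0)"
    by (intro sum.cong refl) (simp add: vertex_def)
  then show ?thesis using i by (simp add: height_def)
qed

lemma height_add: "height h (\<lambda>k. l k + l' k) = height h l + height h l'"
  by (simp add: height_def of_rat_add distrib_right sum.distrib)

text \<open>The two exponents add up to \<open>- e\<^sub>i - e\<^sub>j\<close>.\<close>

lemma height_bary:
  assumes ij: "adjacent S i j" "i < k" "k < j"
  shows "height h (\<lambda>m. - bary i j k m) + height h (\<lambda>m. - bary i j (i + j - k) m) = h i + h j"
proof -
  have eq: "(\<lambda>m. - bary i j k m + - bary i j (i + j - k) m) = (\<lambda>m. vertex i m + vertex j m)"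
  proof
    fix m
    have ne: "i \<noteq> j" using ij by simp
    have s: "bary i j k i + bary i j k j = 1" by (rule bary_sums(1)[OF ij(2,3)])
    consider "m = i" | "m = j" | "m \<noteq> i" "m \<noteq> j" by blast
    then show "- bary i j k m + - bary i j (i + j - k) m = vertex i m + vertex j m"
    proof cases
      case 1 then show ?thesis using s ne unfolding 1 bary_reflect[OF ij(2,3)] by (simp add: vertex_def)
    next
      case 2 then show ?thesis using s ne unfolding 2 bary_reflect[OF ij(2,3)] by (simp add: vertex_def)
    next
      case 3 then show ?thesis by (simp add: vertex_def bary_def)
    qed
  qed
  have le: "i \<le> n" "j \<le> n" using adjacentD[OF ij(1)] by auto
  show ?thesis unfolding height_add[symmetric] eq height_add[of h "vertex i"] height_vertex[OF le(1)] height_vertex[OF le(2)] ..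
qed

lemma vertex_nonpos: "vertex i k \<le> 0" by (simp add: vertex_def)

lemma bary_nonneg: "i < k \<Longrightarrow> k < j \<Longrightarrow> 0 \<le> bary i j k m" by (simp add: bary_def)

lemma first_term_limit:
  assumes y: "deep y" and h: "h \<in> height_cone n S" and ij: "i < j" "j \<le> n"
  shows "((\<lambda>t. exp (ray y h t i) * exp (ray y h t j) * X B (ray y h t) (0, 0) (int i + int j, 2)
     - (if adjacent S i j then edge_limit B i j (\<lambda>m. ray y h t m + gamma_const) else 0)) \<longlongrightarrow> 0) at_top"
proof (cases "adjacent S i j")
  case True
  have le: "i \<le> n" "j \<le> n" "i \<noteq> j" using ij by auto
  have "height h (\<lambda>_. 0) + height h (\<lambda>k. vertex i k + vertex j k) = h i + h j"
    unfolding height_add height_vertex[OF le(1)] height_vertex[OF le(2)] by (simp add: height_def)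
  from X_vertex_limit[OF B _ _ y h Lset_zero _ Lset_edge[OF le(1,2)] _ this]
  show ?thesis using True vertex_nonpos by (simp add: leadX_edge[OF B le] add_nonpos_nonpos)
next
  case False
  then show ?thesis using limit_nonadjacent_first[OF B y h ij False] by simp
qed

lemma ray_term_limit:
  assumes y: "deep y" and h: "h \<in> height_cone n S" and ij: "i \<le> n" "j \<le> n"
  shows "((\<lambda>t. exp (ray y h t i) * exp (ray y h t j) * X B (ray y h t) (int i, 1) (int j, 1)
     - (if i \<in> S \<and> j \<in> S then ray_limit B i j (\<lambda>m. ray y h t m + gamma_const) else 0)) \<longlongrightarrow> 0) at_top"
proof (cases "i \<in> S \<and> j \<in> S")
  case True
  have "height h (vertex i) + height h (vertex j) = h i + h j"
    unfolding height_vertex[OF ij(1)] height_vertex[OF ij(2)] ..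
  from X_vertex_limit[OF B _ _ y h Lset_vertex[OF ij(1)] vertex_nonpos Lset_vertex[OF ij(2)] vertex_nonpos this]
  show ?thesis using True by (simp add: leadX_ray[OF B ij])
next
  case False
  then show ?thesis using limit_outside[OF B y h ij False] unfolding if_not_P[OF False] by simp
qed

lemma between_term_limit:
  assumes y: "deep y" and h: "h \<in> height_cone n S" and ij: "i < j" "j \<le> n" and k: "i < k" "k < j"
  shows "((\<lambda>t. exp (ray y h t i) * exp (ray y h t j) * X B (ray y h t) (int k, 1) (int (i + j - k), 1)
     - (if adjacent S i j then twisted_limit B i j k else 0)) \<longlongrightarrow> 0) at_top"
proof (cases "adjacent S i j")
  case True
  have k': "i < i + j - k" "i + j - k < j" "i + j - (i + j - k) = k" using k by auto
  have notS: "m \<notin> S" "m \<le> n" if "i < m" "m < j" for m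
    using True that adjacentD[OF True] unfolding adjacent_def by (auto simp: min_def max_def split: if_splits)
  have box: "(int m, 1) \<in> Box S" if "i < m" "m < j" for m unfolding Box_eq using notS[OF that] by auto
  note g = box[OF k] box[OF k'(1,2)]
  have L: "(\<lambda>m. - bary i j k m) \<in> Lset n S (int k, 1) (int (i + j - k), 1)"
    using Lset_bary[OF True k g(2)] by simp
  have L': "(\<lambda>m. - bary i j (i + j - k) m) \<in> Lset n S (int (i + j - k), 1) (int k, 1)"
    using Lset_bary[OF True k'(1,2) g(1)] unfolding k'(3) by simp
  from X_vertex_limit[OF B _ _ y h L _ L' _ height_bary[OF True k]]
  show ?thesis using True bary_nonneg[OF k] bary_nonneg[OF k'(1,2)] by (simp add: leadX_twisted[OF B True k])
next
  case False
  then show ?thesis using limit_nonadjacent_between[OF B y h ij False k] by simp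
qed

lemma pair_term_limit:
  assumes y: "deep y" and h: "h \<in> height_cone n S" and ij: "i < j" "j \<le> n"
  shows "((\<lambda>t. pair_term i j (ray y h t) - pair_limit i j (\<lambda>m. ray y h t m + gamma_const)) \<longlongrightarrow> 0) at_top"
proof -
  have le: "i \<le> n" using ij by simp
  define a where "a t = exp (ray y h t i) * exp (ray y h t j) * X B (ray y h t) (0, 0) (int i + int j, 2)
     - (if adjacent S i j then edge_limit B i j (\<lambda>m. ray y h t m + gamma_const) else 0)" for t
  define b where "b t = (if j < n then exp (ray y h t i) * exp (ray y h t j) * X B (ray y h t) (int i, 1) (int j, 1)
     - (if i \<in> S \<and> j \<in> S then ray_limit B i j (\<lambda>m. ray y h t m + gamma_const) else 0) else 0)" for t
  define c where "c t = (if 0 < i then exp (ray y h t j) * exp (ray y h t i) * X B (ray y h t) (int j, 1) (int i, 1)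
     - (if j \<in> S \<and> i \<in> S then ray_limit B j i (\<lambda>m. ray y h t m + gamma_const) else 0) else 0)" for t
  define e where "e t = (\<Sum>k\<in>{i<..<j}. exp (ray y h t i) * exp (ray y h t j) * X B (ray y h t) (int k, 1) (int (i + j - k), 1)
     - (if adjacent S i j then twisted_limit B i j k else 0))" for t
  have "(a \<longlongrightarrow> 0) at_top" unfolding a_def by (rule first_term_limit[OF y h ij])
  moreover have "(b \<longlongrightarrow> 0) at_top" unfolding b_def using ray_term_limit[OF y h le ij(2)] by (cases "j < n") simp_all
  moreover have "(c \<longlongrightarrow> 0) at_top" unfolding c_def using ray_term_limit[OF y h ij(2) le] by (cases "0 < i") simp_all
  moreover have "(e \<longlongrightarrow> 0) at_top" unfolding e_def
    by (rule tendsto_null_sum) (rule between_term_limit[OF y h ij], auto)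
  ultimately have "((\<lambda>t. (of_nat j - of_nat i)\<^sup>2 * a t - of_nat n / 2 * (of_nat j - of_nat i) * (b t + c t + 2 * e t)) \<longlongrightarrow>
     (of_nat j - of_nat i)\<^sup>2 * 0 - of_nat n / 2 * (of_nat j - of_nat i) * (0 + 0 + 2 * 0)) at_top"
    by (intro tendsto_intros)
  moreover have "pair_term i j (ray y h t) - pair_limit i j (\<lambda>m. ray y h t m + gamma_const) =
     (of_nat j - of_nat i)\<^sup>2 * a t - of_nat n / 2 * (of_nat j - of_nat i) * (b t + c t + 2 * e t)" for t
  proof -
    have alg: "u * p - v * (q1 + q2 + 2 * q3) - (u * p' - v * (q1' + q2' + 2 * q3')) =
       u * (p - p') - v * ((q1 - q1') + (q2 - q2') + 2 * (q3 - q3'))" for u v p p' q1 q1' q2 q2' q3 q3' :: complex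
      by (simp add: algebra_simps)
    have if_diff: "(if P then r - s else 0) = (if P then r else 0) - (if P then s else 0)" for P and r s :: complex by simp
    show ?thesis
      unfolding pair_term_def pair_limit_def alg a_def b_def c_def e_def if_diff sum_subtractf ..
  qed
  ultimately show ?thesis by simp
qed

definition total_limit :: "(nat \<Rightarrow> complex) \<Rightarrow> complex" where
  "total_limit z = (\<Sum>(i, j) | i < j \<and> j \<le> n. pair_limit i j z)"

lemma affine_total_limit: "affine_in n total_limit"
proof -
  have e: "affine_in n (edge_limit B i j)" "affine_in n (ray_limit B i j)" for i j
    unfolding edge_limit_def[OF B, abs_def] ray_limit_def[OF B, abs_def]
    by (intro affine_cmult affine_add affine_const affine_basic)+
  have p: "affine_in n (pair_limit i j)" for i j
    unfolding pair_limit_def[abs_def]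
    by (intro affine_diff affine_cmult affine_add affine_if affine_const e)
  show ?thesis unfolding total_limit_def[abs_def]
    by (rule affine_sum) (auto intro: p)
qed

text \<open>Along a ray the pairing is constant and asymptotic to an affine function of \<open>y\<close>, so the slope along the ray
  is zero and the pairing equals that affine function everywhere. Translating a single \<open>y\<^sub>m\<close> by \<open>\<i>\<close> changes no height,
  so it stays in the region of convergence; constancy along it shows that each linear coefficient is zero. Thus the
  affine function may be evaluated at 0.\<close>

lemma sym_pairing_total:
  assumes y: "deep y"
  shows "sym_pairing (int n) (\<lambda>i. exp (y (nat i))) (X B y) = total_limit (\<lambda>_. 0)"
proof -
  obtain R T where RT: "total_limit z = R + (\<Sum>m\<le>n. T m * z m)" for z
    using affine_total_limit unfolding affine_in_def by blast
  define P where "P y = sym_pairing (int n) (\<lambda>i. exp (y (nat i))) (X B y)" for y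
  (* The heights of y themselves are a direction in the height cone. *)
  obtain h where h: "h \<in> height_cone n S"
  proof -
    have "(\<lambda>k. - Re (y k)) \<in> height_cone n S"
      unfolding height_cone_iff
    proof (intro allI impI)
      fix i j k assume "i < j \<and> adjacent S i j \<and> k \<le> n \<and> k \<noteq> i \<and> k \<noteq> j"
      then have "decay < margin (\<lambda>k. - Re (y k)) i j k" using y unfolding deep_def by blast
      moreover have "0 < decay" unfolding decay_def by (simp add: add_nonneg_pos)
      ultimately show "0 < margin (\<lambda>k. - Re (y k)) i j k" by linarith
    qed
    then show ?thesis by (rule that)
  qed
  have P_ray: "P (ray y h t) = P y" if y: "deep y" and t: "0 \<le> t" for y t
  proof -
    let ?w = "\<lambda>k. - of_real (h k) :: complex"
    have r: "ray y h t = (\<lambda>k. y k + of_real t * ?w k)" by (simp add: ray_def fun_eq_iff)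
    have "of_real t \<in> deep_times y ?w" using deep_ray[OF y h t] unfolding deep_times_def r mem_Collect_eq .
    moreover have "0 \<in> deep_times y ?w" using y by (simp add: deep_times_def)
    ultimately have "P (\<lambda>k. y k + of_real t * ?w k) = P (\<lambda>k. y k + 0 * ?w k)"
      unfolding P_def by (rule sym_pairing_constant[OF B])
    then show ?thesis unfolding r by simp
  qed
  have lim: "P y = total_limit (\<lambda>m. y m + gamma_const)" if y: "deep y" for y
  proof -
    have "((\<lambda>t. \<Sum>(i, j) | i < j \<and> j \<le> n. pair_term i j (ray y h t) - pair_limit i j (\<lambda>m. ray y h t m + gamma_const)) \<longlongrightarrow> 0) at_top"
    proof (rule tendsto_null_sum)
      fix p assume "p \<in> {(i, j). i < j \<and> j \<le> n}"
      then show "((\<lambda>t. case p of (i, j) \<Rightarrow> pair_term i j (ray y h t) - pair_limit i j (\<lambda>m. ray y h t m + gamma_const)) \<longlongrightarrow> 0) at_top"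
        using pair_term_limit[OF y h, of "fst p" "snd p"] by (cases p) simp
    qed
    moreover have "(\<Sum>(i, j) | i < j \<and> j \<le> n. pair_term i j (ray y h t) - pair_limit i j (\<lambda>m. ray y h t m + gamma_const)) =
       P (ray y h t) - total_limit (\<lambda>m. ray y h t m + gamma_const)" for t
      unfolding P_def sym_pairing_terms total_limit_def by (simp add: case_prod_unfold sum_subtractf)
    ultimately have l1: "((\<lambda>t. P (ray y h t) - total_limit (\<lambda>m. ray y h t m + gamma_const)) \<longlongrightarrow> 0) at_top" by simp
    define \<tau> where "\<tau> = (\<Sum>m\<le>n. T m * of_real (h m))"
    define \<rho> where "\<rho> = P y - total_limit (\<lambda>m. y m + gamma_const)"
    have tl: "total_limit (\<lambda>m. ray y h t m + gamma_const) = total_limit (\<lambda>m. y m + gamma_const) - of_real t * \<tau>" for t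
    proof -
      have "(\<Sum>m\<le>n. T m * (ray y h t m + gamma_const)) = (\<Sum>m\<le>n. T m * (y m + gamma_const) - of_real t * (T m * of_real (h m)))"
        by (intro sum.cong refl) (simp add: ray_def algebra_simps)
      then show ?thesis unfolding RT \<tau>_def by (simp add: sum_subtractf sum_distrib_left)
    qed
    have l2: "((\<lambda>t. \<rho> + of_real t * \<tau>) \<longlongrightarrow> 0) at_top"
    proof (rule Lim_transform_eventually[OF l1])
      show "\<forall>\<^sub>F t in at_top. P (ray y h t) - total_limit (\<lambda>m. ray y h t m + gamma_const) = \<rho> + of_real t * \<tau>"
        using eventually_ge_at_top[of "0 :: real"]
        by eventually_elim (simp add: P_ray[OF y] tl \<rho>_def)
    qed
    (* Subtracting the limit relation from its translate by 1 isolates the slope. *)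
    have "((\<lambda>t. \<rho> + of_real (t + 1) * \<tau>) \<longlongrightarrow> 0) at_top"
      using filterlim_compose[OF l2 filterlim_tendsto_add_at_top[OF tendsto_const filterlim_ident, of 1]] by (simp add: add.commute)
    from tendsto_diff[OF this l2] have "((\<lambda>t :: real. \<tau>) \<longlongrightarrow> 0) at_top" by (simp add: algebra_simps)
    then have "\<tau> = 0" by (simp add: tendsto_const_iff)
    then have "\<rho> = 0" using l2 by (simp add: tendsto_const_iff)
    then show ?thesis by (simp add: \<rho>_def)
  qed
  have "T m = 0" if m: "m \<le> n" for m
  proof -
    define w where "w k = (if k = m then \<i> else 0)" for k
    have "(\<lambda>k. - Re (y k + 1 * w k)) = (\<lambda>k. - Re (y k))" by (rule ext) (simp add: w_def)
    then have "deep (\<lambda>k. y k + 1 * w k)" using y unfolding deep_def by simp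
    then have one: "1 \<in> deep_times y w" by (simp add: deep_times_def)
    have zero: "0 \<in> deep_times y w" using y by (simp add: deep_times_def)
    have "P (\<lambda>k. y k + 1 * w k) = P (\<lambda>k. y k + 0 * w k)"
      unfolding P_def by (rule sym_pairing_constant[OF B one zero])
    then have "total_limit (\<lambda>k. (y k + 1 * w k) + gamma_const) = total_limit (\<lambda>k. y k + gamma_const)"
      using lim[OF \<open>deep (\<lambda>k. y k + 1 * w k)\<close>] lim[OF y] by simp
    then have "(\<Sum>k\<le>n. T k * (y k + 1 * w k + gamma_const)) = (\<Sum>k\<le>n. T k * (y k + gamma_const))" unfolding RT by simp
    moreover have "(\<Sum>k\<le>n. T k * (y k + 1 * w k + gamma_const)) = (\<Sum>k\<le>n. T k * (y k + gamma_const)) + T m * \<i>"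
    proof -
      have "(\<Sum>k\<le>n. T k * (y k + 1 * w k + gamma_const)) = (\<Sum>k\<le>n. T k * (y k + gamma_const) + (if k = m then T m * \<i> else 0))"
        by (intro sum.cong refl) (simp add: w_def algebra_simps)
      then show ?thesis using m by (simp add: sum.distrib)
    qed
    ultimately show ?thesis by simp
  qed
  then have "total_limit z = R" for z unfolding RT by simp
  then show ?thesis using lim[OF y] unfolding P_def by simp
qed

end

end

section \<open>Comparison with the stated sum\<close>

context fan begin

text \<open>Translating the height cone by this function leads into the region of convergence. The square is strictly convex at the rays; the
  constant added for \<open>k \<notin> S\<close> lifts these points above the chords, below which they lie by at most \<open>n\<^sup>2\<close>.\<close>

definition deep_height :: "nat \<Rightarrow> real" where
  "deep_height k = (decay + 1) * ((real k)\<^sup>2 + (if k \<in> S then 0 else (real n)\<^sup>2 + 1))"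

lemma margin_square: "i < j \<Longrightarrow> margin (\<lambda>k. (real k)\<^sup>2) i j m = (real m - real i) * (real m - real j)"
proof -
  assume "i < j"
  then have "real j - real i \<noteq> 0" by simp
  then show ?thesis by (simp add: margin_def chord_def divide_simps power2_eq_square) (simp add: algebra_simps)
qed

lemma margin_deep_height:
  assumes ij: "i < j" "adjacent S i j" and k: "k \<le> n" "k \<noteq> i" "k \<noteq> j"
  shows "decay + 1 \<le> margin deep_height i j k"
proof -
  define \<delta> where "\<delta> k = (if k \<in> S then 0 else (real n)\<^sup>2 + 1)" for k
  have S: "i \<in> S" "j \<in> S" and between: "\<And>m. m \<in> S \<Longrightarrow> i < m \<Longrightarrow> m < j \<Longrightarrow> False"
    using ij unfolding adjacent_def by (auto simp: min_def max_def)
  have le: "i \<le> n" "j \<le> n" using S S_sub by auto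
  have "margin deep_height i j k = margin (\<lambda>k. (decay + 1) * (real k)\<^sup>2 + (decay + 1) * \<delta> k) i j k"
    by (intro arg_cong[where f = "\<lambda>h. margin h i j k"] ext) (simp add: deep_height_def \<delta>_def distrib_left)
  also have "\<dots> = (decay + 1) * ((real k - real i) * (real k - real j) + \<delta> k)"
  proof -
    have "margin \<delta> i j k = \<delta> k" using S by (simp add: margin_def chord_def \<delta>_def)
    then show ?thesis unfolding margin_linear margin_square[OF ij(1)] by (simp add: distrib_left)
  qed
  finally have m: "margin deep_height i j k = (decay + 1) * ((real k - real i) * (real k - real j) + \<delta> k)" .
  have "1 \<le> (real k - real i) * (real k - real j) + \<delta> k"
  proof (cases "k \<in> S")
    case True
    have "1 * 1 \<le> (real k - real i) * (real k - real j)"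
    proof (cases "k < i")
      case True
      then have "1 \<le> real i - real k" "1 \<le> real j - real k" using ij(1) by linarith+
      then have "1 * 1 \<le> (real i - real k) * (real j - real k)" by (intro mult_mono) auto
      then show ?thesis by (simp add: algebra_simps)
    next
      case False
      then have "j < k" using between[OF \<open>k \<in> S\<close>] k by (meson linorder_neqE_nat)
      then have "1 \<le> real k - real i" "1 \<le> real k - real j" using ij(1) by linarith+
      then show ?thesis by (intro mult_mono) auto
    qed
    then show ?thesis using True by (simp add: \<delta>_def)
  next
    case False
    have "\<bar>(real k - real i) * (real k - real j)\<bar> \<le> real n * real n"
      unfolding abs_mult using le k by (intro mult_mono) auto
    then have "- ((real n)\<^sup>2) \<le> (real k - real i) * (real k - real j)" unfolding power2_eq_square by linarith
    then show ?thesis using False by (simp add: \<delta>_def)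
  qed
  moreover have "0 < decay + 1" unfolding decay_def by (simp add: add_nonneg_pos)
  ultimately show ?thesis unfolding m by (metis mult.right_neutral mult_left_mono less_imp_le)
qed

lemma deep_height_in_cone: "deep_height \<in> height_cone n S"
  unfolding height_cone_iff
proof (intro allI impI)
  fix i j k assume "i < j \<and> adjacent S i j \<and> k \<le> n \<and> k \<noteq> i \<and> k \<noteq> j"
  then have "decay + 1 \<le> margin deep_height i j k" by (intro margin_deep_height) auto
  moreover have "0 < decay + 1" unfolding decay_def by (simp add: add_nonneg_pos)
  ultimately show "0 < margin deep_height i j k" by linarith
qed

lemma deep_of_height:
  assumes x: "\<forall>k\<le>n. exp (lx k) = x k" and h: "(\<lambda>k. - ln (cmod (x k)) - deep_height k) \<in> height_cone n S"
  shows "deep lx"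
  unfolding deep_def
proof (intro allI impI)
  fix i j k assume asm: "i < j \<and> adjacent S i j \<and> k \<le> n \<and> k \<noteq> i \<and> k \<noteq> j"
  let ?h = "\<lambda>k. - ln (cmod (x k)) - deep_height k"
  have le: "i \<le> n" "j \<le> n" "k \<le> n" using asm adjacentD[of i j] by auto
  have Re: "- Re (lx m) = 1 * ?h m + 1 * deep_height m" if "m \<le> n" for m
  proof -
    have "cmod (x m) = exp (Re (lx m))" using x that by (metis norm_exp_eq_Re)
    then show ?thesis by simp
  qed
  have "margin (\<lambda>k. - Re (lx k)) i j k = margin (\<lambda>k. 1 * ?h k + 1 * deep_height k) i j k"
    unfolding margin_def chord_def Re[OF le(1)] Re[OF le(2)] Re[OF le(3)] ..
  also have "\<dots> = margin ?h i j k + margin deep_height i j k" unfolding margin_linear by simp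
  finally have "margin (\<lambda>k. - Re (lx k)) i j k = margin ?h i j k + margin deep_height i j k" .
  moreover have "0 < margin ?h i j k" using h asm unfolding height_cone_iff by blast
  moreover have "decay + 1 \<le> margin deep_height i j k" using asm by (intro margin_deep_height) auto
  ultimately show "decay < margin (\<lambda>k. - Re (lx k)) i j k" by linarith
qed

text \<open>Each index that is not a ray lies between exactly one pair of adjacent rays.\<close>

lemma sum_between_rays:
  fixes g :: "nat \<Rightarrow> complex"
  shows "(\<Sum>k\<in>{..n} - S. g k) = (\<Sum>(i, j) | i < j \<and> j \<le> n. if adjacent S i j then \<Sum>k\<in>{i<..<j}. g k else 0)"
proof -
  let ?A = "{(i, j). i < j \<and> adjacent S i j}"
  have sub: "?A \<subseteq> {(i, j). i < j \<and> j \<le> n}" using adjacentD by auto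
  have fin: "finite ?A" using finite_subset[OF sub finite_pairs] .
  have U: "{..n} - S = (\<Union>p\<in>?A. {fst p<..<snd p})"
  proof
    show "{..n} - S \<subseteq> (\<Union>p\<in>?A. {fst p<..<snd p})"
    proof
      fix k assume "k \<in> {..n} - S"
      then obtain i j where "i < k" "k < j" "adjacent S i j" using bracket_exists[of k] by auto
      then show "k \<in> (\<Union>p\<in>?A. {fst p<..<snd p})" by (intro UN_I[of "(i, j)"]) auto
    qed
    show "(\<Union>p\<in>?A. {fst p<..<snd p}) \<subseteq> {..n} - S"
    proof
      fix k assume "k \<in> (\<Union>p\<in>?A. {fst p<..<snd p})"
      then obtain i j where ij: "adjacent S i j" "i < k" "k < j" by auto
      then have "k \<notin> S" unfolding adjacent_def by (auto simp: min_def max_def)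
      moreover have "j \<le> n" using adjacentD[OF ij(1)] by auto
      ultimately show "k \<in> {..n} - S" using ij by auto
    qed
  qed
  have disj: "\<forall>p\<in>?A. \<forall>q\<in>?A. p \<noteq> q \<longrightarrow> {fst p<..<snd p} \<inter> {fst q<..<snd q} = {}"
  proof (intro ballI impI, rule ccontr)
    fix p q assume pq: "p \<in> ?A" "q \<in> ?A" "p \<noteq> q" and ne: "{fst p<..<snd p} \<inter> {fst q<..<snd q} \<noteq> {}"
    obtain i j i' j' where e: "p = (i, j)" "q = (i', j')" by (cases p, cases q)
    obtain k where "i < k" "k < j" "i' < k" "k < j'" using ne by (auto simp: e)
    then show False using bracket_unique[of i j k i' j'] pq by (auto simp: e)
  qed
  have "(\<Sum>k\<in>{..n} - S. g k) = (\<Sum>p\<in>?A. \<Sum>k\<in>{fst p<..<snd p}. g k)"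
    unfolding U by (rule sum.UNION_disjoint[OF fin _ disj]) simp
  also have "\<dots> = (\<Sum>p | fst p < snd p \<and> snd p \<le> n. if adjacent S (fst p) (snd p) then \<Sum>k\<in>{fst p<..<snd p}. g k else 0)"
    by (rule sum.mono_neutral_cong_left) (use sub finite_pairs in \<open>auto simp: case_prod_unfold\<close>)
  finally show ?thesis by (simp add: case_prod_unfold)
qed

text \<open>The three sums of the formula are matched with the limits at \<open>z = 0\<close>. In the first one, \<open>k\<close> is replaced by
  \<open>i + j - k\<close>, since the sector is \<open>(i + j - k, 1)\<close> for the splitting \<open>(k, 1)\<close>. In the other two, pairs that do not
  occur in the limit contribute zero because \<open>F\<^sub>0\<close>, \<open>F\<^sub>n\<close> and \<open>F\<^bsub>{i, j}\<^esub>\<close> for nonadjacent \<open>i, j\<close> are relations.\<close>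

lemma stated_sum_value:
  assumes \<Lambda>: "Vector_Spaces.linear pm_scale (*) \<Lambda>" and B: "bilinear_form (relH n S) (relHc n S) B"
    and eq: "\<And>u v. \<Lambda> (u \<otimes> v) = B u v"
  shows "\<Lambda> (- pm_scale (of_nat n)
            (\<Sum>\<gamma>\<in>Box S - {(0, 0)}. case sector_cone S \<gamma> of (i, j) \<Rightarrow>
               pm_scale ((of_nat j - of_nat i)
                         * (sin (of_real pi * of_rat (box_coord S \<gamma> i)))\<^sup>2 / (of_real pi)\<^sup>2)
                 (oneH \<gamma> \<otimes> Ftw (box_dual S \<gamma>)))
        + (\<Sum>(i, j) | i \<in> S \<and> j \<in> S \<and> i < j.
               pm_scale ((of_nat j - of_nat i)\<^sup>2 * (1 / (2 * of_real pi * \<i>)\<^sup>2))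
                 (oneH (0, 0) \<otimes> Fcone {i, j}))
        - pm_scale (of_nat n)
            (\<Sum>(i, j) | i \<in> S \<and> j \<in> S \<and> i < j.
               pm_scale ((of_nat j - of_nat i) * (1 / (2 * (2 * of_real pi * \<i>)\<^sup>2)))
                 (pm_scale (D i) (oneH (0, 0)) \<otimes> Fcone {j}
                  + pm_scale (D j) (oneH (0, 0)) \<otimes> Fcone {i}))) = total_limit B (\<lambda>_. 0)"
proof -
  interpret L: Vector_Spaces.linear "pm_scale :: complex \<Rightarrow> (int \<times> int, Hc_gen) free_tensor \<Rightarrow> _" "(*)" \<Lambda> by (rule \<Lambda>)
  let ?P = "{(i, j). i < j \<and> j \<le> n}"
  let ?Q = "{(i, j). i \<in> S \<and> j \<in> S \<and> i < j}"
  have QP: "?Q \<subseteq> ?P" using S_sub by auto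
  define A1 where "A1 i j = (if adjacent S i j then \<Sum>k\<in>{i<..<j}. twisted_limit B i j k else 0)" for i j
  define A2 where "A2 i j = (of_nat j - of_nat i)\<^sup>2 * (if adjacent S i j then edge_limit B i j (\<lambda>_. 0) else 0)" for i j
  define A3 where "A3 i j = (if i \<in> S \<and> j \<in> S then (B (pm_scale (D i) (oneH (0, 0))) (Fcone {j}) + B (pm_scale (D j) (oneH (0, 0))) (Fcone {i})) / period\<^sup>2 else 0)" for i j
  define G where "G \<gamma> = (case sector_cone S \<gamma> of (i, j) \<Rightarrow>
      (of_nat j - of_nat i) * (sin (of_real pi * of_rat (box_coord S \<gamma> i)))\<^sup>2 / (of_real pi)\<^sup>2 * B (oneH \<gamma>) (Ftw (box_dual S \<gamma>)))" for \<gamma>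
  have F_end: "B u (Fcone {0}) = 0" "B u (Fcone {n}) = 0" for u
    by (rule functional_rel[OF B_right[OF B] Fcone_ray_rel], simp add: inner_rays_def)+
  have ray0: "ray_limit B i j (\<lambda>_. 0) = B (pm_scale (D i) (oneH (0, 0))) (Fcone {j}) / period\<^sup>2" for i j
    by (simp add: ray_limit_def[OF B])
  have pair: "pair_limit B i j (\<lambda>_. 0) = A2 i j - of_nat n * ((of_nat j - of_nat i) / 2 * A3 i j) - of_nat n * ((of_nat j - of_nat i) * A1 i j)"
    if ij: "i < j" "j \<le> n" for i j
  proof -
    (* The conditions j < n and 0 < i may be dropped, because F_n and F_0 are zero. *)
    have r1: "(if j < n then if i \<in> S \<and> j \<in> S then ray_limit B i j (\<lambda>_. 0) else 0 else 0) =
       (if i \<in> S \<and> j \<in> S then B (pm_scale (D i) (oneH (0, 0))) (Fcone {j}) / period\<^sup>2 else 0)"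
      using ij(2) F_end(2) unfolding ray0 by (cases "j = n") auto
    have r2: "(if 0 < i then if j \<in> S \<and> i \<in> S then ray_limit B j i (\<lambda>_. 0) else 0 else 0) =
       (if i \<in> S \<and> j \<in> S then B (pm_scale (D j) (oneH (0, 0))) (Fcone {i}) / period\<^sup>2 else 0)"
      using F_end(1) unfolding ray0 by (cases "i = 0") auto
    have r3: "(if P then a / p else 0) + (if P then b / p else 0) = (if P then (a + b) / p else 0)" for P and a b p :: complex
      by (simp add: add_divide_distrib)
    have regroup: "u - c / 2 * d * (v + 2 * w) = u - c * (d / 2 * v) - c * (d * w)" for u v w c d :: complex
      by (simp add: field_simps)
    have r4: "(\<Sum>k\<in>{i<..<j}. if adjacent S i j then twisted_limit B i j k else 0) = A1 i j"
      by (simp add: A1_def)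
    show ?thesis unfolding pair_limit_def[OF B] r1 r2 r3 r4 A2_def[symmetric] A3_def[symmetric] by (rule regroup)
  qed
  have T1: "(\<Sum>\<gamma>\<in>Box S - {(0, 0)}. G \<gamma>) = (\<Sum>(i, j)\<in>?P. (of_nat j - of_nat i) * A1 i j)"
  proof -
    have "Box S - {(0, 0)} = (\<lambda>k. (int k, 1 :: int)) ` ({..n} - S)" unfolding Box_eq by auto
    then have "(\<Sum>\<gamma>\<in>Box S - {(0, 0)}. G \<gamma>) = (\<Sum>k\<in>{..n} - S. G (int k, 1))"
      by (simp add: sum.reindex inj_on_def)
    also have "\<dots> = (\<Sum>(i, j)\<in>?P. if adjacent S i j then \<Sum>k\<in>{i<..<j}. G (int k, 1) else 0)"
      by (rule sum_between_rays)
    also have "\<dots> = (\<Sum>(i, j)\<in>?P. (of_nat j - of_nat i) * A1 i j)"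
    proof (rule sum.cong[OF refl])
      fix p assume "p \<in> ?P"
      obtain i j where p: "p = (i, j)" by (cases p)
      have "(\<Sum>k\<in>{i<..<j}. G (int k, 1)) = (of_nat j - of_nat i) * (\<Sum>k\<in>{i<..<j}. twisted_limit B i j k)" if adj: "adjacent S i j"
        unfolding sum_distrib_left
      proof (rule sum.reindex_bij_witness[where i = "\<lambda>k. i + j - k" and j = "\<lambda>k. i + j - k"])
        fix k assume "k \<in> {i<..<j}"
        then have k: "i < k" "k < j" by auto
        have refl2: "i + j - (i + j - k) = k" using k by simp
        show "(of_nat j - of_nat i) * twisted_limit B i j (i + j - k) = G (int k, 1)"
          unfolding G_def sector_data[OF adj k] twisted_limit_def[OF B] prod.case refl2 by simp
      qed auto
      then show "(case p of (i, j) \<Rightarrow> if adjacent S i j then \<Sum>k\<in>{i<..<j}. G (int k, 1) else 0) =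
          (case p of (i, j) \<Rightarrow> (of_nat j - of_nat i) * A1 i j)"
        unfolding p prod.case A1_def by simp
    qed
    finally show ?thesis .
  qed
  have T2: "(\<Sum>(i, j)\<in>?Q. (of_nat j - of_nat i)\<^sup>2 * (1 / period\<^sup>2) * B (oneH (0, 0)) (Fcone {i, j})) = (\<Sum>(i, j)\<in>?P. A2 i j)"
  proof (rule sum.mono_neutral_cong_left[OF finite_pairs QP])
    show "\<forall>p\<in>?P - ?Q. (case p of (i, j) \<Rightarrow> A2 i j) = 0"
      by (auto simp: A2_def adjacent_def split: if_splits)
    fix p assume "p \<in> ?Q"
    then obtain i j where p: "p = (i, j)" "i \<noteq> j" by auto
    have "B (oneH (0, 0)) (Fcone {i, j}) = 0" if "\<not> adjacent S i j"
      by (rule functional_rel[OF B_right[OF B] Fcone_pair_rel[OF p(2) that]])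
    then show "(case p of (i, j) \<Rightarrow> (of_nat j - of_nat i)\<^sup>2 * (1 / period\<^sup>2) * B (oneH (0, 0)) (Fcone {i, j})) = (case p of (i, j) \<Rightarrow> A2 i j)"
      unfolding p(1) prod.case A2_def edge_limit_def[OF B] by simp
  qed
  have T3: "(\<Sum>(i, j)\<in>?Q. (of_nat j - of_nat i) * (1 / (2 * period\<^sup>2)) *
      (B (pm_scale (D i) (oneH (0, 0))) (Fcone {j}) + B (pm_scale (D j) (oneH (0, 0))) (Fcone {i}))) = (\<Sum>(i, j)\<in>?P. (of_nat j - of_nat i) / 2 * A3 i j)"
  proof (rule sum.mono_neutral_cong_left[OF finite_pairs QP])
    show "\<forall>p\<in>?P - ?Q. (case p of (i, j) \<Rightarrow> (of_nat j - of_nat i) / 2 * A3 i j) = 0"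
      by (auto simp: A3_def split: if_splits)
    fix p assume "p \<in> ?Q"
    then obtain i j where p: "p = (i, j)" "i \<in> S" "j \<in> S" by auto
    show "(case p of (i, j) \<Rightarrow> (of_nat j - of_nat i) * (1 / (2 * period\<^sup>2)) *
      (B (pm_scale (D i) (oneH (0, 0))) (Fcone {j}) + B (pm_scale (D j) (oneH (0, 0))) (Fcone {i}))) = (case p of (i, j) \<Rightarrow> (of_nat j - of_nat i) / 2 * A3 i j)"
      unfolding p(1) prod.case A3_def if_P[OF conjI[OF p(2,3)]] by simp
  qed
  have "total_limit B (\<lambda>_. 0) = (\<Sum>(i, j)\<in>?P. A2 i j - of_nat n * ((of_nat j - of_nat i) / 2 * A3 i j) - of_nat n * ((of_nat j - of_nat i) * A1 i j))"
    unfolding total_limit_def[OF B] by (rule sum.cong[OF refl]) (auto simp: pair)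
  also have "\<dots> = (\<Sum>(i, j)\<in>?P. A2 i j) - of_nat n * (\<Sum>(i, j)\<in>?P. (of_nat j - of_nat i) / 2 * A3 i j)
      - of_nat n * (\<Sum>(i, j)\<in>?P. (of_nat j - of_nat i) * A1 i j)"
    by (simp only: case_prod_unfold sum_subtractf sum_distrib_left)
  finally have total: "total_limit B (\<lambda>_. 0) = - (of_nat n * (\<Sum>(i, j)\<in>?P. (of_nat j - of_nat i) * A1 i j)) + (\<Sum>(i, j)\<in>?P. A2 i j)
      - of_nat n * (\<Sum>(i, j)\<in>?P. (of_nat j - of_nat i) / 2 * A3 i j)" by simp
  show ?thesis
    unfolding total T1[symmetric] T2[symmetric] T3[symmetric] G_def
    unfolding case_prod_unfold L.add L.diff L.neg L.scale L.sum eq ..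
qed

end

theorem theorem5p10:
  fixes n :: nat and S :: "nat set"
  assumes "1 \<le> n" and "S \<subseteq> {0..n}" and "0 \<in> S" and "n \<in> S"
  shows "\<exists>a\<in>height_cone n S. \<forall>x lx :: nat \<Rightarrow> complex.
    (\<forall>k\<le>n. exp (lx k) = x k) \<and>
    (\<lambda>k. - ln (cmod (x k)) - a k) \<in> height_cone n S \<longrightarrow>
      (\<forall>c\<in>lattice_points (cone2 0 n). Gamma_converges n S lx c) \<and>
      (\<forall>c\<in>lattice_points (interior (cone2 0 n)). Gammao_converges n S lx c) \<and>
      tensor_class (relH n S) (relHc n S) (Gamma_pairing n S x lx) =
      tensor_class (relH n S) (relHc n S)
       (- pm_scale (of_nat n)
            (\<Sum>\<gamma>\<in>Box S - {(0, 0)}. case sector_cone S \<gamma> of (i, j) \<Rightarrow>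
               pm_scale ((of_nat j - of_nat i)
                         * (sin (of_real pi * of_rat (box_coord S \<gamma> i)))\<^sup>2 / (of_real pi)\<^sup>2)
                 (oneH \<gamma> \<otimes> Ftw (box_dual S \<gamma>)))
        + (\<Sum>(i, j) | i \<in> S \<and> j \<in> S \<and> i < j.
               pm_scale ((of_nat j - of_nat i)\<^sup>2 * (1 / (2 * of_real pi * \<i>)\<^sup>2))
                 (oneH (0, 0) \<otimes> Fcone {i, j}))
        - pm_scale (of_nat n)
            (\<Sum>(i, j) | i \<in> S \<and> j \<in> S \<and> i < j.
               pm_scale ((of_nat j - of_nat i) * (1 / (2 * (2 * of_real pi * \<i>)\<^sup>2)))
                 (pm_scale (D i) (oneH (0, 0)) \<otimes> Fcone {j}
                  + pm_scale (D j) (oneH (0, 0)) \<otimes> Fcone {i})))"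
proof -
  interpret fan n S using assms by unfold_locales
  show ?thesis
  proof (rule bexI[OF _ deep_height_in_cone], intro allI impI, elim conjE)
    fix x lx :: "nat \<Rightarrow> complex"
    assume x: "\<forall>k\<le>n. exp (lx k) = x k" and h: "(\<lambda>k. - ln (cmod (x k)) - deep_height k) \<in> height_cone n S"
    have deep: "deep lx" by (rule deep_of_height[OF x h])
    show "(\<forall>c\<in>lattice_points (cone2 0 n). Gamma_converges n S lx c) \<and>
      (\<forall>c\<in>lattice_points (interior (cone2 0 n)). Gammao_converges n S lx c) \<and>
      tensor_class (relH n S) (relHc n S) (Gamma_pairing n S x lx) =
      tensor_class (relH n S) (relHc n S)
       (- pm_scale (of_nat n)
            (\<Sum>\<gamma>\<in>Box S - {(0, 0)}. case sector_cone S \<gamma> of (i, j) \<Rightarrow>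
               pm_scale ((of_nat j - of_nat i)
                         * (sin (of_real pi * of_rat (box_coord S \<gamma> i)))\<^sup>2 / (of_real pi)\<^sup>2)
                 (oneH \<gamma> \<otimes> Ftw (box_dual S \<gamma>)))
        + (\<Sum>(i, j) | i \<in> S \<and> j \<in> S \<and> i < j.
               pm_scale ((of_nat j - of_nat i)\<^sup>2 * (1 / (2 * of_real pi * \<i>)\<^sup>2))
                 (oneH (0, 0) \<otimes> Fcone {i, j}))
        - pm_scale (of_nat n)
            (\<Sum>(i, j) | i \<in> S \<and> j \<in> S \<and> i < j.
               pm_scale ((of_nat j - of_nat i) * (1 / (2 * (2 * of_real pi * \<i>)\<^sup>2)))
                 (pm_scale (D i) (oneH (0, 0)) \<otimes> Fcone {j}
                  + pm_scale (D j) (oneH (0, 0)) \<otimes> Fcone {i})))"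
      (is "_ \<and> _ \<and> _ = tensor_class _ _ ?R")
    proof (intro conjI ballI)
      show "Gamma_converges n S lx c" if "c \<in> lattice_points (cone2 0 n)" for c
        by (rule Gamma_converges_deep(1)[OF deep that])
      show "Gammao_converges n S lx c" if "c \<in> lattice_points (interior (cone2 0 n))" for c
        by (rule Gamma_converges_deep(2)[OF deep that])
      show "tensor_class (relH n S) (relHc n S) (Gamma_pairing n S x lx) = tensor_class (relH n S) (relHc n S) ?R"
      proof (rule tensor_class_eqI)
        fix \<Lambda> assume \<Lambda>: "Vector_Spaces.linear pm_scale (*) \<Lambda>" and B: "bilinear_form (relH n S) (relHc n S) (\<lambda>u v. \<Lambda> (u \<otimes> v))"
        have "\<Lambda> (Gamma_pairing n S x lx) = sym_pairing (int n) (\<lambda>i. exp (lx (nat i))) (X (\<lambda>u v. \<Lambda> (u \<otimes> v)) lx)"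
          using x by (intro linear_Gamma_pairing[OF \<Lambda> B deep]) simp
        also have "\<dots> = total_limit (\<lambda>u v. \<Lambda> (u \<otimes> v)) (\<lambda>_. 0)" by (rule sym_pairing_total[OF B deep])
        also have "\<dots> = \<Lambda> ?R" by (rule stated_sum_value[OF \<Lambda> B refl, symmetric])
        finally show "\<Lambda> (Gamma_pairing n S x lx) = \<Lambda> ?R" .
      qed
    qed
  qed
qed

end
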